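(* Let $d\in\mathbb N$, and let $P_d(k)=\prod_{r=0}^{d}(k-v^{2r-d})$ and $Q_d(k)=\prod_{r=1}^{d}(k-v^{2r-d})$ in $\mathbf U^{\mathrm{mir}}_v(2)$. The natural epimorphism $$\pi_d:\mathbf U^{\mathrm{mir}}_v(2)\longrightarrow\mathcal{MS}_v(2,d),\qquad e\mapsto\widetilde e,\quad f\mapsto\widetilde f,\quad k^{\pm1}\mapsto\widetilde k^{\pm1},\quad \ell\mapsto\widetilde\ell,$$ has kernel the two-sided ideal $$\operatorname{Ker}\pi_d=\left\langle P_d(k),\ (\ell-1)Q_d(k)\right\rangle .$$ Equivalently, there is a unique $\mathbb K$-algebra isomorphism $$\mathbf U(2,d):=\mathbf U^{\mathrm{mir}}_v(2)\big/\left\langle P_d(k),(\ell-1)Q_d(k)\right\rangle\xrightarrow{\ \sim\ }\mathcal{MS}_v(2,d)$$ which sends $e,f,k^{\pm1},\ell$ to $\widetilde e,\widetilde f,\widetilde k^{\pm1},\widetilde\ell$, respectively.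
   Context: $v$ is an indeterminate, $\mathbb K=\mathbb C(v)$, $\mathbb N=\{0,1,2,\dots\}$, and $[m]=\frac{v^m-v^{-m}}{v-v^{-1}}$ for $m\in\mathbb Z$. For $d=0$ the empty product gives $Q_0=1$. $\langle\cdots\rangle$ denotes the two-sided ideal generated. **The algebra $\mathbf U^{\mathrm{mir}}_v(2)$** (mirabolic quantum $\mathfrak{sl}_2$) is the unital associative $\mathbb K$-algebra generated by $e,f,k,k^{-1},\ell$ subject to: $kk^{-1}=k^{-1}k=1$; $kek^{-1}=v^2e$, $kfk^{-1}=v^{-2}f$; $ef-fe=(k-k^{-1})/(v-v^{-1})$; $\ell^2=\ell$, $k\ell=\ell k$, $\ell e\ell=\ell e$, $\ell f\ell=f\ell$; $[2]e\ell e=v^{-1}e^2\ell+v\ell e^2$; $[2]f\ell f=v^{-1}\ell f^2+vf^2\ell$. **The algebra $\mathcal{MS}_v(2,d)$** (generic mirabolic quantum Schur algebra). Let $q$ be a prime power, $V=\mathbb F_q^d$, $\mathcal F(2,d)=\{F=(0=F_0\subseteq F_1\subseteq F_2=V)\}$ (flags of subspaces), and let $G_d=\mathrm{GL}(V)$ act diagonally on $\mathfrak X_d=\mathcal F(2,d)\times\mathcal F(2,d)\times V$. The $G_d$-invariant functions on $\mathfrak X_d$ form an algebra under the convolution $(\alpha*\beta)(F,F'',w)=\sum_{F'\in\mathcal F(2,d),\,u\in V}\alpha(F,F',u)\,\beta(F',F'',w-u)$. Let $\Theta_{2,d}$ be the set of $2\times 2$ matrices $A=(a_{ij})$ over $\mathbb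 N$ with entries summing to $d$. A decoration is one of the sets $\varnothing,\{(1,1)\},\{(1,2)\},\{(2,1)\},\{(1,2),(2,1)\},\{(2,2)\}$. Let $\Xi_{2,d}$ be the set of pairs $(A,\Delta)$ with $A\in\Theta_{2,d}$, $\Delta$ a decoration, and $a_{ij}>0$ for all $(i,j)\in\Delta$. The $G_d$-orbits on $\mathfrak X_d$ are parametrized by $\Xi_{2,d}$: the orbit $\mathcal O_{A,\Delta}$ consists of the $(F,F',w)$ for which $V$ has a basis $\{b_{ijs}:1\le i,j\le 2,\,1\le s\le a_{ij}\}$ with $F_1=\operatorname{span}\{b_{1js}\}$, $F'_1=\operatorname{span}\{b_{i1s}\}$ and $w=\sum_{(i,j)\in\Delta}b_{ij1}$. Let $T_{A,\Delta}$ be the characteristic function of $\mathcal O_{A,\Delta}$. The structure constants in the basis $\{T_{A,\Delta}\}$ are given by polynomials in $q$ with integer coefficients (independent of $q$). $\mathcal{MS}_v(2,d)$ is the $\mathbb K$-algebra with basis $\{T_{A,\Delta}\mid(A,\Delta)\in\Xi_{2,d}\}$ and structure constants obtained from these polynomials by substituting $q=v^2$. **Geometric generators.** Let $D(a,b)=\operatorname{diag}(a,b)$ and $E_{ij}$ the $2\times2$ matrix units. Put $\mathbf 1_r=T_{D(r,d-r),\varnothing}$ ($0\le r\le d$), $e_r=T_{D(r,d-r-1)+E_{12},\varnothing}$ and $f_r=T_{D(r,d-r-1)+E_{21},\varnothing}$ ($0\le r\le d-1$), $x_r=T_{D(r,d-r),\{(1,1)\}}$ ($1\le r\le d$). Then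 $\widetilde e=\sum_{r=0}^{d-1}v^{-r}e_r$, $\widetilde f=\sum_{r=0}^{d-1}v^{1+r-d}f_r$, $\widetilde k^{\pm1}=\sum_{r=0}^{d}v^{\pm(2r-d)}\mathbf 1_r$, $\widetilde\ell=\mathbf 1_0+\sum_{r=1}^{d}v^{-2r}(\mathbf 1_r+x_r)$. The identity element is $\sum_{r=0}^d\mathbf 1_r$. **Known fact (Rosso).** These elements generate $\mathcal{MS}_v(2,d)$ and satisfy the defining relations of $\mathbf U^{\mathrm{mir}}_v(2)$, so $\pi_d$ is a well-defined surjective algebra homomorphism. *)

theory Defs
  imports
    "HOL-Analysis.Finite_Cartesian_Product"
    "HOL-Library.Poly_Mapping"
    "HOL-Computational_Algebra.Polynomial"
    "HOL-Computational_Algebra.Fraction_Field"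
    "HOL-Algebra.QuotRing"
    "HOL-Algebra.Module"
begin

section \<open>The ground field \<open>\<complex>(v)\<close>\<close>

type_synonym ratfun = "complex poly fract"

definition vv :: ratfun where
  "vv = Fract [:0, 1:] 1"

definition qint :: "int \<Rightarrow> ratfun" where
  "qint m = (vv powi m - vv powi (- m)) / (vv - inverse vv)"


section \<open>Algebras over \<open>\<complex>(v)\<close>\<close>

text \<open>
  A not necessarily commutative unital algebra is a record of type
  \<^typ>\<open>(ratfun, 'a) module\<close>: its ring part carries the multiplication and its
  \<open>smult\<close> the action of the field of scalars, which is the whole type
  \<^typ>\<open>ratfun\<close>. The locale \<open>algebra\<close> of the library is not used because it requires
  commutativity.
\<close>

definition alg_hom :: "(ratfun, 'a) module \<Rightarrow> (ratfun, 'b) module \<Rightarrow> ('a \<Rightarrow> 'b) set" where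
  "alg_hom A B =
     {h \<in> ring_hom A B. \<forall>c. \<forall>x \<in> carrier A. h (c \<odot>\<^bsub>A\<^esub> x) = c \<odot>\<^bsub>B\<^esub> h x}"

definition alg_iso :: "(ratfun, 'a) module \<Rightarrow> (ratfun, 'b) module \<Rightarrow> ('a \<Rightarrow> 'b) set" where
  "alg_iso A B = {h \<in> alg_hom A B. bij_betw h (carrier A) (carrier B)}"

definition quot_alg :: "(ratfun, 'a) module \<Rightarrow> 'a set \<Rightarrow> (ratfun, 'a set) module" where
  "quot_alg A I = ring.extend (A Quot I)
     (module.fields (\<lambda>c X. \<Union>x\<in>X. I +>\<^bsub>A\<^esub> (c \<odot>\<^bsub>A\<^esub> x)))"


section \<open>The mirabolic quantum algebra\<close>

text \<open>Words form a monoid under concatenation, written additively because the monoid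
  algebra in \<^theory>\<open>HOL-Library.Poly_Mapping\<close> is built over an additive monoid.\<close>

instantiation list :: (type) monoid_add
begin

definition zero_list :: "'a list" where
  "zero_list = []"

definition plus_list :: "'a list \<Rightarrow> 'a list \<Rightarrow> 'a list" where
  "plus_list xs ys = xs @ ys"

instance
  by standard (simp_all add: zero_list_def plus_list_def)

end

text \<open>\<open>Gki\<close> stands for \<open>k\<^sup>-\<^sup>1\<close>.\<close>

datatype gen = Ge | Gf | Gk | Gki | Gl

type_synonym free_elt = "gen list \<Rightarrow>\<^sub>0 ratfun"

definition fgen :: "gen \<Rightarrow> free_elt" where
  "fgen g = Poly_Mapping.single [g] 1"

definition fconst :: "ratfun \<Rightarrow> free_elt" where
  "fconst c = Poly_Mapping.single [] c"

definition free_alg :: "(ratfun, free_elt) module" where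
  "free_alg = \<lparr>carrier = UNIV, mult = (*), one = 1, zero = 0, add = (+),
                smult = (\<lambda>c p. fconst c * p)\<rparr>"

text \<open>A defining relation \<open>a = b\<close> is represented by \<open>a - b\<close>.\<close>

definition mir_relations :: "free_elt set" where
  "mir_relations =
    (let e = fgen Ge; f = fgen Gf; k = fgen Gk; k' = fgen Gki; l = fgen Gl in
     { k * k' - 1,
       k' * k - 1,
       k * e * k' - fconst (vv powi 2) * e,
       k * f * k' - fconst (vv powi (-2)) * f,
       (e * f - f * e) - fconst (1 / (vv - inverse vv)) * (k - k'),
       l * l - l,
       k * l - l * k,
       l * e * l - l * e,
       l * f * l - f * l,
       fconst (qint 2) * e * l * e - (fconst (inverse vv) * e * e * l + fconst vv * l * e * e),
       fconst (qint 2) * f * l * f - (fconst (inverse vv) * l * f * f + fconst vv * f * f * l) })"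

definition Umir :: "(ratfun, free_elt set) module" where
  "Umir = quot_alg free_alg (Idl\<^bsub>free_alg\<^esub> mir_relations)"

definition Ugen :: "gen \<Rightarrow> free_elt set" where
  "Ugen g = (Idl\<^bsub>free_alg\<^esub> mir_relations) +>\<^bsub>free_alg\<^esub> fgen g"

text \<open>The product of \<open>k - v\<^bsup>2r-d\<^esup>\<close> over the list \<open>rs\<close>; the factors commute, so the order
  given by the list is immaterial.\<close>

definition kprod :: "nat \<Rightarrow> nat list \<Rightarrow> free_elt set" where
  "kprod d rs = foldr
     (\<lambda>r p. (Ugen Gk \<ominus>\<^bsub>Umir\<^esub> ((vv powi (2 * int r - int d)) \<odot>\<^bsub>Umir\<^esub> \<one>\<^bsub>Umir\<^esub>)) \<otimes>\<^bsub>Umir\<^esub> p)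
     rs \<one>\<^bsub>Umir\<^esub>"

definition Pk :: "nat \<Rightarrow> free_elt set" where
  "Pk d = kprod d [0..<d + 1]"

definition Qk :: "nat \<Rightarrow> free_elt set" where
  "Qk d = kprod d [1..<d + 1]"

definition mir_ideal :: "nat \<Rightarrow> free_elt set set" where
  "mir_ideal d = Idl\<^bsub>Umir\<^esub> {Pk d, (Ugen Gl \<ominus>\<^bsub>Umir\<^esub> \<one>\<^bsub>Umir\<^esub>) \<otimes>\<^bsub>Umir\<^esub> Qk d}"

definition U2 :: "nat \<Rightarrow> (ratfun, free_elt set set) module" where
  "U2 d = quot_alg Umir (mir_ideal d)"

definition U2gen :: "nat \<Rightarrow> gen \<Rightarrow> free_elt set set" where
  "U2gen d g = mir_ideal d +>\<^bsub>Umir\<^esub> Ugen g"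


section \<open>Decorated matrices\<close>

text \<open>The elements of the two-element type \<^typ>\<open>2\<close> are written \<open>1\<close> and \<open>2\<close>.\<close>

type_synonym deco = "(2 \<times> 2) set"
type_synonym dmat = "(nat ^ 2 ^ 2) \<times> deco"

definition Theta :: "nat \<Rightarrow> (nat ^ 2 ^ 2) set" where
  "Theta d = {A. (\<Sum>i\<in>UNIV. \<Sum>j\<in>UNIV. A $ i $ j) = d}"

definition decorations :: "deco set" where
  "decorations = {{}, {(1, 1)}, {(1, 2)}, {(2, 1)}, {(1, 2), (2, 1)}, {(2, 2)}}"

definition Xi :: "nat \<Rightarrow> dmat set" where
  "Xi d = {(A, D). A \<in> Theta d \<and> D \<in> decorations \<and> (\<forall>(i, j) \<in> D. A $ i $ j > 0)}"

definition Dmat :: "nat \<Rightarrow> nat \<Rightarrow> nat ^ 2 ^ 2" where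
  "Dmat a b = (\<chi> i j. if i = j then (if i = 1 then a else b) else 0)"

definition Emat :: "2 \<Rightarrow> 2 \<Rightarrow> nat ^ 2 ^ 2" where
  "Emat i j = (\<chi> i' j'. if i' = i \<and> j' = j then 1 else 0)"


section \<open>Orbits and convolution over a finite field\<close>

text \<open>
  The finite fields are the fields \<open>R\<close> with finite carrier inside the fixed type
  \<^typ>\<open>int\<close>; up to isomorphism these are all finite fields, so that quantifying over
  them amounts to quantifying over all prime powers \<open>q = card (carrier R)\<close>.
  The ring multiplication of the record \<open>Vsp\<close> is irrelevant.
\<close>

type_synonym vec_elt = "nat \<Rightarrow> int"
type_synonym config = "vec_elt set \<times> vec_elt set \<times> vec_elt"

definition Vsp :: "int ring \<Rightarrow> nat \<Rightarrow> (int, vec_elt) module" where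
  "Vsp R d = \<lparr>carrier = {..<d} \<rightarrow>\<^sub>E carrier R, mult = undefined, one = undefined,
     zero = (\<lambda>i\<in>{..<d}. \<zero>\<^bsub>R\<^esub>),
     add = (\<lambda>x y. \<lambda>i\<in>{..<d}. x i \<oplus>\<^bsub>R\<^esub> y i),
     smult = (\<lambda>c x. \<lambda>i\<in>{..<d}. c \<otimes>\<^bsub>R\<^esub> x i)\<rparr>"

text \<open>A flag \<open>0 = F\<^sub>0 \<subseteq> F\<^sub>1 \<subseteq> F\<^sub>2 = V\<close> is represented by its only free member, the
  subspace \<open>F\<^sub>1\<close>.\<close>

definition flags :: "int ring \<Rightarrow> nat \<Rightarrow> vec_elt set set" where
  "flags R d = {W. submodule W R (Vsp R d)}"

definition configs :: "int ring \<Rightarrow> nat \<Rightarrow> config set" where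
  "configs R d = flags R d \<times> flags R d \<times> carrier (Vsp R d)"

definition lin_comb :: "int ring \<Rightarrow> nat \<Rightarrow> ('i \<Rightarrow> vec_elt) \<Rightarrow> 'i set \<Rightarrow> ('i \<Rightarrow> int) \<Rightarrow> vec_elt" where
  "lin_comb R d b I c = (\<Oplus>\<^bsub>Vsp R d\<^esub>t\<in>I. c t \<odot>\<^bsub>Vsp R d\<^esub> b t)"

definition fam_span :: "int ring \<Rightarrow> nat \<Rightarrow> ('i \<Rightarrow> vec_elt) \<Rightarrow> 'i set \<Rightarrow> vec_elt set" where
  "fam_span R d b I = {lin_comb R d b I c | c. c \<in> I \<rightarrow> carrier R}"

definition fam_basis :: "int ring \<Rightarrow> nat \<Rightarrow> ('i \<Rightarrow> vec_elt) \<Rightarrow> 'i set \<Rightarrow> bool" where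
  "fam_basis R d b I \<longleftrightarrow>
     b \<in> I \<rightarrow> carrier (Vsp R d) \<and>
     (\<forall>c \<in> I \<rightarrow> carrier R. lin_comb R d b I c = \<zero>\<^bsub>Vsp R d\<^esub> \<longrightarrow> (\<forall>t\<in>I. c t = \<zero>\<^bsub>R\<^esub>)) \<and>
     fam_span R d b I = carrier (Vsp R d)"

definition idx :: "nat ^ 2 ^ 2 \<Rightarrow> (2 \<times> 2 \<times> nat) set" where
  "idx A = {(i, j, s). 1 \<le> s \<and> s \<le> A $ i $ j}"

definition orbit :: "int ring \<Rightarrow> nat \<Rightarrow> dmat \<Rightarrow> config set" where
  "orbit R d X = (case X of (A, D) \<Rightarrow>
     {(F, F', w). (F, F', w) \<in> configs R d \<and>
        (\<exists>b. fam_basis R d b (idx A) \<and>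
             F = fam_span R d b {(i, j, s) \<in> idx A. i = 1} \<and>
             F' = fam_span R d b {(i, j, s) \<in> idx A. j = 1} \<and>
             w = (\<Oplus>\<^bsub>Vsp R d\<^esub>p\<in>D. b (fst p, snd p, 1)))})"

definition charfun :: "int ring \<Rightarrow> nat \<Rightarrow> dmat \<Rightarrow> config \<Rightarrow> int" where
  "charfun R d X t = (if t \<in> orbit R d X then 1 else 0)"

definition conv :: "int ring \<Rightarrow> nat \<Rightarrow> (config \<Rightarrow> int) \<Rightarrow> (config \<Rightarrow> int) \<Rightarrow> config \<Rightarrow> int" where
  "conv R d \<alpha> \<beta> = (\<lambda>(F, F'', w).
     \<Sum>F'\<in>flags R d. \<Sum>u\<in>carrier (Vsp R d).
       \<alpha> (F, F', u) * \<beta> (F', F'', w \<ominus>\<^bsub>Vsp R d\<^esub> u))"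

definition is_struct_polys :: "nat \<Rightarrow> (dmat \<Rightarrow> dmat \<Rightarrow> dmat \<Rightarrow> int poly) \<Rightarrow> bool" where
  "is_struct_polys d c \<longleftrightarrow>
     (\<forall>R :: int ring. field R \<and> finite (carrier R) \<longrightarrow>
       (\<forall>X \<in> Xi d. \<forall>Y \<in> Xi d. \<forall>t \<in> configs R d.
          conv R d (charfun R d X) (charfun R d Y) t =
          (\<Sum>Z\<in>Xi d. poly (c X Y Z) (int (card (carrier R))) * charfun R d Z t)))"

text \<open>On \<open>Xi d\<close> the structure polynomials are determined by this property: orbits are
  nonempty and pairwise disjoint, and there are infinitely many prime powers.\<close>

definition struct_poly :: "nat \<Rightarrow> dmat \<Rightarrow> dmat \<Rightarrow> dmat \<Rightarrow> int poly" where
  "struct_poly d = (SOME c. is_struct_polys d c)"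


section \<open>The generic mirabolic quantum Schur algebra\<close>

text \<open>An element is given by its coordinates with respect to the basis indexed by
  \<open>Xi d\<close>, extended by \<open>0\<close> outside \<open>Xi d\<close>.\<close>

definition Tbas :: "dmat \<Rightarrow> dmat \<Rightarrow> ratfun" where
  "Tbas X = (\<lambda>Y. if Y = X then 1 else 0)"

definition MS :: "nat \<Rightarrow> (ratfun, dmat \<Rightarrow> ratfun) module" where
  "MS d = \<lparr>carrier = {a. \<forall>X. X \<notin> Xi d \<longrightarrow> a X = 0},
     mult = (\<lambda>a b Z. if Z \<in> Xi d
               then \<Sum>X\<in>Xi d. \<Sum>Y\<in>Xi d.
                      a X * b Y * poly (map_poly of_int (struct_poly d X Y Z)) (vv powi 2)
               else 0),
     one = (\<lambda>X. \<Sum>r\<in>{0..d}. Tbas (Dmat r (d - r), {}) X),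
     zero = (\<lambda>_. 0),
     add = (\<lambda>a b X. a X + b X),
     smult = (\<lambda>c a X. c * a X)\<rparr>"

definition MS1 :: "nat \<Rightarrow> nat \<Rightarrow> dmat \<Rightarrow> ratfun" where
  "MS1 d r = Tbas (Dmat r (d - r), {})"

definition MSe :: "nat \<Rightarrow> nat \<Rightarrow> dmat \<Rightarrow> ratfun" where
  "MSe d r = Tbas (Dmat r (d - r - 1) + Emat 1 2, {})"

definition MSf :: "nat \<Rightarrow> nat \<Rightarrow> dmat \<Rightarrow> ratfun" where
  "MSf d r = Tbas (Dmat r (d - r - 1) + Emat 2 1, {})"

definition MSx :: "nat \<Rightarrow> nat \<Rightarrow> dmat \<Rightarrow> ratfun" where
  "MSx d r = Tbas (Dmat r (d - r), {(1, 1)})"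

fun MSgen :: "nat \<Rightarrow> gen \<Rightarrow> dmat \<Rightarrow> ratfun" where
  "MSgen d Ge = (\<Oplus>\<^bsub>MS d\<^esub>r\<in>{0..<d}. (vv powi (- int r)) \<odot>\<^bsub>MS d\<^esub> MSe d r)"
| "MSgen d Gf = (\<Oplus>\<^bsub>MS d\<^esub>r\<in>{0..<d}. (vv powi (1 + int r - int d)) \<odot>\<^bsub>MS d\<^esub> MSf d r)"
| "MSgen d Gk = (\<Oplus>\<^bsub>MS d\<^esub>r\<in>{0..d}. (vv powi (2 * int r - int d)) \<odot>\<^bsub>MS d\<^esub> MS1 d r)"
| "MSgen d Gki = (\<Oplus>\<^bsub>MS d\<^esub>r\<in>{0..d}. (vv powi (- (2 * int r - int d))) \<odot>\<^bsub>MS d\<^esub> MS1 d r)"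
| "MSgen d Gl = MS1 d 0 \<oplus>\<^bsub>MS d\<^esub>
     (\<Oplus>\<^bsub>MS d\<^esub>r\<in>{1..d}. (vv powi (- 2 * int r)) \<odot>\<^bsub>MS d\<^esub> (MS1 d r \<oplus>\<^bsub>MS d\<^esub> MSx d r))"

end

theory Submission
  imports Defs "HOL-Number_Theory.Residues" "HOL-Analysis.Cartesian_Space"
begin

text \<open>
  Over a finite field, left convolution by the generators acts on functions of the relative position of
  \<open>(F, F', w)\<close>: it sums over the hyperplanes of \<open>F\<close>, over the subspaces in which \<open>F\<close> is a hyperplane,
  or over the translates of \<open>w\<close> by \<open>F\<close>. The coefficients of these three operators are polynomials in
  \<open>q\<close>. Starting from the diagonal functions \<open>1\<^sub>r\<close>, the operators produce every orbit function up to
  division by monic polynomials in \<open>q\<close>; this yields the structure polynomials and, at \<open>q = v\<^sup>2\<close>,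
  surjectivity. Identities between the polynomials are checked at all primes, because every
  orbit type occurs over every finite field.

  The kernel is controlled by a dimension count. Let the weights of \<open>k\<close> be
  \<open>v\<^bsup>-n\<^esup>, v\<^bsup>2-n\<^esup>, \<dots>, v\<^bsup>n\<^esup>\<close>, let \<open>p\<close> be the projector to the highest one (up to a scalar), and suppose
  that \<open>l\<close> acts as \<open>1\<close> on the lowest one. The ideals generated by \<open>l p\<close> and by \<open>(1 - l) p\<close> are spanned by the products
  of a left and a right module generated by a highest weight vector, of dimension \<open>n + 1\<close> and \<open>2 n\<close>
  respectively. Modulo them both extreme weights disappear and \<open>n\<close> drops by \<open>2\<close>, but the condition on
  the lowest weight is lost; it is restored by factoring out the ideal generated by
  \<open>(1 - l) p\<^sub>0\<close> for the new lowest weight projector \<open>p\<^sub>0\<close>, which has dimension at most the square of \<open>n - 1\<close>. The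
  total is the number of orbit types, the dimension of the target.
\<close>

section \<open>Subspaces of a finite vector space\<close>

text \<open>The dimension count needs only an upper bound. The quotient is spanned by at most as
  many products as the target has basis vectors, and a surjection onto the target turns this into an
  equality, so linear independence comes from the geometric side. Each square in the count is the
  product of a left and a right module; the module theory is therefore done once, for operators
  \<open>e\<close>, \<open>f\<close>, \<open>l\<close> on weight vectors, and applied to both
  regular actions.

  The obstacle is \<open>e (l (f m))\<close> for a highest weight vector \<open>m\<close> killed by
  \<open>l\<close>: a priori it is a further highest weight vector. The condition on the lowest
  weight makes it a multiple of \<open>m\<close>. After the extreme weights are removed, the new
  lowest weight is an old inner one, on which \<open>l\<close> is unconstrained; but a lowest weight
  vector killed by \<open>l\<close> stays killed under \<open>e\<close>, so restoring the condition
  costs only a simple chain.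

  Multiplicativity of the map to the target comes from letting the free algebra act on the target by
  operators that commute with right multiplication, and applying them to the unit.\<close>

definition gn :: "'a::comm_semiring_1 \<Rightarrow> nat \<Rightarrow> 'a" where
  "gn t n = (\<Sum>i<n. t ^ i)"

lemma gn_0 [simp]: "gn t 0 = 0"
  and gn_Suc: "gn t (Suc n) = gn t n + t ^ n"
  and gn_Suc0 [simp]: "gn t (Suc 0) = 1"
  by (simp_all add: gn_def)

lemma of_nat_gn: "of_nat (gn t n) = gn (of_nat t) n"
  by (simp add: gn_def)

text \<open>\<open>gn q n\<close> is the number of lines of an n-dimensional space over a field with
  q elements, and each line carries q - 1 nonzero vectors.\<close>

lemma power_eq_gn: "t ^ n = 1 + (t - 1) * gn t n" for t :: "'a::comm_ring_1"
proof (induction n)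
  case (Suc n)
  have "1 + (t - 1) * gn t (Suc n) = (1 + (t - 1) * gn t n) - t ^ n + t ^ Suc n"
    by (simp add: gn_Suc algebra_simps)
  also have "\<dots> = t ^ Suc n" unfolding Suc.IH[symmetric] by simp
  finally show ?case ..
qed simp

lemma power_eq_gn_nat: "t > 0 \<Longrightarrow> t ^ n = 1 + (t - 1) * gn t n" for t :: nat
proof -
  assume "t > 0"
  then have "int (t ^ n) = int (1 + (t - 1) * gn t n)"
    using power_eq_gn[of "int t" n] by (simp add: of_nat_gn Suc_leI)
  then show ?thesis using of_nat_eq_iff by blast
qed

text \<open>Inclusion-exclusion for a sum whose terms depend only on the truth values of
  \<open>P\<close> and \<open>Q\<close>. The cardinalities enter as ring elements, so that no
  difference is truncated; an empty class may be given any value, and below it is given 0.\<close>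

lemma sum_two_predicates:
  fixes f :: "'b \<Rightarrow> 'a::comm_ring_1"
  assumes "finite A"
    and "\<And>x. x \<in> A \<Longrightarrow> P x \<Longrightarrow> Q x \<Longrightarrow> f x = u1"
    and "\<And>x. x \<in> A \<Longrightarrow> P x \<Longrightarrow> \<not> Q x \<Longrightarrow> f x = u2"
    and "\<And>x. x \<in> A \<Longrightarrow> \<not> P x \<Longrightarrow> Q x \<Longrightarrow> f x = u3"
    and "\<And>x. x \<in> A \<Longrightarrow> \<not> P x \<Longrightarrow> \<not> Q x \<Longrightarrow> f x = u4"
    and n: "of_nat (card A) = n" and p: "of_nat (card {x \<in> A. P x}) = p" and qq: "of_nat (card {x \<in> A. Q x}) = qq"
    and pq: "of_nat (card {x \<in> A. P x \<and> Q x}) = pq"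
  shows "sum f A = pq * u1 + (p - pq) * u2 + (qq - pq) * u3 + (n - p - qq + pq) * u4"
proof -
  have c: "(\<Sum>x\<in>A. of_bool (S x)) = (of_nat (card {x \<in> A. S x}) :: 'a)" for S
  proof -
    have "{x \<in> A. S x} = A \<inter> {x. S x}" by blast
    then show ?thesis using assms(1) by simp
  qed
  have "sum f A = (\<Sum>x\<in>A. of_bool (P x \<and> Q x) * u1 + (of_bool (P x) - of_bool (P x \<and> Q x)) * u2
    + (of_bool (Q x) - of_bool (P x \<and> Q x)) * u3
    + (1 - of_bool (P x) - of_bool (Q x) + of_bool (P x \<and> Q x)) * u4)"
    using assms(2-5) by (intro sum.cong) auto
  also have "\<dots> = pq * u1 + (p - pq) * u2 + (qq - pq) * u3 + (n - p - qq + pq) * u4"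
    unfolding sum.distrib sum_distrib_right[symmetric] sum_subtractf c p pq qq
    by (simp add: n)
  finally show ?thesis .
qed

locale fvec = module R M for R (structure) and M (structure) +
  assumes field_R: "field R"
    and finite_R: "finite (carrier R)"
    and finite_M: "finite (carrier M)"
begin

abbreviation vplus (infixl "\<oplus>\<oplus>" 65) where "x \<oplus>\<oplus> y \<equiv> x \<oplus>\<^bsub>M\<^esub> y"
abbreviation vneg where "vneg x \<equiv> \<ominus>\<^bsub>M\<^esub> x"
abbreviation vzero where "vzero \<equiv> \<zero>\<^bsub>M\<^esub>"

definition sub :: "'c set \<Rightarrow> bool" where "sub W \<longleftrightarrow> submodule W R M"

definition q :: nat where "q = card (carrier R)"

definition ssum :: "'c set \<Rightarrow> 'c set \<Rightarrow> 'c set" where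
  "ssum A B = {x \<oplus>\<oplus> y | x y. x \<in> A \<and> y \<in> B}"

definition line :: "'c \<Rightarrow> 'c set" where "line x = {c \<odot>\<^bsub>M\<^esub> x | c. c \<in> carrier R}"

text \<open>The cardinality of a subspace is a power of \<open>q\<close>, and its exponent serves as the dimension.\<close>

definition dimn :: "'c set \<Rightarrow> nat" where "dimn W = (LEAST n. card W \<le> q ^ n)"

lemma sub_subset: "sub W \<Longrightarrow> W \<subseteq> carrier M"
  unfolding sub_def by (rule submoduleE(1))

lemma sub_zero [simp]: "sub W \<Longrightarrow> vzero \<in> W"
  unfolding sub_def using subgroup.one_closed[OF submodule.axioms(1), of W R M] by simp

lemma sub_add: "sub W \<Longrightarrow> x \<in> W \<Longrightarrow> y \<in> W \<Longrightarrow> x \<oplus>\<oplus> y \<in> W"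
  unfolding sub_def by (rule submoduleE(5))

lemma sub_neg: "sub W \<Longrightarrow> x \<in> W \<Longrightarrow> vneg x \<in> W"
  unfolding sub_def by (rule submoduleE(3))

lemma sub_smult: "sub W \<Longrightarrow> c \<in> carrier R \<Longrightarrow> x \<in> W \<Longrightarrow> c \<odot>\<^bsub>M\<^esub> x \<in> W"
  unfolding sub_def by (rule submoduleE(4))

lemma sub_carrier: "sub W \<Longrightarrow> x \<in> W \<Longrightarrow> x \<in> carrier M"
  using sub_subset by blast

lemma sub_finite: "sub W \<Longrightarrow> finite W"
  using sub_subset finite_M finite_subset by blast

lemma sub_minus: "sub W \<Longrightarrow> x \<in> W \<Longrightarrow> y \<in> W \<Longrightarrow> x \<ominus>\<^bsub>M\<^esub> y \<in> W"
  by (simp add: a_minus_def sub_add sub_neg)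

lemma subI:
  assumes "W \<subseteq> carrier M" "vzero \<in> W"
    "\<And>x y. x \<in> W \<Longrightarrow> y \<in> W \<Longrightarrow> x \<oplus>\<oplus> y \<in> W"
    "\<And>c x. c \<in> carrier R \<Longrightarrow> x \<in> W \<Longrightarrow> c \<odot>\<^bsub>M\<^esub> x \<in> W"
  shows "sub W"
  unfolding sub_def
proof (rule submoduleI)
  fix a assume a: "a \<in> W"
  then have "a \<in> carrier M" using assms(1) by blast
  then have "vneg a = (\<ominus> \<one>) \<odot>\<^bsub>M\<^esub> a" by (simp add: smult_l_minus)
  then show "vneg a \<in> W" using assms(4) a by simp
qed (use assms in auto)

lemma sub_M: "sub (carrier M)"
  by (rule subI) auto

lemma sub_null: "sub {vzero}"
  by (rule subI) auto

lemma sub_inter: "sub A \<Longrightarrow> sub B \<Longrightarrow> sub (A \<inter> B)"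
  by (rule subI) (use sub_subset sub_add sub_smult in auto)

lemma ssumI: "x \<in> A \<Longrightarrow> y \<in> B \<Longrightarrow> x \<oplus>\<oplus> y \<in> ssum A B"
  unfolding ssum_def by blast

lemma ssumE:
  assumes "z \<in> ssum A B" obtains x y where "x \<in> A" "y \<in> B" "z = x \<oplus>\<oplus> y"
  using assms unfolding ssum_def by blast

lemma sub_ssum: assumes A: "sub A" and B: "sub B" shows "sub (ssum A B)"
proof (rule subI)
  show "ssum A B \<subseteq> carrier M"
    using sub_subset[OF A] sub_subset[OF B] unfolding ssum_def by blast
  show "vzero \<in> ssum A B"
    using ssumI[OF sub_zero[OF A] sub_zero[OF B]] by simp
next
  fix x y assume "x \<in> ssum A B" "y \<in> ssum A B"
  then obtain a b a' b' where ab: "a \<in> A" "b \<in> B" "x = a \<oplus>\<oplus> b" "a' \<in> A" "b' \<in> B" "y = a' \<oplus>\<oplus> b'"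
    unfolding ssum_def by blast
  then have "a \<in> carrier M" "b \<in> carrier M" "a' \<in> carrier M" "b' \<in> carrier M"
    using sub_carrier[OF A] sub_carrier[OF B] by blast+
  then have "x \<oplus>\<oplus> y = (a \<oplus>\<oplus> a') \<oplus>\<oplus> (b \<oplus>\<oplus> b')"
    unfolding ab by (simp add: M.a_ac)
  then show "x \<oplus>\<oplus> y \<in> ssum A B"
    using ab by (simp add: ssumI sub_add A B)
next
  fix c x assume c: "c \<in> carrier R" and "x \<in> ssum A B"
  then obtain a b where ab: "a \<in> A" "b \<in> B" "x = a \<oplus>\<oplus> b" unfolding ssum_def by blast
  then have "c \<odot>\<^bsub>M\<^esub> x = c \<odot>\<^bsub>M\<^esub> a \<oplus>\<oplus> c \<odot>\<^bsub>M\<^esub> b"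
    using c sub_carrier[OF A] sub_carrier[OF B] by (simp add: smult_r_distr)
  then show "c \<odot>\<^bsub>M\<^esub> x \<in> ssum A B"
    using ab c by (simp add: ssumI sub_smult A B)
qed

lemma ssum_upper1: assumes "sub A" "sub B" shows "A \<subseteq> ssum A B"
proof
  fix x assume x: "x \<in> A"
  have "x \<oplus>\<oplus> vzero \<in> ssum A B" using assms x by (intro ssumI) auto
  then show "x \<in> ssum A B" using sub_carrier[OF assms(1) x] by simp
qed

lemma ssum_commute: assumes "sub A" "sub B" shows "ssum A B = ssum B A"
  unfolding ssum_def using sub_carrier[OF assms(1)] sub_carrier[OF assms(2)] M.a_comm by blast

lemma ssum_upper2: assumes "sub A" "sub B" shows "B \<subseteq> ssum A B"
  using ssum_upper1[OF assms(2,1)] ssum_commute[OF assms] by simp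

lemma ssum_least: "sub C \<Longrightarrow> A \<subseteq> C \<Longrightarrow> B \<subseteq> C \<Longrightarrow> ssum A B \<subseteq> C"
  unfolding ssum_def using sub_add by blast

lemma line_self: "x \<in> carrier M \<Longrightarrow> x \<in> line x"
  unfolding line_def using smult_one by (metis (mono_tags, lifting) R.one_closed mem_Collect_eq)

lemma sub_line: assumes x: "x \<in> carrier M" shows "sub (line x)"
proof (rule subI)
  show "line x \<subseteq> carrier M" unfolding line_def using x by auto
  show "vzero \<in> line x" unfolding line_def using x smult_l_null R.zero_closed by (metis (mono_tags, lifting) mem_Collect_eq)
next
  fix y z assume "y \<in> line x" "z \<in> line x"
  then obtain c d where "c \<in> carrier R" "y = c \<odot>\<^bsub>M\<^esub> x" "d \<in> carrier R" "z = d \<odot>\<^bsub>M\<^esub> x"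
    unfolding line_def by blast
  then have "y \<oplus>\<oplus> z = (c \<oplus> d) \<odot>\<^bsub>M\<^esub> x" "c \<oplus> d \<in> carrier R" using x by (auto simp: smult_l_distr)
  then show "y \<oplus>\<oplus> z \<in> line x" unfolding line_def by blast
next
  fix c y assume c: "c \<in> carrier R" and "y \<in> line x"
  then obtain d where "d \<in> carrier R" "y = d \<odot>\<^bsub>M\<^esub> x"
    unfolding line_def by blast
  then have "c \<odot>\<^bsub>M\<^esub> y = (c \<otimes> d) \<odot>\<^bsub>M\<^esub> x" "c \<otimes> d \<in> carrier R" using x c by (auto simp: smult_assoc1)
  then show "c \<odot>\<^bsub>M\<^esub> y \<in> line x" unfolding line_def by blast
qed

lemma line_least: "sub W \<Longrightarrow> x \<in> W \<Longrightarrow> line x \<subseteq> W"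
  unfolding line_def using sub_smult by blast

lemma q_ge2: "q \<ge> 2"
proof -
  interpret F: field R by (rule field_R)
  have "card {\<zero>, \<one>} \<le> card (carrier R)"
    by (rule card_mono) (auto simp: finite_R)
  then show ?thesis unfolding q_def by simp
qed

lemma q_pos [simp]: "q > 0"
  using q_ge2 by simp

lemma smult_mem_imp:
  assumes W: "sub W" and x: "x \<in> carrier M" and c: "c \<in> carrier R" "c \<noteq> \<zero>" and cx: "c \<odot>\<^bsub>M\<^esub> x \<in> W"
  shows "x \<in> W"
proof -
  interpret F: field R by (rule field_R)
  have i: "inv c \<in> carrier R" "inv c \<otimes> c = \<one>" using c F.field_Units by auto
  have "x = (inv c \<otimes> c) \<odot>\<^bsub>M\<^esub> x" using i x by simp
  also have "\<dots> = inv c \<odot>\<^bsub>M\<^esub> (c \<odot>\<^bsub>M\<^esub> x)" using i c x by (intro smult_assoc1)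
  also have "\<dots> \<in> W" using W i cx by (rule_tac sub_smult)
  finally show ?thesis .
qed

text \<open>The map from (c, w) to w + c x is injective: two representations of one vector would put
  a nonzero multiple of x, hence x itself, into W.\<close>

lemma card_ssum_line:
  assumes W: "sub W" and x: "x \<in> carrier M" "x \<notin> W"
  shows "card (ssum W (line x)) = q * card W"
proof -
  let ?f = "\<lambda>(c, w). w \<oplus>\<oplus> c \<odot>\<^bsub>M\<^esub> x"
  have inj: "inj_on ?f (carrier R \<times> W)"
  proof (rule inj_onI, clarify)
    fix c w c' w' assume cw: "c \<in> carrier R" "w \<in> W" "c' \<in> carrier R" "w' \<in> W"
      and eq: "w \<oplus>\<oplus> c \<odot>\<^bsub>M\<^esub> x = w' \<oplus>\<oplus> c' \<odot>\<^bsub>M\<^esub> x"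
    note car = sub_carrier[OF W cw(2)] sub_carrier[OF W cw(4)]
    have cx: "c \<odot>\<^bsub>M\<^esub> x \<in> carrier M" "c' \<odot>\<^bsub>M\<^esub> x \<in> carrier M" using cw x by auto
    have "(c \<ominus> c') \<odot>\<^bsub>M\<^esub> x = c \<odot>\<^bsub>M\<^esub> x \<oplus>\<oplus> vneg (c' \<odot>\<^bsub>M\<^esub> x)"
      using cw x by (simp add: a_minus_def smult_l_distr smult_l_minus)
    also have "\<dots> = w' \<oplus>\<oplus> vneg w"
    proof -
      have "c \<odot>\<^bsub>M\<^esub> x = vneg w \<oplus>\<oplus> (w \<oplus>\<oplus> c \<odot>\<^bsub>M\<^esub> x)"
        using car cx by (simp add: M.r_neg1)
      also have "\<dots> = vneg w \<oplus>\<oplus> (w' \<oplus>\<oplus> c' \<odot>\<^bsub>M\<^esub> x)" by (simp add: eq)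
      finally have e: "c \<odot>\<^bsub>M\<^esub> x = vneg w \<oplus>\<oplus> (w' \<oplus>\<oplus> c' \<odot>\<^bsub>M\<^esub> x)" .
      have "c \<odot>\<^bsub>M\<^esub> x = (w' \<oplus>\<oplus> vneg w) \<oplus>\<oplus> c' \<odot>\<^bsub>M\<^esub> x"
        using e M.a_lcomm[of "vneg w" w' "c' \<odot>\<^bsub>M\<^esub> x"] M.a_assoc[of w' "vneg w" "c' \<odot>\<^bsub>M\<^esub> x"] car cx by simp
      then show ?thesis using car cx M.a_assoc[of "w' \<oplus>\<oplus> vneg w" "c' \<odot>\<^bsub>M\<^esub> x" "vneg (c' \<odot>\<^bsub>M\<^esub> x)"]
        by (simp add: M.r_neg)
    qed
    also have "\<dots> \<in> W" using cw W by (simp add: sub_add sub_neg)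
    finally have "(c \<ominus> c') \<odot>\<^bsub>M\<^esub> x \<in> W" .
    then have "c \<ominus> c' = \<zero>" using smult_mem_imp[OF W x(1)] x(2) cw by (meson R.minus_closed)
    then have c: "c = c'" using cw by simp
    then show "c = c' \<and> w = w'" using eq car cx by simp
  qed
  have "?f ` (carrier R \<times> W) = ssum W (line x)"
    unfolding ssum_def line_def by auto
  then have "card (ssum W (line x)) = card (carrier R \<times> W)"
    using card_image[OF inj] by simp
  then show ?thesis by (simp add: q_def card_cartesian_product)
qed

text \<open>Lines are added to A one at a time until B is reached; each of them multiplies the
  cardinality by q.\<close>

lemma card_sub_factor:
  assumes "sub A" "sub B" "A \<subseteq> B"
  shows "\<exists>n. card B = q ^ n * card A"
  using assms
proof (induction "card B - card A" arbitrary: A rule: less_induct)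
  case less
  show ?case
  proof (cases "A = B")
    case True then show ?thesis by (intro exI[of _ 0]) simp
  next
    case False
    then obtain x where x: "x \<in> B" "x \<notin> A" using less.prems by blast
    have xM: "x \<in> carrier M" using less.prems(2) x(1) by (rule sub_carrier)
    let ?A = "ssum A (line x)"
    have s: "sub ?A" "?A \<subseteq> B"
      using less.prems x xM by (auto intro!: sub_ssum sub_line ssum_least line_least del: subsetI)
    have cA: "card ?A = q * card A" using less.prems(1) xM x(2) by (rule card_ssum_line)
    have "card A > 0" using less.prems(1) sub_finite sub_zero by (metis card_gt_0_iff empty_iff)
    then have "card A < card ?A" using q_ge2 cA by simp
    moreover have "card ?A \<le> card B" using s less.prems by (intro card_mono sub_finite)
    ultimately have "card B - card ?A < card B - card A" by simp
    from less.hyps[OF this s(1) less.prems(2) s(2)] obtain n where "card B = q ^ n * card ?A" ..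
    then show ?thesis using cA by (intro exI[of _ "Suc n"]) simp
  qed
qed

lemma card_dimn: assumes "sub W" shows "card W = q ^ dimn W"
proof -
  obtain n where n: "card W = q ^ n"
    using card_sub_factor[OF sub_null assms] assms by auto
  have "dimn W = n" unfolding dimn_def n using q_ge2 by (intro Least_equality) (auto simp: power_increasing_iff)
  then show ?thesis using n by simp
qed

lemma q_power_inject [simp]: "q ^ m = q ^ n \<longleftrightarrow> m = n"
  using q_ge2 by (intro power_inject_exp) auto

lemma q_power_le [simp]: "q ^ m \<le> q ^ n \<longleftrightarrow> m \<le> n"
  using q_ge2 by (intro power_increasing_iff) auto

lemma dimn_eqI: "sub W \<Longrightarrow> card W = q ^ n \<Longrightarrow> dimn W = n"
  using card_dimn by simp

lemma dimn_mono: assumes "sub A" "sub B" "A \<subseteq> B" shows "dimn A \<le> dimn B"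
proof -
  have "card A \<le> card B" using assms by (intro card_mono sub_finite)
  then show ?thesis using assms by (simp add: card_dimn)
qed

lemma dimn_eq_imp_eq: "sub A \<Longrightarrow> sub B \<Longrightarrow> A \<subseteq> B \<Longrightarrow> dimn A = dimn B \<Longrightarrow> A = B"
  by (metis card_dimn card_subset_eq sub_finite)

lemma dimn_ssum_line: "sub W \<Longrightarrow> x \<in> carrier M \<Longrightarrow> x \<notin> W \<Longrightarrow> dimn (ssum W (line x)) = Suc (dimn W)"
  by (rule dimn_eqI) (simp_all add: sub_ssum sub_line card_ssum_line card_dimn[symmetric] del: card_dimn)

text \<open>The fibre of addition over a + b is a copy of the intersection: its points are the pairs
  (a + u, -u + b).\<close>

lemma card_ssum: assumes A: "sub A" and B: "sub B"
  shows "card (ssum A B) * card (A \<inter> B) = card A * card B"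
proof -
  let ?f = "\<lambda>(x, y). x \<oplus>\<oplus> y"
  have fin: "finite (A \<times> B)" "finite (ssum A B)" using A B by (auto intro!: sub_finite sub_ssum)
  have fib: "card {p \<in> A \<times> B. ?f p = z} = card (A \<inter> B)" if z: "z \<in> ssum A B" for z
  proof -
    obtain a b where ab: "a \<in> A" "b \<in> B" "z = a \<oplus>\<oplus> b" using z unfolding ssum_def by blast
    note car = sub_carrier[OF A] sub_carrier[OF B]
    have "bij_betw (\<lambda>u. (a \<oplus>\<oplus> u, vneg u \<oplus>\<oplus> b)) (A \<inter> B) {p \<in> A \<times> B. ?f p = z}"
    proof (rule bij_betwI')
      fix u v assume "u \<in> A \<inter> B" "v \<in> A \<inter> B"
      then have "u \<in> carrier M" "v \<in> carrier M" "a \<in> carrier M" using car(1) ab by auto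
      then show "((a \<oplus>\<oplus> u, vneg u \<oplus>\<oplus> b) = (a \<oplus>\<oplus> v, vneg v \<oplus>\<oplus> b)) = (u = v)"
        by auto
    next
      fix u assume u: "u \<in> A \<inter> B"
      then have c: "u \<in> carrier M" "a \<in> carrier M" "b \<in> carrier M" using car ab by auto
      then have "a \<oplus>\<oplus> u \<oplus>\<oplus> (vneg u \<oplus>\<oplus> b) = z"
        using M.a_assoc[of a u "vneg u \<oplus>\<oplus> b"] ab by (simp add: M.r_neg2)
      moreover have "a \<oplus>\<oplus> u \<in> A" "vneg u \<oplus>\<oplus> b \<in> B"
        using u ab by (simp_all add: sub_add[OF A] sub_add[OF B] sub_neg[OF B])
      ultimately show "(a \<oplus>\<oplus> u, vneg u \<oplus>\<oplus> b) \<in> {p \<in> A \<times> B. ?f p = z}" by simp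
    next
      fix p assume "p \<in> {p \<in> A \<times> B. ?f p = z}"
      then obtain x y where p: "p = (x, y)" "x \<in> A" "y \<in> B" "x \<oplus>\<oplus> y = a \<oplus>\<oplus> b" unfolding ab(3) by auto
      note cc = car(1)[OF p(2)] car(2)[OF p(3)] car(1)[OF ab(1)] car(2)[OF ab(2)]
      let ?u = "vneg a \<oplus>\<oplus> x"
      have "?u \<oplus>\<oplus> y = vneg a \<oplus>\<oplus> (x \<oplus>\<oplus> y)" using cc by (simp add: M.a_assoc)
      also have "\<dots> = b" unfolding p(4) using cc by (simp add: M.r_neg1)
      finally have uy: "?u \<oplus>\<oplus> y = b" .
      have uc: "?u \<in> carrier M" using cc by simp
      have 3: "vneg ?u \<oplus>\<oplus> b = y" using uy cc(2) uc M.r_neg1[of ?u y] by simp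
      have u: "?u = b \<oplus>\<oplus> vneg y"
        using uy cc uc M.a_assoc[of ?u y "vneg y"] by (simp add: M.r_neg)
      have "?u \<in> A" using p ab by (simp add: sub_add[OF A] sub_neg[OF A])
      moreover have "?u \<in> B" unfolding u using p ab by (simp add: sub_add[OF B] sub_neg[OF B])
      ultimately have 1: "?u \<in> A \<inter> B" by simp
      have 2: "a \<oplus>\<oplus> ?u = x" using cc by (simp add: M.r_neg2)
      show "\<exists>u\<in>A \<inter> B. p = (a \<oplus>\<oplus> u, vneg u \<oplus>\<oplus> b)"
        using 1 2 3 p(1) by (intro bexI[of _ ?u]) simp_all
    qed
    then show ?thesis by (simp add: bij_betw_same_card)
  qed
  have "card (A \<times> B) = (\<Sum>z\<in>ssum A B. \<Sum>p\<in>{p \<in> A \<times> B. ?f p = z}. 1)"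
    using sum.group[of "A \<times> B" "ssum A B" ?f "\<lambda>_. 1 :: nat"] fin by (force simp: ssumI)
  also have "\<dots> = card (ssum A B) * card (A \<inter> B)" using fib by simp
  finally show ?thesis by (simp add: card_cartesian_product)
qed

lemma dimn_ssum: assumes "sub A" "sub B"
  shows "dimn (ssum A B) + dimn (A \<inter> B) = dimn A + dimn B"
proof -
  have "q ^ (dimn (ssum A B) + dimn (A \<inter> B)) = q ^ (dimn A + dimn B)"
    using card_ssum[OF assms] assms by (simp add: card_dimn sub_ssum sub_inter power_add)
  then show ?thesis by simp
qed


end

section \<open>Counting hyperplanes and one-dimensional extensions\<close>

context fvec begin
definition overs :: "'c set \<Rightarrow> 'c set set" where
  "overs F = {H. sub H \<and> F \<subseteq> H \<and> dimn H = Suc (dimn F)}"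

definition hyper :: "'c set \<Rightarrow> 'c set set" where
  "hyper F = {H. sub H \<and> H \<subseteq> F \<and> Suc (dimn H) = dimn F}"

lemma finite_subs: "finite {H. sub H}"
  by (rule finite_subset[of _ "Pow (carrier M)"]) (auto simp: finite_M dest: sub_subset)

lemma finite_overs: "finite (overs F)" and finite_hyper: "finite (hyper F)"
  unfolding overs_def hyper_def by (auto intro: finite_subset[OF _ finite_subs])

lemma ssum_line_mem: assumes "sub F" "x \<in> carrier M" shows "x \<in> ssum F (line x)"
  using ssum_upper2[OF assms(1) sub_line[OF assms(2)]] line_self[OF assms(2)] by blast

lemma ssum_line_over:
  assumes F: "sub F" and x: "x \<in> carrier M" "x \<notin> F"
  shows "ssum F (line x) \<in> overs F"
  unfolding overs_def using F x by (simp add: sub_ssum sub_line ssum_upper1 dimn_ssum_line)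

lemma over_unique:
  assumes F: "sub F" and H: "H \<in> overs F" and x: "x \<in> H" "x \<notin> F"
  shows "H = ssum F (line x)"
proof -
  have H': "sub H" "F \<subseteq> H" "dimn H = Suc (dimn F)" using H unfolding overs_def by auto
  have xM: "x \<in> carrier M" using H'(1) x(1) by (rule sub_carrier)
  have "ssum F (line x) \<subseteq> H" using H' x by (intro ssum_least line_least)
  then show ?thesis
    using H' F x xM by (metis dimn_eq_imp_eq dimn_ssum_line sub_line sub_ssum)
qed

lemma card_diff_dimn: assumes "sub A" "sub B" "A \<subseteq> B"
  shows "card (B - A) = q ^ dimn A * ((q - 1) * gn q (dimn B - dimn A))"
proof -
  have "dimn A \<le> dimn B" using assms by (rule dimn_mono)
  then have "q ^ dimn B = q ^ dimn A * q ^ (dimn B - dimn A)" by (simp flip: power_add)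
  also have "\<dots> = q ^ dimn A + q ^ dimn A * ((q - 1) * gn q (dimn B - dimn A))"
    by (subst power_eq_gn_nat[OF q_pos, of "dimn B - dimn A"]) (simp add: algebra_simps)
  finally show ?thesis
    using assms by (simp add: card_Diff_subset sub_finite card_dimn)
qed

text \<open>The sets H - F partition C - F, because an extension is determined by any of its vectors
  outside F, and they all have the same size.\<close>

lemma card_over_within:
  assumes F: "sub F" and C: "sub C" "F \<subseteq> C"
  shows "card {H \<in> overs F. H \<subseteq> C} = gn q (dimn C - dimn F)"
proof -
  let ?S = "{H \<in> overs F. H \<subseteq> C}"
  have fin: "finite ?S" using finite_overs by simp
  have "C - F = (\<Union>H\<in>?S. H - F)"
  proof (intro equalityI subsetI)
    fix x assume x: "x \<in> C - F"
    then have xM: "x \<in> carrier M" using sub_carrier[OF C(1)] by blast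
    have "ssum F (line x) \<in> ?S"
      using x ssum_line_over[OF F xM] ssum_least[OF C(1) C(2) line_least[OF C(1)]] by simp
    then show "x \<in> (\<Union>H\<in>?S. H - F)" using ssum_line_mem[OF F xM] x by blast
  qed auto
  then have "card (C - F) = card (\<Union>H\<in>?S. H - F)" by simp
  also have "\<dots> = (\<Sum>H\<in>?S. card (H - F))"
  proof (rule card_UN_disjoint[OF fin])
    show "\<forall>H\<in>?S. finite (H - F)" by (auto simp: overs_def sub_finite)
    show "\<forall>H\<in>?S. \<forall>H'\<in>?S. H \<noteq> H' \<longrightarrow> (H - F) \<inter> (H' - F) = {}"
    proof (intro ballI impI)
      fix H H' assume h: "H \<in> ?S" "H' \<in> ?S" "H \<noteq> H'"
      have "x \<notin> H'" if "x \<in> H" "x \<notin> F" for x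
        using over_unique[OF F, of H x] over_unique[OF F, of H' x] that h by auto
      then show "(H - F) \<inter> (H' - F) = {}" by blast
    qed
  qed
  also have "\<dots> = (\<Sum>H\<in>?S. q ^ dimn F * (q - 1))"
    by (rule sum.cong) (auto simp: overs_def card_diff_dimn F)
  finally have "card ?S * (q ^ dimn F * (q - 1)) = gn q (dimn C - dimn F) * (q ^ dimn F * (q - 1))"
    using card_diff_dimn[OF F C] q_ge2 by (auto simp: mult_ac)
  moreover have "q ^ dimn F * (q - 1) > 0" using q_ge2 by simp
  ultimately show ?thesis by (simp add: mult_cancel2)
qed

text \<open>Double counting of the pairs (H, x) with x in H outside C: the hyperplanes through x are
  those containing C + line x, to which the induction hypothesis applies. Codimension 1 is treated
  apart, since there H - C is empty and its size cannot be cancelled.\<close>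

lemma card_hyper_containing:
  assumes F: "sub F" and C: "sub C" "C \<subseteq> F"
  shows "card {H \<in> hyper F. C \<subseteq> H} = gn q (dimn F - dimn C)"
  using C
proof (induction "dimn F - dimn C" arbitrary: C)
  case 0
  have "False" if "H \<in> hyper F" "C \<subseteq> H" for H
    using that 0 dimn_mono[of C H] unfolding hyper_def by simp
  then have "{H \<in> hyper F. C \<subseteq> H} = {}" by blast
  moreover have "gn q (dimn F - dimn C) = 0" using "0.hyps"[symmetric] by simp
  ultimately show ?case by (simp only: card.empty)
next
  case (Suc n)
  show ?case
  proof (cases "n = 0")
    case True
    have "{H \<in> hyper F. C \<subseteq> H} = {C}"
    proof (intro equalityI subsetI)
      fix H assume "H \<in> {H \<in> hyper F. C \<subseteq> H}"
      then have H: "sub H" "C \<subseteq> H" "Suc (dimn H) = dimn F" unfolding hyper_def by auto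
      then have "dimn C = dimn H" using Suc.hyps(2) True by simp
      then show "H \<in> {C}" using dimn_eq_imp_eq[of C H] Suc.prems H by simp
    qed (use Suc True in \<open>auto simp: hyper_def\<close>)
    moreover have "gn q (dimn F - dimn C) = 1" using Suc.hyps(2)[symmetric] True by simp
    ultimately show ?thesis by simp
  next
    case False
    let ?S = "{H \<in> hyper F. C \<subseteq> H}"
    have fin: "finite ?S" "finite (F - C)" using finite_hyper F by (auto simp: sub_finite)
    have k: "card {H \<in> ?S. x \<in> H} = gn q n" if x: "x \<in> F - C" for x
    proof -
      have xM: "x \<in> carrier M" using x sub_carrier[OF F] by blast
      let ?C = "ssum C (line x)"
      have s: "sub ?C" using Suc.prems xM by (simp add: sub_ssum sub_line)
      have "{H \<in> ?S. x \<in> H} = {H \<in> hyper F. ?C \<subseteq> H}"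
      proof (intro Collect_cong iffI)
        fix H assume "H \<in> ?S \<and> x \<in> H"
        moreover from this have "sub H" by (simp add: hyper_def)
        ultimately show "H \<in> hyper F \<and> ?C \<subseteq> H" using ssum_least[of H C "line x"] line_least[of H x] by simp
      next
        fix H assume "H \<in> hyper F \<and> ?C \<subseteq> H"
        then show "H \<in> ?S \<and> x \<in> H"
          using ssum_line_mem[OF Suc.prems(1) xM] ssum_upper1[OF Suc.prems(1) sub_line[OF xM]] by blast
      qed
      moreover have "?C \<subseteq> F" using x F Suc.prems by (intro ssum_least line_least) auto
      moreover have d: "n = dimn F - dimn ?C"
        using Suc.hyps(2) x dimn_ssum_line[OF Suc.prems(1) xM] by simp
      ultimately show ?thesis using Suc.hyps(1)[OF d s] d by simp
    qed
    have "(\<Sum>H\<in>?S. card {x \<in> F - C. x \<in> H}) = (\<Sum>x\<in>F - C. gn q n)"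
      by (rule sum_multicount_gen) (use fin k in auto)
    moreover have "card {x \<in> F - C. x \<in> H} = q ^ dimn C * ((q - 1) * gn q n)" if "H \<in> ?S" for H
    proof -
      have "{x \<in> F - C. x \<in> H} = H - C" using that unfolding hyper_def by auto
      moreover have "dimn H - dimn C = n" using that Suc.hyps(2) unfolding hyper_def mem_Collect_eq by linarith
      ultimately show ?thesis using that Suc.prems by (simp add: hyper_def card_diff_dimn)
    qed
    ultimately have "card ?S * (q ^ dimn C * ((q - 1) * gn q n)) = gn q (Suc n) * (q ^ dimn C * ((q - 1) * gn q n))"
      using card_diff_dimn[OF Suc.prems(1) F Suc.prems(2)] Suc.hyps(2) by (simp add: mult_ac)
    moreover have "gn q n > 0"
    proof -
      have "n = Suc (n - 1)" using False by simp
      then have "gn q n = gn q (n - 1) + q ^ (n - 1)" by (metis gn_Suc)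
      then show ?thesis using q_pos by simp
    qed
    then have "q ^ dimn C * ((q - 1) * gn q n) > 0" using q_ge2 by simp
    ultimately show ?thesis using Suc.hyps(2) by (simp add: mult_cancel2)
  qed
qed

end

section \<open>Relative positions of two subspaces and a vector\<close>

text \<open>The position \<open>(a, b, c, x, g)\<close> stands for the matrix with rows \<open>(a, b)\<close> and \<open>(c, x)\<close> and the
  decoration \<open>g\<close>; here \<open>Dx\<close> is the decoration \<open>{(1, 2), (2, 1)}\<close>.\<close>

datatype dtype = D0 | D11 | D12 | D21 | Dx | D22

type_synonym ix = "nat \<times> nat \<times> nat \<times> nat \<times> dtype"

text \<open>Where a subtraction below is truncated, its term has coefficient \<open>0\<close>, provided that the
  decorated entries are positive.\<close>

fun opE :: "'c::comm_ring_1 \<Rightarrow> (ix \<Rightarrow> 'c) \<Rightarrow> ix \<Rightarrow> 'c" where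
  "opE t \<phi> (a, b, c, x, D0) = gn t b * \<phi> (a, b - 1, c, x + 1, D0)
     + (gn t (a + b) - gn t b) * \<phi> (a - 1, b, c + 1, x, D0)"
| "opE t \<phi> (a, b, c, x, D11) = gn t b * \<phi> (a, b - 1, c, x + 1, D11)
     + (gn t (a + b - 1) - gn t b) * \<phi> (a - 1, b, c + 1, x, D11)
     + (gn t (a + b) - gn t (a + b - 1)) * \<phi> (a - 1, b, c + 1, x, D21)"
| "opE t \<phi> (a, b, c, x, D12) = gn t (b - 1) * \<phi> (a, b - 1, c, x + 1, D12)
     + (gn t b - gn t (b - 1)) * \<phi> (a, b - 1, c, x + 1, D22)
     + (gn t (a + b - 1) - gn t (b - 1)) * \<phi> (a - 1, b, c + 1, x, D12)
     + (gn t (a + b) - gn t b - gn t (a + b - 1) + gn t (b - 1)) * \<phi> (a - 1, b, c + 1, x, Dx)"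
| "opE t \<phi> (a, b, c, x, D21) = gn t b * \<phi> (a, b - 1, c, x + 1, D21)
     + (gn t (a + b) - gn t b) * \<phi> (a - 1, b, c + 1, x, D21)"
| "opE t \<phi> (a, b, c, x, Dx) = gn t (b - 1) * \<phi> (a, b - 1, c, x + 1, Dx)
     + (gn t b - gn t (b - 1)) * \<phi> (a, b - 1, c, x + 1, D22)
     + (gn t (a + b) - gn t b) * \<phi> (a - 1, b, c + 1, x, Dx)"
| "opE t \<phi> (a, b, c, x, D22) = gn t b * \<phi> (a, b - 1, c, x + 1, D22)
     + (gn t (a + b) - gn t b) * \<phi> (a - 1, b, c + 1, x, D22)"

text \<open>The isolated terms with coefficient 1 belong to the one extension F + line w that
  contains w. The last equation covers \<open>D0\<close>, \<open>D11\<close> and \<open>D12\<close>,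
  where w lies in F and keeps its decoration.\<close>

fun opF :: "'c::comm_ring_1 \<Rightarrow> (ix \<Rightarrow> 'c) \<Rightarrow> ix \<Rightarrow> 'c" where
  "opF t \<phi> (a, b, c, x, D21) = \<phi> (a + 1, b, c - 1, x, D11)
     + (gn t c - 1) * \<phi> (a + 1, b, c - 1, x, D21)
     + (gn t (c + x) - gn t c) * \<phi> (a, b + 1, c, x - 1, D21)"
| "opF t \<phi> (a, b, c, x, Dx) = \<phi> (a + 1, b, c - 1, x, D12)
     + (gn t c - 1) * \<phi> (a + 1, b, c - 1, x, Dx)
     + (gn t (c + x) - gn t c) * \<phi> (a, b + 1, c, x - 1, Dx)"
| "opF t \<phi> (a, b, c, x, D22) = gn t c * \<phi> (a + 1, b, c - 1, x, D22)
     + \<phi> (a, b + 1, c, x - 1, D12)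
     + (gn t (c + 1) - gn t c - 1) * \<phi> (a, b + 1, c, x - 1, Dx)
     + (gn t (c + x) - gn t (c + 1)) * \<phi> (a, b + 1, c, x - 1, D22)"
| "opF t \<phi> (a, b, c, x, g) = gn t c * \<phi> (a + 1, b, c - 1, x, g)
     + (gn t (c + x) - gn t c) * \<phi> (a, b + 1, c, x - 1, g)"

text \<open>Translation by F preserves the three classes w in F, w in F + G outside F, and w outside
  F + G; so the value depends only on the class of the decoration.\<close>

fun opL :: "'c::comm_ring_1 \<Rightarrow> (ix \<Rightarrow> 'c) \<Rightarrow> ix \<Rightarrow> 'c" where
  "opL t \<phi> (a, b, c, x, D21) = t ^ a * \<phi> (a, b, c, x, D21) + (t ^ (a + b) - t ^ a) * \<phi> (a, b, c, x, Dx)"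
| "opL t \<phi> (a, b, c, x, Dx) = t ^ a * \<phi> (a, b, c, x, D21) + (t ^ (a + b) - t ^ a) * \<phi> (a, b, c, x, Dx)"
| "opL t \<phi> (a, b, c, x, D22) = t ^ (a + b) * \<phi> (a, b, c, x, D22)"
| "opL t \<phi> (a, b, c, x, g) = \<phi> (a, b, c, x, D0) + (t ^ a - 1) * \<phi> (a, b, c, x, D11)
     + (t ^ (a + b) - t ^ a) * \<phi> (a, b, c, x, D12)"

section \<open>The type of a configuration and its change under hyperplanes\<close>

context fvec begin

definition pos :: "'c set \<Rightarrow> 'c set \<Rightarrow> 'c \<Rightarrow> dtype" where
  "pos F G w = (if w = vzero then D0 else if w \<in> F \<inter> G then D11 else if w \<in> F then D12
     else if w \<in> G then D21 else if w \<in> ssum F G then Dx else D22)"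

definition ctype :: "'c set \<Rightarrow> 'c set \<Rightarrow> 'c \<Rightarrow> ix" where
  "ctype F G w = (dimn (F \<inter> G), dimn F - dimn (F \<inter> G), dimn G - dimn (F \<inter> G),
     dimn (carrier M) - dimn (ssum F G), pos F G w)"

lemma pos_simps:
  assumes "sub F" "sub G"
  shows "pos F G vzero = D0"
    "w \<noteq> vzero \<Longrightarrow> w \<in> F \<Longrightarrow> w \<in> G \<Longrightarrow> pos F G w = D11"
    "w \<in> F \<Longrightarrow> w \<notin> G \<Longrightarrow> pos F G w = D12"
    "w \<notin> F \<Longrightarrow> w \<in> G \<Longrightarrow> pos F G w = D21"
    "w \<notin> F \<Longrightarrow> w \<notin> G \<Longrightarrow> w \<in> ssum F G \<Longrightarrow> pos F G w = Dx"
    "w \<notin> ssum F G \<Longrightarrow> pos F G w = D22"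
  using sub_zero[OF assms(1)] sub_zero[OF assms(2)] ssum_upper1[OF assms] ssum_upper2[OF assms]
  unfolding pos_def by auto

lemma card_hyper: assumes F: "sub F" shows "card (hyper F) = gn q (dimn F)"
proof -
  have "dimn {vzero} = 0" by (rule dimn_eqI[OF sub_null]) simp
  moreover have "{H \<in> hyper F. {vzero} \<subseteq> H} = hyper F" unfolding hyper_def by auto
  ultimately show ?thesis using card_hyper_containing[OF F sub_null] F by auto
qed

lemma hyper_containing_vec:
  assumes F: "sub F" and U: "sub U" "U \<subseteq> F" and y: "y \<in> F" "y \<notin> U"
  shows "card {H \<in> hyper F. U \<subseteq> H \<and> y \<in> H} = gn q (dimn F - dimn U - 1)"
proof -
  have yM: "y \<in> carrier M" using F y(1) by (rule sub_carrier)
  have s: "sub (ssum U (line y))" using U yM by (simp add: sub_ssum sub_line)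
  have le: "ssum U (line y) \<subseteq> F" using U F y by (intro ssum_least line_least)
  have "{H \<in> hyper F. U \<subseteq> H \<and> y \<in> H} = {H \<in> hyper F. ssum U (line y) \<subseteq> H}"
  proof (intro Collect_cong conj_cong refl iffI)
    fix H assume "H \<in> hyper F" "U \<subseteq> H \<and> y \<in> H"
    then show "ssum U (line y) \<subseteq> H" by (intro ssum_least line_least) (auto simp: hyper_def)
  next
    fix H assume "ssum U (line y) \<subseteq> H"
    then show "U \<subseteq> H \<and> y \<in> H" using ssum_line_mem[OF U(1) yM] ssum_upper1[OF U(1) sub_line[OF yM]] by blast
  qed
  then show ?thesis using card_hyper_containing[OF F s le] dimn_ssum_line[OF U(1) yM y(2)] by simp
qed

lemma hyper_containing_nonzero:
  assumes F: "sub F" and y: "y \<in> F" "y \<noteq> vzero"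
  shows "card {H \<in> hyper F. y \<in> H} = gn q (dimn F - 1)"
proof -
  have "dimn {vzero} = 0" by (rule dimn_eqI[OF sub_null]) simp
  moreover have "{H \<in> hyper F. {vzero} \<subseteq> H \<and> y \<in> H} = {H \<in> hyper F. y \<in> H}" unfolding hyper_def by auto
  ultimately show ?thesis using hyper_containing_vec[OF F sub_null _ y(1)] F y by auto
qed

text \<open>Whether H contains the intersection U of F and G decides the matrix of the new type.
  Whether H contains w or, for w in F + G, the component of w in F decides the decoration. The sum
  is then evaluated by \<open>sum_two_predicates\<close>.\<close>

lemma sum_hyper:
  fixes \<phi> :: "ix \<Rightarrow> 'k::comm_ring_1"
  assumes F: "sub F" and G: "sub G" and w: "w \<in> carrier M"
  shows "(\<Sum>H\<in>hyper F. \<phi> (ctype H G w)) = opE (of_nat q) \<phi> (ctype F G w)"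
proof -
  define U where "U = F \<inter> G"
  define a b c x where abc: "a = dimn U" "b = dimn F - dimn U" "c = dimn G - dimn U"
    "x = dimn (carrier M) - dimn (ssum F G)"
  have U: "sub U" "U \<subseteq> F" "U \<subseteq> G" unfolding U_def using F G by (auto simp: sub_inter)
  have dU: "dimn U \<le> dimn F" "dimn U \<le> dimn G" using dimn_mono U F G by auto
  have dS: "dimn (ssum F G) + dimn U = dimn F + dimn G" unfolding U_def by (rule dimn_ssum[OF F G])
  have FG: "sub (ssum F G)" "ssum F G \<subseteq> carrier M" using F G by (auto simp: sub_ssum sub_subset)
  have dM: "dimn (ssum F G) \<le> dimn (carrier M)" using FG sub_M by (intro dimn_mono)
  have ct: "ctype F G z = (a, b, c, x, pos F G z)" for z unfolding ctype_def abc U_def ..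
  have ab: "dimn F = a + b" "dimn F - dimn U = b" using dU abc by auto
  have T1: "ctype H G z = (a, b - 1, c, x + 1, pos H G z)" if H: "H \<in> hyper F" "U \<subseteq> H" for H z
  proof -
    have H': "sub H" "H \<subseteq> F" "Suc (dimn H) = dimn F" using H unfolding hyper_def by auto
    have HG: "H \<inter> G = U" using H' H(2) unfolding U_def by blast
    have "dimn (ssum H G) + dimn U = dimn H + dimn G" using dimn_ssum[OF H'(1) G] HG by simp
    then show ?thesis unfolding ctype_def HG abc using H'(3) dS dM dU by auto
  qed
  \<comment> \<open>If H does not contain U, then H and U together span F; so the intersection with
    G loses one dimension while H + G is still F + G.\<close>
  have T2: "ctype H G z = (a - 1, b, c + 1, x, pos H G z) \<and> ssum H G = ssum F G"
    if H: "H \<in> hyper F" "\<not> U \<subseteq> H" for H z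
  proof -
    have H': "sub H" "H \<subseteq> F" "Suc (dimn H) = dimn F" using H unfolding hyper_def by auto
    have HG: "H \<inter> G = H \<inter> U" using H' unfolding U_def by blast
    have HU: "sub (ssum H U)" "ssum H U \<subseteq> F" using H' U F by (auto intro!: sub_ssum ssum_least del: subsetI)
    have "dimn H \<noteq> dimn (ssum H U)"
      using dimn_eq_imp_eq[OF H'(1) HU(1) ssum_upper1[OF H'(1) U(1)]] H(2) ssum_upper2[OF H'(1) U(1)] by auto
    moreover have "dimn H \<le> dimn (ssum H U)" using H' HU U by (intro dimn_mono ssum_upper1)
    ultimately have "dimn (ssum H U) = dimn F" using dimn_mono[OF HU(1) F HU(2)] H'(3) by simp
    then have d: "Suc (dimn (H \<inter> G)) = a" "Suc (dimn (H \<inter> U)) = a" using dimn_ssum[OF H'(1) U(1)] H'(3) HG abc by auto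
    have d2: "dimn (ssum H G) = dimn (ssum F G)"
      using dimn_ssum[OF H'(1) G] d(1) dS H'(3) abc by simp
    have "ssum H G \<subseteq> ssum F G" using H' unfolding ssum_def by blast
    then have e: "ssum H G = ssum F G" using d2 H'(1) F G FG by (intro dimn_eq_imp_eq sub_ssum)
    show ?thesis unfolding ctype_def e using d(1) H'(3) dU abc by auto
  qed
  have n: "of_nat (card (hyper F)) = gn (of_nat q :: 'k) (a + b)"
    by (simp add: card_hyper[OF F] ab of_nat_gn)
  have p: "of_nat (card {H \<in> hyper F. U \<subseteq> H}) = gn (of_nat q :: 'k) b"
    by (simp only: card_hyper_containing[OF F U(1,2)] ab(2) of_nat_gn)
  have fin: "finite (hyper F)" by (rule finite_hyper)
  have subH: "sub H" "H \<subseteq> F" if "H \<in> hyper F" for H using that unfolding hyper_def by auto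
  \<comment> \<open>For H containing U, the sum H + G meets F in H only.\<close>
  have notin_ssum: "w' \<oplus>\<oplus> g \<notin> ssum H G"
    if "H \<in> hyper F" "U \<subseteq> H" "w' \<in> F" "w' \<notin> H" "g \<in> G" for H w' g
  proof
    assume "w' \<oplus>\<oplus> g \<in> ssum H G"
    then obtain h g' where h: "h \<in> H" "g' \<in> G" "w' \<oplus>\<oplus> g = h \<oplus>\<oplus> g'" by (rule ssumE)
    have cc: "h \<in> carrier M" "g' \<in> carrier M" "w' \<in> carrier M" "g \<in> carrier M"
      using h that sub_carrier[OF G] sub_carrier[OF F] subH(2)[OF that(1)] by blast+
    have "w' = w' \<oplus>\<oplus> g \<oplus>\<oplus> vneg g" using cc by (simp add: M.a_assoc M.r_neg)
    also have "\<dots> = h \<oplus>\<oplus> (g' \<oplus>\<oplus> vneg g)" unfolding h(3) using cc by (simp add: M.a_assoc)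
    finally have e: "w' = h \<oplus>\<oplus> (g' \<oplus>\<oplus> vneg g)" .
    have "g' \<oplus>\<oplus> vneg g = vneg h \<oplus>\<oplus> w'" unfolding e using cc by (simp add: M.r_neg1)
    also have "\<dots> \<in> F" using h that(3) subH(2)[OF that(1)] by (auto intro!: sub_add[OF F] sub_neg[OF F])
    finally have "g' \<oplus>\<oplus> vneg g \<in> U"
      unfolding U_def using sub_add[OF G] sub_neg[OF G] h that by auto
    then have "w' \<in> H" unfolding e using that(2) h sub_add[OF subH(1)[OF that(1)]] by auto
    then show False using that by simp
  qed
  have ssum_mono: "ssum H G \<subseteq> ssum F G" if "H \<in> hyper F" for H
    using subH(2)[OF that] unfolding ssum_def by blast
  consider "w = vzero" | "w \<noteq> vzero" "w \<in> F" "w \<in> G" | "w \<in> F" "w \<notin> G" | "w \<notin> F" "w \<in> G"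
    | "w \<notin> F" "w \<notin> G" "w \<in> ssum F G" | "w \<notin> ssum F G" by blast
  then show ?thesis
  proof cases
    case 1
    have "(\<Sum>H\<in>hyper F. \<phi> (ctype H G w)) = gn (of_nat q) b * \<phi> (a, b - 1, c, x + 1, D0)
      + (gn (of_nat q) b - gn (of_nat q) b) * 0 + (gn (of_nat q) (a + b) - gn (of_nat q) b) * \<phi> (a - 1, b, c + 1, x, D0)
      + (gn (of_nat q) (a + b) - gn (of_nat q) b - gn (of_nat q) (a + b) + gn (of_nat q) b) * 0"
      by (rule sum_two_predicates[where P = "\<lambda>H. U \<subseteq> H" and Q = "\<lambda>_. True"])
        (use fin n p in \<open>auto simp: T1 T2 pos_simps subH G 1 del: subsetI\<close>)
    then show ?thesis by (simp add: ct 1 pos_simps F G)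
  next
    case 2
    have wU: "w \<in> U" using 2 unfolding U_def by simp
    have "(\<Sum>H\<in>hyper F. \<phi> (ctype H G w)) = gn (of_nat q) b * \<phi> (a, b - 1, c, x + 1, D11)
      + (gn (of_nat q) b - gn (of_nat q) b) * 0
      + (gn (of_nat q) (a + b - 1) - gn (of_nat q) b) * \<phi> (a - 1, b, c + 1, x, D11)
      + (gn (of_nat q) (a + b) - gn (of_nat q) b - gn (of_nat q) (a + b - 1) + gn (of_nat q) b) * \<phi> (a - 1, b, c + 1, x, D21)"
    proof (rule sum_two_predicates[where P = "\<lambda>H. U \<subseteq> H" and Q = "\<lambda>H. w \<in> H"])
      show "of_nat (card {H \<in> hyper F. w \<in> H}) = gn (of_nat q :: 'k) (a + b - 1)"
        by (simp add: hyper_containing_nonzero[OF F 2(2,1)] ab of_nat_gn)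
      have "{H \<in> hyper F. U \<subseteq> H \<and> w \<in> H} = {H \<in> hyper F. U \<subseteq> H}" using wU by auto
      then show "of_nat (card {H \<in> hyper F. U \<subseteq> H \<and> w \<in> H}) = gn (of_nat q :: 'k) b" using p by simp
    qed (use fin n p 2 wU in \<open>auto simp: T1 T2 pos_simps subH G del: subsetI\<close>)
    then show ?thesis by (simp add: ct 2 pos_simps F G algebra_simps)
  next
    case 3
    have wU: "w \<notin> U" "w \<noteq> vzero" using 3 sub_zero[OF G] unfolding U_def by auto
    have nin: "w \<notin> ssum H G" if "H \<in> hyper F" "U \<subseteq> H" "w \<notin> H" for H
      using notin_ssum[OF that(1,2) 3(1) that(3) sub_zero[OF G]] w by simp
    have inn: "w \<in> ssum F G" using ssum_upper1[OF F G] 3 by blast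
    have "(\<Sum>H\<in>hyper F. \<phi> (ctype H G w)) = gn (of_nat q) (b - 1) * \<phi> (a, b - 1, c, x + 1, D12)
      + (gn (of_nat q) b - gn (of_nat q) (b - 1)) * \<phi> (a, b - 1, c, x + 1, D22)
      + (gn (of_nat q) (a + b - 1) - gn (of_nat q) (b - 1)) * \<phi> (a - 1, b, c + 1, x, D12)
      + (gn (of_nat q) (a + b) - gn (of_nat q) b - gn (of_nat q) (a + b - 1) + gn (of_nat q) (b - 1)) * \<phi> (a - 1, b, c + 1, x, Dx)"
    proof (rule sum_two_predicates[where P = "\<lambda>H. U \<subseteq> H" and Q = "\<lambda>H. w \<in> H"])
      show "of_nat (card {H \<in> hyper F. w \<in> H}) = gn (of_nat q :: 'k) (a + b - 1)"
        by (simp add: hyper_containing_nonzero[OF F 3(1) wU(2)] ab of_nat_gn)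
      show "of_nat (card {H \<in> hyper F. U \<subseteq> H \<and> w \<in> H}) = gn (of_nat q :: 'k) (b - 1)"
        by (simp only: hyper_containing_vec[OF F U(1,2) 3(1) wU(1)] ab(2) of_nat_gn)
    qed (use fin n p 3 wU nin inn in \<open>auto simp: T1 T2 pos_simps subH G del: subsetI\<close>)
    then show ?thesis by (simp add: ct 3 pos_simps F G)
  next
    case 4
    have nin: "w \<notin> H" if "H \<in> hyper F" for H using subH(2)[OF that] 4 by blast
    have "(\<Sum>H\<in>hyper F. \<phi> (ctype H G w)) = gn (of_nat q) b * \<phi> (a, b - 1, c, x + 1, D21)
      + (gn (of_nat q) b - gn (of_nat q) b) * 0 + (gn (of_nat q) (a + b) - gn (of_nat q) b) * \<phi> (a - 1, b, c + 1, x, D21)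
      + (gn (of_nat q) (a + b) - gn (of_nat q) b - gn (of_nat q) (a + b) + gn (of_nat q) b) * 0"
      by (rule sum_two_predicates[where P = "\<lambda>H. U \<subseteq> H" and Q = "\<lambda>_. True"])
        (use fin n p nin 4 in \<open>auto simp: T1 T2 pos_simps subH G del: subsetI\<close>)
    then show ?thesis by (simp add: ct 4 pos_simps F G)
  next
    case 5
    obtain y g where y: "y \<in> F" "g \<in> G" "w = y \<oplus>\<oplus> g" using 5(3) by (rule ssumE)
    have yU: "y \<notin> U" using 5(2) y(2,3) sub_add[OF G] unfolding U_def by auto
    have yz: "y \<noteq> vzero" using yU U by auto
    have nin: "w \<notin> H" if "H \<in> hyper F" for H using subH(2)[OF that] 5 by blast
    have s1: "w \<in> ssum H G" if "y \<in> H" for H unfolding y(3) using that y(2) by (rule ssumI)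
    have s2: "w \<notin> ssum H G" if "H \<in> hyper F" "U \<subseteq> H" "y \<notin> H" for H
      unfolding y(3) using that y by (intro notin_ssum)
    have "(\<Sum>H\<in>hyper F. \<phi> (ctype H G w)) = gn (of_nat q) (b - 1) * \<phi> (a, b - 1, c, x + 1, Dx)
      + (gn (of_nat q) b - gn (of_nat q) (b - 1)) * \<phi> (a, b - 1, c, x + 1, D22)
      + (gn (of_nat q) (a + b - 1) - gn (of_nat q) (b - 1)) * \<phi> (a - 1, b, c + 1, x, Dx)
      + (gn (of_nat q) (a + b) - gn (of_nat q) b - gn (of_nat q) (a + b - 1) + gn (of_nat q) (b - 1)) * \<phi> (a - 1, b, c + 1, x, Dx)"
    proof (rule sum_two_predicates[where P = "\<lambda>H. U \<subseteq> H" and Q = "\<lambda>H. y \<in> H"])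
      show "of_nat (card {H \<in> hyper F. y \<in> H}) = gn (of_nat q :: 'k) (a + b - 1)"
        by (simp add: hyper_containing_nonzero[OF F y(1) yz] ab of_nat_gn)
      show "of_nat (card {H \<in> hyper F. U \<subseteq> H \<and> y \<in> H}) = gn (of_nat q :: 'k) (b - 1)"
        by (simp only: hyper_containing_vec[OF F U(1,2) y(1) yU] ab(2) of_nat_gn)
    qed (use fin n p 5 nin s1 s2 in \<open>auto simp: T1 T2 pos_simps subH G del: subsetI\<close>)
    then show ?thesis by (simp add: ct 5 pos_simps F G algebra_simps)
  next
    case 6
    have nin: "w \<notin> ssum H G" if "H \<in> hyper F" for H using ssum_mono[OF that] 6 by blast
    have "(\<Sum>H\<in>hyper F. \<phi> (ctype H G w)) = gn (of_nat q) b * \<phi> (a, b - 1, c, x + 1, D22)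
      + (gn (of_nat q) b - gn (of_nat q) b) * 0 + (gn (of_nat q) (a + b) - gn (of_nat q) b) * \<phi> (a - 1, b, c + 1, x, D22)
      + (gn (of_nat q) (a + b) - gn (of_nat q) b - gn (of_nat q) (a + b) + gn (of_nat q) b) * 0"
      by (rule sum_two_predicates[where P = "\<lambda>H. U \<subseteq> H" and Q = "\<lambda>_. True"])
        (use fin n p nin 6 in \<open>auto simp: T1 T2 pos_simps subH G del: subsetI\<close>)
    then show ?thesis by (simp add: ct 6 pos_simps F G)
  qed
qed

end

context fvec begin

text \<open>Whether H lies inside S = F + G decides the matrix. For w outside F exactly one
  extension contains w, namely F + line w.\<close>

lemma sum_overs:
  fixes \<phi> :: "ix \<Rightarrow> 'k::comm_ring_1"
  assumes F: "sub F" and G: "sub G" and w: "w \<in> carrier M"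
  shows "(\<Sum>H\<in>overs F. \<phi> (ctype H G w)) = opF (of_nat q) \<phi> (ctype F G w)"
proof -
  define U where "U = F \<inter> G"
  define S where "S = ssum F G"
  define a b c x where abc: "a = dimn U" "b = dimn F - dimn U" "c = dimn G - dimn U"
    "x = dimn (carrier M) - dimn S"
  let ?q = "of_nat q :: 'k"
  have U: "sub U" "U \<subseteq> F" "U \<subseteq> G" unfolding U_def using F G by (auto simp: sub_inter)
  have dU: "dimn U \<le> dimn F" "dimn U \<le> dimn G" using dimn_mono U F G by auto
  have dS: "dimn S + dimn U = dimn F + dimn G" unfolding U_def S_def by (rule dimn_ssum[OF F G])
  have S: "sub S" "S \<subseteq> carrier M" "F \<subseteq> S" "G \<subseteq> S"
    unfolding S_def using F G by (auto simp: sub_ssum dest: sub_subset[OF sub_ssum[OF F G], THEN subsetD]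
        ssum_upper1[OF F G, THEN subsetD] ssum_upper2[OF F G, THEN subsetD])
  have dM: "dimn S \<le> dimn (carrier M)" using S sub_M by (intro dimn_mono)
  have ct: "ctype F G z = (a, b, c, x, pos F G z)" for z unfolding ctype_def abc U_def S_def ..
  have d: "dimn F = a + b" "dimn G = a + c" "dimn S = a + b + c" "dimn (carrier M) = a + b + c + x"
    using dU dS dM abc by auto
  have H': "sub H" "F \<subseteq> H" "dimn H = Suc (dimn F)" if "H \<in> overs F" for H
    using that unfolding overs_def by auto
  have T1: "ctype H G z = (a + 1, b, c - 1, x, pos H G z) \<and> ssum H G = S"
    if H: "H \<in> overs F" "H \<subseteq> S" for H z
  proof -
    have e: "ssum H G = S"
    proof (rule equalityI)
      show "ssum H G \<subseteq> S" using S H by (intro ssum_least)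
      show "S \<subseteq> ssum H G" unfolding S_def using H'(2)[OF H(1)] unfolding ssum_def by blast
    qed
    have "dimn S + dimn (H \<inter> G) = dimn H + dimn G" using dimn_ssum[OF H'(1)[OF H(1)] G] e by simp
    then have "dimn (H \<inter> G) = a + 1" using d H'(3)[OF H(1)] by simp
    then show ?thesis unfolding ctype_def e using d H'(3)[OF H(1)] by auto
  qed
  have sub_over: "H = ssum F (line y)" if "H \<in> overs F" "y \<in> H" "y \<notin> F" for H y
    using over_unique[OF F that] .
  have line_S: "ssum F (line y) \<subseteq> S" if "y \<in> S" for y using S that by (intro ssum_least line_least)
  have T2: "ctype H G z = (a, b + 1, c, x - 1, pos H G z)" and T2': "dimn (ssum H G) = dimn S + 1"
    if H: "H \<in> overs F" "\<not> H \<subseteq> S" for H z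
  proof -
    have "y \<in> F" if "y \<in> H" "y \<in> G" for y
      using sub_over[OF H(1) that(1)] line_S[of y] that S(4) H(2) by blast
    then have HG: "H \<inter> G = U" unfolding U_def using H'(2)[OF H(1)] by blast
    have "dimn (ssum H G) + dimn U = dimn H + dimn G" using dimn_ssum[OF H'(1)[OF H(1)] G] HG by simp
    then show dd: "dimn (ssum H G) = dimn S + 1" using d H'(3)[OF H(1)] abc(1) by simp
    show "ctype H G z = (a, b + 1, c, x - 1, pos H G z)"
      unfolding ctype_def HG using dd d H'(3)[OF H(1)] abc(1) by auto
  qed
  have fin: "finite (overs F)" by (rule finite_overs)
  have all: "{H \<in> overs F. H \<subseteq> carrier M} = overs F" using sub_subset H'(1) by blast
  have n: "of_nat (card (overs F)) = gn ?q (c + x)"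
    using card_over_within[OF F sub_M sub_subset[OF F]] d unfolding all by (simp add: of_nat_gn)
  have p: "of_nat (card {H \<in> overs F. H \<subseteq> S}) = gn ?q c"
    using card_over_within[OF F S(1,3)] d by (simp add: of_nat_gn)
  have sing: "{H \<in> overs F. y \<in> H} = {ssum F (line y)}" if "y \<notin> F" "y \<in> carrier M" for y
    using sub_over[OF _ _ that(1)] ssum_line_over[OF F that(2,1)] ssum_line_mem[OF F that(2)] by blast
  have ssum_S: "S \<subseteq> ssum H G" if "H \<in> overs F" for H
    unfolding S_def using H'(2)[OF that] unfolding ssum_def by blast
  consider "w = vzero" | "w \<noteq> vzero" "w \<in> F" "w \<in> G" | "w \<in> F" "w \<notin> G" | "w \<notin> F" "w \<in> G"
    | "w \<notin> F" "w \<notin> G" "w \<in> S" | "w \<notin> S" by blast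
  then show ?thesis
  proof cases
    case 1
    have "(\<Sum>H\<in>overs F. \<phi> (ctype H G w)) = gn ?q c * \<phi> (a + 1, b, c - 1, x, D0)
      + (gn ?q c - gn ?q c) * 0 + (gn ?q (c + x) - gn ?q c) * \<phi> (a, b + 1, c, x - 1, D0)
      + (gn ?q (c + x) - gn ?q c - gn ?q (c + x) + gn ?q c) * 0"
      by (rule sum_two_predicates[where P = "\<lambda>H. H \<subseteq> S" and Q = "\<lambda>_. True"])
        (use fin n p in \<open>auto simp: T1 T2 pos_simps H' G 1 del: subsetI\<close>)
    then show ?thesis by (simp add: ct 1 pos_simps F G)
  next
    case 2
    have wH: "w \<in> H" if "H \<in> overs F" for H using H'(2)[OF that] 2 by blast
    have "(\<Sum>H\<in>overs F. \<phi> (ctype H G w)) = gn ?q c * \<phi> (a + 1, b, c - 1, x, D11)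
      + (gn ?q c - gn ?q c) * 0 + (gn ?q (c + x) - gn ?q c) * \<phi> (a, b + 1, c, x - 1, D11)
      + (gn ?q (c + x) - gn ?q c - gn ?q (c + x) + gn ?q c) * 0"
      by (rule sum_two_predicates[where P = "\<lambda>H. H \<subseteq> S" and Q = "\<lambda>_. True"])
        (use fin n p wH 2 in \<open>auto simp: T1 T2 pos_simps H' G del: subsetI\<close>)
    then show ?thesis by (simp add: ct 2 pos_simps F G)
  next
    case 3
    have wH: "w \<in> H" if "H \<in> overs F" for H using H'(2)[OF that] 3 by blast
    have "(\<Sum>H\<in>overs F. \<phi> (ctype H G w)) = gn ?q c * \<phi> (a + 1, b, c - 1, x, D12)
      + (gn ?q c - gn ?q c) * 0 + (gn ?q (c + x) - gn ?q c) * \<phi> (a, b + 1, c, x - 1, D12)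
      + (gn ?q (c + x) - gn ?q c - gn ?q (c + x) + gn ?q c) * 0"
      by (rule sum_two_predicates[where P = "\<lambda>H. H \<subseteq> S" and Q = "\<lambda>_. True"])
        (use fin n p wH 3 in \<open>auto simp: T1 T2 pos_simps H' G del: subsetI\<close>)
    then show ?thesis by (simp add: ct 3 pos_simps F G)
  next
    case 4
    have PQ: "H \<subseteq> S" if "H \<in> overs F" "w \<in> H" for H
      using sub_over[OF that 4(1)] line_S[of w] 4(2) S(4) by blast
    have wz: "w \<noteq> vzero" using 4 sub_zero[OF F] by blast
    have pq: "{H \<in> overs F. H \<subseteq> S \<and> w \<in> H} = {H \<in> overs F. w \<in> H}" using PQ by blast
    have "(\<Sum>H\<in>overs F. \<phi> (ctype H G w)) = 1 * \<phi> (a + 1, b, c - 1, x, D11)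
      + (gn ?q c - 1) * \<phi> (a + 1, b, c - 1, x, D21) + (1 - 1) * 0
      + (gn ?q (c + x) - gn ?q c - 1 + 1) * \<phi> (a, b + 1, c, x - 1, D21)"
      by (rule sum_two_predicates[where P = "\<lambda>H. H \<subseteq> S" and Q = "\<lambda>H. w \<in> H"])
        (use fin n p PQ wz 4 in \<open>auto simp: T1 T2 pos_simps H' G pq sing[OF 4(1) w] del: subsetI\<close>)
    then show ?thesis by (simp add: ct 4 pos_simps F G)
  next
    case 5
    have PQ: "H \<subseteq> S" if "H \<in> overs F" "w \<in> H" for H
      using sub_over[OF that 5(1)] line_S[of w] 5(3) by blast
    have pq: "{H \<in> overs F. H \<subseteq> S \<and> w \<in> H} = {H \<in> overs F. w \<in> H}" using PQ by blast
    have inS: "w \<in> ssum H G" if "H \<in> overs F" for H using ssum_S[OF that] 5(3) by blast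
    have "(\<Sum>H\<in>overs F. \<phi> (ctype H G w)) = 1 * \<phi> (a + 1, b, c - 1, x, D12)
      + (gn ?q c - 1) * \<phi> (a + 1, b, c - 1, x, Dx) + (1 - 1) * 0
      + (gn ?q (c + x) - gn ?q c - 1 + 1) * \<phi> (a, b + 1, c, x - 1, Dx)"
      by (rule sum_two_predicates[where P = "\<lambda>H. H \<subseteq> S" and Q = "\<lambda>H. w \<in> H"])
        (use fin n p PQ inS 5 in \<open>auto simp: T1 T2 pos_simps H' G pq sing[OF 5(1) w] del: subsetI\<close>)
    then show ?thesis using 5 by (simp add: ct pos_simps F G flip: S_def)
  next
    case 6
    \<comment> \<open>\<open>H0\<close> is the only extension containing w and is split off from the
      sum. Among the others outside S, the vector w lies in H + G exactly when H is inside
      \<open>K\<close>, because H + G and \<open>K\<close> have the same dimension.\<close>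
    define K where "K = ssum S (line w)"
    define H0 where "H0 = ssum F (line w)"
    have wF: "w \<notin> F" "w \<notin> G" using 6 S by auto
    have K: "sub K" "S \<subseteq> K" "w \<in> K" "dimn K = dimn S + 1"
      unfolding K_def using S(1) w 6
      by (simp_all add: sub_ssum sub_line dimn_ssum_line ssum_line_mem ssum_upper1)
    have H0: "H0 \<in> overs F" "w \<in> H0" "H0 \<subseteq> K" "\<not> H0 \<subseteq> S"
      unfolding H0_def using ssum_line_over[OF F w wF(1)] ssum_line_mem[OF F w] 6
        ssum_least[OF K(1) subset_trans[OF S(3) K(2)] line_least[OF K(1,3)]] by blast+
    have wH: "w \<notin> H" if "H \<in> overs F" "H \<noteq> H0" for H
      using sub_over[OF that(1) _ wF(1)] that(2) unfolding H0_def by blast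
    let ?A = "overs F - {H0}"
    have cA: "of_nat (card {H \<in> ?A. R H}) = (of_nat (card {H \<in> overs F. R H}) :: 'k) - 1" if "R H0" for R
    proof -
      have "{H \<in> ?A. R H} = {H \<in> overs F. R H} - {H0}" by blast
      then have "card {H \<in> overs F. R H} = Suc (card {H \<in> ?A. R H})"
        using card.remove[of "{H \<in> overs F. R H}" H0] fin H0(1) that by simp
      then show ?thesis by simp
    qed
    have n': "of_nat (card ?A) = gn ?q (c + x) - 1" using cA[of "\<lambda>_. True"] n by (simp add: set_diff_eq)
    have "dimn K - dimn F = c + 1" using K(4) d by simp
    then have "of_nat (card {H \<in> overs F. H \<subseteq> K}) = gn ?q (c + 1)"
      using card_over_within[OF F K(1)] S(3) K(2) by (simp add: of_nat_gn)
    then have q': "of_nat (card {H \<in> ?A. H \<subseteq> K}) = gn ?q (c + 1) - 1"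
      using cA[of "\<lambda>H. H \<subseteq> K"] H0(3) by (simp only:)
    have e1: "{H \<in> ?A. H \<subseteq> S} = {H \<in> overs F. H \<subseteq> S}" "{H \<in> ?A. H \<subseteq> S \<and> H \<subseteq> K} = {H \<in> overs F. H \<subseteq> S}"
      using H0(4) K(2) by auto
    have QK: "w \<in> ssum H G \<longleftrightarrow> H \<subseteq> K" if "H \<in> overs F" "\<not> H \<subseteq> S" for H
    proof -
      have sH: "sub (ssum H G)" "H \<subseteq> ssum H G" using H'(1)[OF that(1)] G by (auto simp: sub_ssum ssum_upper1 del: subsetI)
      have dd: "dimn (ssum H G) = dimn K" using T2'[OF that] K(4) by simp
      show ?thesis
      proof
        assume "w \<in> ssum H G"
        then have "K \<subseteq> ssum H G" unfolding K_def using sH ssum_S[OF that(1)] by (intro ssum_least line_least)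
        then have "K = ssum H G" using dd K(1) sH(1) by (intro dimn_eq_imp_eq) auto
        then show "H \<subseteq> K" using sH by simp
      next
        assume "H \<subseteq> K"
        then have "ssum H G \<subseteq> K" using K(1,2) S(4) by (intro ssum_least) auto
        then have "ssum H G = K" using dd K(1) sH(1) by (intro dimn_eq_imp_eq)
        then show "w \<in> ssum H G" using K(3) by simp
      qed
    qed
    have "(\<Sum>H\<in>?A. \<phi> (ctype H G w)) = gn ?q c * \<phi> (a + 1, b, c - 1, x, D22) + (gn ?q c - gn ?q c) * 0
      + (gn ?q (c + 1) - 1 - gn ?q c) * \<phi> (a, b + 1, c, x - 1, Dx)
      + (gn ?q (c + x) - 1 - gn ?q c - (gn ?q (c + 1) - 1) + gn ?q c) * \<phi> (a, b + 1, c, x - 1, D22)"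
    proof (rule sum_two_predicates[where P = "\<lambda>H. H \<subseteq> S" and Q = "\<lambda>H. H \<subseteq> K"])
      fix H assume H: "H \<in> ?A"
      then have HA: "H \<in> overs F" "w \<notin> H" "sub H" using wH H' by auto
      show "\<phi> (ctype H G w) = \<phi> (a + 1, b, c - 1, x, D22)" if "H \<subseteq> S"
        using T1[OF HA(1) that, of w] pos_simps(6)[OF HA(3) G, of w] 6 by simp
      show "\<phi> (ctype H G w) = 0" if "H \<subseteq> S" "\<not> H \<subseteq> K" using that K(2) by blast
      show "\<phi> (ctype H G w) = \<phi> (a, b + 1, c, x - 1, Dx)" if "\<not> H \<subseteq> S" "H \<subseteq> K"
        using T2[OF HA(1) that(1), of w] pos_simps(5)[OF HA(3) G HA(2) wF(2)] QK[OF HA(1) that(1)] that(2) by simp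
      show "\<phi> (ctype H G w) = \<phi> (a, b + 1, c, x - 1, D22)" if "\<not> H \<subseteq> S" "\<not> H \<subseteq> K"
        using T2[OF HA(1) that(1), of w] pos_simps(6)[OF HA(3) G, of w] QK[OF HA(1) that(1)] that(2) by simp
    qed (use fin n' q' p e1 in simp_all)
    moreover have "\<phi> (ctype H0 G w) = \<phi> (a, b + 1, c, x - 1, D12)"
      using H0 wF by (simp add: T2 pos_simps H' G)
    ultimately have "(\<Sum>H\<in>overs F. \<phi> (ctype H G w)) = \<phi> (a, b + 1, c, x - 1, D12)
      + (gn ?q c * \<phi> (a + 1, b, c - 1, x, D22) + (gn ?q c - gn ?q c) * 0
      + (gn ?q (c + 1) - 1 - gn ?q c) * \<phi> (a, b + 1, c, x - 1, Dx)
      + (gn ?q (c + x) - 1 - gn ?q c - (gn ?q (c + 1) - 1) + gn ?q c) * \<phi> (a, b + 1, c, x - 1, D22))"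
      using sum.remove[OF fin H0(1), of "\<lambda>H. \<phi> (ctype H G w)"] by simp
    moreover have "pos F G w = D22" using 6 F G by (simp add: pos_simps flip: S_def)
    ultimately show ?thesis by (simp add: ct algebra_simps)
  qed
qed

lemma card_translate_inter:
  assumes F: "sub F" and U: "sub U" "U \<subseteq> F" and y: "y \<in> F"
  shows "card {u \<in> F. y \<ominus>\<^bsub>M\<^esub> u \<in> U} = q ^ dimn U"
proof -
  have inv: "y \<ominus>\<^bsub>M\<^esub> (y \<ominus>\<^bsub>M\<^esub> u) = u" if "u \<in> F" for u
    using sub_carrier[OF F y] sub_carrier[OF F that]
    by (simp add: a_minus_def M.minus_add M.r_neg2)
  have "bij_betw (\<lambda>u. y \<ominus>\<^bsub>M\<^esub> u) {u \<in> F. y \<ominus>\<^bsub>M\<^esub> u \<in> U} U"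
    by (rule bij_betw_byWitness[where f' = "\<lambda>u. y \<ominus>\<^bsub>M\<^esub> u"]) (use inv U y in \<open>auto intro: sub_minus[OF F]\<close>)
  then show ?thesis using U(1) by (simp add: bij_betw_same_card card_dimn)
qed

lemma sum_translates:
  fixes \<phi> :: "ix \<Rightarrow> 'k::comm_ring_1"
  assumes F: "sub F" and G: "sub G" and w: "w \<in> carrier M"
  shows "(\<Sum>u\<in>F. \<phi> (ctype F G (w \<ominus>\<^bsub>M\<^esub> u))) = opL (of_nat q) \<phi> (ctype F G w)"
proof -
  define U where "U = F \<inter> G"
  define a b c x where abc: "a = dimn U" "b = dimn F - dimn U" "c = dimn G - dimn U"
    "x = dimn (carrier M) - dimn (ssum F G)"
  let ?q = "of_nat q :: 'k"
  have U: "sub U" "U \<subseteq> F" "U \<subseteq> G" unfolding U_def using F G by (auto simp: sub_inter)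
  have ct: "ctype F G z = (a, b, c, x, pos F G z)" for z unfolding ctype_def abc U_def ..
  have dF: "dimn F = a + b" using abc dimn_mono[OF U(1) F U(2)] by simp
  have fin: "finite F" using F by (rule sub_finite)
  have S: "sub (ssum F G)" using F G by (rule sub_ssum)
  have n: "of_nat (card F) = ?q ^ (a + b)" using card_dimn[OF F] dF by simp
  have restore: "w = (w \<ominus>\<^bsub>M\<^esub> u) \<oplus>\<oplus> u" if "u \<in> F" for u
    using w sub_carrier[OF F that] by (simp add: a_minus_def M.a_assoc M.l_neg)
  have mem: "w \<ominus>\<^bsub>M\<^esub> u \<in> C \<longleftrightarrow> w \<in> C" if "sub C" "F \<subseteq> C" "u \<in> F" for u C
    using restore[OF that(3)] sub_add[OF that(1), of "w \<ominus>\<^bsub>M\<^esub> u" u] sub_minus[OF that(1), of w u] that by auto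
  have memF: "w \<ominus>\<^bsub>M\<^esub> u \<in> F \<longleftrightarrow> w \<in> F" if "u \<in> F" for u using mem[OF F _ that] by simp
  have memS: "w \<ominus>\<^bsub>M\<^esub> u \<in> ssum F G \<longleftrightarrow> w \<in> ssum F G" if "u \<in> F" for u
    using mem[OF S ssum_upper1[OF F G] that] .
  consider "w \<in> F" | "w \<notin> F" "w \<in> ssum F G" | "w \<notin> ssum F G" by blast
  then show ?thesis
  proof cases
    case 1
    have zero: "w \<ominus>\<^bsub>M\<^esub> u = vzero \<longleftrightarrow> u = w" if "u \<in> F" for u
      using restore[OF that] w sub_carrier[OF F that] by (auto simp: a_minus_def M.r_neg)
    have eU: "w \<ominus>\<^bsub>M\<^esub> u \<in> G \<longleftrightarrow> w \<ominus>\<^bsub>M\<^esub> u \<in> U" if "u \<in> F" for u using memF[OF that] 1 unfolding U_def by simp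
    have p: "{u \<in> F. w \<ominus>\<^bsub>M\<^esub> u = vzero} = {w}" using zero 1 by blast
    have pq: "{u \<in> F. w \<ominus>\<^bsub>M\<^esub> u = vzero \<and> w \<ominus>\<^bsub>M\<^esub> u \<in> G} = {w}" using p sub_zero[OF G] w by (auto simp: a_minus_def M.r_neg)
    have "{u \<in> F. w \<ominus>\<^bsub>M\<^esub> u \<in> G} = {u \<in> F. w \<ominus>\<^bsub>M\<^esub> u \<in> U}" using eU by blast
    then have qq: "of_nat (card {u \<in> F. w \<ominus>\<^bsub>M\<^esub> u \<in> G}) = ?q ^ a"
      using card_translate_inter[OF F U(1,2) 1] abc by simp
    have "(\<Sum>u\<in>F. \<phi> (ctype F G (w \<ominus>\<^bsub>M\<^esub> u))) = 1 * \<phi> (a, b, c, x, D0) + (1 - 1) * 0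
      + (?q ^ a - 1) * \<phi> (a, b, c, x, D11) + (?q ^ (a + b) - 1 - ?q ^ a + 1) * \<phi> (a, b, c, x, D12)"
      by (rule sum_two_predicates[where P = "\<lambda>u. w \<ominus>\<^bsub>M\<^esub> u = vzero" and Q = "\<lambda>u. w \<ominus>\<^bsub>M\<^esub> u \<in> G"])
        (use fin n qq 1 memF sub_zero[OF G] in \<open>auto simp: ct p pq pos_simps F G\<close>)
    moreover have "pos F G w \<in> {D0, D11, D12}" using 1 unfolding pos_def by auto
    ultimately show ?thesis by (auto simp: ct)
  next
    case 2
    obtain y g where y: "y \<in> F" "g \<in> G" "w = y \<oplus>\<oplus> g" using 2(2) by (rule ssumE)
    \<comment> \<open>Modulo G the vector w equals its component y in F, so w - u lies in G exactly
      when y - u lies in U.\<close>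
    have "w \<ominus>\<^bsub>M\<^esub> u \<in> G \<longleftrightarrow> y \<ominus>\<^bsub>M\<^esub> u \<in> U" if "u \<in> F" for u
    proof -
      have cc: "y \<in> carrier M" "g \<in> carrier M" "u \<in> carrier M" using y sub_carrier[OF F] sub_carrier[OF G] that by auto
      have e: "w \<ominus>\<^bsub>M\<^esub> u = (y \<ominus>\<^bsub>M\<^esub> u) \<oplus>\<oplus> g" unfolding y(3) using cc by (simp add: a_minus_def M.a_ac)
      then have e2: "y \<ominus>\<^bsub>M\<^esub> u = (w \<ominus>\<^bsub>M\<^esub> u) \<ominus>\<^bsub>M\<^esub> g" using cc by (simp add: a_minus_def M.a_assoc M.r_neg)
      have "y \<ominus>\<^bsub>M\<^esub> u \<in> F" using y(1) that by (rule sub_minus[OF F])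
      moreover have "y \<ominus>\<^bsub>M\<^esub> u \<in> G" if "w \<ominus>\<^bsub>M\<^esub> u \<in> G" unfolding e2 using that y(2) by (rule sub_minus[OF G])
      moreover have "w \<ominus>\<^bsub>M\<^esub> u \<in> G" if "y \<ominus>\<^bsub>M\<^esub> u \<in> G" unfolding e using that y(2) by (rule sub_add[OF G])
      ultimately show ?thesis unfolding U_def by blast
    qed
    then have "{u \<in> F. w \<ominus>\<^bsub>M\<^esub> u \<in> G} = {u \<in> F. y \<ominus>\<^bsub>M\<^esub> u \<in> U}" by blast
    then have p: "of_nat (card {u \<in> F. w \<ominus>\<^bsub>M\<^esub> u \<in> G}) = ?q ^ a"
      using card_translate_inter[OF F U(1,2) y(1)] abc by simp
    have "(\<Sum>u\<in>F. \<phi> (ctype F G (w \<ominus>\<^bsub>M\<^esub> u))) = ?q ^ a * \<phi> (a, b, c, x, D21) + (?q ^ a - ?q ^ a) * 0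
      + (?q ^ (a + b) - ?q ^ a) * \<phi> (a, b, c, x, Dx) + (?q ^ (a + b) - ?q ^ a - ?q ^ (a + b) + ?q ^ a) * 0"
      by (rule sum_two_predicates[where P = "\<lambda>u. w \<ominus>\<^bsub>M\<^esub> u \<in> G" and Q = "\<lambda>_. True"])
        (use fin n p 2 memF memS in \<open>auto simp: ct pos_simps F G\<close>)
    moreover have "pos F G w \<in> {D21, Dx}" using 2 sub_zero[OF F] unfolding pos_def by auto
    ultimately show ?thesis by (auto simp: ct)
  next
    case 3
    then have "(\<Sum>u\<in>F. \<phi> (ctype F G (w \<ominus>\<^bsub>M\<^esub> u))) = (\<Sum>u\<in>F. \<phi> (a, b, c, x, D22))"
      by (intro sum.cong) (auto simp: ct pos_simps F G memS)
    then show ?thesis using 3 n by (simp add: ct pos_simps F G)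
  qed
qed

end

section \<open>Orbits of configurations\<close>

fun valid :: "ix \<Rightarrow> bool" where
  "valid (a, b, c, x, D0) = True"
| "valid (a, b, c, x, D11) = (a > 0)"
| "valid (a, b, c, x, D12) = (b > 0)"
| "valid (a, b, c, x, D21) = (c > 0)"
| "valid (a, b, c, x, Dx) = (b > 0 \<and> c > 0)"
| "valid (a, b, c, x, D22) = (x > 0)"

definition Ix :: "nat \<Rightarrow> ix set" where
  "Ix d = {(a, b, c, x, g). valid (a, b, c, x, g) \<and> a + b + c + x = d}"

fun dset :: "dtype \<Rightarrow> (2 \<times> 2) set" where
  "dset D0 = {}"
| "dset D11 = {(1, 1)}"
| "dset D12 = {(1, 2)}"
| "dset D21 = {(2, 1)}"
| "dset Dx = {(1, 2), (2, 1)}"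
| "dset D22 = {(2, 2)}"

fun mk :: "ix \<Rightarrow> dmat" where
  "mk (a, b, c, x, g) = ((\<chi> i j. if i = 1 then if j = 1 then a else b else if j = 1 then c else x), dset g)"

section \<open>Spans and extensions of bases\<close>

context fvec begin

definition vhull :: "'c set \<Rightarrow> 'c set" where
  "vhull Z = \<Inter> {W. sub W \<and> Z \<subseteq> W}"

lemma hull_subset: "Z \<subseteq> vhull Z"
  unfolding vhull_def by blast

lemma hull_least: "sub W \<Longrightarrow> Z \<subseteq> W \<Longrightarrow> vhull Z \<subseteq> W"
  unfolding vhull_def by blast

lemma sub_hull: assumes Z: "Z \<subseteq> carrier M" shows "sub (vhull Z)"
proof (rule subI)
  show "vhull Z \<subseteq> carrier M" using Z by (intro hull_least sub_M)
  show "vzero \<in> vhull Z" unfolding vhull_def by simp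
  show "x \<oplus>\<oplus> y \<in> vhull Z" if "x \<in> vhull Z" "y \<in> vhull Z" for x y
    using that sub_add unfolding vhull_def by blast
  show "c \<odot>\<^bsub>M\<^esub> x \<in> vhull Z" if "c \<in> carrier R" "x \<in> vhull Z" for x c
    using that sub_smult unfolding vhull_def by blast
qed

lemma hull_mono: "Z \<subseteq> Y \<Longrightarrow> vhull Z \<subseteq> vhull Y"
  unfolding vhull_def by blast

lemma hull_sub: "sub W \<Longrightarrow> vhull W = W"
  using hull_least[of W W] hull_subset[of W] by simp

lemma hull_Un_hull: "vhull (vhull Z \<union> Y) = vhull (Z \<union> Y)"
  unfolding vhull_def by blast

lemma hull_Un_hull2: "vhull (Z \<union> vhull Y) = vhull (Z \<union> Y)"
  unfolding vhull_def by blast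

lemma hull_Un_sub: assumes A: "sub A" and B: "sub B" shows "vhull (A \<union> B) = ssum A B"
proof (rule equalityI)
  show "vhull (A \<union> B) \<subseteq> ssum A B"
    using ssum_upper1[OF A B] ssum_upper2[OF A B] by (intro hull_least sub_ssum A B) blast
  have "sub (vhull (A \<union> B))" using sub_subset[OF A] sub_subset[OF B] by (intro sub_hull) blast
  then show "ssum A B \<subseteq> vhull (A \<union> B)" using hull_subset[of "A \<union> B"] by (intro ssum_least) auto
qed

lemma hull_insert: assumes "sub A" "y \<in> carrier M" shows "vhull (insert y A) = ssum A (line y)"
proof -
  have "vhull (insert y A) = vhull (A \<union> line y)"
  proof (rule equalityI)
    show "vhull (insert y A) \<subseteq> vhull (A \<union> line y)" using line_self[OF assms(2)] by (intro hull_mono) blast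
    have s: "sub (vhull (insert y A))" using assms sub_subset by (intro sub_hull) auto
    have "line y \<subseteq> vhull (insert y A)" using hull_subset[of "insert y A"] by (intro line_least s) blast
    then show "vhull (A \<union> line y) \<subseteq> vhull (insert y A)" using hull_subset[of "insert y A"] by (intro hull_least s) blast
  qed
  then show ?thesis using assms by (simp add: hull_Un_sub sub_line)
qed

lemma dimn_hull_le: assumes "finite Y" "Y \<subseteq> carrier M" "sub A"
  shows "dimn (vhull (A \<union> Y)) \<le> dimn A + card Y"
  using assms(1,2)
proof (induction Y rule: finite_induct)
  case empty then show ?case using hull_sub[OF assms(3)] by simp
next
  case (insert y Y)
  have s: "sub (vhull (A \<union> Y))" using insert.prems sub_subset[OF assms(3)] by (intro sub_hull) blast
  have y: "y \<in> carrier M" using insert.prems by simp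
  have "vhull (A \<union> insert y Y) = vhull (insert y (vhull (A \<union> Y)))"
    using hull_Un_hull2[of "{y}" "A \<union> Y"] by simp
  also have "\<dots> = ssum (vhull (A \<union> Y)) (line y)" using s y by (rule hull_insert)
  finally have e: "vhull (A \<union> insert y Y) = ssum (vhull (A \<union> Y)) (line y)" .
  have "dimn (ssum (vhull (A \<union> Y)) (line y)) \<le> Suc (dimn (vhull (A \<union> Y)))"
  proof (cases "y \<in> vhull (A \<union> Y)")
    case True
    then have "ssum (vhull (A \<union> Y)) (line y) \<subseteq> vhull (A \<union> Y)" using s by (intro ssum_least line_least) auto
    then have "dimn (ssum (vhull (A \<union> Y)) (line y)) \<le> dimn (vhull (A \<union> Y))"
      using s y by (intro dimn_mono sub_ssum sub_line)
    then show ?thesis by simp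
  qed (use s y in \<open>simp add: dimn_ssum_line\<close>)
  then show ?case using insert e by simp
qed

lemma dimn_null: "dimn {vzero} = 0"
  by (rule dimn_eqI[OF sub_null]) simp

lemma hull_insert_zero: assumes "Z \<subseteq> carrier M" shows "vhull ({vzero} \<union> Z) = vhull Z"
proof (rule equalityI)
  have "sub (vhull Z)" using assms by (rule sub_hull)
  then show "vhull ({vzero} \<union> Z) \<subseteq> vhull Z" using hull_subset[of Z] by (intro hull_least) auto
qed (intro hull_mono, blast)

text \<open>Basis extension with a prescribed first vector: it is the first vector of a block that
  the decoration refers to.\<close>

lemma exists_complement_family:
  assumes A: "sub A" and B: "sub B" "A \<subseteq> B" and m: "dimn B = dimn A + m"
    and y: "m > 0 \<Longrightarrow> y \<in> B \<and> y \<notin> A"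
  shows "\<exists>g :: nat \<Rightarrow> 'c. g ` {1..m} \<subseteq> B \<and> B = vhull (A \<union> g ` {1..m}) \<and> (m > 0 \<longrightarrow> g 1 = y)"
  using A B(2) m y
proof (induction m arbitrary: A y)
  case 0
  then have "A = B" using B(1) by (intro dimn_eq_imp_eq) auto
  then show ?case using hull_sub[OF B(1)] by auto
next
  case (Suc m)
  have yM: "y \<in> carrier M" using Suc.prems(4) sub_carrier[OF B(1)] by blast
  let ?A = "ssum A (line y)"
  have s: "sub ?A" "?A \<subseteq> B" "dimn ?A = Suc (dimn A)"
    using Suc.prems yM B(1) by (auto simp: sub_ssum sub_line dimn_ssum_line intro!: ssum_least line_least del: subsetI)
  have "\<exists>z. m > 0 \<longrightarrow> z \<in> B \<and> z \<notin> ?A"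
  proof (cases "m > 0")
    case True
    then have "?A \<noteq> B" using Suc.prems(3) s(3) by auto
    then show ?thesis using s(2) by blast
  qed simp
  then obtain z where "m > 0 \<Longrightarrow> z \<in> B \<and> z \<notin> ?A" by blast
  then obtain g :: "nat \<Rightarrow> 'c" where g: "g ` {1..m} \<subseteq> B" "B = vhull (?A \<union> g ` {1..m})"
    using Suc.IH[of ?A z] s Suc.prems(3) by auto
  let ?g = "\<lambda>s. if s = 1 then y else g (s - 1)"
  have "?g ` {1..Suc m} = insert y (g ` {1..m})"
  proof (intro equalityI subsetI)
    fix u assume "u \<in> ?g ` {1..Suc m}"
    then obtain s where s: "s \<in> {1..Suc m}" "u = ?g s" by blast
    then have "s = 1 \<or> s - 1 \<in> {1..m}" by auto
    then show "u \<in> insert y (g ` {1..m})" using s(2) by auto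
  next
    fix u assume "u \<in> insert y (g ` {1..m})"
    then consider "u = y" | s where "s \<in> {1..m}" "u = g s" by auto
    then show "u \<in> ?g ` {1..Suc m}"
    proof cases
      case 2 then show ?thesis by (intro image_eqI[of _ _ "Suc s"]) auto
    qed auto
  qed
  moreover have "B = vhull (A \<union> insert y (g ` {1..m}))"
  proof -
    have "B = vhull (vhull (insert y A) \<union> g ` {1..m})" using g(2) hull_insert[OF Suc.prems(1) yM] by simp
    then show ?thesis by (simp add: hull_Un_hull)
  qed
  ultimately have "?g ` {1..Suc m} \<subseteq> B \<and> B = vhull (A \<union> ?g ` {1..Suc m}) \<and> (Suc m > 0 \<longrightarrow> ?g 1 = y)"
    using g(1) Suc.prems(4) by auto
  then show ?case by (intro exI[of _ ?g])
qed

end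

section \<open>The coordinate space over a finite field\<close>

locale fspace =
  fixes R :: "int ring" (structure) and d :: nat
  assumes field_R: "field R" and finite_R: "finite (carrier R)"
begin

lemma fvec_Vsp: "fvec R (Vsp R d)"
proof -
  interpret F: field R by (rule field_R)
  note V = Vsp_def
  have "abelian_group (Vsp R d)"
  proof (rule abelian_groupI)
    fix x assume x: "x \<in> carrier (Vsp R d)"
    then show "\<exists>y\<in>carrier (Vsp R d). y \<oplus>\<^bsub>Vsp R d\<^esub> x = \<zero>\<^bsub>Vsp R d\<^esub>"
      by (intro bexI[of _ "\<lambda>i\<in>{..<d}. \<ominus> x i"]) (auto simp: V F.l_neg PiE_iff intro!: restrict_ext)
  next
    fix x y z assume "x \<in> carrier (Vsp R d)" "y \<in> carrier (Vsp R d)" "z \<in> carrier (Vsp R d)"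
    then show "x \<oplus>\<^bsub>Vsp R d\<^esub> y \<oplus>\<^bsub>Vsp R d\<^esub> z = x \<oplus>\<^bsub>Vsp R d\<^esub> (y \<oplus>\<^bsub>Vsp R d\<^esub> z)"
      by (auto simp: V F.a_assoc PiE_iff intro!: restrict_ext)
  next
    fix x y assume "x \<in> carrier (Vsp R d)" "y \<in> carrier (Vsp R d)"
    then show "x \<oplus>\<^bsub>Vsp R d\<^esub> y = y \<oplus>\<^bsub>Vsp R d\<^esub> x"
      by (auto simp: V F.a_comm PiE_iff intro!: restrict_ext)
  next
    fix x assume "x \<in> carrier (Vsp R d)"
    then show "\<zero>\<^bsub>Vsp R d\<^esub> \<oplus>\<^bsub>Vsp R d\<^esub> x = x"
      by (auto simp: V PiE_iff restrict_def extensional_def intro!: ext)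
  qed (auto simp: V)
  then have "module R (Vsp R d)"
  proof (rule moduleI[OF F.is_cring])
    fix x assume "x \<in> carrier (Vsp R d)"
    then show "\<one> \<odot>\<^bsub>Vsp R d\<^esub> x = x"
      by (auto simp: V PiE_iff restrict_def extensional_def intro!: ext)
  next
    fix a x y assume "a \<in> carrier R" "x \<in> carrier (Vsp R d)" "y \<in> carrier (Vsp R d)"
    then show "a \<odot>\<^bsub>Vsp R d\<^esub> (x \<oplus>\<^bsub>Vsp R d\<^esub> y) = a \<odot>\<^bsub>Vsp R d\<^esub> x \<oplus>\<^bsub>Vsp R d\<^esub> a \<odot>\<^bsub>Vsp R d\<^esub> y"
      by (auto simp: V F.r_distr PiE_iff intro!: restrict_ext)
  next
    fix a b x assume "a \<in> carrier R" "b \<in> carrier R" "x \<in> carrier (Vsp R d)"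
    then show "(a \<oplus> b) \<odot>\<^bsub>Vsp R d\<^esub> x = a \<odot>\<^bsub>Vsp R d\<^esub> x \<oplus>\<^bsub>Vsp R d\<^esub> b \<odot>\<^bsub>Vsp R d\<^esub> x"
      "a \<otimes> b \<odot>\<^bsub>Vsp R d\<^esub> x = a \<odot>\<^bsub>Vsp R d\<^esub> (b \<odot>\<^bsub>Vsp R d\<^esub> x)"
      by (auto simp: V F.l_distr F.m_assoc PiE_iff intro!: restrict_ext)
  qed (auto simp: V)
  moreover have "finite (carrier (Vsp R d))" by (auto simp: V finite_R intro!: finite_PiE)
  ultimately show ?thesis
    unfolding fvec_def fvec_axioms_def using field_R finite_R by simp
qed

end

sublocale fspace \<subseteq> V: fvec R "Vsp R d"
  by (rule fvec_Vsp)

context fspace begin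

lemma dimn_V: "V.dimn (carrier (Vsp R d)) = d"
  by (rule V.dimn_eqI[OF V.sub_M]) (simp add: Vsp_def V.q_def card_PiE)

lemma flags_eq: "flags R d = {W. V.sub W}"
  unfolding flags_def V.sub_def ..

lemma fam_span_hull:
  assumes fin: "finite I" and b: "b \<in> I \<rightarrow> carrier (Vsp R d)"
  shows "fam_span R d b I = V.vhull (b ` I)"
  using fin b
proof (induction I rule: finite_induct)
  case empty
  have "V.vhull {} = {\<zero>\<^bsub>Vsp R d\<^esub>}"
    using V.hull_insert_zero[of "{}"] V.hull_sub[OF V.sub_null] by simp
  then show ?case by (auto simp: fam_span_def lin_comb_def)
next
  case (insert t I)
  have b: "b t \<in> carrier (Vsp R d)" "b \<in> I \<rightarrow> carrier (Vsp R d)" using insert.prems by auto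
  have hI: "V.sub (V.vhull (b ` I))" using b by (intro V.sub_hull) auto
  have lc: "lin_comb R d b (insert t I) c = c t \<odot>\<^bsub>Vsp R d\<^esub> b t \<oplus>\<^bsub>Vsp R d\<^esub> lin_comb R d b I c"
    if "c \<in> insert t I \<rightarrow> carrier R" for c
    unfolding lin_comb_def using insert.hyps b that by (intro V.M.finsum_insert) auto
  have lc_car: "lin_comb R d b I c \<in> carrier (Vsp R d)" if "c \<in> I \<rightarrow> carrier R" for c
    unfolding lin_comb_def using b that by (intro V.M.finsum_closed) auto
  have "fam_span R d b (insert t I) = V.ssum (fam_span R d b I) (V.line (b t))"
  proof (intro equalityI subsetI)
    fix x assume "x \<in> fam_span R d b (insert t I)"
    then obtain c where c: "c \<in> insert t I \<rightarrow> carrier R" "x = lin_comb R d b (insert t I) c"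
      unfolding fam_span_def by blast
    have cI: "c \<in> I \<rightarrow> carrier R" "c t \<in> carrier R" using c by auto
    have "x = lin_comb R d b I c \<oplus>\<^bsub>Vsp R d\<^esub> c t \<odot>\<^bsub>Vsp R d\<^esub> b t"
      using c lc[OF c(1)] lc_car[OF cI(1)] b cI by (simp add: V.M.a_comm)
    then show "x \<in> V.ssum (fam_span R d b I) (V.line (b t))"
      unfolding V.ssum_def fam_span_def V.line_def using cI by blast
  next
    fix x assume "x \<in> V.ssum (fam_span R d b I) (V.line (b t))"
    then obtain c e where c: "c \<in> I \<rightarrow> carrier R" "e \<in> carrier R" "x = lin_comb R d b I c \<oplus>\<^bsub>Vsp R d\<^esub> e \<odot>\<^bsub>Vsp R d\<^esub> b t"
      unfolding V.ssum_def fam_span_def V.line_def by blast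
    let ?c = "c(t := e)"
    have c': "?c \<in> insert t I \<rightarrow> carrier R" using c by auto
    have "lin_comb R d b I ?c = lin_comb R d b I c"
      unfolding lin_comb_def using insert.hyps b c by (intro V.M.finsum_cong') auto
    then have "lin_comb R d b (insert t I) ?c = x"
      using lc[OF c'] c lc_car[OF c(1)] b by (simp add: V.M.a_comm)
    then show "x \<in> fam_span R d b (insert t I)" unfolding fam_span_def using c' by blast
  qed
  also have "\<dots> = V.vhull (insert (b t) (V.vhull (b ` I)))"
    using insert.IH[OF b(2)] V.hull_insert[OF hI b(1)] by simp
  also have "\<dots> = V.vhull (b ` insert t I)"
    using V.hull_Un_hull2[of "{b t}" "b ` I"] by simp
  finally show ?case .
qed

text \<open>Independence follows by counting: the set of coefficient vectors and the space have the
  same finite cardinality, so surjectivity of the linear combination map makes it injective.\<close>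

lemma fam_basis_iff:
  assumes fin: "finite I" and card: "card I = d"
  shows "fam_basis R d b I \<longleftrightarrow> b \<in> I \<rightarrow> carrier (Vsp R d) \<and> V.vhull (b ` I) = carrier (Vsp R d)"
proof (cases "b \<in> I \<rightarrow> carrier (Vsp R d)")
  case True
  note b = this
  have indep: "\<forall>c \<in> I \<rightarrow> carrier R. lin_comb R d b I c = \<zero>\<^bsub>Vsp R d\<^esub> \<longrightarrow> (\<forall>t\<in>I. c t = \<zero>)"
    if sp: "fam_span R d b I = carrier (Vsp R d)"
  proof (intro ballI impI)
    fix c t assume c: "c \<in> I \<rightarrow> carrier R" "lin_comb R d b I c = \<zero>\<^bsub>Vsp R d\<^esub>" and t: "t \<in> I"
    have restr: "lin_comb R d b I (restrict e I) = lin_comb R d b I e" if "e \<in> I \<rightarrow> carrier R" for e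
      unfolding lin_comb_def using b that by (intro V.M.finsum_cong') auto
    have "carrier (Vsp R d) = lin_comb R d b I ` (I \<rightarrow>\<^sub>E carrier R)"
    proof (intro equalityI subsetI)
      fix x assume "x \<in> carrier (Vsp R d)"
      then obtain e where e: "e \<in> I \<rightarrow> carrier R" "x = lin_comb R d b I e"
        using sp unfolding fam_span_def by blast
      then show "x \<in> lin_comb R d b I ` (I \<rightarrow>\<^sub>E carrier R)"
        using restr[OF e(1)] by (intro image_eqI[of _ _ "restrict e I"]) auto
    next
      fix x assume "x \<in> lin_comb R d b I ` (I \<rightarrow>\<^sub>E carrier R)"
      then have "x \<in> fam_span R d b I" unfolding fam_span_def by (auto simp: PiE_def)
      then show "x \<in> carrier (Vsp R d)" using sp by simp
    qed
    moreover have "card (carrier (Vsp R d)) = card (I \<rightarrow>\<^sub>E carrier R)"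
      using fin by (simp add: card_PiE Vsp_def card)
    ultimately have inj: "inj_on (lin_comb R d b I) (I \<rightarrow>\<^sub>E carrier R)"
      using fin finite_R by (intro eq_card_imp_inj_on) (auto intro: finite_PiE)
    have z: "(\<lambda>i. \<zero>) \<in> I \<rightarrow> carrier R" by simp
    have "lin_comb R d b I (\<lambda>i. \<zero>) = (\<Oplus>\<^bsub>Vsp R d\<^esub>i\<in>I. \<zero>\<^bsub>Vsp R d\<^esub>)"
      unfolding lin_comb_def by (intro V.M.finsum_cong') (auto simp: V.smult_l_null[OF Pi_mem[OF b]])
    then have "lin_comb R d b I (restrict c I) = lin_comb R d b I (restrict (\<lambda>i. \<zero>) I)"
      using restr[OF c(1)] restr[OF z] c(2) by simp
    then have "restrict c I = restrict (\<lambda>i. \<zero>) I"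
      using inj c(1) by (auto dest!: inj_onD)
    then show "c t = \<zero>" using t by (metis restrict_apply')
  qed
  show ?thesis using b indep fam_span_hull[OF fin b] unfolding fam_basis_def by auto
qed (auto simp: fam_basis_def)

end

definition blk :: "2 \<Rightarrow> 2 \<Rightarrow> nat \<Rightarrow> (2 \<times> 2 \<times> nat) set" where
  "blk i j n = (\<lambda>s. (i, j, s)) ` {1..n}"

lemma idx_mk: "idx (fst (mk (a, b, c, x, g))) = blk 1 1 a \<union> blk 1 2 b \<union> (blk 2 1 c \<union> blk 2 2 x)"
  (is "_ = ?B")
proof (intro equalityI subsetI)
  fix p assume "p \<in> idx (fst (mk (a, b, c, x, g)))"
  then obtain i j s where p: "p = (i, j, s)" "1 \<le> s" "s \<le> fst (mk (a, b, c, x, g)) $ i $ j"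
    unfolding idx_def by blast
  then show "p \<in> ?B"
    using exhaust_2[of i] exhaust_2[of j] by (auto simp: blk_def)
qed (auto simp: idx_def blk_def)

lemma finite_blk [simp]: "finite (blk i j n)"
  and card_blk [simp]: "card (blk i j n) = n"
  unfolding blk_def by (simp_all add: card_image inj_on_def)

lemma in_blk: "(i', j', s) \<in> blk i j n \<longleftrightarrow> i' = i \<and> j' = j \<and> 1 \<le> s \<and> s \<le> n"
  unfolding blk_def by auto

lemma blk_disjoint: "(i, j) \<noteq> (i', j') \<Longrightarrow> blk i j n \<inter> blk i' j' m = {}"
  unfolding blk_def by auto

lemma blk_rows: "{(i, j, s) \<in> blk 1 1 a \<union> blk 1 2 b \<union> (blk 2 1 c \<union> blk 2 2 x). i = 1} = blk 1 1 a \<union> blk 1 2 b"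
  by (auto simp: in_blk)

lemma blk_columns: "{(i, j, s) \<in> blk 1 1 a \<union> blk 1 2 b \<union> (blk 2 1 c \<union> blk 2 2 x). j = 1} = blk 1 1 a \<union> blk 2 1 c"
  by (auto simp: in_blk)

lemma mk_inj: "mk y = mk z \<longleftrightarrow> y = z"
proof
  assume eq: "mk y = mk z"
  obtain a b c x g a' b' c' x' g' where yz: "y = (a, b, c, x, g)" "z = (a', b', c', x', g')"
    by (metis prod.exhaust)
  have m: "fst (mk y) $ i $ j = fst (mk z) $ i $ j" for i j using eq by simp
  have "a = a'" "b = b'" "c = c'" "x = x'"
    using m[of 1 1] m[of 1 2] m[of 2 1] m[of 2 2] by (simp_all add: yz)
  moreover have "dset g = dset g'" using eq by (simp add: yz)
  then have "g = g'" by (cases g; cases g') auto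
  ultimately show "y = z" by (simp add: yz)
qed simp

lemma Xi_eq: "Xi d = mk ` Ix d"
proof (intro equalityI subsetI)
  fix p assume p: "p \<in> Xi d"
  obtain A D where AD: "p = (A, D)" by fastforce
  define a b c x where abc: "a = A $ 1 $ 1" "b = A $ 1 $ 2" "c = A $ 2 $ 1" "x = A $ 2 $ 2"
  have A: "A = fst (mk (a, b, c, x, g))" for g
    unfolding vec_eq_iff by (auto simp: abc forall_2)
  have tot: "a + b + c + x = d" using p unfolding AD Xi_def Theta_def by (simp add: sum_2 abc)
  have D: "D \<in> decorations" "\<forall>(i, j)\<in>D. A $ i $ j > 0" using p unfolding AD Xi_def by auto
  then obtain g where g: "D = dset g"
    unfolding decorations_def by (metis (no_types) dset.simps insertE singletonD)
  have "valid (a, b, c, x, g)" using D(2) unfolding g by (cases g) (auto simp: abc)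
  then have "(a, b, c, x, g) \<in> Ix d" using tot unfolding Ix_def by simp
  moreover have "p = mk (a, b, c, x, g)" using A[of g] by (simp add: AD g)
  ultimately show "p \<in> mk ` Ix d" by blast
next
  fix p assume "p \<in> mk ` Ix d"
  then obtain a b c x g where z: "p = mk (a, b, c, x, g)" "valid (a, b, c, x, g)" "a + b + c + x = d"
    unfolding Ix_def by blast
  have "dset g \<in> decorations" unfolding decorations_def by (cases g) auto
  moreover have "\<forall>(i, j)\<in>dset g. fst p $ i $ j > 0" using z by (cases g) auto
  ultimately show "p \<in> Xi d"
    using z(3) unfolding Xi_def Theta_def z(1) by (simp add: sum_2)
qed

lemma finite_Ix: "finite (Ix d)"
proof (rule finite_subset)
  show "Ix d \<subseteq> {..d} \<times> {..d} \<times> {..d} \<times> {..d} \<times> {D0, D11, D12, D21, Dx, D22}"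
  proof
    fix z assume z: "z \<in> Ix d"
    obtain a b c x g where zz: "z = (a, b, c, x, g)" by (metis prod.exhaust)
    have "a + b + c + x = d" using z unfolding zz Ix_def by simp
    then have "a \<le> d" "b \<le> d" "c \<le> d" "x \<le> d" by simp_all
    then show "z \<in> {..d} \<times> {..d} \<times> {..d} \<times> {..d} \<times> {D0, D11, D12, D21, Dx, D22}"
      unfolding zz by (cases g) simp_all
  qed
qed simp

section \<open>Subspaces spanned by parts of a basis\<close>

context fvec begin

context
  fixes b :: "'i \<Rightarrow> 'c" and I :: "'i set"
  assumes fin: "finite I" and b: "b \<in> I \<rightarrow> carrier M" and gen: "vhull (b ` I) = carrier M"
    and card: "card I = dimn (carrier M)"
begin

lemma sub_vhull_family: "J \<subseteq> I \<Longrightarrow> sub (vhull (b ` J))"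
  using b by (intro sub_hull) auto

text \<open>The lower bound holds because the remaining \<open>card I - card J\<close> vectors have
  to fill up the rest of the space.\<close>

lemma dimn_vhull_family: assumes J: "J \<subseteq> I" shows "dimn (vhull (b ` J)) = card J"
proof (rule antisym)
  have finJ: "finite J" using J fin finite_subset by blast
  have bJ: "b ` K \<subseteq> carrier M" if "K \<subseteq> I" for K using b that by auto
  have "dimn (vhull ({vzero} \<union> b ` J)) \<le> dimn {vzero} + card (b ` J)"
    using finJ bJ[OF J] sub_null by (intro dimn_hull_le) auto
  then show "dimn (vhull (b ` J)) \<le> card J"
    using hull_insert_zero[OF bJ[OF J]] card_image_le[OF finJ, of b] by (simp add: dimn_null)
  have "vhull (vhull (b ` J) \<union> b ` (I - J)) = carrier M"
    unfolding hull_Un_hull gen[symmetric] using J by (simp add: image_Un[symmetric] Un_absorb1)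
  then have "dimn (carrier M) \<le> dimn (vhull (b ` J)) + card (b ` (I - J))"
    using dimn_hull_le[of "b ` (I - J)" "vhull (b ` J)"] fin bJ[of "I - J"] sub_vhull_family[OF J] by auto
  moreover have "card (b ` (I - J)) \<le> card I - card J"
    using card_image_le[of "I - J" b] fin J finJ by (simp add: card_Diff_subset)
  moreover have "card J \<le> card I" using fin J by (rule card_mono)
  ultimately show "card J \<le> dimn (vhull (b ` J))" using card by simp
qed

lemma vhull_family_mem: assumes J: "J \<subseteq> I" and t: "t \<in> I" shows "b t \<in> vhull (b ` J) \<longleftrightarrow> t \<in> J"
proof
  assume m: "b t \<in> vhull (b ` J)"
  show "t \<in> J"
  proof (rule ccontr)
    assume "t \<notin> J"
    then have c: "card (insert t J) = Suc (card J)" using fin J finite_subset by (metis card_insert_disjoint)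
    have "vhull (b ` insert t J) \<subseteq> vhull (b ` J)"
      using m hull_subset[of "b ` J"] by (intro hull_least sub_vhull_family J) auto
    then have "dimn (vhull (b ` insert t J)) \<le> dimn (vhull (b ` J))"
      using J t by (intro dimn_mono sub_vhull_family) auto
    then show False using dimn_vhull_family[of "insert t J"] dimn_vhull_family[OF J] J t c by simp
  qed
qed (use hull_subset[of "b ` J"] in blast)

lemma ssum_vhull_family: assumes "J \<subseteq> I" "K \<subseteq> I"
  shows "ssum (vhull (b ` J)) (vhull (b ` K)) = vhull (b ` (J \<union> K))"
  using hull_Un_sub[OF sub_vhull_family[OF assms(1)] sub_vhull_family[OF assms(2)]]
  by (simp add: hull_Un_hull hull_Un_hull2 image_Un)

text \<open>One inclusion is clear, and the dimension formula for sums gives both sides the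
  dimension \<open>card (J \<inter> K)\<close>.\<close>

lemma inter_vhull_family: assumes J: "J \<subseteq> I" and K: "K \<subseteq> I"
  shows "vhull (b ` J) \<inter> vhull (b ` K) = vhull (b ` (J \<inter> K))"
proof -
  have fJ: "finite J" "finite K" using J K fin finite_subset by blast+
  have JK: "J \<inter> K \<subseteq> I" "J \<union> K \<subseteq> I" using J K by auto
  have "dimn (vhull (b ` J) \<inter> vhull (b ` K)) = card (J \<inter> K)"
    using dimn_ssum[OF sub_vhull_family[OF J] sub_vhull_family[OF K]] card_Un_Int[OF fJ]
    by (simp add: ssum_vhull_family J K JK dimn_vhull_family)
  then have "vhull (b ` (J \<inter> K)) = vhull (b ` J) \<inter> vhull (b ` K)"
    using J K JK by (intro dimn_eq_imp_eq sub_inter sub_vhull_family)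
      (auto simp: dimn_vhull_family intro: hull_mono[THEN subsetD, rotated])
  then show ?thesis ..
qed

end

lemma dimn_pos: assumes "sub W" "y \<in> W" "y \<noteq> vzero" shows "dimn W > 0"
proof (rule ccontr)
  assume "\<not> dimn W > 0"
  then have "{vzero} = W" using assms(1) dimn_null by (intro dimn_eq_imp_eq sub_null) auto
  then show False using assms by auto
qed

lemma dimn_less: assumes "sub A" "sub B" "A \<subseteq> B" "y \<in> B" "y \<notin> A" shows "dimn A < dimn B"
  using dimn_mono[OF assms(1-3)] dimn_eq_imp_eq[OF assms(1-3)] assms(4,5) by (cases "dimn A = dimn B") auto

text \<open>The vector w, or a component of it, witnesses the strict inclusion that makes a
  decorated entry positive.\<close>

lemma ctype_Ix:
  assumes F: "sub F" and G: "sub G" and w: "w \<in> carrier M"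
  shows "ctype F G w \<in> Ix (dimn (carrier M))"
proof -
  have s: "sub (F \<inter> G)" "sub (ssum F G)" using F G by (auto intro: sub_inter sub_ssum)
  have le: "dimn (F \<inter> G) \<le> dimn F" "dimn (F \<inter> G) \<le> dimn G" "dimn (ssum F G) \<le> dimn (carrier M)"
    using F G s sub_M sub_subset[OF s(2)] by (auto intro: dimn_mono)
  have sum: "dimn (F \<inter> G) + (dimn F - dimn (F \<inter> G)) + (dimn G - dimn (F \<inter> G)) + (dimn (carrier M) - dimn (ssum F G)) = dimn (carrier M)"
    using dimn_ssum[OF F G] le by simp
  have FU: "dimn (F \<inter> G) < dimn F" if "y \<in> F" "y \<notin> G" for y
    using that by (intro dimn_less[OF s(1) F]) auto
  have GU: "dimn (F \<inter> G) < dimn G" if "y \<notin> F" "y \<in> G" for y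
    using that by (intro dimn_less[OF s(1) G]) auto
  consider "w = vzero" | "w \<noteq> vzero" "w \<in> F" "w \<in> G" | "w \<in> F" "w \<notin> G" | "w \<notin> F" "w \<in> G"
    | "w \<notin> F" "w \<notin> G" "w \<in> ssum F G" | "w \<notin> ssum F G" by blast
  then have "valid (ctype F G w)"
  proof cases
    case 1 then show ?thesis by (simp add: ctype_def pos_simps F G)
  next
    case 2 then show ?thesis using dimn_pos[OF s(1), of w] by (simp add: ctype_def pos_simps F G)
  next
    case 3 then show ?thesis using FU by (simp add: ctype_def pos_simps F G)
  next
    case 4 then show ?thesis using GU by (simp add: ctype_def pos_simps F G)
  next
    case 5
    obtain y g where y: "y \<in> F" "g \<in> G" "w = y \<oplus>\<oplus> g" using 5(3) by (rule ssumE)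
    have "y \<notin> G" using 5 y sub_add[OF G] by auto
    moreover have "g \<notin> F" using 5 y sub_add[OF F] by auto
    ultimately show ?thesis using FU[OF y(1)] GU[OF _ y(2)] 5 by (simp add: ctype_def pos_simps F G)
  next
    case 6
    have "dimn (ssum F G) < dimn (carrier M)"
      using 6 w s(2) by (intro dimn_less[OF s(2) sub_M sub_subset]) auto
    then show ?thesis using 6 by (simp add: ctype_def pos_simps F G)
  qed
  then show ?thesis using sum unfolding Ix_def ctype_def by auto
qed

end

context fspace begin

lemma finsum_dset:
  assumes "valid (a, b, c, x, g)" "v \<in> idx (fst (mk (a, b, c, x, g))) \<rightarrow> carrier (Vsp R d)"
  shows "(\<Oplus>\<^bsub>Vsp R d\<^esub>p\<in>dset g. v (fst p, snd p, 1)) = (case g of D0 \<Rightarrow> \<zero>\<^bsub>Vsp R d\<^esub> | D11 \<Rightarrow> v (1, 1, 1)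
    | D12 \<Rightarrow> v (1, 2, 1) | D21 \<Rightarrow> v (2, 1, 1) | Dx \<Rightarrow> v (1, 2, 1) \<oplus>\<^bsub>Vsp R d\<^esub> v (2, 1, 1) | D22 \<Rightarrow> v (2, 2, 1))"
proof -
  have m: "v (i, j, s) \<in> carrier (Vsp R d)" if "(i, j, s) \<in> idx (fst (mk (a, b, c, x, g)))" for i j s
    using assms(2) that by blast
  show ?thesis
    using assms(1) m unfolding idx_mk by (cases g) (auto simp: in_blk V.M.finsum_insert)
qed

lemma card_idx_mk: "z \<in> Ix d \<Longrightarrow> card (idx (fst (mk z))) = d"
  and finite_idx_mk: "finite (idx (fst (mk z)))"
proof -
  obtain a b c x g where z: "z = (a, b, c, x, g)" by (metis prod.exhaust)
  show "finite (idx (fst (mk z)))" unfolding z idx_mk by simp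
  assume "z \<in> Ix d"
  then have "a + b + c + x = d" unfolding Ix_def z by simp
  then show "card (idx (fst (mk z))) = d"
    unfolding z idx_mk by (simp add: card_Un_disjoint blk_disjoint Int_Un_distrib Int_Un_distrib2)
qed

text \<open>In an adapted basis F, G, their sum and their intersection are spans of subfamilies, so
  dimensions and the place of w are read off from index sets.\<close>

lemma orbit_imp_ctype:
  assumes z: "z \<in> Ix d" and t: "(F, G, w) \<in> orbit R d (mk z)"
  shows "V.ctype F G w = z"
proof -
  obtain a b c x g where zz: "z = (a, b, c, x, g)" by (metis prod.exhaust)
  let ?I = "idx (fst (mk z))"
  have mkz: "mk z = (fst (mk z), dset g)" unfolding zz by simp
  have val: "valid (a, b, c, x, g)" and tot: "a + b + c + x = d" using z unfolding zz Ix_def by auto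
  obtain v where v: "fam_basis R d v ?I" "F = fam_span R d v {(i, j, s) \<in> ?I. i = 1}"
    "G = fam_span R d v {(i, j, s) \<in> ?I. j = 1}" "w = (\<Oplus>\<^bsub>Vsp R d\<^esub>p\<in>dset g. v (fst p, snd p, 1))"
    using t unfolding orbit_def by (subst (asm) mkz) (simp only: prod.case mem_Collect_eq, blast)
  have vb: "v \<in> ?I \<rightarrow> carrier (Vsp R d)" "V.vhull (v ` ?I) = carrier (Vsp R d)"
    using v(1) fam_basis_iff[OF finite_idx_mk card_idx_mk[OF z]] by auto
  have "card ?I = V.dimn (carrier (Vsp R d))" using card_idx_mk[OF z] dimn_V by simp
  note fam = finite_idx_mk[of z] vb this
  let ?J = "blk 1 1 a \<union> blk 1 2 b" and ?K = "blk 1 1 a \<union> blk 2 1 c"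
  have I: "?I = blk 1 1 a \<union> blk 1 2 b \<union> (blk 2 1 c \<union> blk 2 2 x)" unfolding zz idx_mk ..
  have J: "{(i, j, s) \<in> ?I. i = 1} = ?J" "{(i, j, s) \<in> ?I. j = 1} = ?K"
    unfolding I by (rule blk_rows blk_columns)+
  have sub: "?J \<subseteq> ?I" "?K \<subseteq> ?I" "?J \<union> ?K \<subseteq> ?I" "?J \<inter> ?K \<subseteq> ?I" unfolding I by auto
  have fs: "fam_span R d v L = V.vhull (v ` L)" if "L \<subseteq> ?I" for L
    using finite_subset[OF that finite_idx_mk] vb(1) that by (intro fam_span_hull) auto
  have F: "F = V.vhull (v ` ?J)" and G: "G = V.vhull (v ` ?K)" using v(2,3) sub by (simp_all add: J fs)
  have JK: "?J \<inter> ?K = blk 1 1 a" by (simp add: Un_Int_distrib[symmetric] blk_disjoint)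
  have FG: "F \<inter> G = V.vhull (v ` blk 1 1 a)"
    unfolding F G using V.inter_vhull_family[OF fam sub(1,2)] by (simp only: JK)
  have S: "V.ssum F G = V.vhull (v ` (?J \<union> ?K))"
    unfolding F G by (rule V.ssum_vhull_family[OF fam sub(1,2)])
  have sF: "V.sub F" "V.sub G" unfolding F G by (intro V.sub_vhull_family[OF fam] sub)+
  have "?J \<union> ?K = (blk 1 1 a \<union> blk 1 2 b) \<union> blk 2 1 c" by auto
  then have c: "card ?J = a + b" "card ?K = a + c" "card (?J \<union> ?K) = a + b + c"
    by (simp_all add: card_Un_disjoint blk_disjoint Int_Un_distrib2)
  then have dims: "V.dimn F = a + b" "V.dimn G = a + c" "V.dimn (V.ssum F G) = a + b + c" "V.dimn (F \<inter> G) = a"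
    unfolding S unfolding F G V.inter_vhull_family[OF fam sub(1,2)] using c sub
    by (simp_all only: V.dimn_vhull_family[OF fam] JK card_blk)
  have mF: "v t \<in> F \<longleftrightarrow> t \<in> ?J" and mG: "v t \<in> G \<longleftrightarrow> t \<in> ?K" and mS: "v t \<in> V.ssum F G \<longleftrightarrow> t \<in> ?J \<union> ?K"
    and vz: "v t \<noteq> \<zero>\<^bsub>Vsp R d\<^esub>" and vc: "v t \<in> carrier (Vsp R d)"
    if "t \<in> ?I" for t
  proof -
    show "v t \<in> F \<longleftrightarrow> t \<in> ?J" unfolding F by (rule V.vhull_family_mem[OF fam sub(1) that])
    show "v t \<in> G \<longleftrightarrow> t \<in> ?K" unfolding G by (rule V.vhull_family_mem[OF fam sub(2) that])
    show "v t \<in> V.ssum F G \<longleftrightarrow> t \<in> ?J \<union> ?K" unfolding S by (rule V.vhull_family_mem[OF fam sub(3) that])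
    have "V.sub (V.vhull (v ` {}))" by (rule V.sub_vhull_family[OF fam]) simp
    then show "v t \<noteq> \<zero>\<^bsub>Vsp R d\<^esub>" using V.vhull_family_mem[OF fam _ that, of "{}"] V.sub_zero by auto
    show "v t \<in> carrier (Vsp R d)" using vb(1) that by blast
  qed
  have w: "w = (case g of D0 \<Rightarrow> \<zero>\<^bsub>Vsp R d\<^esub> | D11 \<Rightarrow> v (1, 1, 1)
    | D12 \<Rightarrow> v (1, 2, 1) | D21 \<Rightarrow> v (2, 1, 1) | Dx \<Rightarrow> v (1, 2, 1) \<oplus>\<^bsub>Vsp R d\<^esub> v (2, 1, 1) | D22 \<Rightarrow> v (2, 2, 1))"
    using v(4) finsum_dset[OF val] vb(1) unfolding zz by simp
  have "V.pos F G w = g"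
  proof (cases g)
    case D0 then show ?thesis using w sF by (simp add: V.pos_simps)
  next
    case D11
    then have "(1, 1, 1) \<in> ?I" "w = v (1, 1, 1)" using w val unfolding I by (auto simp: in_blk)
    then show ?thesis using D11 mF mG vz sF by (simp add: V.pos_simps in_blk I)
  next
    case D12
    then have "(1, 2, 1) \<in> ?I" "w = v (1, 2, 1)" using w val unfolding I by (auto simp: in_blk)
    then show ?thesis using D12 mF mG vz sF by (simp add: V.pos_simps in_blk I)
  next
    case D21
    then have "(2, 1, 1) \<in> ?I" "w = v (2, 1, 1)" using w val unfolding I by (auto simp: in_blk)
    then show ?thesis using D21 mF mG vz sF by (simp add: V.pos_simps in_blk I)
  next
    case D22
    then have "(2, 2, 1) \<in> ?I" "w = v (2, 2, 1)" using w val unfolding I by (auto simp: in_blk)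
    then show ?thesis using D22 mS vz sF by (simp add: V.pos_simps in_blk I)
  next
    case Dx
    then have i: "(1, 2, 1) \<in> ?I" "(2, 1, 1) \<in> ?I" and ww: "w = v (1, 2, 1) \<oplus>\<^bsub>Vsp R d\<^esub> v (2, 1, 1)"
      using w val unfolding I by (auto simp: in_blk)
    let ?y = "v (1, 2, 1)" and ?u = "v (2, 1, 1)"
    have m: "?y \<in> F" "?y \<notin> G" "?u \<in> G" "?u \<notin> F" using mF[OF i(1)] mF[OF i(2)] mG[OF i(1)] mG[OF i(2)] i
      by (simp_all add: in_blk I)
    have "w \<notin> F"
    proof
      assume "w \<in> F"
      then have "\<ominus>\<^bsub>Vsp R d\<^esub> ?y \<oplus>\<^bsub>Vsp R d\<^esub> w \<in> F" using m sF(1) by (intro V.sub_add V.sub_neg)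
      then show False using m vc[OF i(1)] vc[OF i(2)] unfolding ww by (simp add: V.M.r_neg1)
    qed
    moreover have "w \<notin> G"
    proof
      assume "w \<in> G"
      then have "w \<oplus>\<^bsub>Vsp R d\<^esub> \<ominus>\<^bsub>Vsp R d\<^esub> ?u \<in> G" using m sF(2) by (intro V.sub_add V.sub_neg)
      then show False using m vc[OF i(1)] vc[OF i(2)] unfolding ww by (simp add: V.M.a_assoc V.M.r_neg)
    qed
    moreover have "w \<in> V.ssum F G" unfolding ww using m by (intro V.ssumI)
    ultimately show ?thesis using Dx sF by (simp add: V.pos_simps)
  qed
  then show ?thesis unfolding V.ctype_def zz dims dimn_V using tot by auto
qed

text \<open>An adapted basis is built block by block: from 0 to U, from U to F, from U to G, and
  from F + G to the whole space. Each block starts with the vector that the decoration requires; for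
  \<open>Dx\<close> these are the two components of w.\<close>

lemma ctype_imp_orbit:
  assumes F: "V.sub F" and G: "V.sub G" and w: "w \<in> carrier (Vsp R d)"
  shows "(F, G, w) \<in> orbit R d (mk (V.ctype F G w))"
proof -
  define z where "z = V.ctype F G w"
  obtain a b c x g where zz: "z = (a, b, c, x, g)" by (metis prod.exhaust)
  have zI: "z \<in> Ix d" unfolding z_def using V.ctype_Ix[OF F G w] dimn_V by simp
  let ?M = "carrier (Vsp R d)"
  define U where "U = F \<inter> G"
  define S where "S = V.ssum F G"
  have comp: "a = V.dimn U" "b = V.dimn F - V.dimn U" "c = V.dimn G - V.dimn U" "x = V.dimn ?M - V.dimn S"
    "g = V.pos F G w"
    using zz unfolding z_def V.ctype_def U_def S_def by auto
  have U: "V.sub U" "U \<subseteq> F" "U \<subseteq> G" unfolding U_def using F G by (auto intro: V.sub_inter)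
  have S: "V.sub S" "S \<subseteq> ?M" unfolding S_def using V.sub_ssum[OF F G] V.sub_subset by auto
  have dU: "V.dimn F = V.dimn U + b" "V.dimn G = V.dimn U + c" "V.dimn U = V.dimn {\<zero>\<^bsub>Vsp R d\<^esub>} + a" "V.dimn ?M = V.dimn S + x"
    using V.dimn_mono[OF U(1) F U(2)] V.dimn_mono[OF U(1) G U(3)] V.dimn_mono[OF S(1) V.sub_M S(2)] comp
    by (auto simp: V.dimn_null)
  have pick: "\<exists>y. m > 0 \<longrightarrow> y \<in> B \<and> y \<notin> A" if "V.sub A" "V.sub B" "A \<subseteq> B" "V.dimn B = V.dimn A + m" for A B m
  proof (cases "m > 0")
    case True
    then have "A \<noteq> B" using that(4) by auto
    then show ?thesis using that(3) by blast
  qed simp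
  have val: "valid (a, b, c, x, g)" using zI unfolding zz Ix_def by simp
  have "\<exists>y u. w = y \<oplus>\<^bsub>Vsp R d\<^esub> u \<and> y \<in> F \<and> y \<notin> G \<and> u \<in> G \<and> u \<notin> F" if "g = Dx"
  proof -
    have "w \<in> S" "w \<notin> F" "w \<notin> G" using that comp(5) unfolding V.pos_def S_def by (auto split: if_splits)
    then obtain y u where y: "y \<in> F" "u \<in> G" "w = y \<oplus>\<^bsub>Vsp R d\<^esub> u" unfolding S_def by (auto elim: V.ssumE)
    then have "y \<notin> G" "u \<notin> F" using \<open>w \<notin> F\<close> \<open>w \<notin> G\<close> V.sub_add[OF F] V.sub_add[OF G] by auto
    then show ?thesis using y by blast
  qed
  then obtain y u where yu: "g = Dx \<Longrightarrow> w = y \<oplus>\<^bsub>Vsp R d\<^esub> u \<and> y \<in> F \<and> y \<notin> G \<and> u \<in> G \<and> u \<notin> F" by blast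
  obtain y11 where y11: "a > 0 \<longrightarrow> y11 \<in> U \<and> y11 \<notin> {\<zero>\<^bsub>Vsp R d\<^esub>}"
    using pick[OF V.sub_null U(1) _ dU(3)] U(1) by auto
  obtain y12 where y12: "b > 0 \<longrightarrow> y12 \<in> F \<and> y12 \<notin> U" using pick[OF U(1) F U(2) dU(1)] by blast
  obtain y21 where y21: "c > 0 \<longrightarrow> y21 \<in> G \<and> y21 \<notin> U" using pick[OF U(1) G U(3) dU(2)] by blast
  obtain y22 where y22: "x > 0 \<longrightarrow> y22 \<in> ?M \<and> y22 \<notin> S" using pick[OF S(1) V.sub_M S(2) dU(4)] by blast
  have pos: "g = D11 \<Longrightarrow> w \<in> U \<and> w \<noteq> \<zero>\<^bsub>Vsp R d\<^esub>" "g = D12 \<Longrightarrow> w \<in> F \<and> w \<notin> U" "g = D21 \<Longrightarrow> w \<in> G \<and> w \<notin> U"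
    "g = D22 \<Longrightarrow> w \<notin> S" "g = D0 \<Longrightarrow> w = \<zero>\<^bsub>Vsp R d\<^esub>"
    using comp(5) unfolding V.pos_def S_def U_def by (auto split: if_splits)
  have zU: "{\<zero>\<^bsub>Vsp R d\<^esub>} \<subseteq> U" using U(1) by simp
  have cond11: "a > 0 \<Longrightarrow> (if g = D11 then w else y11) \<in> U \<and> (if g = D11 then w else y11) \<notin> {\<zero>\<^bsub>Vsp R d\<^esub>}"
    using y11 pos(1) by simp
  obtain g11 :: "nat \<Rightarrow> vec_elt" where g11: "g11 ` {1..a} \<subseteq> U" "U = V.vhull ({\<zero>\<^bsub>Vsp R d\<^esub>} \<union> g11 ` {1..a})"
    "a > 0 \<longrightarrow> g11 1 = (if g = D11 then w else y11)"
    using V.exists_complement_family[OF V.sub_null U(1) zU dU(3) cond11] by blast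
  have cond12: "b > 0 \<Longrightarrow> (if g = D12 then w else if g = Dx then y else y12) \<in> F
      \<and> (if g = D12 then w else if g = Dx then y else y12) \<notin> U"
    using y12 pos(2) yu unfolding U_def by auto
  obtain g12 :: "nat \<Rightarrow> vec_elt" where g12: "g12 ` {1..b} \<subseteq> F" "F = V.vhull (U \<union> g12 ` {1..b})"
    "b > 0 \<longrightarrow> g12 1 = (if g = D12 then w else if g = Dx then y else y12)"
    using V.exists_complement_family[OF U(1) F U(2) dU(1) cond12] by blast
  have cond21: "c > 0 \<Longrightarrow> (if g = D21 then w else if g = Dx then u else y21) \<in> G
      \<and> (if g = D21 then w else if g = Dx then u else y21) \<notin> U"
    using y21 pos(3) yu unfolding U_def by auto
  obtain g21 :: "nat \<Rightarrow> vec_elt" where g21: "g21 ` {1..c} \<subseteq> G" "G = V.vhull (U \<union> g21 ` {1..c})"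
    "c > 0 \<longrightarrow> g21 1 = (if g = D21 then w else if g = Dx then u else y21)"
    using V.exists_complement_family[OF U(1) G U(3) dU(2) cond21] by blast
  have cond22: "x > 0 \<Longrightarrow> (if g = D22 then w else y22) \<in> ?M \<and> (if g = D22 then w else y22) \<notin> S"
    using y22 pos(4) w by auto
  obtain g22 :: "nat \<Rightarrow> vec_elt" where g22: "g22 ` {1..x} \<subseteq> ?M" "?M = V.vhull (S \<union> g22 ` {1..x})"
    "x > 0 \<longrightarrow> g22 1 = (if g = D22 then w else y22)"
    using V.exists_complement_family[OF S(1) V.sub_M S(2) dU(4) cond22] by blast
  define v :: "2 \<times> 2 \<times> nat \<Rightarrow> vec_elt" where
    "v = (\<lambda>(i, j, s). if i = 1 then if j = 1 then g11 s else g12 s else if j = 1 then g21 s else g22 s)"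
  have img: "v ` blk 1 1 n = g11 ` {1..n}" "v ` blk 1 2 n = g12 ` {1..n}" "v ` blk 2 1 n = g21 ` {1..n}" "v ` blk 2 2 n = g22 ` {1..n}" for n
    unfolding blk_def image_image v_def by auto
  let ?I = "idx (fst (mk z))"
  have I: "?I = blk 1 1 a \<union> blk 1 2 b \<union> (blk 2 1 c \<union> blk 2 2 x)" unfolding zz idx_mk ..
  have J: "{(i, j, s) \<in> ?I. i = 1} = blk 1 1 a \<union> blk 1 2 b" "{(i, j, s) \<in> ?I. j = 1} = blk 1 1 a \<union> blk 2 1 c"
    unfolding I by (rule blk_rows blk_columns)+
  have sM: "U \<subseteq> ?M" "F \<subseteq> ?M" "G \<subseteq> ?M" by (rule V.sub_subset[OF U(1)] V.sub_subset[OF F] V.sub_subset[OF G])+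
  have vI: "v ` ?I \<subseteq> ?M" unfolding I image_Un img
    by (intro Un_least subset_trans[OF g11(1) sM(1)] subset_trans[OF g12(1) sM(2)] subset_trans[OF g21(1) sM(3)] g22(1))
  then have vI': "v \<in> ?I \<rightarrow> ?M" by blast
  have hU: "U = V.vhull (g11 ` {1..a})"
    using g11(2) V.hull_insert_zero[OF subset_trans[OF g11(1) sM(1)]] by (simp only:)
  have hF: "F = V.vhull (g11 ` {1..a} \<union> g12 ` {1..b})"
    using g12(2) unfolding hU V.hull_Un_hull .
  have hG: "G = V.vhull (g11 ` {1..a} \<union> g21 ` {1..c})"
    using g21(2) unfolding hU V.hull_Un_hull .
  have "S = V.vhull (F \<union> G)" unfolding S_def using V.hull_Un_sub[OF F G] ..
  also have "\<dots> = V.vhull (g11 ` {1..a} \<union> g12 ` {1..b} \<union> g21 ` {1..c})"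
    by (subst hF, subst hG) (simp only: V.hull_Un_hull V.hull_Un_hull2, rule arg_cong[where f = V.vhull], blast)
  finally have hS: "S = V.vhull (g11 ` {1..a} \<union> g12 ` {1..b} \<union> g21 ` {1..c})" .
  have hM: "V.vhull (v ` ?I) = ?M"
    using g22(2)[symmetric] unfolding hS V.hull_Un_hull I image_Un img by (simp only: Un_assoc)
  have fs: "fam_span R d v L = V.vhull (v ` L)" if "L \<subseteq> ?I" for L
    using finite_subset[OF that finite_idx_mk] vI' that by (intro fam_span_hull) auto
  have 1: "fam_basis R d v ?I" using fam_basis_iff[OF finite_idx_mk card_idx_mk[OF zI]] vI' hM by simp
  have sub: "blk 1 1 a \<union> blk 1 2 b \<subseteq> ?I" "blk 1 1 a \<union> blk 2 1 c \<subseteq> ?I" unfolding I by auto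
  have 2: "F = fam_span R d v {(i, j, s) \<in> ?I. i = 1}" unfolding J fs[OF sub(1)] image_Un img by (rule hF)
  have 3: "G = fam_span R d v {(i, j, s) \<in> ?I. j = 1}" unfolding J fs[OF sub(2)] image_Un img by (rule hG)
  have 4: "w = (\<Oplus>\<^bsub>Vsp R d\<^esub>p\<in>dset g. v (fst p, snd p, 1))"
    using finsum_dset[OF val, of v] vI' val pos yu g11(3) g12(3) g21(3) g22(3) unfolding zz
    by (cases g) (auto simp: v_def)
  have "mk z = (fst (mk z), dset g)" unfolding zz by simp
  moreover have "(F, G, w) \<in> configs R d" unfolding configs_def flags_eq using F G w by simp
  ultimately have "(F, G, w) \<in> orbit R d (mk z)"
    unfolding orbit_def using 1 2 3 4 by auto
  then show ?thesis unfolding z_def .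
qed

lemma orbit_iff:
  assumes "z \<in> Ix d" "V.sub F" "V.sub G" "w \<in> carrier (Vsp R d)"
  shows "(F, G, w) \<in> orbit R d (mk z) \<longleftrightarrow> V.ctype F G w = z"
  using orbit_imp_ctype[OF assms(1)] ctype_imp_orbit[OF assms(2-4)] by auto

text \<open>Any basis of the space, indexed by the cells of the matrix, yields a configuration of
  the given type. This allows identities between functions of types to be tested on
  configurations.\<close>

lemma exists_ctype:
  assumes z: "z \<in> Ix d"
  shows "\<exists>F G w. V.sub F \<and> V.sub G \<and> w \<in> carrier (Vsp R d) \<and> V.ctype F G w = z"
proof -
  obtain a b c x g where zz: "z = (a, b, c, x, g)" by (metis prod.exhaust)
  let ?I = "idx (fst (mk z))" and ?M = "carrier (Vsp R d)"
  have "\<exists>y. d > 0 \<longrightarrow> y \<in> ?M \<and> y \<notin> {\<zero>\<^bsub>Vsp R d\<^esub>}"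
  proof (rule ccontr)
    assume "\<nexists>y. d > 0 \<longrightarrow> y \<in> ?M \<and> y \<notin> {\<zero>\<^bsub>Vsp R d\<^esub>}"
    then have "d > 0" "?M = {\<zero>\<^bsub>Vsp R d\<^esub>}" using V.sub_zero[OF V.sub_M] by blast+
    then show False using dimn_V V.dimn_null by simp
  qed
  then obtain y where "d > 0 \<longrightarrow> y \<in> ?M \<and> y \<notin> {\<zero>\<^bsub>Vsp R d\<^esub>}" by blast
  then obtain h :: "nat \<Rightarrow> vec_elt" where h: "h ` {1..d} \<subseteq> ?M" "?M = V.vhull ({\<zero>\<^bsub>Vsp R d\<^esub>} \<union> h ` {1..d})"
    using V.exists_complement_family[OF V.sub_null V.sub_M, of d y] by (auto simp: dimn_V V.dimn_null)
  have "card ?I = card {1..d}" using card_idx_mk[OF z] by simp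
  then obtain \<beta> where \<beta>: "bij_betw \<beta> ?I {1..d}"
    using finite_same_card_bij[OF finite_idx_mk] by blast
  define v where "v = h \<circ> \<beta>"
  have img: "v ` ?I = h ` {1..d}" unfolding v_def image_comp[symmetric] using \<beta> by (simp add: bij_betw_def)
  then have vI: "v \<in> ?I \<rightarrow> ?M" using h(1) by blast
  have hM: "V.vhull (v ` ?I) = ?M" using h V.hull_insert_zero[OF h(1)] unfolding img by simp
  have fb: "fam_basis R d v ?I" using fam_basis_iff[OF finite_idx_mk card_idx_mk[OF z]] vI hM by simp
  define F where "F = fam_span R d v {(i, j, s) \<in> ?I. i = 1}"
  define G where "G = fam_span R d v {(i, j, s) \<in> ?I. j = 1}"
  define w where "w = (\<Oplus>\<^bsub>Vsp R d\<^esub>p\<in>dset g. v (fst p, snd p, 1))"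
  have fs: "fam_span R d v L = V.vhull (v ` L)" "V.sub (V.vhull (v ` L))" if "L \<subseteq> ?I" for L
    using finite_subset[OF that finite_idx_mk] vI that by (auto intro!: fam_span_hull V.sub_hull)
  have L: "{(i, j, s) \<in> ?I. i = 1} \<subseteq> ?I" "{(i, j, s) \<in> ?I. j = 1} \<subseteq> ?I" by auto
  have s: "V.sub F" "V.sub G" unfolding F_def G_def using fs[OF L(1)] fs[OF L(2)] by simp_all
  have val: "valid (a, b, c, x, g)" using z unfolding zz Ix_def by simp
  have w: "w \<in> ?M"
    unfolding w_def using val vI unfolding zz idx_mk
    by (intro V.M.finsum_closed) (cases g; auto simp: in_blk dest: Pi_mem)
  have "mk z = (fst (mk z), dset g)" unfolding zz by simp
  moreover have "(F, G, w) \<in> configs R d" unfolding configs_def flags_eq using s w by simp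
  ultimately have "(F, G, w) \<in> orbit R d (mk z)"
    unfolding orbit_def using fb F_def G_def w_def by auto
  then show ?thesis using orbit_imp_ctype[OF z] s w by blast
qed

end

section \<open>The one-step operators over a commutative ring\<close>

fun rk :: "ix \<Rightarrow> nat" where "rk (a, b, c, x, g) = a + b"
fun tot :: "ix \<Rightarrow> nat" where "tot (a, b, c, x, g) = a + b + c + x"

lemma Ix_iff: "z \<in> Ix d \<longleftrightarrow> valid z \<and> tot z = d"
  by (cases z) (auto simp: Ix_def)

text \<open>The values 0 and 1 are boundary cases: a step can empty a decorated cell, and two steps
  subtract 2 from an entry.\<close>

lemma nat3_cases: obtains "n = 0" | "n = Suc 0" | m where "n = Suc (Suc m)"
  by (cases n rule: nat.exhaust) (auto, metis nat.exhaust)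

text \<open>A step that would leave the valid positions has coefficient 0, so only valid positions
  of the neighbouring rank matter.\<close>

lemma opE_cong:
  assumes z: "valid z" and eq: "\<And>y. valid y \<Longrightarrow> tot y = tot z \<Longrightarrow> Suc (rk y) = rk z \<Longrightarrow> \<phi> y = \<psi> y"
  shows "opE t \<phi> z = opE t \<psi> z"
proof -
  obtain a b c x g where zz: "z = (a, b, c, x, g)" by (metis prod.exhaust)
  show ?thesis
    using z unfolding zz
    by (cases g; cases a rule: nat3_cases; cases b rule: nat3_cases) (simp_all add: eq zz)
qed

lemma opF_cong:
  assumes z: "valid z" and eq: "\<And>y. valid y \<Longrightarrow> tot y = tot z \<Longrightarrow> rk y = Suc (rk z) \<Longrightarrow> \<phi> y = \<psi> y"
  shows "opF t \<phi> z = opF t \<psi> z"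
proof -
  obtain a b c x g where zz: "z = (a, b, c, x, g)" by (metis prod.exhaust)
  show ?thesis
    using z unfolding zz
    by (cases g; cases c rule: nat3_cases; cases x rule: nat3_cases) (simp_all add: eq zz gn_Suc)
qed

lemma opL_cong:
  assumes z: "valid z" and eq: "\<And>y. valid y \<Longrightarrow> tot y = tot z \<Longrightarrow> rk y = rk z \<Longrightarrow> \<phi> y = \<psi> y"
  shows "opL t \<phi> z = opL t \<psi> z"
proof -
  obtain a b c x g where zz: "z = (a, b, c, x, g)" by (metis prod.exhaust)
  show ?thesis
    using z unfolding zz
    by (cases g; cases a; cases b) (simp_all add: eq zz)
qed

section \<open>Product forms of the coefficients\<close>

lemma gn_add: "gn t (m + n) = gn t m + gn t n + (t - 1) * gn t m * gn t n" for t :: "'a::comm_ring_1"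
proof (induction n)
  case (Suc n)
  have "gn t (m + Suc n) = gn t (m + n) + (1 + (t - 1) * gn t m) * (1 + (t - 1) * gn t n)"
    by (simp add: gn_Suc power_add flip: power_eq_gn)
  then show ?case unfolding Suc.IH by (simp add: gn_Suc power_eq_gn[of t n] algebra_simps)
qed simp

lemma gn_Suc': "gn t (Suc n) = 1 + t * gn t n" for t :: "'a::comm_ring_1"
  using gn_add[of t 1 n] by (simp add: algebra_simps)

lemma gn_diff: "gn t (m + n) - gn t n = t ^ n * gn t m" "gn t (n + m) - gn t n = t ^ n * gn t m"
  for t :: "'a::comm_ring_1"
  using gn_add[of t n m] by (simp_all add: power_eq_gn[of t n] algebra_simps)


lemma opE_D0: "opE t \<phi> (a, b, c, x, D0) = gn t b * \<phi> (a, b - 1, c, Suc x, D0) + t ^ b * gn t a * \<phi> (a - 1, b, Suc c, x, D0)"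
  by (simp add: gn_diff)

lemma opE_D11: "opE t \<phi> (Suc a, b, c, x, D11) = gn t b * \<phi> (Suc a, b - 1, c, Suc x, D11)
   + t ^ b * gn t a * \<phi> (a, b, Suc c, x, D11) + t ^ b * t ^ a * \<phi> (a, b, Suc c, x, D21)"
  by (simp add: gn_diff gn_Suc power_add algebra_simps)

lemma opE_D12: "opE t \<phi> (a, Suc b, c, x, D12) = gn t b * \<phi> (a, b, c, Suc x, D12) + t ^ b * \<phi> (a, b, c, Suc x, D22)
   + t ^ b * gn t a * \<phi> (a - 1, Suc b, Suc c, x, D12) + t ^ b * (t ^ a - 1) * \<phi> (a - 1, Suc b, Suc c, x, Dx)"
  by (simp add: gn_diff gn_Suc power_add algebra_simps)

lemma opE_D21: "opE t \<phi> (a, b, c, x, D21) = gn t b * \<phi> (a, b - 1, c, Suc x, D21) + t ^ b * gn t a * \<phi> (a - 1, b, Suc c, x, D21)"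
  by (simp add: gn_diff)

lemma opE_Dx: "opE t \<phi> (a, Suc b, c, x, Dx) = gn t b * \<phi> (a, b, c, Suc x, Dx) + t ^ b * \<phi> (a, b, c, Suc x, D22)
   + t * t ^ b * gn t a * \<phi> (a - 1, Suc b, Suc c, x, Dx)"
  using gn_diff(1)[of t a "Suc b"] by (simp add: gn_diff gn_Suc power_add algebra_simps)

lemma opE_D22: "opE t \<phi> (a, b, c, x, D22) = gn t b * \<phi> (a, b - 1, c, Suc x, D22) + t ^ b * gn t a * \<phi> (a - 1, b, Suc c, x, D22)"
  by (simp add: gn_diff)

lemma opF_easy: "g \<in> {D0, D11, D12} \<Longrightarrow> opF t \<phi> (a, b, c, x, g) = gn t c * \<phi> (Suc a, b, c - 1, x, g) + t ^ c * gn t x * \<phi> (a, Suc b, c, x - 1, g)"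
  by (auto simp: gn_diff)

lemma opF_D21: "opF t \<phi> (a, b, Suc c, x, D21) = \<phi> (Suc a, b, c, x, D11) + t * gn t c * \<phi> (Suc a, b, c, x, D21)
   + t * t ^ c * gn t x * \<phi> (a, Suc b, Suc c, x - 1, D21)"
  using gn_diff(2)[of t "Suc c" x] by (simp add: gn_Suc' algebra_simps)

lemma opF_Dx: "opF t \<phi> (a, b, Suc c, x, Dx) = \<phi> (Suc a, b, c, x, D12) + t * gn t c * \<phi> (Suc a, b, c, x, Dx)
   + t * t ^ c * gn t x * \<phi> (a, Suc b, Suc c, x - 1, Dx)"
  using gn_diff(2)[of t "Suc c" x] by (simp add: gn_Suc' algebra_simps)

lemma opF_D22: "opF t \<phi> (a, b, c, Suc x, D22) = gn t c * \<phi> (Suc a, b, c - 1, Suc x, D22) + \<phi> (a, Suc b, c, x, D12)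
   + (t ^ c - 1) * \<phi> (a, Suc b, c, x, Dx) + t * t ^ c * gn t x * \<phi> (a, Suc b, c, x, D22)"
  using gn_diff(2)[of t "Suc c" x] by (simp add: gn_Suc algebra_simps)

lemmas op_prod = opE_D0 opE_D11 opE_D12 opE_D21 opE_Dx opE_D22 opF_easy opF_D21 opF_Dx opF_D22


text \<open>Multiplication by \<open>t - 1\<close> turns \<open>gn t n\<close> into \<open>t ^ n - 1\<close>, so that the relations between the
  operators become polynomial identities in powers of \<open>t\<close>.\<close>

definition opE' :: "'c::comm_ring_1 \<Rightarrow> (ix \<Rightarrow> 'c) \<Rightarrow> ix \<Rightarrow> 'c" where
  "opE' t \<phi> z = (t - 1) * opE t \<phi> z"

definition opF' :: "'c::comm_ring_1 \<Rightarrow> (ix \<Rightarrow> 'c) \<Rightarrow> ix \<Rightarrow> 'c" where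
  "opF' t \<phi> z = (t - 1) * opF t \<phi> z"

lemma scale_gn: "(t - 1) * gn t n = t ^ n - 1" for t :: "'c::comm_ring_1"
  by (simp add: power_eq_gn[of t n])

lemma scale_terms:
  fixes t :: "'c::comm_ring_1"
  shows "(t - 1) * (gn t n * y) = (t ^ n - 1) * y"
    "(t - 1) * (w * gn t n * y) = w * (t ^ n - 1) * y"
    "(t - 1) * (t ^ m * (t ^ n - 1) * y) = (t - 1) * t ^ m * (t ^ n - 1) * y"
    "(t - 1) * (t ^ m * t ^ n * y) = (t - 1) * t ^ m * t ^ n * y"
    "(t - 1) * (t ^ m * y) = (t - 1) * t ^ m * y"
    "(t - 1) * ((t ^ n - 1) * y) = (t - 1) * (t ^ n - 1) * y"
  by (simp_all only: scale_gn[symmetric] mult.assoc mult.left_commute[of w])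

lemma opE'_simps:
  "opE' t \<phi> (a, b, c, x, D0) = (t ^ b - 1) * \<phi> (a, b - 1, c, Suc x, D0) + t ^ b * (t ^ a - 1) * \<phi> (a - 1, b, Suc c, x, D0)"
  "opE' t \<phi> (Suc a, b, c, x, D11) = (t ^ b - 1) * \<phi> (Suc a, b - 1, c, Suc x, D11)
   + t ^ b * (t ^ a - 1) * \<phi> (a, b, Suc c, x, D11) + (t - 1) * t ^ b * t ^ a * \<phi> (a, b, Suc c, x, D21)"
  "opE' t \<phi> (a, Suc b, c, x, D12) = (t ^ b - 1) * \<phi> (a, b, c, Suc x, D12) + (t - 1) * t ^ b * \<phi> (a, b, c, Suc x, D22)
   + t ^ b * (t ^ a - 1) * \<phi> (a - 1, Suc b, Suc c, x, D12) + (t - 1) * t ^ b * (t ^ a - 1) * \<phi> (a - 1, Suc b, Suc c, x, Dx)"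
  "opE' t \<phi> (a, b, c, x, D21) = (t ^ b - 1) * \<phi> (a, b - 1, c, Suc x, D21) + t ^ b * (t ^ a - 1) * \<phi> (a - 1, b, Suc c, x, D21)"
  "opE' t \<phi> (a, Suc b, c, x, Dx) = (t ^ b - 1) * \<phi> (a, b, c, Suc x, Dx) + (t - 1) * t ^ b * \<phi> (a, b, c, Suc x, D22)
   + t * t ^ b * (t ^ a - 1) * \<phi> (a - 1, Suc b, Suc c, x, Dx)"
  "opE' t \<phi> (a, b, c, x, D22) = (t ^ b - 1) * \<phi> (a, b - 1, c, Suc x, D22) + t ^ b * (t ^ a - 1) * \<phi> (a - 1, b, Suc c, x, D22)"
  unfolding opE'_def op_prod by (simp_all only: distrib_left scale_terms)

lemma opF'_simps:
  "g \<in> {D0, D11, D12} \<Longrightarrow> opF' t \<phi> (a, b, c, x, g) = (t ^ c - 1) * \<phi> (Suc a, b, c - 1, x, g) + t ^ c * (t ^ x - 1) * \<phi> (a, Suc b, c, x - 1, g)"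
  "opF' t \<phi> (a, b, Suc c, x, D21) = (t - 1) * \<phi> (Suc a, b, c, x, D11) + t * (t ^ c - 1) * \<phi> (Suc a, b, c, x, D21)
   + t * t ^ c * (t ^ x - 1) * \<phi> (a, Suc b, Suc c, x - 1, D21)"
  "opF' t \<phi> (a, b, Suc c, x, Dx) = (t - 1) * \<phi> (Suc a, b, c, x, D12) + t * (t ^ c - 1) * \<phi> (Suc a, b, c, x, Dx)
   + t * t ^ c * (t ^ x - 1) * \<phi> (a, Suc b, Suc c, x - 1, Dx)"
  "opF' t \<phi> (a, b, c, Suc x, D22) = (t ^ c - 1) * \<phi> (Suc a, b, c - 1, Suc x, D22) + (t - 1) * \<phi> (a, Suc b, c, x, D12)
   + (t - 1) * (t ^ c - 1) * \<phi> (a, Suc b, c, x, Dx) + t * t ^ c * (t ^ x - 1) * \<phi> (a, Suc b, c, x, D22)"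
  unfolding opF'_def by (simp_all only: op_prod distrib_left scale_terms)


text \<open>The two powers of t are the cardinalities of F and of the quotient of the space by F; at
  t = v^2 their difference becomes the commutator of e and f.\<close>

lemma opE'_opF':
  fixes t :: "'c::comm_ring_1"
  shows "valid (a, b, c, x, g) \<Longrightarrow> opE' t (opF' t \<phi>) (a, b, c, x, g)
    = opF' t (opE' t \<phi>) (a, b, c, x, g) + (t - 1) * (t ^ (a + b) - t ^ (c + x)) * \<phi> (a, b, c, x, g)"
  by (cases g; cases a; cases b; cases c; cases x) (simp_all add: opE'_simps opF'_simps power_add algebra_simps)

text \<open>Summing twice over the translates by F counts every translate as often as F has
  elements.\<close>

lemma opL_opL: "opL t (opL t \<phi>) (a, b, c, x, g) = t ^ (a + b) * opL t \<phi> (a, b, c, x, g)"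
  by (cases g) (simp_all add: power_add algebra_simps)

text \<open>Translation by F absorbs translation by a hyperplane H, which has t^(a+b-1) elements;
  the factor t on the left clears this exponent.\<close>

lemma opL_opE'_opL:
  fixes t :: "'c::comm_ring_1"
  shows "valid (a, b, c, x, g) \<Longrightarrow>
    t * opL t (opE' t (opL t \<phi>)) (a, b, c, x, g) = t ^ (a + b) * opL t (opE' t \<phi>) (a, b, c, x, g)"
  by (cases g; cases a; cases b) (simp_all add: opE'_simps opF'_simps power_add algebra_simps)

text \<open>Here the translations by the larger space H absorb those by F, each counted t^(a+b)
  times.\<close>

lemma opL_opF'_opL:
  fixes t :: "'c::comm_ring_1"
  shows "valid (a, b, c, x, g) \<Longrightarrow>
    opL t (opF' t (opL t \<phi>)) (a, b, c, x, g) = t ^ (a + b) * opF' t (opL t \<phi>) (a, b, c, x, g)"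
  by (cases g; cases c; cases x) (simp_all add: opE'_simps opF'_simps power_add algebra_simps)

text \<open>For a subspace K of codimension 2 in F there are t + 1 hyperplanes of F containing K.
  Together they cover F once and K another t times, which splits the sum over translates by the
  intermediate spaces into one by F and t times one by K.\<close>

lemma opE'_opL_opE':
  fixes t :: "'c::comm_ring_1"
  shows "valid (a, b, c, x, g) \<Longrightarrow> (1 + t) * opE' t (opL t (opE' t \<phi>)) (a, b, c, x, g)
    = t * opE' t (opE' t (opL t \<phi>)) (a, b, c, x, g) + opL t (opE' t (opE' t \<phi>)) (a, b, c, x, g)"
  by (cases g; cases a rule: nat3_cases; cases b rule: nat3_cases) (simp_all add: opE'_simps opF'_simps power_add algebra_simps)

text \<open>The same covering argument, with F in the role of the small space.\<close>

lemma opF'_opL_opF':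
  fixes t :: "'c::comm_ring_1"
  shows "valid (a, b, c, x, g) \<Longrightarrow> (1 + t) * opF' t (opL t (opF' t \<phi>)) (a, b, c, x, g)
    = t * opL t (opF' t (opF' t \<phi>)) (a, b, c, x, g) + opF' t (opF' t (opL t \<phi>)) (a, b, c, x, g)"
  by (cases g; cases c rule: nat3_cases; cases x rule: nat3_cases) (simp_all add: opE'_simps opF'_simps power_add algebra_simps)

section \<open>Generation by one-step operators\<close>

definition \<delta> :: "ix \<Rightarrow> ix \<Rightarrow> 'c::comm_ring_1" where "\<delta> y z = (if z = y then 1 else 0)"

text \<open>Used for two sets: with t the polynomial variable, the functions whose convolution with
  a fixed basis element is polynomial in q; with t = v^2, the functions in the image of the algebra.
  Functions matter only on \<open>Ix d\<close>, hence \<open>S_agree\<close>.\<close>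

locale generation =
  fixes t :: "'c::comm_ring_1" and d :: nat and S :: "(ix \<Rightarrow> 'c) set"
  assumes S_zero: "(\<lambda>_. 0) \<in> S"
    and S_add: "\<phi> \<in> S \<Longrightarrow> \<psi> \<in> S \<Longrightarrow> (\<lambda>z. \<phi> z + \<psi> z) \<in> S"
    and S_scale: "\<phi> \<in> S \<Longrightarrow> (\<lambda>z. k * \<phi> z) \<in> S"
    and S_E: "\<phi> \<in> S \<Longrightarrow> opE t \<phi> \<in> S"
    and S_F: "\<phi> \<in> S \<Longrightarrow> opF t \<phi> \<in> S"
    and S_L: "\<phi> \<in> S \<Longrightarrow> opL t \<phi> \<in> S"
    and S_agree: "\<phi> \<in> S \<Longrightarrow> (\<And>z. z \<in> Ix d \<Longrightarrow> \<psi> z = \<phi> z) \<Longrightarrow> \<psi> \<in> S"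
    and S_div_gn: "(\<lambda>z. gn t (Suc n) * \<phi> z) \<in> S \<Longrightarrow> \<phi> \<in> S"
    and S_div_power: "(\<lambda>z. t ^ n * \<phi> z) \<in> S \<Longrightarrow> \<phi> \<in> S"
    and S_unit: "r \<le> d \<Longrightarrow> \<delta> (r, 0, 0, d - r, D0) \<in> S"
begin

lemma S_comb1:
  assumes "\<phi>1 \<in> S" "\<And>a b c x g. valid (a, b, c, x, g) \<Longrightarrow> \<psi> (a, b, c, x, g) = k * \<phi>1 (a, b, c, x, g)"
  shows "\<psi> \<in> S"
proof (rule S_agree[OF S_scale[OF assms(1), of k]])
  fix z assume "z \<in> Ix d"
  then show "\<psi> z = k * \<phi>1 z" using assms(2) by (cases z) (simp add: Ix_iff)
qed

lemma S_comb2: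
  assumes "\<phi>1 \<in> S" "\<phi>2 \<in> S"
    "\<And>a b c x g. valid (a, b, c, x, g) \<Longrightarrow> \<psi> (a, b, c, x, g) = \<phi>1 (a, b, c, x, g) - k2 * \<phi>2 (a, b, c, x, g)"
  shows "\<psi> \<in> S"
proof (rule S_agree[OF S_add[OF assms(1) S_scale[OF assms(2), of "- k2"]]])
  fix z assume "z \<in> Ix d"
  then show "\<psi> z = \<phi>1 z + - k2 * \<phi>2 z" using assms(3) by (cases z) (simp add: Ix_iff)
qed

lemma S_comb3:
  assumes "\<phi>1 \<in> S" "\<phi>2 \<in> S" "\<phi>3 \<in> S"
    "\<And>a b c x g. valid (a, b, c, x, g) \<Longrightarrow>
      \<psi> (a, b, c, x, g) = \<phi>1 (a, b, c, x, g) - k2 * \<phi>2 (a, b, c, x, g) - k3 * \<phi>3 (a, b, c, x, g)"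
  shows "\<psi> \<in> S"
proof -
  have "(\<lambda>z. \<phi>1 z - k2 * \<phi>2 z) \<in> S" by (rule S_comb2[OF assms(1,2)]) simp
  then show ?thesis by (rule S_comb2[OF _ assms(3)]) (rule assms(4))
qed

lemma S_outside: "y \<notin> Ix d \<Longrightarrow> \<delta> y \<in> S"
  by (rule S_agree[OF S_zero]) (auto simp: \<delta>_def)

text \<open>Each of the following inductions solves a one-step multiplication formula for its leading
  term, whose coefficient is a quantum integer or a power of \<open>t\<close>.\<close>

lemma S_induct:
  assumes step: "\<And>b a c x. (\<And>a' b' c' x'. b' + c' < Suc b + c \<Longrightarrow> \<delta> (a', b', c', x', g) \<in> S) \<Longrightarrow>
      \<delta> (a, Suc b, c, x, g) \<in> S"
    and base: "\<And>a c x. (a, 0, c, x, g) \<in> Ix d \<Longrightarrow>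
      (\<And>a' b' c' x'. b' + c' < c \<Longrightarrow> \<delta> (a', b', c', x', g) \<in> S) \<Longrightarrow> \<delta> (a, 0, c, x, g) \<in> S"
  shows "\<delta> (a, b, c, x, g) \<in> S"
proof (induction "b + c" arbitrary: a b c x rule: less_induct)
  case less
  show ?case
  proof (cases b)
    case 0
    show ?thesis
    proof (cases "(a, 0, c, x, g) \<in> Ix d")
      case True
      then have "\<delta> (a, 0, c, x, g) \<in> S" using less 0 by (intro base) simp_all
      then show ?thesis by (simp add: 0)
    qed (simp add: 0 S_outside)
  next
    case (Suc b')
    have "\<delta> (a, Suc b', c, x, g) \<in> S" using less Suc by (intro step) simp
    then show ?thesis by (simp add: Suc)
  qed
qed

text \<open>For b > 0 the operator E, applied at \<open>(a, b, c, Suc x)\<close>, produces the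
  wanted function with coefficient \<open>gn t (Suc b)\<close> and one function with smaller b + c.
  For b = 0 the operator F raises c in the same way, starting from the diagonal.\<close>

lemma S_D0: "\<delta> (a, b, c, x, D0) \<in> S"
proof (rule S_induct)
  fix a b c x :: nat
  assume IH: "\<And>a' b' c' x'. b' + c' < Suc b + c \<Longrightarrow> \<delta> (a', b', c', x', D0) \<in> S"
  have 1: "opE t (\<delta> (a, b, c, Suc x, D0)) \<in> S" and 2: "\<delta> (Suc a, b, c - 1, Suc x, D0) \<in> S"
    by (auto intro!: S_E IH)
  show "\<delta> (a, Suc b, c, x, D0) \<in> S"
  proof (rule S_div_gn[of b], rule S_comb2[OF 1 2, where ?k2.0 = "if c = 0 then 0 else t ^ b * gn t (Suc a)"])
    fix a' b' c' x' g' assume "valid (a', b', c', x', g')"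
    then show "gn t (Suc b) * \<delta> (a, Suc b, c, x, D0) (a', b', c', x', g') = opE t (\<delta> (a, b, c, Suc x, D0)) (a', b', c', x', g')
      - (if c = 0 then 0 else t ^ b * gn t (Suc a)) * \<delta> (Suc a, b, c - 1, Suc x, D0) (a', b', c', x', g')"
      by (cases g'; cases a'; cases b'; cases c) (auto simp: \<delta>_def op_prod simp del: opE.simps)
  qed
next
  fix a c x :: nat
  assume I: "(a, 0, c, x, D0) \<in> Ix d" and IH: "\<And>a' b' c' x'. b' + c' < c \<Longrightarrow> \<delta> (a', b', c', x', D0) \<in> S"
  show "\<delta> (a, 0, c, x, D0) \<in> S"
  proof (cases c)
    case 0
    then have "x = d - a" "a \<le> d" using I by (auto simp: Ix_def)
    then show ?thesis using S_unit[of a] 0 by simp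
  next
    case (Suc c')
    have "opF t (\<delta> (Suc a, 0, c', x, D0)) \<in> S" using Suc by (intro S_F IH) simp
    then show ?thesis
      unfolding Suc
    proof (rule S_div_gn[of c', OF S_comb1])
      fix a2 b2 c2 x2 g2 assume "valid (a2, b2, c2, x2, g2)"
      then show "gn t (Suc c') * \<delta> (a, 0, Suc c', x, D0) (a2, b2, c2, x2, g2) = 1 * opF t (\<delta> (Suc a, 0, c', x, D0)) (a2, b2, c2, x2, g2)"
        by (cases g2; cases c2; cases x2) (auto simp: \<delta>_def op_prod simp del: opF.simps)
    qed
  qed
qed

text \<open>For b = 0 the operator L adds to an undecorated function exactly the one with decoration
  \<open>D11\<close>, since \<open>D12\<close> requires b > 0.\<close>

lemma S_D11: "\<delta> (a, b, c, x, D11) \<in> S"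
proof (rule S_induct)
  fix a b c x :: nat
  assume IH: "\<And>a' b' c' x'. b' + c' < Suc b + c \<Longrightarrow> \<delta> (a', b', c', x', D11) \<in> S"
  have 1: "opE t (\<delta> (a, b, c, Suc x, D11)) \<in> S" and 2: "\<delta> (Suc a, b, c - 1, Suc x, D11) \<in> S"
    by (auto intro!: S_E IH)
  show "\<delta> (a, Suc b, c, x, D11) \<in> S"
  proof (rule S_div_gn[of b], rule S_comb2[OF 1 2, where ?k2.0 = "if c = 0 then 0 else t ^ b * gn t a"])
    fix a' b' c' x' g' assume "valid (a', b', c', x', g')"
    then show "gn t (Suc b) * \<delta> (a, Suc b, c, x, D11) (a', b', c', x', g') = opE t (\<delta> (a, b, c, Suc x, D11)) (a', b', c', x', g')
      - (if c = 0 then 0 else t ^ b * gn t a) * \<delta> (Suc a, b, c - 1, Suc x, D11) (a', b', c', x', g')"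
      by (cases g'; cases a'; cases b'; cases c) (auto simp: \<delta>_def op_prod simp del: opE.simps)
  qed
next
  fix a c x :: nat
  show "\<delta> (a, 0, c, x, D11) \<in> S"
  proof (rule S_comb2[OF S_L[OF S_D0[of a 0 c x]] S_D0[of a 0 c x], where ?k2.0 = 1])
    fix a' b' c' x' g' assume "valid (a', b', c', x', g')"
    then show "\<delta> (a, 0, c, x, D11) (a', b', c', x', g') = opL t (\<delta> (a, 0, c, x, D0)) (a', b', c', x', g') - 1 * \<delta> (a, 0, c, x, D0) (a', b', c', x', g')"
      by (cases g') (auto simp: \<delta>_def)
  qed
qed

lemma S_D12: "\<delta> (a, b, c, x, D12) \<in> S"
proof (rule S_comb3[OF S_L[OF S_D0[of a b c x]] S_D0[of a b c x] S_D11[of a b c x], where ?k2.0 = 1 and ?k3.0 = 1])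
  fix a' b' c' x' g' assume "valid (a', b', c', x', g')"
  then show "\<delta> (a, b, c, x, D12) (a', b', c', x', g') = opL t (\<delta> (a, b, c, x, D0)) (a', b', c', x', g')
      - 1 * \<delta> (a, b, c, x, D0) (a', b', c', x', g') - 1 * \<delta> (a, b, c, x, D11) (a', b', c', x', g')"
    by (cases g') (auto simp: \<delta>_def)
qed

text \<open>For b = 0 the operator F moves a \<open>D11\<close> vector out of the first row: it
  yields the wanted function with coefficient 1 and a multiple of a \<open>D11\<close>
  function.\<close>

lemma S_D21: "\<delta> (a, b, c, x, D21) \<in> S"
proof (rule S_induct)
  fix a b c x :: nat
  assume IH: "\<And>a' b' c' x'. b' + c' < Suc b + c \<Longrightarrow> \<delta> (a', b', c', x', D21) \<in> S"
  have 1: "opE t (\<delta> (a, b, c, Suc x, D21)) \<in> S" and 2: "\<delta> (Suc a, b, c - 1, Suc x, D21) \<in> S"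
    by (auto intro!: S_E IH)
  show "\<delta> (a, Suc b, c, x, D21) \<in> S"
  proof (rule S_div_gn[of b], rule S_comb3[OF 1 2 S_D11[of "Suc a" b "c - 1" "Suc x"],
        where ?k2.0 = "if c = 0 then 0 else t ^ b * gn t (Suc a)" and ?k3.0 = "if c = 0 then 0 else t ^ b * t ^ a"])
    fix a' b' c' x' g' assume "valid (a', b', c', x', g')"
    then show "gn t (Suc b) * \<delta> (a, Suc b, c, x, D21) (a', b', c', x', g') = opE t (\<delta> (a, b, c, Suc x, D21)) (a', b', c', x', g')
      - (if c = 0 then 0 else t ^ b * gn t (Suc a)) * \<delta> (Suc a, b, c - 1, Suc x, D21) (a', b', c', x', g')
      - (if c = 0 then 0 else t ^ b * t ^ a) * \<delta> (Suc a, b, c - 1, Suc x, D11) (a', b', c', x', g')"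
      by (cases g'; cases a'; cases b'; cases c) (auto simp: \<delta>_def op_prod simp del: opE.simps)
  qed
next
  fix a c x :: nat
  assume I: "(a, 0, c, x, D21) \<in> Ix d"
  then obtain c' where c: "c = Suc c'" by (cases c) (auto simp: Ix_def)
  show "\<delta> (a, 0, c, x, D21) \<in> S"
    unfolding c
  proof (rule S_comb2[OF S_F[OF S_D11[of "Suc a" 0 c' x]] S_D11[of a 0 "Suc c'" x], where ?k2.0 = "gn t (Suc c')"])
    fix a2 b2 c2 x2 g2 assume "valid (a2, b2, c2, x2, g2)"
    then show "\<delta> (a, 0, Suc c', x, D21) (a2, b2, c2, x2, g2) = opF t (\<delta> (Suc a, 0, c', x, D11)) (a2, b2, c2, x2, g2)
        - gn t (Suc c') * \<delta> (a, 0, Suc c', x, D11) (a2, b2, c2, x2, g2)"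
      by (cases g2; cases c2; cases x2) (auto simp: \<delta>_def op_prod simp del: opF.simps)
  qed
qed

text \<open>L sends the \<open>D21\<close> function to t^a times the sum of the \<open>D21\<close>
  and \<open>Dx\<close> functions; this is where division by a power of t enters.\<close>

lemma S_Dx: "\<delta> (a, b, c, x, Dx) \<in> S"
proof (rule S_div_power[of a], rule S_comb2[OF S_L[OF S_D21[of a b c x]] S_D21[of a b c x], where ?k2.0 = "t ^ a"])
  fix a' b' c' x' g' assume "valid (a', b', c', x', g')"
  then show "t ^ a * \<delta> (a, b, c, x, Dx) (a', b', c', x', g') = opL t (\<delta> (a, b, c, x, D21)) (a', b', c', x', g')
      - t ^ a * \<delta> (a, b, c, x, D21) (a', b', c', x', g')"
    by (cases g') (auto simp: \<delta>_def)
qed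

text \<open>F sends the \<open>D12\<close> function at \<open>(a, Suc b, c, x')\<close> to the
  wanted function, with coefficient 1, plus known \<open>D12\<close> and \<open>Dx\<close>
  functions. Those with first entry a - 1 are absent for a = 0.\<close>

lemma S_D22: "\<delta> (a, b, c, x, D22) \<in> S"
proof (cases x)
  case 0
  then show ?thesis by (intro S_outside) (simp add: Ix_def)
next
  case (Suc x')
  let ?f = "\<lambda>z. opF t (\<delta> (a, Suc b, c, x', D12)) z - (t ^ c * gn t (Suc x')) * \<delta> (a, b, c, Suc x', D12) z"
  have 1: "?f \<in> S"
    by (rule S_comb2[OF S_F[OF S_D12[of a "Suc b" c x']] S_D12[of a b c "Suc x'"]]) simp
  show ?thesis
  proof (rule S_comb3[OF 1 S_D12[of "a - 1" "Suc b" "Suc c" x'] S_Dx[of "a - 1" "Suc b" "Suc c" x'],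
      where ?k2.0 = "if a = 0 then 0 else gn t (Suc c)" and ?k3.0 = "if a = 0 then 0 else 1"])
    fix a2 b2 c2 x2 g2 assume "valid (a2, b2, c2, x2, g2)"
    then show "\<delta> (a, b, c, x, D22) (a2, b2, c2, x2, g2) = ?f (a2, b2, c2, x2, g2)
       - (if a = 0 then 0 else gn t (Suc c)) * \<delta> (a - 1, Suc b, Suc c, x', D12) (a2, b2, c2, x2, g2)
       - (if a = 0 then 0 else 1) * \<delta> (a - 1, Suc b, Suc c, x', Dx) (a2, b2, c2, x2, g2)"
      unfolding Suc by (cases g2; cases c2; cases x2; cases a) (auto simp: \<delta>_def op_prod simp del: opF.simps)
  qed
qed

lemma S_delta: "\<delta> z \<in> S"
proof -
  obtain a b c x g where "z = (a, b, c, x, g)" by (metis prod.exhaust)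
  then show ?thesis by (cases g) (simp_all add: S_D0 S_D11 S_D12 S_D21 S_Dx S_D22)
qed

end

section \<open>Modules generated by extremal weight vectors\<close>

lemma vv_power: "vv ^ k = Fract (Polynomial.monom 1 k) 1"
proof (induction k)
  case 0 then show ?case by (simp add: One_fract_def)
next
  case (Suc k)
  have "[:0, 1:] * Polynomial.monom 1 k = (Polynomial.monom 1 (Suc k) :: complex poly)" by (simp add: monom_Suc)
  then show ?case using Suc by (simp add: vv_def)
qed

lemma vv_nonzero [simp]: "vv \<noteq> 0"
  unfolding vv_def by (simp add: Zero_fract_def eq_fract)

lemma vv_power_eq_1: "vv ^ k = 1 \<longleftrightarrow> k = 0"
proof
  assume "vv ^ k = 1"
  then have "Polynomial.monom 1 k = (1 :: complex poly)" by (simp add: vv_power One_fract_def eq_fract)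
  then have "Polynomial.degree (Polynomial.monom (1 :: complex) k) = 0" by simp
  then show "k = 0" by (simp add: degree_monom_eq)
qed simp

lemma vv_powi_eq_1: "vv powi i = 1 \<longleftrightarrow> i = 0"
proof
  assume i: "vv powi i = 1"
  show "i = 0"
  proof (cases "i \<ge> 0")
    case True
    then show ?thesis using i vv_power_eq_1[of "nat i"] by (simp add: power_int_def)
  next
    case False
    then show ?thesis using i vv_power_eq_1[of "nat (- i)"] by (simp add: power_int_def power_inverse)
  qed
qed simp

lemma vv_powi_inject: "vv powi i = vv powi j \<longleftrightarrow> i = j"
proof
  assume "vv powi i = vv powi j"
  then have "vv powi (i - j) = 1" by (simp add: power_int_diff)
  then show "i = j" by (simp add: vv_powi_eq_1)
qed simp

lemma vv_diff_inverse_nonzero: "vv - inverse vv \<noteq> 0"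
proof
  assume "vv - inverse vv = 0"
  then have "vv powi 1 = vv powi (- 1)" by (simp add: power_int_minus)
  then show False unfolding vv_powi_inject by simp
qed

lemma qint_eq_0: "qint m = 0 \<longleftrightarrow> m = 0"
  unfolding qint_def using vv_diff_inverse_nonzero vv_powi_inject[of m "- m"] by auto

lemma qint_0 [simp]: "qint 0 = 0"
  by (simp add: qint_eq_0)

lemma qint_1 [simp]: "qint 1 = 1"
  unfolding qint_def using vv_diff_inverse_nonzero by (simp add: power_int_minus)

lemma qint_2: "qint 2 = vv + inverse vv"
proof -
  have "vv powi 2 - vv powi (- 2) = (vv + inverse vv) * (vv - inverse vv)"
    by (simp add: power_int_minus power2_eq_square algebra_simps)
  then show ?thesis unfolding qint_def using vv_diff_inverse_nonzero by simp
qed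

lemma qint_identity: "qint (a + 1) * qint b = qint (a + b) + qint a * qint (b - 1)"
proof -
  define w where "w = vv - inverse vv"
  define A B where "A = vv powi a" and "B = vv powi b"
  have nz: "w \<noteq> 0" "A \<noteq> 0" "B \<noteq> 0" unfolding w_def A_def B_def using vv_diff_inverse_nonzero by simp_all
  have q: "qint (a + 1) = (A * vv - inverse (A * vv)) / w" "qint b = (B - inverse B) / w"
    "qint (a + b) = (A * B - inverse (A * B)) * w / (w * w)" "qint a = (A - inverse A) / w" "qint (b - 1) = (B / vv - vv / B) / w"
    unfolding qint_def w_def[symmetric] using nz
    by (simp_all add: A_def B_def power_int_add power_int_diff power_int_minus field_simps)
  have "(A * vv - inverse (A * vv)) * (B - inverse B) = (A * B - inverse (A * B)) * w + (A - inverse A) * (B / vv - vv / B)"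
    unfolding w_def using nz by (simp add: field_simps)
  then show ?thesis unfolding q by (simp add: add_divide_distrib)
qed

lemma qint_identity2: "qint (a + 1) * qint b = qint (b - a) + qint a * qint (b + 1)"
proof -
  define w where "w = vv - inverse vv"
  define A B where "A = vv powi a" and "B = vv powi b"
  have nz: "w \<noteq> 0" "A \<noteq> 0" "B \<noteq> 0" unfolding w_def A_def B_def using vv_diff_inverse_nonzero by simp_all
  have q: "qint (a + 1) = (A * vv - inverse (A * vv)) / w" "qint b = (B - inverse B) / w"
    "qint (b - a) = (B / A - A / B) * w / (w * w)" "qint a = (A - inverse A) / w" "qint (b + 1) = (B * vv - inverse (B * vv)) / w"
    unfolding qint_def w_def[symmetric] using nz
    by (simp_all add: A_def B_def power_int_add power_int_diff power_int_minus field_simps)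
  have "(A * vv - inverse (A * vv)) * (B - inverse B) = (B / A - A / B) * w + (A - inverse A) * (B * vv - inverse (B * vv))"
    unfolding w_def using nz by (simp add: field_simps)
  then show ?thesis unfolding q by (simp add: add_divide_distrib)
qed

lemma qint_minus: "qint (- i) = - qint i"
  unfolding qint_def by (simp add: minus_divide_left)

text \<open>Here \<open>wt j x\<close> stands for k x = v^(2j-n) x, so that j runs from 0 at the
  lowest to n at the highest weight. Encoding k by a predicate keeps only the three operators that
  move vectors nontrivially.\<close>

locale mirabolic_module = vector_space sc for sc :: "ratfun \<Rightarrow> 'm::ab_group_add \<Rightarrow> 'm" +
  fixes e f l :: "'m \<Rightarrow> 'm" and wt :: "int \<Rightarrow> 'm \<Rightarrow> bool" and n :: nat
  assumes e_add: "e (x + y) = e x + e y" and e_sc: "e (sc c x) = sc c (e x)"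
    and f_add: "f (x + y) = f x + f y" and f_sc: "f (sc c x) = sc c (f x)"
    and l_add: "l (x + y) = l x + l y" and l_sc: "l (sc c x) = sc c (l x)"
    and wt_e: "wt j x \<Longrightarrow> wt (j + 1) (e x)"
    and wt_f: "wt j x \<Longrightarrow> wt (j - 1) (f x)"
    and wt_l: "wt j x \<Longrightarrow> wt j (l x)"
    and wt_out: "wt j x \<Longrightarrow> j < 0 \<or> int n < j \<Longrightarrow> x = 0"
    and comm: "wt j x \<Longrightarrow> e (f x) = f (e x) + sc (qint (2 * j - int n)) x"
    and ll: "l (l x) = l x"
    and lel: "l (e (l x)) = l (e x)"
    and lfl: "l (f (l x)) = f (l x)"
    and serre_e: "sc (qint 2) (e (l (e x))) = sc (inverse vv) (e (e (l x))) + sc vv (l (e (e x)))"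
    and serre_f: "sc (qint 2) (f (l (f x))) = sc (inverse vv) (l (f (f x))) + sc vv (f (f (l x)))"
begin

abbreviation E where "E k \<equiv> (e ^^ k)"
abbreviation F where "F k \<equiv> (f ^^ k)"

lemma e_zero [simp]: "e 0 = 0" and f_zero [simp]: "f 0 = 0" and l_zero [simp]: "l 0 = 0"
  using e_add[of 0 0] f_add[of 0 0] l_add[of 0 0] by simp_all

lemma F_add: "F k (x + y) = F k x + F k y" and F_sc: "F k (sc c x) = sc c (F k x)"
  and E_add: "E k (x + y) = E k x + E k y" and E_sc: "E k (sc c x) = sc c (E k x)"
  by (induction k) (simp_all add: f_add f_sc e_add e_sc)

lemma F_zero [simp]: "F k 0 = 0" and E_zero [simp]: "E k 0 = 0"
  by (induction k) simp_all

lemma wt_F: "wt j x \<Longrightarrow> wt (j - int k) (F k x)"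
proof (induction k)
  case (Suc k) then show ?case using wt_f[of "j - int k" "F k x"] by (simp add: algebra_simps)
qed simp

lemma wt_E: "wt j x \<Longrightarrow> wt (j + int k) (E k x)"
proof (induction k)
  case (Suc k) then show ?case using wt_e[of "j + int k" "E k x"] by (simp add: algebra_simps)
qed simp

text \<open>The standard commutation of e past a power of f; the weight contributions of the k + 1
  commutators are summed by \<open>qint_identity2\<close>.\<close>

lemma e_F: assumes "wt j x"
  shows "e (F (Suc k) x) = F (Suc k) (e x) + sc (qint (int k + 1) * qint (2 * j - int n - int k)) (F k x)"
proof (induction k)
  case 0 then show ?case using comm[OF assms] by simp
next
  case (Suc k)
  let ?y = "F (Suc k) x"
  have "e (F (Suc (Suc k)) x) = f (e ?y) + sc (qint (2 * (j - int (Suc k)) - int n)) ?y"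
    using comm[OF wt_F[OF assms, of "Suc k"]] by simp
  also have "f (e ?y) = F (Suc (Suc k)) (e x) + sc (qint (int k + 1) * qint (2 * j - int n - int k)) ?y"
    unfolding Suc.IH by (simp add: f_add f_sc)
  finally have 1: "e (F (Suc (Suc k)) x) = F (Suc (Suc k)) (e x)
    + sc (qint (int k + 1) * qint (2 * j - int n - int k) + qint (2 * (j - int (Suc k)) - int n)) ?y"
    by (simp add: scale_left_distrib add.assoc)
  have "qint (int (Suc k) + 1) * qint (2 * j - int n - int (Suc k))
      = qint (int k + 1) * qint (2 * j - int n - int k) + qint (2 * (j - int (Suc k)) - int n)"
    using qint_identity2[of "int k + 1" "2 * j - int n - int (Suc k)"] by (simp add: algebra_simps)
  then show ?case using 1 by simp
qed

lemma l_F: "l m = m \<Longrightarrow> l (F k m) = F k m"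
proof (induction k)
  case (Suc k) then show ?case using lfl[of "F k m"] by simp
qed simp

text \<open>The relation l f l = f l lets \<open>l\<close> fix the whole chain of vectors
  \<open>F k m\<close>, so the quantum sl2 module generated by \<open>m\<close> is already
  stable.\<close>

lemma highest_fixed_stable:
  assumes m: "wt (int n) m" "l m = m"
  defines "X \<equiv> (\<lambda>k. F k m) ` {..n}"
  assumes x: "x \<in> X"
  shows "e x \<in> span X" "f x \<in> span X" "l x \<in> span X" "\<exists>j. wt j x"
proof -
  obtain k where k: "k \<le> n" "x = F k m" using x unfolding X_def by auto
  have em: "e m = 0" using wt_out[OF wt_e[OF m(1)]] by simp
  have FX: "F i m \<in> span X" for i
  proof (cases "i \<le> n")
    case True then show ?thesis unfolding X_def by (intro span_base) simp
  next
    case False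
    then have "F i m = 0" using wt_out[OF wt_F[OF m(1), of i]] by simp
    then show ?thesis by (simp add: span_zero)
  qed
  show "e x \<in> span X"
  proof (cases k)
    case 0 then show ?thesis using k em by (simp add: span_zero)
  next
    case (Suc i)
    have "e x = sc (qint (int i + 1) * qint (2 * int n - int n - int i)) (F i m)"
      unfolding k Suc e_F[OF m(1)] em by simp
    then show ?thesis using FX by (simp add: span_scale)
  qed
  show "f x \<in> span X" using FX[of "Suc k"] k by simp
  show "l x \<in> span X" using l_F[OF m(2)] FX k by simp
  show "\<exists>j. wt j x" using wt_F[OF m(1)] k by blast
qed

text \<open>The Serre relation at \<open>F k m\<close> contains f applied to the previous case,
  which gives a recursion. Its coefficient is [k+1][2] - [k] = [k+2], by
  \<open>qint_identity\<close>.\<close>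

lemma fl_F:
  assumes m: "l m = 0"
  shows "sc (qint (int k + 1)) (f (l (F k m))) = sc (inverse vv * qint (int k)) (l (F (Suc k) m))"
proof (induction k)
  case 0 then show ?case using m by simp
next
  case (Suc k)
  let ?Z = "f (l (F (Suc k) m))"
  have nz: "qint (int k + 1) \<noteq> 0" by (simp add: qint_eq_0)
  have "sc (qint (int k + 1)) (sc (qint 2) ?Z)
    = sc (qint (int k + 1) * inverse vv) (l (F (Suc (Suc k)) m)) + sc vv (f (sc (qint (int k + 1)) (f (l (F k m)))))"
    using serre_f[of "F k m"] by (simp add: scale_right_distrib f_sc mult_ac)
  also have "f (sc (qint (int k + 1)) (f (l (F k m)))) = sc (inverse vv * qint (int k)) ?Z"
    unfolding Suc.IH by (simp add: f_sc)
  finally have "sc (qint (int k + 1) * qint 2 - qint (int k)) ?Z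
    = sc (qint (int k + 1) * inverse vv) (l (F (Suc (Suc k)) m))"
    by (simp add: scale_left_diff_distrib algebra_simps)
  moreover have "qint (int k + 1) * qint 2 - qint (int k) = qint (int (Suc k) + 1)"
    using qint_identity[of 1 "int k + 1"] by (simp add: algebra_simps)
  ultimately show ?case by (simp add: mult_ac algebra_simps)
qed

text \<open>Thus \<open>l\<close> maps the chain below \<open>m\<close> into the chain below
  \<open>l (f m)\<close>; two chains suffice to describe the module.\<close>

lemma l_F_killed:
  assumes m: "l m = 0"
  shows "l (F (Suc k) m) = sc (vv ^ k * qint (int k + 1)) (F k (l (f m)))"
proof (induction k)
  case (Suc k)
  have nz: "qint (int (Suc k)) \<noteq> 0" by (simp add: qint_eq_0)
  have "sc (qint (int (Suc k) + 1)) (f (l (F (Suc k) m))) = sc (inverse vv * qint (int (Suc k))) (l (F (Suc (Suc k)) m))"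
    by (rule fl_F[OF m])
  then have "sc (vv * inverse (qint (int (Suc k)))) (sc (qint (int (Suc k) + 1)) (f (l (F (Suc k) m)))) = l (F (Suc (Suc k)) m)"
    using nz by (simp add: field_simps)
  then have "l (F (Suc (Suc k)) m)
    = sc (vv * inverse (qint (int (Suc k))) * qint (int (Suc k) + 1) * (vv ^ k * qint (int k + 1))) (F (Suc k) (l (f m)))"
    unfolding Suc.IH by (simp add: f_sc mult.assoc)
  moreover have "vv * inverse (qint (int (Suc k))) * qint (int (Suc k) + 1) * (vv ^ k * qint (int k + 1)) = vv ^ Suc k * qint (int (Suc k) + 1)"
    using nz by (simp add: add.commute)
  ultimately show ?case by (simp only:)
qed simp

lemma E_F_highest:
  assumes m: "wt (int n) m"
  shows "E k (F k m) = sc (\<Prod>i<k. qint (int i + 1) * qint (int n - int i)) m"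
proof (induction k)
  case (Suc k)
  have em: "e m = 0" using wt_out[OF wt_e[OF m]] by simp
  have "E (Suc k) (F (Suc k) m) = E k (e (F (Suc k) m))" by (simp only: funpow_Suc_right o_apply)
  also have "\<dots> = sc (qint (int k + 1) * qint (int n - int k)) (E k (F k m))"
    unfolding e_F[OF m] em by (simp add: E_sc)
  finally show ?case unfolding Suc.IH by (simp add: mult_ac)
qed simp

text \<open>A vector \<open>y\<close> just below the top need not be killed by \<open>e\<close>. In
  each step \<open>e_F\<close> adds the contribution of the highest weight vector
  \<open>e y\<close>, and both parts combine by \<open>qint_identity\<close>.\<close>

lemma E_F_subhighest:
  assumes y: "wt (int n - 1) y"
  shows "E (Suc k) (F k y) = sc ((\<Prod>i<k. qint (int i + 1) * qint (int n - 1 - int i)) * qint (int k + 1)) (e y)"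
proof (induction k)
  case (Suc k)
  have wz: "wt (int n) (e y)" using wt_e[OF y] by simp
  have "E (Suc (Suc k)) (F (Suc k) y) = E (Suc k) (e (F (Suc k) y))" by (simp only: funpow_Suc_right o_apply)
  also have "\<dots> = E (Suc k) (F (Suc k) (e y)) + sc (qint (int k + 1) * qint (int n - 2 - int k)) (E (Suc k) (F k y))"
    unfolding e_F[OF y] by (simp only: E_add E_sc) (simp add: algebra_simps)
  also have "\<dots> = sc ((\<Prod>i<Suc k. qint (int i + 1) * qint (int n - int i))
     + qint (int k + 1) * qint (int n - 2 - int k) * ((\<Prod>i<k. qint (int i + 1) * qint (int n - 1 - int i)) * qint (int k + 1))) (e y)"
    unfolding Suc.IH E_F_highest[OF wz] by (simp only: scale_scale scale_left_distrib)
  \<comment> \<open>The product for the top weight n is rewritten with the factors belonging to n -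
    1, so that a common factor can be taken out of the sum.\<close>
  also have "(\<Prod>i<Suc k. qint (int i + 1) * qint (int n - int i))
     = (\<Prod>i<k. qint (int i + 1) * qint (int n - 1 - int i)) * qint (int k + 1) * qint (int n)"
  proof (induction k)
    case (Suc k)
    have "(\<Prod>i<Suc (Suc k). qint (int i + 1) * qint (int n - int i))
      = (\<Prod>i<Suc k. qint (int i + 1) * qint (int n - int i)) * (qint (int k + 2) * qint (int n - 1 - int k))"
      by (simp add: algebra_simps)
    then show ?case unfolding Suc by (simp add: algebra_simps)
  qed simp
  also have "(\<Prod>i<k. qint (int i + 1) * qint (int n - 1 - int i)) * qint (int k + 1) * qint (int n)
     + qint (int k + 1) * qint (int n - 2 - int k) * ((\<Prod>i<k. qint (int i + 1) * qint (int n - 1 - int i)) * qint (int k + 1))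
     = (\<Prod>i<k. qint (int i + 1) * qint (int n - 1 - int i)) * qint (int k + 1) * (qint (int n) + qint (int k + 1) * qint (int n - 2 - int k))"
    by (simp add: algebra_simps)
  also have "qint (int n) + qint (int k + 1) * qint (int n - 2 - int k) = qint (int k + 2) * qint (int n - 1 - int k)"
    using qint_identity[of "int k + 1" "int n - 1 - int k"] by (simp add: algebra_simps)
  finally show ?case by (simp add: algebra_simps)
qed simp

text \<open>The relation \<open>l (F n m) = F n m\<close> holds in the lowest weight space; applying \<open>E n\<close> to it
  brings it back to the highest weight space, where it reads \<open>e (l (f m)) = c m\<close>.\<close>

lemma highest_killed_proportional:
  assumes n: "n > 0" and m: "wt (int n) m" "l m = 0" and low: "\<And>x. wt 0 x \<Longrightarrow> l x = x"
  shows "\<exists>c. e (l (f m)) = sc c m"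
proof -
  let ?y = "l (f m)"
  obtain k where k: "n = Suc k" using n by (cases n) auto
  have y: "wt (int n - 1) ?y" using wt_l[OF wt_f[OF m(1)]] .
  have "wt 0 (F n m)" using wt_F[OF m(1), of n] by simp
  then have "F n m = sc (vv ^ k * qint (int k + 1)) (F k ?y)"
    using low l_F_killed[OF m(2), of k] k by simp
  then have "E n (F n m) = sc (vv ^ k * qint (int k + 1)) (E (Suc k) (F k ?y))"
    using k by (simp only: E_sc)
  then have eq: "sc (\<Prod>i<n. qint (int i + 1) * qint (int n - int i)) m
    = sc (vv ^ k * qint (int k + 1) * ((\<Prod>i<k. qint (int i + 1) * qint (int n - 1 - int i)) * qint (int k + 1))) (e ?y)"
    unfolding E_F_highest[OF m(1)] E_F_subhighest[OF y] by simp
  define K where "K = vv ^ k * qint (int k + 1) * ((\<Prod>i<k. qint (int i + 1) * qint (int n - 1 - int i)) * qint (int k + 1))"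
  have K: "K \<noteq> 0" unfolding K_def k by (auto simp: qint_eq_0)
  have "e ?y = sc (inverse K) (sc K (e ?y))" using K by simp
  also have "\<dots> = sc (inverse K * (\<Prod>i<n. qint (int i + 1) * qint (int n - int i))) m"
    unfolding K_def eq[symmetric] by simp
  finally show ?thesis by blast
qed

text \<open>The first chain has n + 1 members and the second n - 1: its next vector
  \<open>F (n - 1) (l (f m))\<close> is proportional to \<open>F n m\<close>, because
  \<open>l\<close> is the identity on the lowest weight space. The span is closed under
  \<open>e\<close> because \<open>e (l (f m))\<close> is a multiple of \<open>m\<close>.\<close>

lemma highest_killed_stable:
  assumes n: "n > 0" and m: "wt (int n) m" "l m = 0" and low: "\<And>x. wt 0 x \<Longrightarrow> l x = x"
  defines "X \<equiv> (\<lambda>k. F k m) ` {..n} \<union> (\<lambda>k. F k (l (f m))) ` {..<n - 1}"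
  assumes x: "x \<in> X"
  shows "e x \<in> span X" "f x \<in> span X" "l x \<in> span X" "\<exists>j. wt j x"
proof -
  let ?y = "l (f m)"
  have y: "wt (int n - 1) ?y" using wt_l[OF wt_f[OF m(1)]] .
  have em: "e m = 0" using wt_out[OF wt_e[OF m(1)]] by simp
  obtain c where c: "e ?y = sc c m" using highest_killed_proportional[OF n m low] by blast
  have g: "vv ^ k * qint (int k + 1) \<noteq> 0" for k by (auto simp: qint_eq_0)
  have FX: "F i m \<in> span X" for i
  proof (cases "i \<le> n")
    case True then show ?thesis unfolding X_def by (intro span_base) simp
  next
    case False
    then have "F i m = 0" using wt_out[OF wt_F[OF m(1), of i]] by simp
    then show ?thesis by (simp add: span_zero)
  qed
  have Fy: "F i ?y = sc (inverse (vv ^ i * qint (int i + 1))) (l (F (Suc i) m))" for i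
    unfolding l_F_killed[OF m(2)] by (simp only: scale_scale left_inverse[OF g] scale_one)
  have FY: "F i ?y \<in> span X" for i
  proof -
    consider "i < n - 1" | "i = n - 1" | "i \<ge> n" using n by linarith
    then show ?thesis
    proof cases
      case 1 then show ?thesis unfolding X_def by (intro span_base) simp
    next
      case 2
      have "wt 0 (F n m)" using wt_F[OF m(1), of n] by simp
      then have "l (F (Suc i) m) = F n m" using low 2 n by simp
      then show ?thesis unfolding Fy using FX by (simp add: span_scale)
    next
      case 3
      then have "F i ?y = 0" using wt_out[OF wt_F[OF y, of i]] by simp
      then show ?thesis by (simp add: span_zero)
    qed
  qed
  consider k where "x = F k m" | k where "x = F k ?y" using x unfolding X_def by blast
  then have "e x \<in> span X \<and> f x \<in> span X \<and> l x \<in> span X \<and> (\<exists>j. wt j x)"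
  proof cases
    case 1
    have "e x \<in> span X"
    proof (cases k)
      case 0 then show ?thesis using 1 em by (simp add: span_zero)
    next
      case (Suc i)
      have "e x = sc (qint (int i + 1) * qint (2 * int n - int n - int i)) (F i m)"
        unfolding 1 Suc e_F[OF m(1)] em by simp
      then show ?thesis using FX by (simp add: span_scale)
    qed
    moreover have "f x \<in> span X" using FX[of "Suc k"] 1 by simp
    moreover have "l x \<in> span X"
    proof (cases k)
      case 0 then show ?thesis using 1 m by (simp add: span_zero)
    next
      case (Suc i) show ?thesis unfolding 1 Suc l_F_killed[OF m(2)] by (intro span_scale FY)
    qed
    moreover have "\<exists>j. wt j x" using wt_F[OF m(1)] 1 by blast
    ultimately show ?thesis by blast
  next
    case 2
    have "e x \<in> span X"
    proof (cases k)
      case 0 then show ?thesis using 2 c FX[of 0] by (simp add: span_scale)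
    next
      case (Suc i)
      show ?thesis unfolding 2 Suc e_F[OF y] c F_sc by (intro span_add span_scale FX FY)
    qed
    moreover have "f x \<in> span X" using FY[of "Suc k"] 2 by simp
    moreover have "l x \<in> span X" unfolding 2 Fy l_sc ll using FY[of k] unfolding Fy .
    moreover have "\<exists>j. wt j x" using wt_F[OF y] 2 by blast
    ultimately show ?thesis by blast
  qed
  then show "e x \<in> span X" "f x \<in> span X" "l x \<in> span X" "\<exists>j. wt j x" by blast+
qed

lemma f_E: assumes "wt j x" "f x = 0"
  shows "f (E (Suc k) x) = sc (qint (int k + 1) * qint (int n - 2 * j - int k)) (E k x)"
proof (induction k)
  case 0
  have "f (e x) = - sc (qint (2 * j - int n)) x" using comm[OF assms(1)] assms(2) by (simp add: eq_neg_iff_add_eq_0)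
  moreover have "qint (int n - 2 * j) = - qint (2 * j - int n)"
    using qint_minus[of "2 * j - int n"] by simp
  ultimately show ?case by simp
next
  case (Suc k)
  let ?y = "E (Suc k) x"
  have w: "wt (j + int (Suc k)) ?y" using wt_E[OF assms(1)] .
  have "f (e ?y) = e (f ?y) - sc (qint (2 * (j + int (Suc k)) - int n)) ?y"
    using comm[OF w] by simp
  also have "e (f ?y) = sc (qint (int k + 1) * qint (int n - 2 * j - int k)) ?y"
    unfolding Suc.IH by (simp add: e_sc)
  finally have 1: "f (E (Suc (Suc k)) x) = sc (qint (int k + 1) * qint (int n - 2 * j - int k) - qint (2 * (j + int (Suc k)) - int n)) ?y"
    by (simp add: scale_left_diff_distrib)
  have a: "int n - 2 * j - int (Suc k) - (int k + 1) = - (2 * (j + int (Suc k)) - int n)"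
    "int n - 2 * j - int (Suc k) + 1 = int n - 2 * j - int k" "int (Suc k) + 1 = int k + 1 + 1" by simp_all
  have "qint (int (Suc k) + 1) * qint (int n - 2 * j - int (Suc k))
      = qint (int k + 1) * qint (int n - 2 * j - int k) - qint (2 * (j + int (Suc k)) - int n)"
    using qint_identity2[of "int k + 1" "int n - 2 * j - int (Suc k)"] unfolding a qint_minus by simp
  then show ?case using 1 by simp
qed

text \<open>The relation l e l = l e carries \<open>l m = 0\<close> up the whole chain of vectors
  \<open>E k m\<close>.\<close>

lemma lowest_killed_stable:
  assumes m: "wt 0 m" "l m = 0"
  defines "X \<equiv> (\<lambda>k. E k m) ` {..n}"
  assumes x: "x \<in> X"
  shows "e x \<in> span X" "f x \<in> span X" "l x \<in> span X" "\<exists>j. wt j x"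
proof -
  obtain k where k: "k \<le> n" "x = E k m" using x unfolding X_def by auto
  have fm: "f m = 0" using wt_out[OF wt_f[OF m(1)]] by simp
  have EX: "E i m \<in> span X" for i
  proof (cases "i \<le> n")
    case True then show ?thesis unfolding X_def by (intro span_base) simp
  next
    case False
    then have "E i m = 0" using wt_out[OF wt_E[OF m(1), of i]] by simp
    then show ?thesis by (simp add: span_zero)
  qed
  show "e x \<in> span X" using EX[of "Suc k"] k by simp
  show "f x \<in> span X"
  proof (cases k)
    case 0 then show ?thesis using k fm by (simp add: span_zero)
  next
    case (Suc i) show ?thesis unfolding k Suc f_E[OF m(1) fm] by (intro span_scale EX)
  qed
  have "l (E i m) = 0" for i
  proof (induction i)
    case (Suc i) then show ?case using lel[of "E i m"] by simp
  qed (simp add: m)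
  then show "l x \<in> span X" using k by (simp add: span_zero)
  show "\<exists>j. wt j x" using wt_E[OF m(1)] k by blast
qed

text \<open>A lowest weight vector is recovered from its image in the highest weight space, so it
  dies as soon as that space is factored out.\<close>

lemma lowest_generated:
  assumes m: "wt 0 m"
  shows "\<exists>c. c \<noteq> 0 \<and> F n (E n m) = sc c m"
proof -
  have fm: "f m = 0" using wt_out[OF wt_f[OF m(1)]] by simp
  have "F k (E k m) = sc (\<Prod>i<k. qint (int i + 1) * qint (int n - int i)) m" for k
  proof (induction k)
    case (Suc k)
    have "F (Suc k) (E (Suc k) m) = F k (f (E (Suc k) m))" by (simp only: funpow_Suc_right o_apply)
    also have "\<dots> = sc (qint (int k + 1) * qint (int n - int k)) (F k (E k m))"
      unfolding f_E[OF m fm] by (simp add: F_sc)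
    finally show ?case unfolding Suc.IH by (simp add: mult_ac)
  qed simp
  moreover have "(\<Prod>i<n. qint (int i + 1) * qint (int n - int i)) \<noteq> 0" by (auto simp: qint_eq_0)
  ultimately show ?thesis by blast
qed

end

section \<open>Ideals of the free algebra\<close>

definition fsc :: "ratfun \<Rightarrow> free_elt \<Rightarrow> free_elt" where
  "fsc c x = fconst c * x"

lemma fconst_0 [simp]: "fconst 0 = 0"
  and fconst_add: "fconst (a + b) = fconst a + fconst b"
  and fconst_mult: "fconst (a * b) = fconst a * fconst b"
  unfolding fconst_def by (simp_all add: single_add mult_single plus_list_def)

lemma fconst_1 [simp]: "fconst 1 = 1"
  unfolding fconst_def by (simp flip: zero_list_def)

lemma free_induct [case_names zero add]:
  assumes "P 0" "\<And>w c x. P x \<Longrightarrow> P (x + Poly_Mapping.single w c)"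
  shows "P (x :: 'a \<Rightarrow>\<^sub>0 'b::ab_group_add)"
proof (induction x rule: update_induct)
  case const then show ?case by (simp add: assms(1))
next
  case (update f k b)
  have "Poly_Mapping.update k b f = f + Poly_Mapping.single k b"
    using update(1) by (intro poly_mapping_eqI) (auto simp: lookup_update lookup_add lookup_single in_keys_iff when_def)
  then show ?case using assms(2) update by simp
qed

lemma fconst_central: "fconst c * x = x * fconst c"
proof (induction x rule: free_induct)
  case (add w a x)
  then show ?case
    by (simp add: algebra_simps fconst_def mult_single plus_list_def)
qed simp

interpretation fs: vector_space fsc
  by unfold_locales (simp_all add: fsc_def distrib_left distrib_right mult.assoc fconst_add fconst_mult)

lemma fsc_mult_left: "fsc c x * y = fsc c (x * y)"
  and fsc_mult_right: "x * fsc c y = fsc c (x * y)"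
  unfolding fsc_def by (simp add: mult.assoc) (metis fconst_central mult.assoc)

lemma single_Cons: "Poly_Mapping.single (g # w) c = fgen g * Poly_Mapping.single w c"
  and single_snoc: "Poly_Mapping.single (w @ [g]) c = Poly_Mapping.single w c * fgen g"
  unfolding fgen_def by (simp_all add: mult_single plus_list_def)

lemma single_Nil: "Poly_Mapping.single [] c = fsc c 1"
  by (simp add: fsc_def fconst_def)

lemma left_stable:
  assumes N: "fs.subspace N" and g: "\<And>g x. x \<in> N \<Longrightarrow> fgen g * x \<in> N" and x: "x \<in> N"
  shows "a * x \<in> N"
proof (induction a rule: free_induct)
  case zero then show ?case using N by (simp add: fs.subspace_0)
next
  case (add w c a)
  have "Poly_Mapping.single w c * x \<in> N"
  proof (induction w)
    case Nil then show ?case using N x by (simp add: single_Nil fsc_mult_left fs.subspace_scale)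
  next
    case (Cons h w) then show ?case using g by (simp add: single_Cons mult.assoc)
  qed
  then show ?case using N add by (simp add: distrib_right fs.subspace_add)
qed

lemma right_stable:
  assumes N: "fs.subspace N" and g: "\<And>g x. x \<in> N \<Longrightarrow> x * fgen g \<in> N" and x: "x \<in> N"
  shows "x * a \<in> N"
proof (induction a rule: free_induct)
  case zero then show ?case using N by (simp add: fs.subspace_0)
next
  case (add w c a)
  have "x * Poly_Mapping.single w c \<in> N"
  proof (induction w rule: rev_induct)
    case Nil then show ?case using N x by (simp add: single_Nil fsc_mult_right fs.subspace_scale)
  next
    case (snoc h w) then show ?case using g by (simp add: single_snoc mult.assoc[symmetric])
  qed
  then show ?case using N add by (simp add: distrib_left fs.subspace_add)
qed

text \<open>Two-sided ideals of the free algebra in terms of the type class operations, so that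
  linear spans can be used for them.\<close>

definition ideal2 :: "free_elt set \<Rightarrow> bool" where
  "ideal2 J \<longleftrightarrow> fs.subspace J \<and> (\<forall>x\<in>J. \<forall>a. a * x \<in> J \<and> x * a \<in> J)"

lemma ideal2_subspace: "ideal2 J \<Longrightarrow> fs.subspace J"
  and ideal2_left: "ideal2 J \<Longrightarrow> x \<in> J \<Longrightarrow> a * x \<in> J"
  and ideal2_right: "ideal2 J \<Longrightarrow> x \<in> J \<Longrightarrow> x * a \<in> J"
  and ideal2_add: "ideal2 J \<Longrightarrow> x \<in> J \<Longrightarrow> y \<in> J \<Longrightarrow> x + y \<in> J"
  and ideal2_diff: "ideal2 J \<Longrightarrow> x \<in> J \<Longrightarrow> y \<in> J \<Longrightarrow> x - y \<in> J"
  and ideal2_scale: "ideal2 J \<Longrightarrow> x \<in> J \<Longrightarrow> fsc c x \<in> J"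
  unfolding ideal2_def by (simp_all add: fs.subspace_add fs.subspace_diff fs.subspace_scale)

lemma ideal2_scaleD: "ideal2 J \<Longrightarrow> c \<noteq> 0 \<Longrightarrow> fsc c x \<in> J \<Longrightarrow> x \<in> J"
  using ideal2_scale[of J "fsc c x" "inverse c"] by simp

lemma span_linear_image:
  assumes add: "\<And>x y. h (x + y) = h x + h y" and scl: "\<And>c x. h (fsc c x) = fsc c (h x)"
    and X: "\<And>x. x \<in> X \<Longrightarrow> h x \<in> fs.span Y" and x: "x \<in> fs.span X"
  shows "h x \<in> fs.span Y"
  using x
proof (induction rule: fs.span_induct_alt)
  case base
  have "h 0 = 0" using scl[of 0 0] by simp
  then show ?case by (simp add: fs.span_zero)
next
  case (step c x y) then show ?case using X by (simp add: add scl fs.span_add fs.span_scale)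
qed

lemma weight_product_nonzero:
  assumes "\<And>r. r \<in> set rs \<Longrightarrow> j \<noteq> int r"
  shows "(\<Prod>r\<leftarrow>rs. vv powi (2 * j - int n) - vv powi (2 * int r - int n)) \<noteq> 0"
  using assms by (induction rs) (simp_all add: vv_powi_inject)

text \<open>Modulo J the span of X is a left module and the span of Y a right module, so left and
  right multiplications keep the products x y in their span.\<close>

lemma ideal2_products:
  assumes J: "ideal2 J"
    and X: "\<And>g x. x \<in> X \<Longrightarrow> fgen g * x \<in> fs.span (X \<union> J)"
    and Y: "\<And>g y. y \<in> Y \<Longrightarrow> y * fgen g \<in> fs.span (Y \<union> J)"
  defines "Z \<equiv> (\<lambda>(x, y). x * y) ` (X \<times> Y)"
  shows "ideal2 (fs.span (Z \<union> J))"
proof -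
  let ?N = "fs.span (Z \<union> J)"
  have JN: "x \<in> ?N" if "x \<in> J" for x using that by (simp add: fs.span_base)
  have XY: "u * y \<in> ?N" if "u \<in> fs.span (X \<union> J)" "y \<in> Y" for u y
  proof (rule span_linear_image[OF _ _ _ that(1), where h = "\<lambda>u. u * y"])
    fix u assume "u \<in> X \<union> J"
    then show "u * y \<in> ?N"
    proof
      assume "u \<in> X"
      then have "u * y \<in> Z" unfolding Z_def using that(2) by auto
      then show ?thesis by (simp add: fs.span_base)
    qed (intro JN ideal2_right[OF J])
  qed (simp_all add: distrib_right fsc_mult_left)
  have YX: "x * u \<in> ?N" if "u \<in> fs.span (Y \<union> J)" "x \<in> X" for u x
  proof (rule span_linear_image[OF _ _ _ that(1), where h = "\<lambda>u. x * u"])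
    fix u assume "u \<in> Y \<union> J"
    then show "x * u \<in> ?N"
    proof
      assume "u \<in> Y"
      then have "x * u \<in> Z" unfolding Z_def using that(2) by auto
      then show ?thesis by (simp add: fs.span_base)
    qed (intro JN ideal2_left[OF J])
  qed (simp_all add: distrib_left fsc_mult_right)
  have L: "fgen g * z \<in> ?N" if "z \<in> ?N" for g z
  proof (rule span_linear_image[OF _ _ _ that, where h = "\<lambda>z. fgen g * z"])
    fix z assume "z \<in> Z \<union> J"
    then show "fgen g * z \<in> ?N"
    proof
      assume "z \<in> Z"
      then obtain x y where xy: "x \<in> X" "y \<in> Y" "z = x * y" unfolding Z_def by auto
      show ?thesis using XY[OF X[OF xy(1), of g] xy(2)] by (simp add: xy mult.assoc)
    qed (intro JN ideal2_left[OF J])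
  qed (simp_all add: distrib_left fsc_mult_right)
  have R: "z * fgen g \<in> ?N" if "z \<in> ?N" for g z
  proof (rule span_linear_image[OF _ _ _ that, where h = "\<lambda>z. z * fgen g"])
    fix z assume "z \<in> Z \<union> J"
    then show "z * fgen g \<in> ?N"
    proof
      assume "z \<in> Z"
      then obtain x y where xy: "x \<in> X" "y \<in> Y" "z = x * y" unfolding Z_def by auto
      show ?thesis using YX[OF Y[OF xy(2), of g] xy(1)] by (simp add: xy mult.assoc)
    qed (intro JN ideal2_right[OF J])
  qed (simp_all add: distrib_right fsc_mult_left)
  show ?thesis
    unfolding ideal2_def using left_stable[OF fs.subspace_span L] right_stable[OF fs.subspace_span R] fs.subspace_span by blast
qed

text \<open>A basis of J is extended to a basis of the whole space and J is sent to 0. Elements of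
  the range serve as representatives of the quotient without a new type.\<close>

lemma exists_projection:
  assumes J: "fs.subspace J"
  shows "\<exists>\<pi>. (\<forall>x y. \<pi> (x + y) = \<pi> x + \<pi> y) \<and> (\<forall>c x. \<pi> (fsc c x) = fsc c (\<pi> x))
     \<and> (\<forall>x. \<pi> x = 0 \<longleftrightarrow> x \<in> J) \<and> (\<forall>x. x - \<pi> x \<in> J)"
proof -
  interpret p: vector_space_pair fsc fsc ..
  obtain B where B: "B \<subseteq> J" "fs.independent B" "J \<subseteq> fs.span B" using fs.basis_exists[of J] by metis
  have sB: "fs.span B = J" using B(3) fs.span_minimal[OF B(1) J] by (rule equalityI[rotated])
  define C where "C = fs.extend_basis B"
  have C: "fs.independent C" "fs.span C = UNIV" "B \<subseteq> C"
    unfolding C_def by (rule fs.independent_extend_basis[OF B(2)] fs.span_extend_basis[OF B(2)] fs.extend_basis_superset[OF B(2)])+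
  obtain g where g: "Vector_Spaces.linear fsc fsc g" "\<forall>x\<in>C. g x = (if x \<in> B then 0 else x)"
    using p.linear_independent_extend[OF C(1), of "\<lambda>x. if x \<in> B then 0 else x"] by blast
  interpret g: Vector_Spaces.linear fsc fsc g by (rule g(1))
  have d: "x - g x \<in> J" for x
  proof -
    have "x \<in> fs.span C" using C by simp
    then show ?thesis
    proof (induction rule: fs.span_induct_alt)
      case base then show ?case using J by (simp add: fs.subspace_0)
    next
      case (step c x y)
      have "x - g x \<in> J" using g(2) step(1) B(1) J by (auto simp: fs.subspace_0)
      then have "fsc c (x - g x) + (y - g y) \<in> J" using step J by (simp add: fs.subspace_add fs.subspace_scale)
      then show ?case by (simp add: g.add g.scale fs.scale_right_diff_distrib algebra_simps)
    qed
  qed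
  have "g x = 0" if "x \<in> J" for x
    using that unfolding sB[symmetric]
  proof (induction rule: fs.span_induct_alt)
    case (step c x y)
    then have "g x = 0" using g(2) C(3) by auto
    then show ?case using step by (simp add: g.add g.scale)
  qed simp
  moreover have "x \<in> J" if "g x = 0" for x using d[of x] that by simp
  ultimately have "g x = 0 \<longleftrightarrow> x \<in> J" for x by blast
  then show ?thesis using d g.add g.scale by (intro exI[of _ g] conjI allI) simp_all
qed

text \<open>The quotient by \<open>J\<close> is realised on a complement of \<open>J\<close>, the range of the projection \<open>\<pi>\<close>,
  on which the action \<open>act\<close> descends to \<open>\<pi> \<circ> act\<close>. Both the left and the right regular action are of this kind.\<close>

locale mir_ideal_action =
  fixes J :: "free_elt set" and act :: "gen \<Rightarrow> free_elt \<Rightarrow> free_elt" and n :: nat and \<pi> :: "free_elt \<Rightarrow> free_elt"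
  assumes J: "fs.subspace J"
    and act_add: "act g (x + y) = act g x + act g y" and act_scale: "act g (fsc c x) = fsc c (act g x)"
    and act_J: "x \<in> J \<Longrightarrow> act g x \<in> J"
    and pi_add: "\<pi> (x + y) = \<pi> x + \<pi> y" and pi_scale: "\<pi> (fsc c x) = fsc c (\<pi> x)"
    and pi_eq_0: "\<pi> x = 0 \<longleftrightarrow> x \<in> J" and pi_diff: "x - \<pi> x \<in> J"
    and kki: "act Gk (act Gki x) - x \<in> J" "act Gki (act Gk x) - x \<in> J"
    and ke: "act Gk (act Ge x) - fsc (vv powi 2) (act Ge (act Gk x)) \<in> J"
    and kf: "act Gk (act Gf x) - fsc (vv powi -2) (act Gf (act Gk x)) \<in> J"
    and ef: "act Ge (act Gf x) - act Gf (act Ge x) - fsc (1 / (vv - inverse vv)) (act Gk x - act Gki x) \<in> J"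
    and ll: "act Gl (act Gl x) - act Gl x \<in> J"
    and kl: "act Gk (act Gl x) - act Gl (act Gk x) \<in> J"
    and lel: "act Gl (act Ge (act Gl x)) - act Gl (act Ge x) \<in> J"
    and lfl: "act Gl (act Gf (act Gl x)) - act Gf (act Gl x) \<in> J"
    and se: "fsc (qint 2) (act Ge (act Gl (act Ge x))) - (fsc (inverse vv) (act Ge (act Ge (act Gl x)))
        + fsc vv (act Gl (act Ge (act Ge x)))) \<in> J"
    and sf: "fsc (qint 2) (act Gf (act Gl (act Gf x))) - (fsc (inverse vv) (act Gl (act Gf (act Gf x)))
        + fsc vv (act Gf (act Gf (act Gl x)))) \<in> J"
    and weights: "foldr (\<lambda>r y. act Gk y - fsc (vv powi (2 * int r - int n)) y) [0..<n + 1] x \<in> J"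
begin

definition hat :: "gen \<Rightarrow> free_elt \<Rightarrow> free_elt" where "hat g x = \<pi> (act g x)"

lemma pi_0 [simp]: "\<pi> 0 = 0" using pi_eq_0 J fs.subspace_0 by blast

lemma pi_minus: "\<pi> (x - y) = \<pi> x - \<pi> y"
  using pi_add[of "x - y" y] by (simp add: algebra_simps)

lemma pi_cong: "x - y \<in> J \<Longrightarrow> \<pi> x = \<pi> y"
  using pi_eq_0[of "x - y"] by (simp add: pi_minus)

lemma pi_pi [simp]: "\<pi> (\<pi> x) = \<pi> x"
  using pi_cong[OF pi_diff, of x] by simp

lemma act_minus: "act g (x - y) = act g x - act g y"
  using act_add[of g "x - y" y] by (simp add: algebra_simps)

lemma pi_act_pi: "\<pi> (act g (\<pi> x)) = \<pi> (act g x)"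
proof -
  have "act g x - act g (\<pi> x) \<in> J" unfolding act_minus[symmetric] by (intro act_J pi_diff)
  then show ?thesis using pi_cong by metis
qed

definition wt :: "int \<Rightarrow> free_elt \<Rightarrow> bool" where
  "wt j x \<longleftrightarrow> \<pi> x = x \<and> hat Gk x = fsc (vv powi (2 * j - int n)) x"

lemma pi_fold_weight:
  assumes "wt j x"
  shows "\<pi> (foldr (\<lambda>r y. act Gk y - fsc (vv powi (2 * int r - int n)) y) rs x)
    = fsc (\<Prod>r\<leftarrow>rs. vv powi (2 * j - int n) - vv powi (2 * int r - int n)) x"
proof (induction rs)
  case Nil then show ?case using assms by (simp add: wt_def)
next
  case (Cons r rs)
  let ?y = "foldr (\<lambda>r y. act Gk y - fsc (vv powi (2 * int r - int n)) y) rs x"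
  let ?c = "\<Prod>r\<leftarrow>rs. vv powi (2 * j - int n) - vv powi (2 * int r - int n)"
  have "\<pi> (act Gk ?y) = \<pi> (act Gk (fsc ?c x))" using pi_act_pi[of Gk ?y] Cons by simp
  also have "\<dots> = fsc ?c (fsc (vv powi (2 * j - int n)) x)"
    using assms by (simp add: act_scale pi_scale wt_def hat_def)
  finally have "\<pi> (act Gk ?y) = fsc (?c * vv powi (2 * j - int n)) x" by simp
  then show ?case
    using Cons by (simp add: pi_minus pi_scale algebra_simps fs.scale_left_diff_distrib)
qed

lemma hat_hat: "hat g (hat h x) = \<pi> (act g (act h x))"
  unfolding hat_def by (rule pi_act_pi)

lemma hat_hat3: "hat g (hat h (hat i x)) = \<pi> (act g (act h (act i x)))"
  unfolding hat_def by (metis pi_act_pi)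

lemma pi_hat [simp]: "\<pi> (hat g x) = hat g x" unfolding hat_def by simp

lemma hat_ki: assumes "wt j x" shows "hat Gki x = fsc (vv powi - (2 * j - int n)) x"
proof -
  let ?c = "vv powi (2 * j - int n)"
  have "x = hat Gki (hat Gk x)" unfolding hat_hat using pi_cong[OF kki(2), of x] assms by (simp add: wt_def)
  also have "\<dots> = fsc ?c (hat Gki x)" using assms by (simp add: wt_def hat_def act_scale pi_scale)
  finally have "fsc (inverse ?c) x = fsc (inverse ?c) (fsc ?c (hat Gki x))" by simp
  then have "hat Gki x = fsc (inverse ?c) x" by simp
  then show ?thesis by (simp only: power_int_minus)
qed

text \<open>The relations hold for \<open>act\<close> modulo J, hence exactly for
  \<open>hat\<close>. On a vector of weight j the product over all r in 0..n acts by a scalar that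
  vanishes only for j in this range; this excludes all other weights.\<close>

sublocale mm: mirabolic_module fsc "hat Ge" "hat Gf" "hat Gl" wt n
proof
  show "hat Ge (x + y) = hat Ge x + hat Ge y" "hat Gf (x + y) = hat Gf x + hat Gf y" "hat Gl (x + y) = hat Gl x + hat Gl y" for x y
    by (simp_all add: hat_def act_add pi_add)
  show "hat Ge (fsc c x) = fsc c (hat Ge x)" "hat Gf (fsc c x) = fsc c (hat Gf x)" "hat Gl (fsc c x) = fsc c (hat Gl x)" for c x
    by (simp_all add: hat_def act_scale pi_scale)
  show "hat Gl (hat Gl x) = hat Gl x" for x unfolding hat_hat using pi_cong[OF ll] by (simp add: hat_def)
  show "hat Gl (hat Ge (hat Gl x)) = hat Gl (hat Ge x)" for x using pi_cong[OF lel, of x] hat_hat3[of Gl Ge Gl x] hat_hat[of Gl Ge x] by simp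
  show "hat Gl (hat Gf (hat Gl x)) = hat Gf (hat Gl x)" for x using pi_cong[OF lfl, of x] hat_hat3[of Gl Gf Gl x] hat_hat[of Gf Gl x] by simp
  show "fsc (qint 2) (hat Ge (hat Gl (hat Ge x))) = fsc (inverse vv) (hat Ge (hat Ge (hat Gl x))) + fsc vv (hat Gl (hat Ge (hat Ge x)))" for x
    unfolding hat_hat3 using pi_cong[OF se] by (simp add: pi_scale pi_add)
  show "fsc (qint 2) (hat Gf (hat Gl (hat Gf x))) = fsc (inverse vv) (hat Gl (hat Gf (hat Gf x))) + fsc vv (hat Gf (hat Gf (hat Gl x)))" for x
    unfolding hat_hat3 using pi_cong[OF sf] by (simp add: pi_scale pi_add)
next
  fix j x assume w: "wt j x"
  show "wt j (hat Gl x)"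
  proof -
    have "hat Gk (hat Gl x) = hat Gl (hat Gk x)" unfolding hat_hat by (rule pi_cong[OF kl])
    then show ?thesis using w by (simp add: wt_def hat_def act_scale pi_scale)
  qed
  show "wt (j + 1) (hat Ge x)"
  proof -
    have "hat Gk (hat Ge x) = fsc (vv powi 2) (hat Ge (hat Gk x))" unfolding hat_hat using pi_cong[OF ke, of x] by (simp add: pi_scale)
    also have "\<dots> = fsc (vv powi 2 * vv powi (2 * j - int n)) (hat Ge x)" using w by (simp add: wt_def hat_def act_scale pi_scale)
    also have "vv powi 2 * vv powi (2 * j - int n) = vv powi (2 * (j + 1) - int n)"
      by (subst power_int_add[symmetric]) (auto simp: algebra_simps)
    finally show ?thesis by (simp add: wt_def)
  qed
  show "wt (j - 1) (hat Gf x)"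
  proof -
    have "hat Gk (hat Gf x) = fsc (vv powi -2) (hat Gf (hat Gk x))" unfolding hat_hat using pi_cong[OF kf, of x] by (simp add: pi_scale)
    also have "\<dots> = fsc (vv powi -2 * vv powi (2 * j - int n)) (hat Gf x)" using w by (simp add: wt_def hat_def act_scale pi_scale)
    also have "vv powi -2 * vv powi (2 * j - int n) = vv powi (2 * (j - 1) - int n)"
      by (subst power_int_add[symmetric]) (auto simp: algebra_simps)
    finally show ?thesis by (simp add: wt_def)
  qed
  show "hat Ge (hat Gf x) = hat Gf (hat Ge x) + fsc (qint (2 * j - int n)) x"
  proof -
    have "\<pi> (act Ge (act Gf x) - act Gf (act Ge x)) = \<pi> (fsc (1 / (vv - inverse vv)) (act Gk x - act Gki x))"
      by (rule pi_cong[OF ef])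
    then have "hat Ge (hat Gf x) - hat Gf (hat Ge x) = fsc (1 / (vv - inverse vv)) (hat Gk x - hat Gki x)"
      unfolding hat_hat by (simp add: pi_minus pi_scale hat_def)
    also have "hat Gk x - hat Gki x = fsc (vv powi (2 * j - int n) - vv powi - (2 * j - int n)) x"
      using w hat_ki[OF w] by (simp add: wt_def fs.scale_left_diff_distrib)
    finally have "hat Ge (hat Gf x) - hat Gf (hat Ge x) = fsc (qint (2 * j - int n)) x" unfolding qint_def by simp
    then show ?thesis by (simp add: diff_eq_eq add.commute)
  qed
  assume j: "j < 0 \<or> int n < j"
  have "fsc (\<Prod>r\<leftarrow>[0..<n + 1]. vv powi (2 * j - int n) - vv powi (2 * int r - int n)) x = 0"
    unfolding pi_fold_weight[OF w, symmetric] pi_eq_0 by (rule weights)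
  moreover have "(\<Prod>r\<leftarrow>[0..<n + 1]. vv powi (2 * j - int n) - vv powi (2 * int r - int n)) \<noteq> 0"
    by (rule weight_product_nonzero) (use j in auto)
  ultimately show "x = 0" by simp
qed

lemma mem_span_hat: assumes "hat g x \<in> fs.span X" shows "act g x \<in> fs.span (X \<union> J)"
proof -
  have "act g x - hat g x \<in> J" unfolding hat_def by (rule pi_diff)
  then have "(act g x - hat g x) + hat g x \<in> fs.span (X \<union> J)"
    using assms fs.span_mono[of X "X \<union> J"] by (intro fs.span_add) (auto intro: fs.span_base)
  then show ?thesis by simp
qed

text \<open>Stability under the projected operators becomes stability under multiplication in the
  free algebra once J is added to the span. On weight vectors k and its inverse act by
  scalars.\<close>

lemma act_stable:
  assumes "\<And>x. x \<in> X \<Longrightarrow> hat Ge x \<in> fs.span X" "\<And>x. x \<in> X \<Longrightarrow> hat Gf x \<in> fs.span X"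
    "\<And>x. x \<in> X \<Longrightarrow> hat Gl x \<in> fs.span X" "\<And>x. x \<in> X \<Longrightarrow> \<exists>j. wt j x" "x \<in> X"
  shows "act g x \<in> fs.span (X \<union> J)"
proof (rule mem_span_hat)
  obtain j where j: "wt j x" using assms by blast
  have x: "x \<in> fs.span X" using assms(5) by (rule fs.span_base)
  show "hat g x \<in> fs.span X"
  proof (cases g)
    case Gk then show ?thesis using j x by (simp add: wt_def fs.span_scale)
  next
    case Gki then show ?thesis using hat_ki[OF j] x by (simp add: fs.span_scale)
  qed (use assms in auto)
qed

end

text \<open>The lift of \<open>kprod\<close> to the free algebra.\<close>

definition kp :: "nat \<Rightarrow> nat list \<Rightarrow> free_elt" where
  "kp d rs = foldr (\<lambda>r p. (fgen Gk - fconst (vv powi (2 * int r - int d))) * p) rs 1"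

lemma kp_Nil [simp]: "kp d [] = 1"
  and kp_Cons: "kp d (r # rs) = (fgen Gk - fconst (vv powi (2 * int r - int d))) * kp d rs"
  by (simp_all add: kp_def)

lemma kp_append: "kp d (rs @ ss) = kp d rs * kp d ss"
  by (induction rs) (simp_all add: kp_Cons mult.assoc)

lemma k_factor_commute: "(fgen Gk - fconst a) * (fgen Gk - fconst b) = (fgen Gk - fconst b) * (fgen Gk - fconst a)"
  using fconst_central[of a "fgen Gk"] fconst_central[of b "fgen Gk"] fconst_central[of a "fconst b"]
  by (simp add: algebra_simps)

lemma kp_factor_commute: "(fgen Gk - fconst a) * kp d rs = kp d rs * (fgen Gk - fconst a)"
proof (induction rs)
  case (Cons r rs)
  let ?b = "fconst (vv powi (2 * int r - int d))"
  have "(fgen Gk - fconst a) * kp d (r # rs) = ((fgen Gk - fconst a) * (fgen Gk - ?b)) * kp d rs"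
    by (simp only: kp_Cons mult.assoc)
  also have "\<dots> = (fgen Gk - ?b) * ((fgen Gk - fconst a) * kp d rs)"
    by (simp only: k_factor_commute[of a] mult.assoc)
  finally show ?case by (simp only: Cons kp_Cons mult.assoc)
qed simp

text \<open>Brings the product into the iterated form of the locale assumption
  \<open>weights\<close>.\<close>

lemma kp_left: "kp d rs * x = foldr (\<lambda>r y. fgen Gk * y - fsc (vv powi (2 * int r - int d)) y) rs x"
  by (induction rs) (simp_all add: kp_Cons mult.assoc left_diff_distrib fsc_def)

lemma kp_right: "x * kp d rs = foldr (\<lambda>r y. y * fgen Gk - fsc (vv powi (2 * int r - int d)) y) rs x"
proof (induction rs)
  case (Cons r rs)
  have "x * kp d (r # rs) = (x * kp d rs) * (fgen Gk - fconst (vv powi (2 * int r - int d)))"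
    by (simp only: kp_Cons kp_factor_commute mult.assoc)
  then show ?case using Cons by (simp add: right_diff_distrib fsc_def fconst_central)
qed simp

fun swap :: "gen \<Rightarrow> gen" where
  "swap Ge = Gf" | "swap Gf = Ge" | "swap g = g"

text \<open>In the induction J grows while n drops in steps of 2, so n is a parameter of its own
  next to the d of the theorem.\<close>

locale quotient_relations =
  fixes J :: "free_elt set" and n :: nat
  assumes J: "ideal2 J" and rels: "mir_relations \<subseteq> J" and P: "kp n [0..<n + 1] \<in> J"
begin

abbreviation "e \<equiv> fgen Ge"
abbreviation "f \<equiv> fgen Gf"
abbreviation "k \<equiv> fgen Gk"
abbreviation "k' \<equiv> fgen Gki"
abbreviation "l \<equiv> fgen Gl"

lemma relations:
  "k * k' - 1 \<in> J" "k' * k - 1 \<in> J"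
  "k * e * k' - fsc (vv powi 2) e \<in> J" "k * f * k' - fsc (vv powi (-2)) f \<in> J"
  "(e * f - f * e) - fsc (1 / (vv - inverse vv)) (k - k') \<in> J"
  "l * l - l \<in> J" "k * l - l * k \<in> J" "l * e * l - l * e \<in> J" "l * f * l - f * l \<in> J"
  "fsc (qint 2) (e * l * e) - (fsc (inverse vv) (e * e * l) + fsc vv (l * e * e)) \<in> J"
  "fsc (qint 2) (f * l * f) - (fsc (inverse vv) (l * f * f) + fsc vv (f * f * l)) \<in> J"
  using rels unfolding mir_relations_def Let_def fsc_def by (simp_all add: mult.assoc)

lemma ke: "k * e - fsc (vv powi 2) (e * k) \<in> J" and kf: "k * f - fsc (vv powi (-2)) (f * k) \<in> J"
proof -
  have "(k * x * k' - fsc c x) * k - k * x * (k' * k - 1) = k * x - fsc c (x * k)" for x c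
    by (simp add: algebra_simps fsc_mult_left)
  then show "k * e - fsc (vv powi 2) (e * k) \<in> J" "k * f - fsc (vv powi (-2)) (f * k) \<in> J"
    using ideal2_diff[OF J ideal2_right[OF J relations(3), of k] ideal2_left[OF J relations(2), of "k * e"]]
      ideal2_diff[OF J ideal2_right[OF J relations(4), of k] ideal2_left[OF J relations(2), of "k * f"]] by simp_all
qed

lemma fk: "f * k - fsc (vv powi 2) (k * f) \<in> J" and ek: "e * k - fsc (vv powi (-2)) (k * e) \<in> J"
proof -
  have v: "fsc (vv powi 2) (fsc (vv powi (-2)) x) = x" "fsc (vv powi (-2)) (fsc (vv powi 2) x) = x" for x
    by (simp_all add: power_int_minus)
  have "f * k - fsc (vv powi 2) (k * f) = fsc (- (vv powi 2)) (k * f - fsc (vv powi (-2)) (f * k))"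
    using v(1)[of "f * k"] by (simp add: fs.scale_right_diff_distrib)
  then show "f * k - fsc (vv powi 2) (k * f) \<in> J"
    using ideal2_scale[OF J kf, of "- (vv powi 2)"] by (simp only:)
  have "e * k - fsc (vv powi (-2)) (k * e) = fsc (- (vv powi (-2))) (k * e - fsc (vv powi 2) (e * k))"
    using v(2)[of "e * k"] by (simp add: fs.scale_right_diff_distrib)
  then show "e * k - fsc (vv powi (-2)) (k * e) \<in> J"
    using ideal2_scale[OF J ke, of "- (vv powi (-2))"] by (simp only:)
qed

definition \<pi> :: "free_elt \<Rightarrow> free_elt" where
  "\<pi> = (SOME \<pi>. (\<forall>x y. \<pi> (x + y) = \<pi> x + \<pi> y) \<and> (\<forall>c x. \<pi> (fsc c x) = fsc c (\<pi> x))
     \<and> (\<forall>x. \<pi> x = 0 \<longleftrightarrow> x \<in> J) \<and> (\<forall>x. x - \<pi> x \<in> J))"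

lemma pi_props: "\<pi> (x + y) = \<pi> x + \<pi> y" "\<pi> (fsc c x) = fsc c (\<pi> x)" "\<pi> x = 0 \<longleftrightarrow> x \<in> J" "x - \<pi> x \<in> J"
  using someI_ex[OF exists_projection[OF ideal2_subspace[OF J]], folded \<pi>_def] by blast+

sublocale L: mir_ideal_action J "\<lambda>g x. fgen g * x" n \<pi>
proof
  note r = ideal2_right[OF J]
  fix x
  show "fgen Gk * (fgen Gki * x) - x \<in> J" "fgen Gki * (fgen Gk * x) - x \<in> J"
    using r[OF relations(1), of x] r[OF relations(2), of x] by (simp_all add: left_diff_distrib mult.assoc)
  show "fgen Gk * (fgen Ge * x) - fsc (vv powi 2) (fgen Ge * (fgen Gk * x)) \<in> J"
    "fgen Gk * (fgen Gf * x) - fsc (vv powi - 2) (fgen Gf * (fgen Gk * x)) \<in> J"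
    using r[OF ke, of x] r[OF kf, of x] by (simp_all add: left_diff_distrib mult.assoc fsc_mult_left)
  show "fgen Ge * (fgen Gf * x) - fgen Gf * (fgen Ge * x) - fsc (1 / (vv - inverse vv)) (fgen Gk * x - fgen Gki * x) \<in> J"
    using r[OF relations(5), of x] by (simp add: left_diff_distrib mult.assoc fsc_mult_left)
  show "fgen Gl * (fgen Gl * x) - fgen Gl * x \<in> J" "fgen Gk * (fgen Gl * x) - fgen Gl * (fgen Gk * x) \<in> J"
    "fgen Gl * (fgen Ge * (fgen Gl * x)) - fgen Gl * (fgen Ge * x) \<in> J"
    "fgen Gl * (fgen Gf * (fgen Gl * x)) - fgen Gf * (fgen Gl * x) \<in> J"
    using r[OF relations(6), of x] r[OF relations(7), of x] r[OF relations(8), of x] r[OF relations(9), of x]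
    by (simp_all add: left_diff_distrib mult.assoc)
  show "fsc (qint 2) (fgen Ge * (fgen Gl * (fgen Ge * x))) - (fsc (inverse vv) (fgen Ge * (fgen Ge * (fgen Gl * x)))
      + fsc vv (fgen Gl * (fgen Ge * (fgen Ge * x)))) \<in> J"
    "fsc (qint 2) (fgen Gf * (fgen Gl * (fgen Gf * x))) - (fsc (inverse vv) (fgen Gl * (fgen Gf * (fgen Gf * x)))
      + fsc vv (fgen Gf * (fgen Gf * (fgen Gl * x)))) \<in> J"
    using r[OF relations(10), of x] r[OF relations(11), of x]
    by (simp_all add: left_diff_distrib distrib_right mult.assoc fsc_mult_left)
  show "foldr (\<lambda>r y. fgen Gk * y - fsc (vv powi (2 * int r - int n)) y) [0..<n + 1] x \<in> J"
    using r[OF P, of x] unfolding kp_left .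
next
  fix g x y and c :: ratfun
  show "fgen g * (x + y) = fgen g * x + fgen g * y" "fgen g * fsc c x = fsc c (fgen g * x)"
    by (simp_all add: distrib_left fsc_mult_right)
  show "x \<in> J \<Longrightarrow> fgen g * x \<in> J" by (rule ideal2_left[OF J])
  show "\<pi> (x + y) = \<pi> x + \<pi> y" "\<pi> (fsc c x) = fsc c (\<pi> x)" "\<pi> x = 0 \<longleftrightarrow> x \<in> J" "x - \<pi> x \<in> J"
    by (rule pi_props)+
qed (rule ideal2_subspace[OF J])

text \<open>Right multiplication satisfies the same relations once \<open>e\<close> and \<open>f\<close> are interchanged.\<close>

sublocale R: mir_ideal_action J "\<lambda>g x. x * fgen (swap g)" n \<pi>
proof
  note r = ideal2_left[OF J]
  fix x
  show "x * fgen (swap Gki) * fgen (swap Gk) - x \<in> J" "x * fgen (swap Gk) * fgen (swap Gki) - x \<in> J"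
    using r[OF relations(1), of x] r[OF relations(2), of x] by (simp_all add: right_diff_distrib mult.assoc)
  show "x * fgen (swap Ge) * fgen (swap Gk) - fsc (vv powi 2) (x * fgen (swap Gk) * fgen (swap Ge)) \<in> J"
    "x * fgen (swap Gf) * fgen (swap Gk) - fsc (vv powi - 2) (x * fgen (swap Gk) * fgen (swap Gf)) \<in> J"
    using r[OF fk, of x] r[OF ek, of x] by (simp_all add: right_diff_distrib mult.assoc fsc_mult_right)
  show "x * fgen (swap Gf) * fgen (swap Ge) - x * fgen (swap Ge) * fgen (swap Gf)
      - fsc (1 / (vv - inverse vv)) (x * fgen (swap Gk) - x * fgen (swap Gki)) \<in> J"
    using r[OF relations(5), of x] by (simp add: right_diff_distrib mult.assoc fsc_mult_right)
  show "x * fgen (swap Gl) * fgen (swap Gl) - x * fgen (swap Gl) \<in> J"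
    "x * fgen (swap Gl) * fgen (swap Gk) - x * fgen (swap Gk) * fgen (swap Gl) \<in> J"
    "x * fgen (swap Gl) * fgen (swap Ge) * fgen (swap Gl) - x * fgen (swap Ge) * fgen (swap Gl) \<in> J"
    "x * fgen (swap Gl) * fgen (swap Gf) * fgen (swap Gl) - x * fgen (swap Gl) * fgen (swap Gf) \<in> J"
    using r[OF relations(6), of x] fs.subspace_neg[OF ideal2_subspace[OF J] r[OF relations(7), of x]]
      r[OF relations(9), of x] r[OF relations(8), of x]
    by (simp_all add: right_diff_distrib mult.assoc)
  show "fsc (qint 2) (x * fgen (swap Ge) * fgen (swap Gl) * fgen (swap Ge))
      - (fsc (inverse vv) (x * fgen (swap Gl) * fgen (swap Ge) * fgen (swap Ge))
      + fsc vv (x * fgen (swap Ge) * fgen (swap Ge) * fgen (swap Gl))) \<in> J"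
    "fsc (qint 2) (x * fgen (swap Gf) * fgen (swap Gl) * fgen (swap Gf))
      - (fsc (inverse vv) (x * fgen (swap Gf) * fgen (swap Gf) * fgen (swap Gl))
      + fsc vv (x * fgen (swap Gl) * fgen (swap Gf) * fgen (swap Gf))) \<in> J"
    using r[OF relations(11), of x] r[OF relations(10), of x]
    by (simp_all add: right_diff_distrib distrib_left mult.assoc fsc_mult_right)
  show "foldr (\<lambda>r y. y * fgen (swap Gk) - fsc (vv powi (2 * int r - int n)) y) [0..<n + 1] x \<in> J"
    using r[OF P, of x] unfolding kp_right by simp
next
  fix g x y and c :: ratfun
  show "(x + y) * fgen (swap g) = x * fgen (swap g) + y * fgen (swap g)" "fsc c x * fgen (swap g) = fsc c (x * fgen (swap g))"
    by (simp_all add: distrib_right fsc_mult_left)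
  show "x \<in> J \<Longrightarrow> x * fgen (swap g) \<in> J" by (rule ideal2_right[OF J])
qed (rule L.J L.pi_add L.pi_scale L.pi_eq_0 L.pi_diff)+

lemma left_weight:
  assumes "(k - fconst (vv powi (2 * j - int n))) * x \<in> J" shows "L.wt j (\<pi> x)"
proof -
  have "\<pi> (k * x) = \<pi> (fsc (vv powi (2 * j - int n)) x)"
    using L.pi_cong assms by (simp add: left_diff_distrib fsc_def)
  then show ?thesis unfolding L.wt_def L.hat_def by (simp add: L.pi_act_pi pi_props(2))
qed

lemma right_weight:
  assumes "x * (k - fconst (vv powi (2 * j - int n))) \<in> J" shows "R.wt j (\<pi> x)"
proof -
  have "\<pi> (x * k) = \<pi> (fsc (vv powi (2 * j - int n)) x)"
    using R.pi_cong assms by (simp add: right_diff_distrib fsc_def fconst_central)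
  then show ?thesis unfolding R.wt_def R.hat_def using R.pi_act_pi[where g = Gk and x = x] by (simp add: pi_props(2))
qed

end

section \<open>The dimension bound\<close>

text \<open>Since 2 (r + 1) - (n + 2) = 2 r - n, the weights for n + 2 without the two extreme ones
  are the weights for n.\<close>

lemma kp_shift: "kp (Suc (Suc n)) [Suc a..<Suc b] = kp n [a..<b]"
proof -
  have "kp (Suc (Suc n)) (map Suc rs) = kp n rs" for rs
    by (induction rs) (simp_all add: kp_Cons algebra_simps)
  then show ?thesis by (simp only: map_Suc_upt[symmetric])
qed

text \<open>The dimension of J' over J is at most m, expressed by spanning vectors so that bounds
  simply add up.\<close>

definition grown :: "nat \<Rightarrow> free_elt set \<Rightarrow> free_elt set \<Rightarrow> bool" where
  "grown m J J' \<longleftrightarrow> (\<exists>Z. finite Z \<and> card Z \<le> m \<and> J' = fs.span (Z \<union> J))"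

lemma grown_supset: "grown m J J' \<Longrightarrow> J \<subseteq> J'"
  unfolding grown_def using fs.span_superset by blast

lemma grown_trans:
  assumes "grown m J J'" "grown m' J' J''" shows "grown (m + m') J J''"
proof -
  obtain Z where Z: "finite Z" "card Z \<le> m" "J' = fs.span (Z \<union> J)" using assms(1) unfolding grown_def by blast
  obtain Z' where Z': "finite Z'" "card Z' \<le> m'" "J'' = fs.span (Z' \<union> J')" using assms(2) unfolding grown_def by blast
  have "fs.span (Z' \<union> fs.span (Z \<union> J)) = fs.span ((Z \<union> Z') \<union> J)"
  proof (rule antisym)
    have "fs.span (Z \<union> J) \<subseteq> fs.span ((Z \<union> Z') \<union> J)" by (rule fs.span_mono) blast
    moreover have "Z' \<subseteq> fs.span ((Z \<union> Z') \<union> J)" using fs.span_superset[of "(Z \<union> Z') \<union> J"] by blast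
    ultimately show "fs.span (Z' \<union> fs.span (Z \<union> J)) \<subseteq> fs.span ((Z \<union> Z') \<union> J)"
      by (intro fs.span_minimal) simp_all
    have "(Z \<union> Z') \<union> J \<subseteq> Z' \<union> fs.span (Z \<union> J)" using fs.span_superset[of "Z \<union> J"] by blast
    then show "fs.span ((Z \<union> Z') \<union> J) \<subseteq> fs.span (Z' \<union> fs.span (Z \<union> J))" by (rule fs.span_mono)
  qed
  moreover have "finite (Z \<union> Z')" "card (Z \<union> Z') \<le> m + m'"
    using Z Z' card_Un_le[of Z Z'] by simp_all
  ultimately show ?thesis unfolding grown_def Z'(3) Z(3) by blast
qed

lemma grown_mono: "grown m J J' \<Longrightarrow> m \<le> m' \<Longrightarrow> grown m' J J'"
  unfolding grown_def using le_trans by blast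

lemma ideal2_eq_UNIV: "ideal2 J \<Longrightarrow> 1 \<in> J \<Longrightarrow> J = UNIV"
  using ideal2_left[of J 1] by auto

context quotient_relations
begin

lemma extend: "ideal2 J' \<Longrightarrow> J \<subseteq> J' \<Longrightarrow> quotient_relations J' n"
  using rels P by (simp add: quotient_relations_def subset_trans subsetD)

lemma kp_eigen_left:
  assumes y: "(k - fconst a) * y \<in> J"
  shows "kp n rs * y - fsc (\<Prod>r\<leftarrow>rs. a - vv powi (2 * int r - int n)) y \<in> J"
proof (induction rs)
  case Nil then show ?case using fs.subspace_0[OF ideal2_subspace[OF J]] by simp
next
  case (Cons r rs)
  let ?c = "\<Prod>r\<leftarrow>rs. a - vv powi (2 * int r - int n)" and ?b = "vv powi (2 * int r - int n)"
  have "(k - fconst ?b) * (kp n rs * y - fsc ?c y) + fsc ?c ((k - fconst a) * y) \<in> J"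
    by (intro ideal2_add[OF J] ideal2_left[OF J Cons] ideal2_scale[OF J y])
  also have "(k - fconst ?b) * (kp n rs * y - fsc ?c y) + fsc ?c ((k - fconst a) * y)
    = kp n (r # rs) * y - fsc ((a - ?b) * ?c) y"
  proof -
    have "fconst z * y = fsc z y" for y z by (simp add: fsc_def)
    then show ?thesis
      by (simp add: kp_Cons left_diff_distrib right_diff_distrib mult.assoc fsc_mult_left fsc_mult_right
          fs.scale_right_diff_distrib fs.scale_left_diff_distrib mult.commute[of ?c])
  qed
  finally show ?case by simp
qed

lemma kp_eigen_right:
  assumes y: "y * (k - fconst a) \<in> J"
  shows "y * kp n rs - fsc (\<Prod>r\<leftarrow>rs. a - vv powi (2 * int r - int n)) y \<in> J"
proof (induction rs)
  case Nil then show ?case using fs.subspace_0[OF ideal2_subspace[OF J]] by simp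
next
  case (Cons r rs)
  let ?c = "\<Prod>r\<leftarrow>rs. a - vv powi (2 * int r - int n)" and ?b = "vv powi (2 * int r - int n)"
  have "(y * kp n rs - fsc ?c y) * (k - fconst ?b) + fsc ?c (y * (k - fconst a)) \<in> J"
    by (intro ideal2_add[OF J] ideal2_right[OF J Cons] ideal2_scale[OF J y])
  also have "(y * kp n rs - fsc ?c y) * (k - fconst ?b) + fsc ?c (y * (k - fconst a))
    = y * (kp n rs * (k - fconst ?b)) - fsc (?c * a) y + fsc ?c (fsc ?b y)"
  proof -
    have "y * fconst z = fsc z y" for y z by (simp add: fsc_def fconst_central)
    then show ?thesis
      by (simp add: left_diff_distrib right_diff_distrib mult.assoc[symmetric] fsc_mult_left fsc_mult_right fs.scale_right_diff_distrib)
  qed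
  also have "\<dots> = y * kp n (r # rs) - fsc ((a - ?b) * ?c) y"
    by (simp only: kp_Cons kp_factor_commute) (simp add: fs.scale_left_diff_distrib algebra_simps)
  finally show ?case by simp
qed

lemma l_kp: "l * kp n rs - kp n rs * l \<in> J"
proof (induction rs)
  case Nil then show ?case using fs.subspace_0[OF ideal2_subspace[OF J]] by simp
next
  case (Cons r rs)
  let ?b = "fconst (vv powi (2 * int r - int n))"
  have "(k - ?b) * (l * kp n rs - kp n rs * l) - (k * l - l * k) * kp n rs \<in> J"
    by (intro ideal2_diff[OF J] ideal2_left[OF J Cons] ideal2_right[OF J relations(7)])
  also have "(k - ?b) * (l * kp n rs - kp n rs * l) - (k * l - l * k) * kp n rs
     = l * kp n (r # rs) - kp n (r # rs) * l + (l * ?b - ?b * l) * kp n rs"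
    by (simp add: kp_Cons algebra_simps)
  finally show ?case by (simp add: fconst_central)
qed

text \<open>\<open>c0\<close> and \<open>cn\<close> are the scalars by which \<open>p0\<close> and
  \<open>pn\<close> below act on the lowest and the highest weight space.\<close>

definition "c0 = (\<Prod>r\<leftarrow>[1..<n + 1]. vv powi (2 * 0 - int n) - vv powi (2 * int r - int n))"
definition "cn = (\<Prod>r\<leftarrow>[0..<n]. vv powi (2 * int n - int n) - vv powi (2 * int r - int n))"

lemma c0_nonzero: "c0 \<noteq> 0" and cn_nonzero: "cn \<noteq> 0"
  unfolding c0_def cn_def by (rule weight_product_nonzero, simp, arith?)+

text \<open>\<open>p0\<close> omits the root of the lowest weight and \<open>pn\<close> that of the
  highest, so up to scalars they are the projectors to these weight spaces. For n = d,
  \<open>p0\<close> is the lift of Q_d(k).\<close>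

definition "p0 = kp n [1..<n + 1]"
definition "pn = kp n [0..<n]"

lemma k_p0: "(k - fconst (vv powi (2 * 0 - int n))) * p0 \<in> J" "p0 * (k - fconst (vv powi (2 * 0 - int n))) \<in> J"
proof -
  have "(k - fconst (vv powi (2 * 0 - int n))) * p0 = kp n [0..<n + 1]"
    unfolding p0_def by (subst upt_conv_Cons) (simp_all add: kp_Cons)
  then show "(k - fconst (vv powi (2 * 0 - int n))) * p0 \<in> J" using P by simp
  then show "p0 * (k - fconst (vv powi (2 * 0 - int n))) \<in> J" unfolding p0_def by (simp only: kp_factor_commute)
qed

lemma k_pn: "(k - fconst (vv powi (2 * int n - int n))) * pn \<in> J" "pn * (k - fconst (vv powi (2 * int n - int n))) \<in> J"
proof -
  have "pn * (k - fconst (vv powi (2 * int n - int n))) = kp n [0..<n + 1]"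
    unfolding pn_def by (simp add: kp_append kp_Cons)
  then show "pn * (k - fconst (vv powi (2 * int n - int n))) \<in> J" using P by simp
  then show "(k - fconst (vv powi (2 * int n - int n))) * pn \<in> J" unfolding pn_def by (simp only: kp_factor_commute)
qed

text \<open>Modulo J the idempotent l commutes with p. Hence l p and (1 - l) p inherit from p the
  two eigenvalue equations and the idempotency up to the factor c, and l acts on them from both
  sides as 1 and as 0.\<close>

lemma split_projector:
  assumes p: "(k - fconst a) * p \<in> J" "p * (k - fconst a) \<in> J" "l * p - p * l \<in> J" "p * p - fsc c p \<in> J"
  shows "(k - fconst a) * (l * p) \<in> J" "l * p * (k - fconst a) \<in> J" "l * (l * p) - l * p \<in> J" "l * p * l - l * p \<in> J"
    "l * p * (l * p) - fsc c (l * p) \<in> J"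
    and "(k - fconst a) * (p - l * p) \<in> J" "(p - l * p) * (k - fconst a) \<in> J" "l * (p - l * p) \<in> J" "(p - l * p) * l \<in> J"
    "(p - l * p) * (p - l * p) - fsc c (p - l * p) \<in> J"
proof -
  note D = ideal2_diff[OF J] and A = ideal2_add[OF J] and L = ideal2_left[OF J] and R = ideal2_right[OF J]
  have "(k * l - l * k) * p + l * ((k - fconst a) * p) = (k - fconst a) * (l * p)"
    using fsc_mult_right[of l a p] by (simp add: left_diff_distrib right_diff_distrib mult.assoc fsc_def)
  then show 1: "(k - fconst a) * (l * p) \<in> J" using A[OF R[OF relations(7), of p] L[OF p(1), of l]] by (simp only:)
  show 2: "l * p * (k - fconst a) \<in> J" using L[OF p(2), of l] by (simp only: mult.assoc)
  show 3: "l * (l * p) - l * p \<in> J" using R[OF relations(6), of p] by (simp add: left_diff_distrib mult.assoc)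
  show 4: "l * p * l - l * p \<in> J"
    using D[OF 3 L[OF p(3), of l]] by (simp add: right_diff_distrib mult.assoc)
  show 5: "l * p * (l * p) - fsc c (l * p) \<in> J"
    using A[OF R[OF 4, of p] L[OF p(4), of l]]
    by (simp add: right_diff_distrib left_diff_distrib mult.assoc fsc_mult_right)
  show "(k - fconst a) * (p - l * p) \<in> J" using D[OF p(1) 1] by (simp add: right_diff_distrib)
  show "(p - l * p) * (k - fconst a) \<in> J" using D[OF p(2) 2] by (simp add: left_diff_distrib)
  show 6: "l * (p - l * p) \<in> J" using ideal2_scale[OF J 3, of "-1"] by (simp add: right_diff_distrib)
  show 7: "(p - l * p) * l \<in> J" using D[OF ideal2_scale[OF J p(3), of "-1"] 4] by (simp add: left_diff_distrib)
  have "(p * p - fsc c p) - l * (p * p - fsc c p) - (p - l * p) * l * p = (p - l * p) * (p - l * p) - fsc c (p - l * p)"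
    by (simp add: left_diff_distrib right_diff_distrib mult.assoc fsc_mult_right fs.scale_right_diff_distrib)
  then show "(p - l * p) * (p - l * p) - fsc c (p - l * p) \<in> J"
    using D[OF D[OF p(4) L[OF p(4), of l]] R[OF 7, of p]] by (simp only:)
qed

lemmas split_p0 = split_projector[OF k_p0 l_kp[of "[1..<n + 1]", folded p0_def]
    kp_eigen_left[OF k_p0(1), of "[1..<n + 1]", folded p0_def c0_def]]
lemmas split_pn = split_projector[OF k_pn l_kp[of "[0..<n]", folded pn_def]
    kp_eigen_left[OF k_pn(1), of "[0..<n]", folded pn_def cn_def]]

text \<open>X and Y contain the generators of the left and of the right module. Their product is m m
  = c m modulo J, so the span of all products contains m itself.\<close>

lemma adjoin_products:
  assumes X: "finite X" "card X \<le> a" "\<pi> m \<in> X" "\<And>g x. x \<in> X \<Longrightarrow> fgen g * x \<in> fs.span (X \<union> J)"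
    and Y: "finite Y" "card Y \<le> a" "\<pi> m \<in> Y" "\<And>g x. x \<in> Y \<Longrightarrow> x * fgen g \<in> fs.span (Y \<union> J)"
    and m: "m * m - fsc c m \<in> J" "c \<noteq> 0"
  shows "\<exists>J'. ideal2 J' \<and> grown (a\<^sup>2) J J' \<and> m \<in> J'"
proof -
  define Z where "Z = (\<lambda>(x, y). x * y) ` (X \<times> Y)"
  let ?J = "fs.span (Z \<union> J)"
  have i: "ideal2 ?J" unfolding Z_def by (rule ideal2_products[OF J X(4) Y(4)])
  have JJ: "x \<in> ?J" if "x \<in> J" for x using that by (simp add: fs.span_base)
  have "card Z \<le> card (X \<times> Y)" unfolding Z_def by (rule card_image_le) (simp add: X Y)
  also have "\<dots> \<le> a\<^sup>2" using X(2) Y(2) by (simp add: card_cartesian_product power2_eq_square mult_mono)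
  finally have "grown (a\<^sup>2) J ?J" unfolding grown_def using X(1) Y(1) by (intro exI[of _ Z]) (simp add: Z_def)
  moreover have "m \<in> ?J"
  proof -
    have "\<pi> m * \<pi> m \<in> Z" unfolding Z_def using X(3) Y(3) by force
    then have "\<pi> m * \<pi> m \<in> ?J" by (simp add: fs.span_base)
    moreover have "(m - \<pi> m) * m \<in> ?J" "\<pi> m * (m - \<pi> m) \<in> ?J" "m * m - fsc c m \<in> ?J"
      using JJ[OF ideal2_right[OF J pi_props(4)]] JJ[OF ideal2_left[OF J pi_props(4)]] JJ[OF m(1)] by blast+
    ultimately have "\<pi> m * \<pi> m + ((m - \<pi> m) * m + \<pi> m * (m - \<pi> m)) - (m * m - fsc c m) \<in> ?J"
      using ideal2_add[OF i] ideal2_diff[OF i] by metis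
    moreover have "\<pi> m * \<pi> m + ((m - \<pi> m) * m + \<pi> m * (m - \<pi> m)) - (m * m - fsc c m) = fsc c m"
      by (simp add: left_diff_distrib right_diff_distrib)
    ultimately have "fsc c m \<in> ?J" by (simp only:)
    then show ?thesis by (rule ideal2_scaleD[OF i m(2)])
  qed
  ultimately show ?thesis using i by blast
qed

lemma card_image_atMost: "card ((\<lambda>k. g k) ` {..n}) \<le> Suc n"
  using card_image_le[of "{..n}" g] by simp

lemma adjoin_highest_fixed: "\<exists>J'. ideal2 J' \<and> grown ((n + 1)\<^sup>2) J J' \<and> l * pn \<in> J'"
proof -
  let ?m = "l * pn"
  have L: "L.wt (int n) (\<pi> ?m)" "L.hat Gl (\<pi> ?m) = \<pi> ?m"
    using left_weight[OF split_pn(1)] L.pi_cong[OF split_pn(3)] by (simp_all add: L.hat_def L.pi_act_pi)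
  have R: "R.wt (int n) (\<pi> ?m)" "R.hat Gl (\<pi> ?m) = \<pi> ?m"
    using right_weight[OF split_pn(2)] L.pi_cong[OF split_pn(4)] R.pi_act_pi[where g = Gl and x = ?m]
    by (simp_all add: R.hat_def)
  show ?thesis
  proof (rule adjoin_products[OF _ _ _ _ _ _ _ _ split_pn(5) cn_nonzero])
    let ?X = "(\<lambda>k. (L.hat Gf ^^ k) (\<pi> ?m)) ` {..n}" and ?Y = "(\<lambda>k. (R.hat Gf ^^ k) (\<pi> ?m)) ` {..n}"
    show "finite ?X" "finite ?Y" "card ?X \<le> n + 1" "card ?Y \<le> n + 1"
      using card_image_atMost by simp_all
    show "\<pi> ?m \<in> ?X" "\<pi> ?m \<in> ?Y" by (rule image_eqI[of _ _ 0]; simp)+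
    show "fgen g * x \<in> fs.span (?X \<union> J)" if "x \<in> ?X" for g x
      using L.mm.highest_fixed_stable[OF L] that by (rule L.act_stable)
    show "x * fgen g \<in> fs.span (?Y \<union> J)" if "x \<in> ?Y" for g x
    proof -
      \<comment> \<open>The right action of a generator multiplies by its \<open>swap\<close>;
        applying it to \<open>swap g\<close> gives multiplication by g.\<close>
      have "x * fgen (swap (swap g)) \<in> fs.span (?Y \<union> J)"
        using R.mm.highest_fixed_stable[OF R] that by (rule R.act_stable)
      moreover have "swap (swap g) = g" by (cases g) simp_all
      ultimately show ?thesis by simp
    qed
  qed
qed


lemma wt_left: "L.wt j x \<Longrightarrow> (k - fconst (vv powi (2 * j - int n))) * x \<in> J"
  unfolding L.wt_def L.hat_def pi_props(3)[symmetric]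
  by (simp add: left_diff_distrib L.pi_minus pi_props(2) flip: fsc_def)

lemma wt_right: "R.wt j x \<Longrightarrow> x * (k - fconst (vv powi (2 * j - int n))) \<in> J"
  unfolding R.wt_def R.hat_def pi_props(3)[symmetric] right_diff_distrib fconst_central[symmetric]
  by (simp add: L.pi_minus pi_props(2) flip: fsc_def)

text \<open>A vector x of weight 0 satisfies p0 x = c0 x modulo J, so the hypothesis on
  \<open>p0\<close> carries over to x.\<close>

lemma low_left:
  assumes low: "(l - 1) * p0 \<in> J" and x: "L.wt 0 x" shows "L.hat Gl x = x"
proof -
  have 1: "p0 * x - fsc c0 x \<in> J"
    unfolding p0_def c0_def by (rule kp_eigen_left) (use wt_left[OF x] in simp)
  have "(l - 1) * p0 * x - (l - 1) * (p0 * x - fsc c0 x) = fsc c0 ((l - 1) * x)"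
    by (simp add: left_diff_distrib right_diff_distrib mult.assoc fsc_mult_right fs.scale_right_diff_distrib)
  then have "fsc c0 ((l - 1) * x) \<in> J"
    using ideal2_diff[OF J ideal2_right[OF J low, of x] ideal2_left[OF J 1, of "l - 1"]] by (simp only:)
  then have "l * x - x \<in> J" using ideal2_scaleD[OF J c0_nonzero] by (simp add: left_diff_distrib)
  then show ?thesis using L.pi_cong x by (simp add: L.hat_def L.wt_def)
qed

text \<open>On the right the factor l - 1 is first moved past \<open>p0\<close> by
  \<open>l_kp\<close>.\<close>

lemma low_right:
  assumes low: "(l - 1) * p0 \<in> J" and x: "R.wt 0 x" shows "R.hat Gl x = x"
proof -
  have 1: "x * p0 - fsc c0 x \<in> J"
    unfolding p0_def c0_def by (rule kp_eigen_right) (use wt_right[OF x] in simp)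
  have "(l - 1) * p0 - (l * p0 - p0 * l) = p0 * (l - 1)" by (simp add: left_diff_distrib right_diff_distrib)
  then have 2: "p0 * (l - 1) \<in> J"
    using ideal2_diff[OF J low l_kp[of "[1..<n + 1]", folded p0_def]] by (simp only:)
  have "x * (p0 * (l - 1)) - (x * p0 - fsc c0 x) * (l - 1) = fsc c0 (x * (l - 1))"
    by (simp add: left_diff_distrib right_diff_distrib mult.assoc fsc_mult_left fs.scale_right_diff_distrib)
  then have "fsc c0 (x * (l - 1)) \<in> J"
    using ideal2_diff[OF J ideal2_left[OF J 2, of x] ideal2_right[OF J 1, of "l - 1"]] by (simp only:)
  then have "x * l - x \<in> J" using ideal2_scaleD[OF J c0_nonzero] by (simp add: right_diff_distrib)
  then show ?thesis using L.pi_cong x by (simp add: R.hat_def R.wt_def)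
qed

lemma swap_swap: "swap (swap g) = g"
  by (cases g) simp_all

lemma adjoin_highest_killed:
  assumes low: "(l - 1) * p0 \<in> J" and n: "n > 0"
  shows "\<exists>J'. ideal2 J' \<and> grown ((2 * n)\<^sup>2) J J' \<and> pn - l * pn \<in> J'"
proof -
  let ?m = "pn - l * pn"
  have L: "L.wt (int n) (\<pi> ?m)" "L.hat Gl (\<pi> ?m) = 0"
    using left_weight[OF split_pn(6)] split_pn(8) by (simp_all add: L.hat_def L.pi_act_pi pi_props(3))
  have R: "R.wt (int n) (\<pi> ?m)" "R.hat Gl (\<pi> ?m) = 0"
    using right_weight[OF split_pn(7)] split_pn(9) R.pi_act_pi[where g = Gl and x = ?m]
    by (simp_all add: R.hat_def pi_props(3))
  have card: "card ((\<lambda>k. g k) ` {..n} \<union> (\<lambda>k. h k) ` {..<n - 1}) \<le> 2 * n" for g h :: "nat \<Rightarrow> free_elt"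
    using card_Un_le[of "(\<lambda>k. g k) ` {..n}" "(\<lambda>k. h k) ` {..<n - 1}"] card_image_atMost[of g]
      card_image_le[of "{..<n - 1}" h] n by simp
  show ?thesis
  proof (rule adjoin_products[OF _ _ _ _ _ _ _ _ split_pn(10) cn_nonzero])
    let ?X = "(\<lambda>k. (L.hat Gf ^^ k) (\<pi> ?m)) ` {..n} \<union> (\<lambda>k. (L.hat Gf ^^ k) (L.hat Gl (L.hat Gf (\<pi> ?m)))) ` {..<n - 1}"
    let ?Y = "(\<lambda>k. (R.hat Gf ^^ k) (\<pi> ?m)) ` {..n} \<union> (\<lambda>k. (R.hat Gf ^^ k) (R.hat Gl (R.hat Gf (\<pi> ?m)))) ` {..<n - 1}"
    show "finite ?X" "finite ?Y" by simp_all
    show "card ?X \<le> 2 * n" "card ?Y \<le> 2 * n" by (rule card)+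
    show "\<pi> ?m \<in> ?X" "\<pi> ?m \<in> ?Y" by (rule UnI1, rule image_eqI[of _ _ 0]; simp)+
    show "fgen g * x \<in> fs.span (?X \<union> J)" if "x \<in> ?X" for g x
      using L.mm.highest_killed_stable[OF n L low_left[OF low]] that by (rule L.act_stable)
    show "x * fgen g \<in> fs.span (?Y \<union> J)" if "x \<in> ?Y" for g x
    proof -
      have "x * fgen (swap (swap g)) \<in> fs.span (?Y \<union> J)"
        using R.mm.highest_killed_stable[OF n R low_right[OF low]] that by (rule R.act_stable)
      then show ?thesis by (simp only: swap_swap)
    qed
  qed
qed

lemma adjoin_lowest_killed: "\<exists>J'. ideal2 J' \<and> grown ((n + 1)\<^sup>2) J J' \<and> p0 - l * p0 \<in> J'"
proof -
  let ?m = "p0 - l * p0"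
  have L: "L.wt 0 (\<pi> ?m)" "L.hat Gl (\<pi> ?m) = 0"
    using left_weight[OF split_p0(6)] split_p0(8) by (simp_all add: L.hat_def L.pi_act_pi pi_props(3))
  have R: "R.wt 0 (\<pi> ?m)" "R.hat Gl (\<pi> ?m) = 0"
    using right_weight[OF split_p0(7)] split_p0(9) R.pi_act_pi[where g = Gl and x = ?m]
    by (simp_all add: R.hat_def pi_props(3))
  show ?thesis
  proof (rule adjoin_products[OF _ _ _ _ _ _ _ _ split_p0(10) c0_nonzero])
    let ?X = "(\<lambda>k. (L.hat Ge ^^ k) (\<pi> ?m)) ` {..n}" and ?Y = "(\<lambda>k. (R.hat Ge ^^ k) (\<pi> ?m)) ` {..n}"
    show "finite ?X" "finite ?Y" "card ?X \<le> n + 1" "card ?Y \<le> n + 1"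
      using card_image_atMost by simp_all
    show "\<pi> ?m \<in> ?X" "\<pi> ?m \<in> ?Y" by (rule image_eqI[of _ _ 0]; simp)+
    show "fgen g * x \<in> fs.span (?X \<union> J)" if "x \<in> ?X" for g x
      using L.mm.lowest_killed_stable[OF L] that by (rule L.act_stable)
    show "x * fgen g \<in> fs.span (?Y \<union> J)" if "x \<in> ?Y" for g x
    proof -
      have "x * fgen (swap (swap g)) \<in> fs.span (?Y \<union> J)"
        using R.mm.lowest_killed_stable[OF R] that by (rule R.act_stable)
      then show ?thesis by (simp only: swap_swap)
    qed
  qed
qed

text \<open>Raising \<open>p0\<close> by e^n lands in the highest weight space, on which
  \<open>pn\<close> acts by a nonzero scalar, so the result is 0 modulo J. By
  \<open>lowest_generated\<close>, f^n brings it back to a nonzero multiple of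
  \<open>p0\<close>.\<close>

lemma p0_mem: assumes pn: "pn \<in> J" shows "p0 \<in> J"
proof -
  have w: "L.wt 0 (\<pi> p0)" using k_p0(1) by (intro left_weight) simp
  obtain c where c: "c \<noteq> 0" "(L.hat Gf ^^ n) ((L.hat Ge ^^ n) (\<pi> p0)) = fsc c (\<pi> p0)"
    using L.mm.lowest_generated[OF w] by blast
  define y where "y = (L.hat Ge ^^ n) (\<pi> p0)"
  have wy: "L.wt (int n) y" using L.mm.wt_E[OF w, of n] unfolding y_def by simp
  have "pn * y - fsc cn y \<in> J" unfolding pn_def cn_def by (rule kp_eigen_left[OF wt_left[OF wy]])
  from ideal2_diff[OF J ideal2_right[OF J pn] this] have "pn * y - (pn * y - fsc cn y) \<in> J" .
  moreover have "pn * y - (pn * y - fsc cn y) = fsc cn y" by simp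
  ultimately have "y \<in> J" using ideal2_scaleD[OF J cn_nonzero] by metis
  then have "y = 0" using wy pi_props(3)[of y] by (simp add: L.wt_def)
  then have "fsc c (\<pi> p0) = 0" using c(2) L.mm.F_zero by (simp only: y_def)
  then show ?thesis using c(1) pi_props(3) by simp
qed

text \<open>\<open>p0\<close> and \<open>pn\<close> are the product over the inner weights times k -
  v^n and k - v^(-n); their difference is a nonzero scalar multiple of this product.\<close>

lemma inner_mem: assumes n: "n > 0" and pn: "pn \<in> J" shows "kp n [1..<n] \<in> J"
proof -
  let ?a = "vv powi (2 * int n - int n)" and ?b = "vv powi (2 * int 0 - int n)"
  have "p0 = kp n [1..<n] * kp n [n]" unfolding p0_def using n by (simp add: kp_append)
  then have 1: "p0 = (k - fconst ?a) * kp n [1..<n]" by (simp add: kp_Cons kp_factor_commute)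
  have 2: "pn = (k - fconst ?b) * kp n [1..<n]"
    unfolding pn_def using n by (subst upt_conv_Cons) (simp_all add: kp_Cons)
  have "fsc (?b - ?a) (kp n [1..<n]) \<in> J"
    using ideal2_diff[OF J p0_mem[OF pn] pn] unfolding 1 2
    by (simp add: left_diff_distrib fs.scale_left_diff_distrib flip: fsc_def)
  moreover have "?b - ?a \<noteq> 0" using n vv_powi_inject[of "2 * int 0 - int n" "2 * int n - int n"] by simp
  ultimately show ?thesis using ideal2_scaleD[OF J] by blast
qed

end

text \<open>For the weights of n + 2 the squares belong to the ideals of l p and (1 - l) p for the
  highest weight, then to that of (1 - l) p for the lowest weight of the remaining range n. For n =
  1 the first two squares, 4 + 4, exhaust the algebra; for n = 0 the first one does.\<close>

fun adim :: "nat \<Rightarrow> nat" where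
  "adim 0 = 1"
| "adim (Suc 0) = 8"
| "adim (Suc (Suc n)) = (n + 3)\<^sup>2 + (2 * (n + 2))\<^sup>2 + (n + 1)\<^sup>2 + adim n"

theorem dimension_bound:
  assumes "quotient_relations J n" "(fgen Gl - 1) * kp n [1..<n + 1] \<in> J"
  shows "grown (adim n) J UNIV"
  using assms
proof (induction n arbitrary: J rule: adim.induct)
  case (1 J)
  interpret A: quotient_relations J 0 by (rule 1)
  obtain J1 where J1: "ideal2 J1" "grown 1 J J1" "fgen Gl * A.pn \<in> J1" using A.adjoin_highest_fixed by auto
  \<comment> \<open>For n = 0 both \<open>pn\<close> and the product in the hypothesis are empty, so
    l and l - 1 both lie in the enlarged ideal.\<close>
  have "(fgen Gl - 1) * 1 \<in> J1" using 1(2) grown_supset[OF J1(2)] by auto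
  then have "fgen Gl * 1 - (fgen Gl - 1) * 1 \<in> J1"
    using J1(3) by (intro ideal2_diff[OF J1(1)]) (simp_all add: A.pn_def)
  then have "J1 = UNIV" using ideal2_eq_UNIV[OF J1(1)] by simp
  then show ?case using J1(2) by simp
next
  case (2 J)
  interpret A: quotient_relations J 1 using 2(1) by simp
  obtain J1 where J1: "ideal2 J1" "grown ((1 + 1)\<^sup>2) J J1" "fgen Gl * A.pn \<in> J1" using A.adjoin_highest_fixed by blast
  interpret B: quotient_relations J1 1 by (rule A.extend[OF J1(1) grown_supset[OF J1(2)]])
  have low: "(fgen Gl - 1) * B.p0 \<in> J1" using 2(2) grown_supset[OF J1(2)] unfolding B.p0_def by auto
  obtain J2 where J2: "ideal2 J2" "grown ((2 * 1)\<^sup>2) J1 J2" "B.pn - fgen Gl * B.pn \<in> J2"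
    using B.adjoin_highest_killed[OF low zero_less_one] by blast
  interpret C: quotient_relations J2 1 by (rule B.extend[OF J2(1) grown_supset[OF J2(2)]])
  have "fgen Gl * B.pn \<in> J2" using J1(3) grown_supset[OF J2(2)] unfolding A.pn_def B.pn_def by blast
  then have "C.pn \<in> J2" using ideal2_add[OF J2(1) J2(3)] unfolding B.pn_def C.pn_def by fastforce
  then have "J2 = UNIV" using C.inner_mem ideal2_eq_UNIV[OF J2(1)] by simp
  then show ?case using grown_trans[OF J1(2) J2(2)] by (simp add: power2_eq_square)
next
  case (3 n J)
  let ?n = "Suc (Suc n)"
  interpret A: quotient_relations J ?n by (rule 3(2))
  obtain J1 where J1: "ideal2 J1" "grown ((?n + 1)\<^sup>2) J J1" "fgen Gl * A.pn \<in> J1" using A.adjoin_highest_fixed by blast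
  interpret B: quotient_relations J1 ?n by (rule A.extend[OF J1(1) grown_supset[OF J1(2)]])
  have low: "(fgen Gl - 1) * B.p0 \<in> J1" using 3(3) grown_supset[OF J1(2)] unfolding B.p0_def by blast
  obtain J2 where J2: "ideal2 J2" "grown ((2 * ?n)\<^sup>2) J1 J2" "B.pn - fgen Gl * B.pn \<in> J2"
    using B.adjoin_highest_killed[OF low] by blast
  interpret C: quotient_relations J2 ?n by (rule B.extend[OF J2(1) grown_supset[OF J2(2)]])
  have "fgen Gl * B.pn \<in> J2" using J1(3) grown_supset[OF J2(2)] unfolding A.pn_def B.pn_def by blast
  then have "C.pn \<in> J2" using ideal2_add[OF J2(1) J2(3)] unfolding B.pn_def C.pn_def by fastforce
  then have "kp ?n [1..<?n] \<in> J2" using C.inner_mem by blast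
  \<comment> \<open>The product over the inner weights is P_n(k) for the reduced n, so the induction
    can continue in this quotient.\<close>
  then have "kp n [0..<n + 1] \<in> J2" using kp_shift[of n 0 "n + 1"] by simp
  then interpret D: quotient_relations J2 n using J2(1) C.rels by unfold_locales
  obtain J3 where J3: "ideal2 J3" "grown ((n + 1)\<^sup>2) J2 J3" "D.p0 - fgen Gl * D.p0 \<in> J3"
    using D.adjoin_lowest_killed by blast
  have q: "quotient_relations J3 n" by (rule D.extend[OF J3(1) grown_supset[OF J3(2)]])
  have "(fgen Gl - 1) * kp n [1..<n + 1] = - 1 * (D.p0 - fgen Gl * D.p0)"
    by (simp add: D.p0_def left_diff_distrib)
  then have "(fgen Gl - 1) * kp n [1..<n + 1] \<in> J3" using ideal2_left[OF J3(1) J3(3), of "- 1"] by (simp only:)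
  then have "grown (adim n) J3 UNIV" by (rule 3(1)[OF q])
  from grown_trans[OF J1(2) grown_trans[OF J2(2) grown_trans[OF J3(2) this]]]
  show ?case by (rule grown_mono) (simp add: algebra_simps)
qed

section \<open>Counting orbit types\<close>

lemma card_four: "card {(a, b, c, x). a + b + c + x = (n :: nat)} = n + 3 choose 3"
proof -
  have "bij_betw (\<lambda>(a, b, c, x). [a, b, c, x]) {(a, b, c, x). a + b + c + x = n} {l. size l = 4 \<and> sum_list l = n}"
    by (rule bij_betwI[where g = "\<lambda>l. (l ! 0, l ! 1, l ! 2, l ! 3)"]) (auto simp: numeral_eq_Suc length_Suc_conv)
  then have "card {(a, b, c, x). a + b + c + x = n} = card {l. size l = 4 \<and> sum_list l = n}" by (rule bij_betw_same_card)
  also have "\<dots> = n + 3 choose n" by (subst card_length_sum_list) (simp add: add.commute)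
  finally show ?thesis using binomial_symmetric[of n "n + 3"] by simp
qed

lemma six_choose_3: "6 * (n + 3 choose 3) = (n + 1) * (n + 2) * (n + 3)"
proof -
  have "3 * (n + 3 choose 3) = (n + 3) * (n + 2 choose 2)"
    using Suc_times_binomial[of 2 "n + 2"] by (simp add: numeral_eq_Suc)
  moreover have "2 * (n + 2 choose 2) = (n + 2) * (n + 1)"
    using Suc_times_binomial[of 1 "n + 1"] by (simp add: numeral_eq_Suc)
  ultimately have "6 * (n + 3 choose 3) = (n + 3) * ((n + 2) * (n + 1))" by (metis mult.assoc mult.left_commute mult_2 numeral_Bit0)
  then show ?thesis by (simp add: algebra_simps)
qed


lemma card_four_shift: "card {(a, b, c, x). a + b + c + x + j = (n :: nat)} = (if j \<le> n then n - j + 3 choose 3 else 0)"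
proof (cases "j \<le> n")
  case True
  then have "{(a, b, c, x). a + b + c + x + j = n} = {(a, b, c, x). a + b + c + x = n - j}" by auto
  then show ?thesis using True card_four[of "n - j"] by simp
next
  case False
  then have "{(a, b, c, x). a + b + c + x + j = n} = {}" by auto
  then show ?thesis using False by (simp only: card.empty if_False)
qed

text \<open>A decorated entry is at least 1, and lowering it by 1 leaves an arbitrary matrix. Four
  decorations mark one entry, and \<open>Dx\<close> marks two.\<close>

lemma card_Ix_eq: "card (Ix n) = (n + 3 choose 3) + 4 * (if 1 \<le> n then n - 1 + 3 choose 3 else 0)
    + (if 2 \<le> n then n - 2 + 3 choose 3 else 0)"
proof -
  define S where "S j = {(a, b, c, x). a + b + c + x + j = (n :: nat)}" for j
  define h :: "dtype \<Rightarrow> nat \<times> nat \<times> nat \<times> nat \<Rightarrow> ix" where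
    "h g = (\<lambda>(a, b, c, x). case g of D0 \<Rightarrow> (a, b, c, x, g) | D11 \<Rightarrow> (Suc a, b, c, x, g) | D12 \<Rightarrow> (a, Suc b, c, x, g)
      | D21 \<Rightarrow> (a, b, Suc c, x, g) | Dx \<Rightarrow> (a, Suc b, Suc c, x, g) | D22 \<Rightarrow> (a, b, c, Suc x, g))" for g
  have inj: "inj_on (h g) A" for g A
    by (cases g) (auto simp: h_def inj_on_def)
  define m where "m g = (case g of D0 \<Rightarrow> 0 | Dx \<Rightarrow> 2 | _ \<Rightarrow> (1 :: nat))" for g
  have part: "{z \<in> Ix n. snd (snd (snd (snd z))) = g} = h g ` S (m g)" for g
  proof (intro equalityI subsetI)
    fix z assume z: "z \<in> {z \<in> Ix n. snd (snd (snd (snd z))) = g}"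
    obtain a b c x where a: "z = (a, b, c, x, g)" using z by (cases z) auto
    show "z \<in> h g ` S (m g)"
      by (rule image_eqI[of _ _ "(a - (if g = D11 then 1 else 0), b - (if g = D12 \<or> g = Dx then 1 else 0),
          c - (if g = D21 \<or> g = Dx then 1 else 0), x - (if g = D22 then 1 else 0))"])
        (use z a in \<open>cases g; simp add: h_def m_def S_def Ix_def\<close>)+
  qed (cases g; auto simp: h_def m_def S_def Ix_def)
  have U: "(UNIV :: dtype set) = {D0, D11, D12, D21, Dx, D22}" using dtype.exhaust by auto
  have "Ix n = (\<Union>g\<in>UNIV. {z \<in> Ix n. snd (snd (snd (snd z))) = g})" by auto
  also have "card \<dots> = (\<Sum>g\<in>UNIV. card {z \<in> Ix n. snd (snd (snd (snd z))) = g})"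
    by (rule card_UN_disjoint) (auto simp: U finite_Ix)
  also have "\<dots> = (\<Sum>g\<in>UNIV. card (S (m g)))" unfolding part by (simp add: card_image inj)
  finally show ?thesis unfolding U S_def card_four_shift by (simp add: m_def)
qed

text \<open>The difference of the binomials (m + 5 over 3) and (m + 3 over 3) is (m + 3)^2. Taken at
  m = n, n - 1 and n - 2 for the three summands of \<open>card_Ix_eq\<close>, it gives the three
  squares in \<open>adim\<close>.\<close>

lemma card_Ix: "card (Ix n) = adim n"
proof (induction n rule: adim.induct)
  case (3 n)
  have six: "6 * (m + 2 + 3 choose 3) = 6 * (m + 3 choose 3) + 6 * (m + 3)\<^sup>2" for m
    unfolding six_choose_3 by (simp add: power2_eq_square algebra_simps)
  have r: "m + 2 + 3 choose 3 = (m + 3 choose 3) + (m + 3)\<^sup>2" for m using six[of m] by linarith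
  consider "n = 0" | "n = 1" | k where "n = k + 2"
    by (metis One_nat_def add_2_eq_Suc' not0_implies_Suc)
  then have "card (Ix (n + 2)) = (n + 3)\<^sup>2 + (2 * (n + 2))\<^sup>2 + (n + 1)\<^sup>2 + card (Ix n)"
  proof cases
    case 3
    then show ?thesis unfolding card_Ix_eq using r[of n] r[of "n - 1"] r[of "n - 2"]
      by (simp add: power2_eq_square algebra_simps)
  qed (simp_all add: card_Ix_eq numeral_eq_Suc)
  then show ?case using 3 by simp
qed (simp_all add: card_Ix_eq numeral_eq_Suc)

section \<open>Convolution and structure polynomials\<close>

text \<open>The eigenvalues of k and the powers of v attached to the other generators are kept apart
  in \<open>ws\<close>, which leaves integer polynomials in t here.\<close>

fun oper :: "gen \<Rightarrow> 'c::comm_ring_1 \<Rightarrow> (ix \<Rightarrow> 'c) \<Rightarrow> ix \<Rightarrow> 'c" where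
  "oper Ge t \<phi> z = opE t \<phi> z"
| "oper Gf t \<phi> z = opF t \<phi> z"
| "oper Gl t \<phi> z = opL t \<phi> z"
| "oper Gk t \<phi> z = \<phi> z"
| "oper Gki t \<phi> z = \<phi> z"

lemma oper_cong:
  assumes "z \<in> Ix d" "\<And>y. y \<in> Ix d \<Longrightarrow> \<phi> y = \<psi> y"
  shows "oper g t \<phi> z = oper g t \<psi> z"
  using assms opE_cong[of z \<phi> \<psi> t] opF_cong[of z \<phi> \<psi> t] opL_cong[of z \<phi> \<psi> t]
  by (cases g) (simp_all add: Ix_iff)

text \<open>The coefficients are polynomials in t over the integers. The homomorphisms in question
  are evaluation at q and the substitution q = v^2.\<close>

lemma oper_hom:
  fixes h :: "'a::comm_ring_1 \<Rightarrow> 'b::comm_ring_1"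
  assumes h: "\<And>x y. h (x + y) = h x + h y" "\<And>x y. h (x * y) = h x * h y" "h 1 = 1"
  shows "h (oper g t \<phi> z) = oper g (h t) (\<lambda>y. h (\<phi> y)) z"
proof -
  have z: "h 0 = 0" using h(1)[of 0 0] by simp
  have m: "h (x - y) = h x - h y" for x y using h(1)[of "x - y" y] by (simp add: algebra_simps)
  have p: "h (x ^ n) = h x ^ n" for x n by (induction n) (simp_all add: h)
  have gn: "h (gn x n) = gn (h x) n" for x n by (induction n) (simp_all add: gn_Suc h z p)
  obtain a b c x ty where zz: "z = (a, b, c, x, ty)" by (metis prod.exhaust)
  show ?thesis unfolding zz by (cases g; cases ty) (simp_all add: h m p gn)
qed

lemma oper_add: "oper g t (\<lambda>y. \<phi> y + \<psi> y) z = oper g t \<phi> z + oper g t \<psi> z"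
  and oper_scale: "oper g t (\<lambda>y. k * \<phi> y) z = k * oper g t \<phi> z"
proof -
  obtain a b c x ty where zz: "z = (a, b, c, x, ty)" by (metis prod.exhaust)
  show "oper g t (\<lambda>y. \<phi> y + \<psi> y) z = oper g t \<phi> z + oper g t \<psi> z"
    unfolding zz by (cases g; cases ty) (simp_all add: algebra_simps)
  show "oper g t (\<lambda>y. k * \<phi> y) z = k * oper g t \<phi> z"
    unfolding zz by (cases g; cases ty) (simp_all add: algebra_simps)
qed

lemma oper_sum: "oper g t (\<lambda>y. \<Sum>i\<in>A. k i * \<phi> i y) z = (\<Sum>i\<in>A. k i * oper g t (\<phi> i) z)"
proof (induction A rule: infinite_finite_induct)
  case (insert i A)
  then show ?case by (simp add: oper_add oper_scale)
qed (use oper_scale[of g t 0] in simp_all)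

context fspace begin

definition ct :: "config \<Rightarrow> ix" where
  "ct t = (case t of (F, G, w) \<Rightarrow> V.ctype F G w)"

text \<open>The geometric counterpart of \<open>oper\<close>, for arbitrary functions of
  configurations.\<close>

fun gop :: "gen \<Rightarrow> (config \<Rightarrow> int) \<Rightarrow> config \<Rightarrow> int" where
  "gop Ge \<alpha> (F, G, w) = (\<Sum>H\<in>V.hyper F. \<alpha> (H, G, w))"
| "gop Gf \<alpha> (F, G, w) = (\<Sum>H\<in>V.overs F. \<alpha> (H, G, w))"
| "gop Gl \<alpha> (F, G, w) = (\<Sum>u\<in>F. \<alpha> (F, G, w \<ominus>\<^bsub>Vsp R d\<^esub> u))"
| "gop Gk \<alpha> (F, G, w) = \<alpha> (F, G, w)"
| "gop Gki \<alpha> (F, G, w) = \<alpha> (F, G, w)"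

lemma configs_iff: "(F, G, w) \<in> configs R d \<longleftrightarrow> V.sub F \<and> V.sub G \<and> w \<in> carrier (Vsp R d)"
  unfolding configs_def flags_eq by auto

lemma ct_Ix: "t \<in> configs R d \<Longrightarrow> ct t \<in> Ix d"
  using V.ctype_Ix dimn_V by (cases t) (simp add: configs_iff ct_def)

lemma ct_surj: assumes "z \<in> Ix d" obtains t where "t \<in> configs R d" "ct t = z"
proof -
  obtain F G w where "V.sub F" "V.sub G" "w \<in> carrier (Vsp R d)" "V.ctype F G w = z"
    using exists_ctype[OF assms] by blast
  then show thesis using that[of "(F, G, w)"] by (simp add: ct_def configs_iff)
qed

lemma gop_ct: "t \<in> configs R d \<Longrightarrow> gop g (\<lambda>t. \<phi> (ct t)) t = oper g (int V.q) \<phi> (ct t)"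
  using V.sum_hyper[where \<phi> = \<phi>] V.sum_overs[where \<phi> = \<phi>] V.sum_translates[where \<phi> = \<phi>]
  by (cases t; cases g) (simp_all add: configs_iff ct_def)

lemma gop_cong:
  assumes t: "t \<in> configs R d" and eq: "\<And>t. t \<in> configs R d \<Longrightarrow> \<alpha> t = \<beta> t"
  shows "gop g \<alpha> t = gop g \<beta> t"
proof -
  obtain F G w where tt: "t = (F, G, w)" by (metis prod.exhaust)
  have F: "V.sub F" "V.sub G" "w \<in> carrier (Vsp R d)" using t by (simp_all add: tt configs_iff)
  show ?thesis
  proof (cases g)
    case Ge
    then show ?thesis unfolding tt using F by (simp add: V.hyper_def eq configs_iff)
  next
    case Gf
    then show ?thesis unfolding tt using F by (simp add: V.overs_def eq configs_iff)
  next
    case Gl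
    have "w \<ominus>\<^bsub>Vsp R d\<^esub> u \<in> carrier (Vsp R d)" if "u \<in> F" for u
      using V.M.minus_closed[OF F(3)] V.sub_subset[OF F(1)] that by blast
    then show ?thesis unfolding tt using F Gl by (simp add: eq configs_iff)
  qed (use t eq in \<open>simp_all add: tt\<close>)
qed

lemma conv_cong:
  assumes t: "t \<in> configs R d" and eq: "\<And>t. t \<in> configs R d \<Longrightarrow> \<alpha> t = \<alpha>' t"
    "\<And>t. t \<in> configs R d \<Longrightarrow> \<beta> t = \<beta>' t"
  shows "conv R d \<alpha> \<beta> t = conv R d \<alpha>' \<beta>' t"
proof -
  obtain F G w where tt: "t = (F, G, w)" by (metis prod.exhaust)
  have F: "V.sub F" "V.sub G" "w \<in> carrier (Vsp R d)" using t by (simp_all add: tt configs_iff)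
  show ?thesis unfolding tt conv_def
    by (simp, intro sum.cong refl arg_cong2[of _ _ _ _ "(*)"] eq; simp add: configs_iff flags_eq F)
qed

text \<open>The operators affect only the left factor of a convolution, so they commute with its
  sums; for \<open>Gl\<close> the summation variable is translated by x.\<close>

lemma conv_gop:
  assumes t: "t \<in> configs R d"
  shows "conv R d (gop g \<alpha>) \<beta> t = gop g (conv R d \<alpha> \<beta>) t"
proof -
  obtain F G w where tt: "t = (F, G, w)" by (metis prod.exhaust)
  have F: "V.sub F" "V.sub G" "w \<in> carrier (Vsp R d)" using t by (simp_all add: tt configs_iff)
  have sw: "(\<Sum>F'\<in>A. \<Sum>u\<in>B. (\<Sum>H\<in>C. k H F' u) * m F' u) = (\<Sum>H\<in>C. \<Sum>F'\<in>A. \<Sum>u\<in>B. k H F' u * m F' u)"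
    for A :: "vec_elt set set" and B :: "vec_elt set" and C :: "'z set" and k and m :: "_ \<Rightarrow> _ \<Rightarrow> int"
  proof -
    have "(\<Sum>F'\<in>A. \<Sum>u\<in>B. (\<Sum>H\<in>C. k H F' u) * m F' u) = (\<Sum>F'\<in>A. \<Sum>H\<in>C. \<Sum>u\<in>B. k H F' u * m F' u)"
      by (intro sum.cong refl) (simp only: sum_distrib_right sum.swap[of _ C])
    also have "\<dots> = (\<Sum>H\<in>C. \<Sum>F'\<in>A. \<Sum>u\<in>B. k H F' u * m F' u)" by (rule sum.swap)
    finally show ?thesis .
  qed
  show ?thesis
  proof (cases g)
    case Gl
    have "(\<Sum>u\<in>carrier (Vsp R d). \<alpha> (F, F', u \<ominus>\<^bsub>Vsp R d\<^esub> x) * \<beta> (F', G, w \<ominus>\<^bsub>Vsp R d\<^esub> u))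
      = (\<Sum>u\<in>carrier (Vsp R d). \<alpha> (F, F', u) * \<beta> (F', G, w \<ominus>\<^bsub>Vsp R d\<^esub> x \<ominus>\<^bsub>Vsp R d\<^esub> u))"
      if x: "x \<in> F" for x F'
    proof -
      have xV: "x \<in> carrier (Vsp R d)" using V.sub_subset[OF F(1)] x by blast
      show ?thesis
      proof (rule sum.reindex_bij_witness[of _ "\<lambda>u. u \<oplus>\<^bsub>Vsp R d\<^esub> x" "\<lambda>u. u \<ominus>\<^bsub>Vsp R d\<^esub> x"])
        fix u assume u: "u \<in> carrier (Vsp R d)"
        have nx: "V.vneg x \<in> carrier (Vsp R d)" and nu: "V.vneg u \<in> carrier (Vsp R d)" using xV u by simp_all
        have 1: "u \<ominus>\<^bsub>Vsp R d\<^esub> x \<oplus>\<^bsub>Vsp R d\<^esub> x = u"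
          unfolding a_minus_def using V.M.a_assoc[OF u nx xV] V.M.l_neg[OF xV] V.M.r_zero[OF u] by (simp only:)
        have 2: "u \<oplus>\<^bsub>Vsp R d\<^esub> x \<ominus>\<^bsub>Vsp R d\<^esub> x = u"
          unfolding a_minus_def using V.M.a_assoc[OF u xV nx] V.M.r_neg[OF xV] V.M.r_zero[OF u] by (simp only:)
        have "V.vneg (u \<ominus>\<^bsub>Vsp R d\<^esub> x) = x \<oplus>\<^bsub>Vsp R d\<^esub> V.vneg u"
          unfolding a_minus_def V.M.minus_add[OF u nx] V.M.minus_minus[OF xV] by (rule V.M.a_comm[OF nu xV])
        then have 3: "w \<ominus>\<^bsub>Vsp R d\<^esub> x \<ominus>\<^bsub>Vsp R d\<^esub> (u \<ominus>\<^bsub>Vsp R d\<^esub> x) = w \<ominus>\<^bsub>Vsp R d\<^esub> u"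
          using V.M.a_assoc[OF F(3) nx V.M.a_closed[OF xV nu]] V.M.r_neg1[OF xV nu] by (simp only: a_minus_def)
        from 1 2 3 show "u \<ominus>\<^bsub>Vsp R d\<^esub> x \<oplus>\<^bsub>Vsp R d\<^esub> x = u" "u \<oplus>\<^bsub>Vsp R d\<^esub> x \<ominus>\<^bsub>Vsp R d\<^esub> x = u"
          "\<alpha> (F, F', u \<ominus>\<^bsub>Vsp R d\<^esub> x) * \<beta> (F', G, w \<ominus>\<^bsub>Vsp R d\<^esub> x \<ominus>\<^bsub>Vsp R d\<^esub> (u \<ominus>\<^bsub>Vsp R d\<^esub> x))
            = \<alpha> (F, F', u \<ominus>\<^bsub>Vsp R d\<^esub> x) * \<beta> (F', G, w \<ominus>\<^bsub>Vsp R d\<^esub> u)" by simp_all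
        show "u \<ominus>\<^bsub>Vsp R d\<^esub> x \<in> carrier (Vsp R d)" "u \<oplus>\<^bsub>Vsp R d\<^esub> x \<in> carrier (Vsp R d)"
          using u xV by simp_all
      qed
    qed
    then show ?thesis unfolding tt conv_def Gl by (simp add: sw)
  qed (simp_all add: tt conv_def sw)
qed

lemma charfun_ct: "z \<in> Ix d \<Longrightarrow> t \<in> configs R d \<Longrightarrow> charfun R d (mk z) t = \<delta> z (ct t)"
  using orbit_iff[of z] by (cases t) (simp add: charfun_def \<delta>_def ct_def configs_iff)

lemma rk_ct: "V.sub F \<Longrightarrow> V.sub G \<Longrightarrow> rk (ct (F, G, w)) = V.dimn F"
  using V.dimn_mono[of "F \<inter> G" F] V.sub_inter[of F G] by (simp add: ct_def V.ctype_def)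

lemma ct_unit:
  assumes F: "V.sub F" and G: "V.sub G" and u: "u \<in> carrier (Vsp R d)"
  shows "ct (F, G, u) = (r, 0, 0, d - r, D0) \<longleftrightarrow> G = F \<and> u = \<zero>\<^bsub>Vsp R d\<^esub> \<and> V.dimn F = r"
proof
  assume c: "ct (F, G, u) = (r, 0, 0, d - r, D0)"
  have s: "V.sub (F \<inter> G)" by (rule V.sub_inter[OF F G])
  have m: "V.dimn (F \<inter> G) \<le> V.dimn F" "V.dimn (F \<inter> G) \<le> V.dimn G"
    using V.dimn_mono[OF s F] V.dimn_mono[OF s G] by simp_all
  have d: "V.dimn (F \<inter> G) = r" "V.dimn F = r" "V.dimn G = r" "V.pos F G u = D0"
    using c m by (simp_all add: ct_def V.ctype_def)
  have "F \<inter> G = F" by (rule V.dimn_eq_imp_eq[OF s F]) (simp_all add: d)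
  moreover have "F \<inter> G = G" by (rule V.dimn_eq_imp_eq[OF s G]) (simp_all add: d)
  ultimately have "G = F" by metis
  then show "G = F \<and> u = \<zero>\<^bsub>Vsp R d\<^esub> \<and> V.dimn F = r"
    using d by (simp add: V.pos_def split: if_splits)
next
  assume a: "G = F \<and> u = \<zero>\<^bsub>Vsp R d\<^esub> \<and> V.dimn F = r"
  have "V.ssum F F = F" using V.ssum_least[OF F subset_refl subset_refl] V.ssum_upper1[OF F F] by blast
  then show "ct (F, G, u) = (r, 0, 0, d - r, D0)"
    using a by (simp add: ct_def V.ctype_def dimn_V V.pos_def)
qed

text \<open>Equal flags and the zero vector are forced by \<open>ct_unit\<close>, so a single
  summand survives.\<close>

lemma conv_unit:
  assumes t: "t \<in> configs R d"
  shows "conv R d (\<lambda>t. \<delta> (r, 0, 0, d - r, D0) (ct t)) \<beta> t = (if rk (ct t) = r then \<beta> t else 0)"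
proof -
  obtain F G w where tt: "t = (F, G, w)" by (metis prod.exhaust)
  have F: "V.sub F" "V.sub G" "w \<in> carrier (Vsp R d)" using t by (simp_all add: tt configs_iff)
  let ?u = "\<delta> (r, 0, 0, d - r, D0) :: ix \<Rightarrow> int"
  have u: "?u (ct (F, F', u)) = (if u = \<zero>\<^bsub>Vsp R d\<^esub> then if F' = F \<and> V.dimn F = r then 1 else 0 else 0)"
    if "F' \<in> {F. V.sub F}" "u \<in> carrier (Vsp R d)" for F' u
    using that ct_unit[OF F(1), of F' u r] by (simp add: \<delta>_def)
  have "conv R d (\<lambda>t. ?u (ct t)) \<beta> t = (\<Sum>F'\<in>{F. V.sub F}. \<Sum>u\<in>carrier (Vsp R d).
      (if u = \<zero>\<^bsub>Vsp R d\<^esub> then if F' = F \<and> V.dimn F = r then 1 else 0 else 0) * \<beta> (F', G, w \<ominus>\<^bsub>Vsp R d\<^esub> u))"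
    unfolding tt conv_def flags_eq by (simp only: prod.case) (intro sum.cong refl, simp only: u)
  also have "\<dots> = (\<Sum>F'\<in>{F. V.sub F}. \<Sum>u\<in>carrier (Vsp R d). if u = \<zero>\<^bsub>Vsp R d\<^esub> then
      (if F' = F then if V.dimn F = r then \<beta> (F', G, w \<ominus>\<^bsub>Vsp R d\<^esub> \<zero>\<^bsub>Vsp R d\<^esub>) else 0 else 0) else 0)"
    by (intro sum.cong refl) auto
  also have "\<dots> = (if V.dimn F = r then \<beta> (F, G, w \<ominus>\<^bsub>Vsp R d\<^esub> \<zero>\<^bsub>Vsp R d\<^esub>) else 0)"
    using F V.finite_subs V.finite_M by (simp add: sum.delta)
  also have "w \<ominus>\<^bsub>Vsp R d\<^esub> \<zero>\<^bsub>Vsp R d\<^esub> = w" using F(3) by (simp add: a_minus_def)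
  finally show ?thesis using rk_ct[OF F(1,2), of w] by (simp add: tt)
qed

end

section \<open>Integer polynomials tested at primes\<close>

lemma prime_fspace:
  assumes "prime p"
  shows "fspace (residue_ring (int p))" and "card (carrier (residue_ring (int p))) = p"
proof -
  interpret residues_prime p "residue_ring (int p)" by unfold_locales (simp_all add: assms)
  show "fspace (residue_ring (int p))" by unfold_locales (simp_all add: is_field)
  show "card (carrier (residue_ring (int p))) = p" by (simp add: res_carrier_eq)
qed

text \<open>The bound \<open>B\<close> leaves room for estimates that hold only at large
  primes.\<close>

lemma poly_eqI_primes:
  fixes f g :: "int poly"
  assumes "\<And>p :: nat. prime p \<Longrightarrow> B < p \<Longrightarrow> poly f (int p) = poly g (int p)"
  shows "f = g"
proof (rule ccontr)
  assume "f \<noteq> g"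
  then have "finite {x. poly (f - g) x = 0}" by (intro poly_roots_finite) simp
  moreover have "int ` {p. prime p \<and> B < p} \<subseteq> {x. poly (f - g) x = 0}" using assms by auto
  ultimately have "finite {p :: nat. prime p \<and> B < p}" using finite_imageD[of int] finite_subset by (metis inj_on_of_nat)
  then have "finite ({p. prime p \<and> B < p} \<union> {..B})" by simp
  moreover have "{p :: nat. prime p} \<subseteq> {p. prime p \<and> B < p} \<union> {..B}" by auto
  ultimately show False using primes_infinite finite_subset by blast
qed

text \<open>The remainder r has smaller degree than g, so |r(p)| < p^(deg g) \<le> g(p) for large p;
  divisibility of r(p) by g(p) then forces r(p) = 0 at infinitely many primes.\<close>

lemma dvd_of_dvd_at_primes:
  fixes g h :: "int poly"
  assumes g: "lead_coeff g = 1" and big: "\<And>p. int p ^ Polynomial.degree g \<le> poly g (int p)"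
    and dvd: "\<And>p :: nat. prime p \<Longrightarrow> poly g (int p) dvd poly h (int p)"
  shows "g dvd h"
proof -
  have g0: "g \<noteq> 0" using g by auto
  obtain s r where sr: "pseudo_divmod h g = (s, r)" by (metis prod.exhaust)
  \<comment> \<open>For a monic divisor pseudo-division is division with remainder.\<close>
  have eq: "h = g * s + r" and deg: "r = 0 \<or> Polynomial.degree r < Polynomial.degree g"
    using pseudo_divmod[OF g0 sr] g by simp_all
  define n where "n = Polynomial.degree g"
  define C where "C = (\<Sum>i\<le>Polynomial.degree r. \<bar>Polynomial.coeff r i\<bar>)"
  have "poly r (int p) = poly 0 (int p)" if p: "prime p" "nat C < p" for p
  proof (rule ccontr)
    assume nz: "poly r (int p) \<noteq> poly 0 (int p)"
    then have r0: "r \<noteq> 0" by auto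
    then have d: "Polynomial.degree r < n" using deg n_def by simp
    have C0: "C \<ge> 0" unfolding C_def by (simp add: sum_nonneg)
    have p1: "int p \<ge> 1" using prime_gt_1_nat[OF p(1)] by simp
    have "poly g (int p) dvd poly r (int p)" using dvd[OF p(1)] unfolding eq by (simp add: dvd_add_right_iff)
    then have "poly g (int p) \<le> \<bar>poly r (int p)\<bar>" using nz by (metis abs_ge_self dvd_imp_le_int order_trans poly_0)
    also have "\<dots> \<le> (\<Sum>i\<le>Polynomial.degree r. \<bar>Polynomial.coeff r i * int p ^ i\<bar>)" unfolding poly_altdef by (rule sum_abs)
    also have "\<dots> \<le> (\<Sum>i\<le>Polynomial.degree r. \<bar>Polynomial.coeff r i\<bar> * int p ^ (n - 1))"
      using p1 d by (intro sum_mono) (simp add: abs_mult mult_left_mono power_increasing)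
    also have "\<dots> = C * int p ^ (n - 1)" unfolding C_def by (simp add: sum_distrib_right)
    also have "\<dots> < int p * int p ^ (n - 1)" using p(2) p1 C0 by (intro mult_strict_right_mono) auto
    also have "\<dots> = int p ^ n" using d by (simp flip: power_Suc)
    also have "\<dots> \<le> poly g (int p)" using big n_def by simp
    finally show False by simp
  qed
  then have "r = 0" by (rule poly_eqI_primes)
  then show ?thesis using eq by simp
qed

lemma X_power: "[:0, 1 :: int:] ^ k = Polynomial.monom 1 k"
  by (simp add: monom_altdef)

lemma monic_gn: "lead_coeff (gn [:0, 1 :: int:] (Suc n)) = 1" "Polynomial.degree (gn [:0, 1 :: int:] (Suc n)) = n"
  "int p ^ n \<le> poly (gn [:0, 1:] (Suc n)) (int p)"
proof -
  have "Polynomial.degree (gn [:0, 1 :: int:] (Suc n)) = n \<and> lead_coeff (gn [:0, 1 :: int:] (Suc n)) = 1"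
  proof (induction n)
    case (Suc n)
    have "Polynomial.degree (gn [:0, 1 :: int:] (Suc n)) < Polynomial.degree (Polynomial.monom (1 :: int) (Suc n))"
      using Suc by (simp add: degree_monom_eq)
    moreover have "Polynomial.coeff (gn [:0, 1 :: int:] (Suc n)) n = 1" using Suc by metis
    ultimately show ?case
      using degree_add_eq_right lead_coeff_add_le
      by (subst (1 2 3) gn_Suc[of _ "Suc n"]) (simp add: X_power degree_monom_eq degree_add_eq_right lead_coeff_add_le coeff_eq_0)
  qed (simp add: gn_Suc)
  then show "lead_coeff (gn [:0, 1 :: int:] (Suc n)) = 1" "Polynomial.degree (gn [:0, 1 :: int:] (Suc n)) = n" by metis+
  have "0 \<le> poly (gn [:0, 1 :: int:] n) (int p)" by (induction n) (simp_all add: gn_Suc)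
  then show "int p ^ n \<le> poly (gn [:0, 1:] (Suc n)) (int p)" by (simp add: gn_Suc)
qed

lemma monic_X_power: "lead_coeff ([:0, 1 :: int:] ^ n) = 1" "Polynomial.degree ([:0, 1 :: int:] ^ n) = n"
  unfolding X_power by (simp_all add: degree_monom_eq)

text \<open>A polynomial for each type, read as an integer function of configurations over R by
  evaluation at q.\<close>

definition evp :: "int ring \<Rightarrow> nat \<Rightarrow> (ix \<Rightarrow> int poly) \<Rightarrow> config \<Rightarrow> int" where
  "evp R d \<phi> t = poly (\<phi> (fspace.ct R d t)) (int (card (carrier R)))"

context fspace begin

lemma evp_oper: "t \<in> configs R d \<Longrightarrow> evp R d (oper g [:0, 1:] \<phi>) t = gop g (evp R d \<phi>) t"
  using oper_hom[of "\<lambda>f. poly f (int V.q)" g "[:0, 1:]" \<phi> "ct t"]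
    gop_ct[of t g "\<lambda>y. poly (\<phi> y) (int V.q)"]
  by (simp add: evp_def[abs_def] V.q_def)

lemma evp_delta: "evp R d (\<delta> y) t = \<delta> y (ct t)"
  by (simp add: evp_def \<delta>_def)

lemma conv_sum: "conv R d (\<lambda>t. \<Sum>i\<in>A. k i * \<alpha> i t) \<beta> t = (\<Sum>i\<in>A. k i * conv R d (\<alpha> i) \<beta> t)"
proof (induction A rule: infinite_finite_induct)
  case (insert i A)
  then show ?case by (cases t) (simp add: conv_def sum.distrib sum_distrib_left algebra_simps)
qed (cases t; simp add: conv_def)+

end

text \<open>One family \<open>\<kappa>\<close> of polynomials has to serve all finite fields at
  once; this uniformity turns its members into structure polynomials.\<close>

definition conv_family :: "nat \<Rightarrow> ix \<Rightarrow> (ix \<Rightarrow> int poly) set" where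
  "conv_family d z = {\<phi>. \<exists>\<kappa>. \<forall>R. fspace R \<longrightarrow>
     (\<forall>t\<in>configs R d. conv R d (evp R d \<phi>) (charfun R d (mk z)) t = evp R d \<kappa> t)}"

lemma conv_familyI:
  assumes "\<And>R t. fspace R \<Longrightarrow> t \<in> configs R d \<Longrightarrow> conv R d (evp R d \<phi>) (charfun R d (mk z)) t = evp R d \<kappa> t"
  shows "\<phi> \<in> conv_family d z"
  unfolding conv_family_def using assms by blast

lemma conv_familyE:
  assumes "\<phi> \<in> conv_family d z"
  obtains \<kappa> where "\<And>R t. fspace R \<Longrightarrow> t \<in> configs R d \<Longrightarrow> conv R d (evp R d \<phi>) (charfun R d (mk z)) t = evp R d \<kappa> t"
  using assms unfolding conv_family_def by blast

lemma conv_family_oper: assumes "\<phi> \<in> conv_family d z" shows "oper g [:0, 1:] \<phi> \<in> conv_family d z"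
proof -
  obtain \<kappa> where k: "\<And>R t. fspace R \<Longrightarrow> t \<in> configs R d \<Longrightarrow> conv R d (evp R d \<phi>) (charfun R d (mk z)) t = evp R d \<kappa> t"
    using assms by (rule conv_familyE) blast
  show ?thesis
  proof (rule conv_familyI)
    fix R t assume R: "fspace R" and t: "t \<in> configs R d"
    interpret fspace R d by (rule R)
    have "conv R d (evp R d (oper g [:0, 1:] \<phi>)) (charfun R d (mk z)) t
        = conv R d (gop g (evp R d \<phi>)) (charfun R d (mk z)) t"
      by (rule conv_cong[OF t]) (simp_all add: evp_oper)
    also have "\<dots> = gop g (evp R d \<kappa>) t"
      unfolding conv_gop[OF t] by (rule gop_cong[OF t]) (rule k[OF R])
    finally show "conv R d (evp R d (oper g [:0, 1:] \<phi>)) (charfun R d (mk z)) t = evp R d (oper g [:0, 1:] \<kappa>) t"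
      using t by (simp add: evp_oper)
  qed
qed

lemma conv_family_linear:
  assumes "\<phi> \<in> conv_family d z" "\<psi> \<in> conv_family d z"
  shows "(\<lambda>y. a * \<phi> y + b * \<psi> y) \<in> conv_family d z"
proof -
  obtain \<kappa> where k: "\<And>R t. fspace R \<Longrightarrow> t \<in> configs R d \<Longrightarrow> conv R d (evp R d \<phi>) (charfun R d (mk z)) t = evp R d \<kappa> t"
    using assms(1) by (rule conv_familyE) blast
  obtain \<mu> where m: "\<And>R t. fspace R \<Longrightarrow> t \<in> configs R d \<Longrightarrow> conv R d (evp R d \<psi>) (charfun R d (mk z)) t = evp R d \<mu> t"
    using assms(2) by (rule conv_familyE) blast
  show ?thesis
  proof (rule conv_familyI)
    fix R t assume R: "fspace R" and t: "t \<in> configs R d"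
    interpret fspace R d by (rule R)
    let ?e = "\<lambda>f. poly f (int (card (carrier R)))"
    have "conv R d (evp R d (\<lambda>y. a * \<phi> y + b * \<psi> y)) (charfun R d (mk z)) t
      = ?e a * conv R d (evp R d \<phi>) (charfun R d (mk z)) t + ?e b * conv R d (evp R d \<psi>) (charfun R d (mk z)) t"
      by (cases t) (simp add: conv_def evp_def sum.distrib sum_distrib_left algebra_simps)
    then show "conv R d (evp R d (\<lambda>y. a * \<phi> y + b * \<psi> y)) (charfun R d (mk z)) t = evp R d (\<lambda>y. a * \<kappa> y + b * \<mu> y) t"
      by (simp add: k[OF R t] m[OF R t]) (simp add: evp_def)
  qed
qed

text \<open>Every orbit type occurs over every prime field, so the values of the quotient are divisible at
  every prime, hence as polynomials.\<close>

lemma conv_family_divide: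
  assumes g: "lead_coeff g = 1" and big: "\<And>p. int p ^ Polynomial.degree g \<le> poly g (int p)"
    and "(\<lambda>y. g * \<phi> y) \<in> conv_family d z"
  shows "\<phi> \<in> conv_family d z"
proof -
  obtain \<kappa> where k: "\<And>R t. fspace R \<Longrightarrow> t \<in> configs R d \<Longrightarrow> conv R d (evp R d (\<lambda>y. g * \<phi> y)) (charfun R d (mk z)) t = evp R d \<kappa> t"
    using assms(3) by (rule conv_familyE) blast
  have k': "poly g (int (card (carrier R))) * conv R d (evp R d \<phi>) (charfun R d (mk z)) t = evp R d \<kappa> t"
    if R: "fspace R" and t: "t \<in> configs R d" for R t
    unfolding k[OF R t, symmetric] by (cases t) (simp add: conv_def evp_def sum_distrib_left algebra_simps)
  have "g dvd \<kappa> y" if y: "y \<in> Ix d" for y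
  proof (rule dvd_of_dvd_at_primes[OF g big])
    fix p :: nat assume p: "prime p"
    interpret fspace "residue_ring (int p)" d by (rule prime_fspace[OF p])
    obtain t where t: "t \<in> configs (residue_ring (int p)) d" "ct t = y" using ct_surj[OF y] .
    show "poly g (int p) dvd poly (\<kappa> y) (int p)"
      using k'[OF fspace_axioms t(1)] t(2) unfolding evp_def prime_fspace(2)[OF p] by (metis dvd_triv_left)
  qed
  then obtain \<mu> where m: "\<And>y. y \<in> Ix d \<Longrightarrow> \<kappa> y = g * \<mu> y" unfolding dvd_def by metis
  show ?thesis
  proof (rule conv_familyI)
    fix R t assume R: "fspace R" and t: "t \<in> configs R d"
    interpret fspace R d by (rule R)
    let ?q = "card (carrier R)"
    have "0 < int ?q ^ Polynomial.degree g" using V.q_ge2 unfolding V.q_def by simp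
    then have "poly g (int ?q) \<noteq> 0" using big[of ?q] by linarith
    moreover have "poly g (int ?q) * conv R d (evp R d \<phi>) (charfun R d (mk z)) t = poly g (int ?q) * evp R d \<mu> t"
      unfolding k'[OF R t] using m[OF ct_Ix[OF t]] by (simp add: evp_def)
    ultimately show "conv R d (evp R d \<phi>) (charfun R d (mk z)) t = evp R d \<mu> t" by simp
  qed
qed

lemma conv_family_generation: assumes z: "z \<in> Ix d" shows "generation [:0, 1:] d (conv_family d z)"
proof
  note lin = conv_family_linear
  show zero: "(\<lambda>_. 0) \<in> conv_family d z"
  proof (rule conv_familyI)
    fix R t show "conv R d (evp R d (\<lambda>_. 0)) (charfun R d (mk z)) t = evp R d (\<lambda>_. 0) t"
      by (cases t) (simp add: conv_def evp_def)
  qed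
  fix \<phi> \<psi> :: "ix \<Rightarrow> int poly" and n r :: nat and k :: "int poly"
  show "\<phi> \<in> conv_family d z \<Longrightarrow> \<psi> \<in> conv_family d z \<Longrightarrow> (\<lambda>y. \<phi> y + \<psi> y) \<in> conv_family d z"
    using lin[of \<phi> d z \<psi> 1 1] by simp
  show "\<phi> \<in> conv_family d z \<Longrightarrow> (\<lambda>y. k * \<phi> y) \<in> conv_family d z"
    using lin[of \<phi> d z "\<lambda>_. 0" k 0] zero by simp
  have "opE t \<phi> = oper Ge t \<phi>" "opF t \<phi> = oper Gf t \<phi>" "opL t \<phi> = oper Gl t \<phi>" for t by auto
  then show "\<phi> \<in> conv_family d z \<Longrightarrow> opE [:0, 1:] \<phi> \<in> conv_family d z"
    "\<phi> \<in> conv_family d z \<Longrightarrow> opF [:0, 1:] \<phi> \<in> conv_family d z"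
    "\<phi> \<in> conv_family d z \<Longrightarrow> opL [:0, 1:] \<phi> \<in> conv_family d z"
    using conv_family_oper by metis+
  show "\<psi> \<in> conv_family d z" if p: "\<phi> \<in> conv_family d z" "\<And>z. z \<in> Ix d \<Longrightarrow> \<psi> z = \<phi> z"
  proof -
    obtain \<kappa> where k: "\<And>R t. fspace R \<Longrightarrow> t \<in> configs R d \<Longrightarrow> conv R d (evp R d \<phi>) (charfun R d (mk z)) t = evp R d \<kappa> t"
      using p(1) by (rule conv_familyE) blast
    show ?thesis
    proof (rule conv_familyI)
      fix R t assume R: "fspace R" and t: "t \<in> configs R d"
      interpret fspace R d by (rule R)
      have "conv R d (evp R d \<psi>) (charfun R d (mk z)) t = conv R d (evp R d \<phi>) (charfun R d (mk z)) t"
        by (rule conv_cong[OF t]) (simp_all add: evp_def p(2) ct_Ix)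
      then show "conv R d (evp R d \<psi>) (charfun R d (mk z)) t = evp R d \<kappa> t" using k[OF R t] by simp
    qed
  qed
  show "\<phi> \<in> conv_family d z" if "(\<lambda>y. gn [:0, 1:] (Suc n) * \<phi> y) \<in> conv_family d z"
    by (rule conv_family_divide[OF monic_gn(1) _ that]) (simp only: monic_gn)
  show "\<phi> \<in> conv_family d z" if "(\<lambda>y. [:0, 1:] ^ n * \<phi> y) \<in> conv_family d z"
    by (rule conv_family_divide[OF monic_X_power(1) _ that]) (simp add: monic_X_power)
  show "\<delta> (r, 0, 0, d - r, D0) \<in> conv_family d z"
  proof (rule conv_familyI)
    fix R t assume R: "fspace R" and t: "t \<in> configs R d"
    interpret fspace R d by (rule R)
    have e: "evp R d (\<delta> (r, 0, 0, d - r, D0)) = (\<lambda>t. \<delta> (r, 0, 0, d - r, D0) (ct t))" by (rule ext) (rule evp_delta)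
    show "conv R d (evp R d (\<delta> (r, 0, 0, d - r, D0))) (charfun R d (mk z)) t
        = evp R d (\<lambda>y. if rk y = r then \<delta> z y else 0) t"
      unfolding e conv_unit[OF t] using charfun_ct[OF z t] by (simp add: evp_def \<delta>_def)
  qed
qed

lemma (in fspace) evp_charfun: "y \<in> Ix d \<Longrightarrow> t \<in> configs R d \<Longrightarrow> evp R d (\<delta> y) t = charfun R d (mk y) t"
  by (simp add: evp_delta charfun_ct)

lemma (in fspace) sum_charfun:
  assumes "t \<in> configs R d"
  shows "(\<Sum>Z\<in>Xi d. h Z * charfun R d Z t) = h (mk (ct t))"
proof -
  have "(\<Sum>Z\<in>Xi d. h Z * charfun R d Z t) = (\<Sum>z\<in>Ix d. h (mk z) * charfun R d (mk z) t)"
    unfolding Xi_eq by (subst sum.reindex) (auto simp: inj_on_def mk_inj)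
  also have "\<dots> = (\<Sum>z\<in>Ix d. if z = ct t then h (mk z) else 0)"
    using assms by (intro sum.cong refl) (auto simp: charfun_ct \<delta>_def)
  also have "\<dots> = h (mk (ct t))" using ct_Ix[OF assms] by (simp add: finite_Ix)
  finally show ?thesis .
qed

text \<open>By \<open>S_delta\<close> every \<open>\<delta> y\<close> belongs to the family of every
  z in \<open>Ix d\<close>, and over each field \<open>\<delta> y\<close> evaluates to a
  characteristic function.\<close>

theorem exists_struct_polys: "\<exists>c. is_struct_polys d c"
proof -
  have "\<exists>\<kappa>. \<forall>R t. fspace R \<longrightarrow> t \<in> configs R d \<longrightarrow> conv R d (evp R d (\<delta> y)) (charfun R d (mk z)) t = evp R d \<kappa> t"
    if "z \<in> Ix d" for y z
    using generation.S_delta[OF conv_family_generation[OF that], of y] conv_familyE by blast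
  note ex = this
  define \<kappa> where "\<kappa> y z = (SOME \<kappa>. \<forall>R t. fspace R \<longrightarrow> t \<in> configs R d \<longrightarrow>
      conv R d (evp R d (\<delta> y)) (charfun R d (mk z)) t = evp R d \<kappa> t)" for y z
  have k: "conv R d (evp R d (\<delta> y)) (charfun R d (mk z)) t = evp R d (\<kappa> y z) t"
    if "z \<in> Ix d" "fspace R" "t \<in> configs R d" for y z R t
    using someI_ex[OF ex[OF that(1), of y]] that(2,3) unfolding \<kappa>_def by blast
  define m where "m = inv_into UNIV mk"
  have m: "m (mk y) = y" for y unfolding m_def by (simp add: inj_def mk_inj)
  have "is_struct_polys d (\<lambda>x y z. \<kappa> (m x) (m y) (m z))"
    unfolding is_struct_polys_def
  proof (intro allI impI ballI)
    fix R :: "int ring" and x y t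
    assume R: "field R \<and> finite (carrier R)" and x: "x \<in> Xi d" and y: "y \<in> Xi d" and t: "t \<in> configs R d"
    interpret fspace R d using R by (simp add: fspace_def)
    obtain x' y' where xy: "x = mk x'" "x' \<in> Ix d" "y = mk y'" "y' \<in> Ix d" using x y unfolding Xi_eq by blast
    have "conv R d (charfun R d x) (charfun R d y) t = conv R d (evp R d (\<delta> x')) (charfun R d (mk y')) t"
      by (rule conv_cong[OF t]) (simp_all add: evp_charfun xy)
    also have "\<dots> = evp R d (\<kappa> x' y') t" by (rule k[OF xy(4) fspace_axioms t])
    finally show "conv R d (charfun R d x) (charfun R d y) t
      = (\<Sum>z\<in>Xi d. poly (\<kappa> (m x) (m y) (m z)) (int (card (carrier R))) * charfun R d z t)"
      unfolding sum_charfun[OF t] by (simp add: evp_def m xy)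
  qed
  then show ?thesis by blast
qed

text \<open>\<open>struct_poly\<close> is a choice, so facts about it are proved by evaluation at
  finite fields, where \<open>conv_charfun\<close> describes its values.\<close>

definition scp :: "nat \<Rightarrow> ix \<Rightarrow> ix \<Rightarrow> ix \<Rightarrow> int poly" where
  "scp d y z w = struct_poly d (mk y) (mk z) (mk w)"

context fspace begin

lemma conv_charfun:
  assumes "y \<in> Ix d" "z \<in> Ix d" "t \<in> configs R d"
  shows "conv R d (charfun R d (mk y)) (charfun R d (mk z)) t = evp R d (scp d y z) t"
proof -
  have "is_struct_polys d (struct_poly d)" unfolding struct_poly_def by (rule someI_ex[OF exists_struct_polys])
  moreover have "mk y \<in> Xi d" "mk z \<in> Xi d" using assms unfolding Xi_eq by simp_all
  ultimately show ?thesis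
    using assms(3) field_R finite_R unfolding is_struct_polys_def by (simp add: sum_charfun evp_def scp_def)
qed

end

text \<open>Left convolution by a generator commutes with right convolution by a basis element; over
  a prime field this is \<open>conv_gop\<close>.\<close>

lemma scp_oper:
  assumes y: "y \<in> Ix d" and z: "z \<in> Ix d" and w: "w \<in> Ix d"
  shows "(\<Sum>u\<in>Ix d. oper g [:0, 1:] (\<delta> y) u * scp d u z w) = oper g [:0, 1:] (scp d y z) w"
proof (rule poly_eqI_primes)
  fix p :: nat assume p: "prime p"
  define R where "R = residue_ring (int p)"
  interpret fspace R d unfolding R_def by (rule prime_fspace[OF p])
  have q: "card (carrier R) = p" unfolding R_def by (rule prime_fspace[OF p])
  obtain t where t: "t \<in> configs R d" "ct t = w" using ct_surj[OF w] .
  let ?k = "\<lambda>u. poly (oper g [:0, 1:] (\<delta> y) u) (int p)"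
  have "poly (\<Sum>u\<in>Ix d. oper g [:0, 1:] (\<delta> y) u * scp d u z w) (int p)
      = (\<Sum>u\<in>Ix d. ?k u * conv R d (charfun R d (mk u)) (charfun R d (mk z)) t)"
    by (simp add: poly_sum conv_charfun[OF _ z t(1)] evp_def t q)
  also have "\<dots> = conv R d (\<lambda>t. \<Sum>u\<in>Ix d. ?k u * charfun R d (mk u) t) (charfun R d (mk z)) t"
    by (rule conv_sum[symmetric])
  also have "\<dots> = conv R d (gop g (charfun R d (mk y))) (charfun R d (mk z)) t"
  proof (rule conv_cong[OF t(1)])
    fix t assume t: "t \<in> configs R d"
    have "(\<Sum>u\<in>Ix d. ?k u * charfun R d (mk u) t) = (\<Sum>u\<in>Ix d. if u = ct t then ?k u else 0)"
      using t by (intro sum.cong refl) (auto simp: charfun_ct \<delta>_def)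
    also have "\<dots> = evp R d (oper g [:0, 1:] (\<delta> y)) t" using ct_Ix[OF t] by (simp add: finite_Ix evp_def q)
    also have "\<dots> = gop g (evp R d (\<delta> y)) t" by (rule evp_oper[OF t])
    also have "\<dots> = gop g (charfun R d (mk y)) t" by (rule gop_cong[OF t]) (rule evp_charfun[OF y])
    finally show "(\<Sum>u\<in>Ix d. ?k u * charfun R d (mk u) t) = gop g (charfun R d (mk y)) t" .
  qed simp
  also have "\<dots> = gop g (evp R d (scp d y z)) t"
    unfolding conv_gop[OF t(1)] by (rule gop_cong[OF t(1)]) (rule conv_charfun[OF y z])
  also have "\<dots> = poly (oper g [:0, 1:] (scp d y z) w) (int p)"
    unfolding evp_oper[OF t(1), symmetric] by (simp add: evp_def t q)
  finally show "poly (\<Sum>u\<in>Ix d. oper g [:0, 1:] (\<delta> y) u * scp d u z w) (int p)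
    = poly (oper g [:0, 1:] (scp d y z) w) (int p)" .
qed

lemma scp_unit:
  assumes z: "z \<in> Ix d" and w: "w \<in> Ix d"
  shows "(\<Sum>r\<le>d. scp d (r, 0, 0, d - r, D0) z w) = \<delta> z w"
proof (rule poly_eqI_primes)
  fix p :: nat assume p: "prime p"
  define R where "R = residue_ring (int p)"
  interpret fspace R d unfolding R_def by (rule prime_fspace[OF p])
  have q: "card (carrier R) = p" unfolding R_def by (rule prime_fspace[OF p])
  obtain t where t: "t \<in> configs R d" "ct t = w" using ct_surj[OF w] .
  have "conv R d (charfun R d (mk (r, 0, 0, d - r, D0))) (charfun R d (mk z)) t = (if rk w = r then \<delta> z w else 0)"
    if r: "r \<le> d" for r
  proof -
    have i: "(r, 0, 0, d - r, D0) \<in> Ix d" using r by (simp add: Ix_def)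
    have "conv R d (charfun R d (mk (r, 0, 0, d - r, D0))) (charfun R d (mk z)) t
        = conv R d (\<lambda>t. \<delta> (r, 0, 0, d - r, D0) (ct t)) (charfun R d (mk z)) t"
      by (rule conv_cong[OF t(1)]) (simp_all only: charfun_ct[OF i])
    then show ?thesis unfolding conv_unit[OF t(1)] by (simp add: t charfun_ct[OF z t(1)])
  qed
  moreover have "conv R d (charfun R d (mk (r, 0, 0, d - r, D0))) (charfun R d (mk z)) t
      = poly (scp d (r, 0, 0, d - r, D0) z w) (int p)" if r: "r \<le> d" for r
    using conv_charfun[OF _ z t(1), of "(r, 0, 0, d - r, D0)"] r by (simp add: evp_def t q Ix_def)
  ultimately have "poly (\<Sum>r\<le>d. scp d (r, 0, 0, d - r, D0) z w) (int p) = (\<Sum>r\<le>d. if rk w = r then \<delta> z w else 0)"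
    unfolding poly_sum by (intro sum.cong refl) simp
  also have "\<dots> = \<delta> z w" using w by (cases w) (simp add: Ix_def)
  finally show "poly (\<Sum>r\<le>d. scp d (r, 0, 0, d - r, D0) z w) (int p) = poly (\<delta> z w) (int p)"
    by (simp add: \<delta>_def)
qed

section \<open>The action on the generic mirabolic Schur algebra\<close>

declare mk.simps [simp del]

lemma (in fspace) conv_rank:
  assumes u: "u \<in> Ix d" and t: "t \<in> configs R d" and ne: "rk u \<noteq> rk (ct t)"
  shows "conv R d (charfun R d (mk u)) \<beta> t = 0"
proof -
  obtain F G w where tt: "t = (F, G, w)" by (metis prod.exhaust)
  have F: "V.sub F" "V.sub G" "w \<in> carrier (Vsp R d)" using t by (simp_all add: tt configs_iff)
  have "charfun R d (mk u) (F, F', x) = 0" if "F' \<in> {F. V.sub F}" "x \<in> carrier (Vsp R d)" for F' x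
  proof -
    have c: "(F, F', x) \<in> configs R d" using that F by (simp add: configs_iff)
    have "ct (F, F', x) \<noteq> u" using rk_ct[OF F(1), of F' x] rk_ct[OF F(1,2), of w] that ne by (auto simp: tt)
    then show ?thesis using charfun_ct[OF u c] by (simp add: \<delta>_def)
  qed
  then show ?thesis unfolding tt conv_def flags_eq by simp
qed

text \<open>A convolution is evaluated at the first flag of its left factor, so a product of basis
  elements is supported in the rank of the left one.\<close>

lemma scp_rank:
  assumes u: "u \<in> Ix d" and z: "z \<in> Ix d" and w: "w \<in> Ix d" and ne: "rk u \<noteq> rk w"
  shows "scp d u z w = 0"
proof (rule poly_eqI_primes)
  fix p :: nat assume p: "prime p"
  define R where "R = residue_ring (int p)"
  interpret fspace R d unfolding R_def by (rule prime_fspace[OF p])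
  have q: "card (carrier R) = p" unfolding R_def by (rule prime_fspace[OF p])
  obtain t where t: "t \<in> configs R d" "ct t = w" using ct_surj[OF w] .
  show "poly (scp d u z w) (int p) = poly 0 (int p)"
    using conv_rank[OF u t(1)] conv_charfun[OF u z t(1)] ne by (simp add: evp_def t q)
qed

section \<open>Specialization at q = v^2\<close>

definition vsq :: ratfun where "vsq = vv powi 2"

definition spec :: "int poly \<Rightarrow> ratfun" where
  "spec f = poly (map_poly of_int f) vsq"

lemma spec_pCons: "spec (pCons a f) = of_int a + vsq * spec f"
  unfolding spec_def by (simp add: map_poly_pCons)

lemma spec_0 [simp]: "spec 0 = 0" by (simp add: spec_def)

lemma spec_1 [simp]: "spec 1 = 1" by (simp add: one_pCons spec_pCons)

lemma spec_X [simp]: "spec [:0, 1:] = vsq" by (simp add: spec_pCons)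

lemma spec_add: "spec (f + g) = spec f + spec g"
  by (induction f g rule: poly_induct2) (simp_all add: spec_pCons algebra_simps)

lemma spec_smult: "spec (Polynomial.smult a f) = of_int a * spec f"
  by (induction f) (simp_all add: spec_pCons algebra_simps)

lemma spec_mult: "spec (f * g) = spec f * spec g"
  by (induction f) (simp_all add: spec_pCons spec_add spec_smult algebra_simps)

lemma spec_sum: "spec (\<Sum>i\<in>A. f i) = (\<Sum>i\<in>A. spec (f i))"
  by (induction A rule: infinite_finite_induct) (simp_all add: spec_add)

lemma spec_delta: "spec (\<delta> y z) = \<delta> y z"
  by (simp add: \<delta>_def)

lemma spec_oper: "spec (oper g [:0, 1:] \<phi> z) = oper g vsq (\<lambda>y. spec (\<phi> y)) z"
  using oper_hom[of spec] by (simp add: spec_add spec_mult)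

definition mkinv :: "dmat \<Rightarrow> ix" where "mkinv = inv_into UNIV mk"

lemma mkinv [simp]: "mkinv (mk z) = z"
  unfolding mkinv_def by (simp add: inj_def mk_inj)

lemma mk_Xi [simp]: "mk z \<in> Xi d \<longleftrightarrow> z \<in> Ix d"
  unfolding Xi_eq by (simp add: inj_image_mem_iff inj_def mk_inj)

lemma sum_Xi: "(\<Sum>X\<in>Xi d. h X) = (\<Sum>z\<in>Ix d. h (mk z))"
  unfolding Xi_eq by (subst sum.reindex) (auto simp: inj_on_def mk_inj)

lemma MS_simps:
  "carrier (MS d) = {a. \<forall>X. X \<notin> Xi d \<longrightarrow> a X = 0}" "\<zero>\<^bsub>MS d\<^esub> = (\<lambda>_. 0)"
  "a \<oplus>\<^bsub>MS d\<^esub> b = (\<lambda>X. a X + b X)" "c \<odot>\<^bsub>MS d\<^esub> a = (\<lambda>X. c * a X)"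
  by (simp_all add: MS_def)

lemma MS_eqI:
  assumes "a \<in> carrier (MS d)" "b \<in> carrier (MS d)" "\<And>z. z \<in> Ix d \<Longrightarrow> a (mk z) = b (mk z)"
  shows "a = b"
proof
  fix X show "a X = b X"
  proof (cases "X \<in> Xi d")
    case True then show ?thesis using assms(3) unfolding Xi_eq by blast
  next
    case False
    have "a X = 0" using assms(1) False unfolding MS_simps(1) by blast
    moreover have "b X = 0" using assms(2) False unfolding MS_simps(1) by blast
    ultimately show ?thesis by simp
  qed
qed

definition strc :: "nat \<Rightarrow> ix \<Rightarrow> ix \<Rightarrow> ix \<Rightarrow> ratfun" where
  "strc d u z w = spec (scp d u z w)"

lemma MS_mult:
  "w \<in> Ix d \<Longrightarrow> (a \<otimes>\<^bsub>MS d\<^esub> b) (mk w) = (\<Sum>u\<in>Ix d. \<Sum>z\<in>Ix d. a (mk u) * b (mk z) * strc d u z w)"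
  by (simp add: MS_def sum_Xi strc_def spec_def scp_def vsq_def)

lemma MS_mult_closed: "a \<otimes>\<^bsub>MS d\<^esub> b \<in> carrier (MS d)"
  by (simp add: MS_def)

lemma strc_oper:
  assumes "y \<in> Ix d" "z \<in> Ix d" "w \<in> Ix d"
  shows "(\<Sum>u\<in>Ix d. oper g vsq (\<delta> y) u * strc d u z w) = oper g vsq (strc d y z) w"
  using arg_cong[OF scp_oper[OF assms, of g], of spec]
  by (simp add: spec_sum spec_mult spec_oper strc_def[abs_def] spec_delta)

lemma strc_unit: "z \<in> Ix d \<Longrightarrow> w \<in> Ix d \<Longrightarrow> (\<Sum>r\<le>d. strc d (r, 0, 0, d - r, D0) z w) = \<delta> z w"
  using arg_cong[OF scp_unit, of z d w spec] by (simp add: spec_sum spec_delta strc_def)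

lemma strc_rank: "u \<in> Ix d \<Longrightarrow> z \<in> Ix d \<Longrightarrow> w \<in> Ix d \<Longrightarrow> rk u \<noteq> rk w \<Longrightarrow> strc d u z w = 0"
  by (simp add: strc_def scp_rank)

text \<open>The powers of v in the geometric generators, as functions of the dimension i of the
  first flag. The summand \<open>e_r\<close> lives at i = r + 1, which turns v^(-r) into
  v^(1-i).\<close>

fun ws :: "nat \<Rightarrow> gen \<Rightarrow> int \<Rightarrow> ratfun" where
  "ws d Ge i = vv powi (1 - i)"
| "ws d Gf i = vv powi (1 + i - int d)"
| "ws d Gk i = vv powi (2 * i - int d)"
| "ws d Gki i = vv powi (- (2 * i - int d))"
| "ws d Gl i = vv powi (- 2 * i)"

text \<open>The value of \<open>oper g\<close> at rank i is computed from values at rank i +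
  \<open>sh g\<close>.\<close>

fun sh :: "gen \<Rightarrow> int" where
  "sh Ge = - 1" | "sh Gf = 1" | "sh g = 0"

text \<open>Left multiplication by the image of a generator: a one-step operator times a power of \<open>v\<close>
  depending on the dimension \<open>rk\<close> of the first subspace.\<close>

definition rho :: "nat \<Rightarrow> gen \<Rightarrow> (dmat \<Rightarrow> ratfun) \<Rightarrow> dmat \<Rightarrow> ratfun" where
  "rho d g a X = (if X \<in> Xi d then ws d g (int (rk (mkinv X))) * oper g vsq (\<lambda>u. a (mk u)) (mkinv X) else 0)"

lemma rho_mk: "w \<in> Ix d \<Longrightarrow> rho d g a (mk w) = ws d g (int (rk w)) * oper g vsq (\<lambda>u. a (mk u)) w"
  by (simp add: rho_def)

lemma rho_closed: "rho d g a \<in> carrier (MS d)"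
  by (simp add: rho_def MS_simps)

text \<open>By \<open>strc_rank\<close> only u of the same rank as w contribute, so the power of v
  can be taken out of the sum; what remains is \<open>strc_oper\<close> and an exchange of
  sums.\<close>

lemma rho_mult:
  assumes a: "a \<in> carrier (MS d)"
  shows "rho d g a \<otimes>\<^bsub>MS d\<^esub> b = rho d g (a \<otimes>\<^bsub>MS d\<^esub> b)"
proof (rule MS_eqI[OF MS_mult_closed rho_closed])
  fix w assume w: "w \<in> Ix d"
  let ?s = "ws d g (int (rk w))"
  have expand: "oper g vsq (\<lambda>u. a (mk u)) u = (\<Sum>y\<in>Ix d. a (mk y) * oper g vsq (\<delta> y) u)" if u: "u \<in> Ix d" for u
  proof -
    have "oper g vsq (\<lambda>u. a (mk u)) u = oper g vsq (\<lambda>u. \<Sum>y\<in>Ix d. a (mk y) * \<delta> y u) u"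
      by (rule oper_cong[OF u]) (simp add: \<delta>_def finite_Ix if_distrib cong: if_cong)
    then show ?thesis unfolding oper_sum .
  qed
  have inner: "(\<Sum>u\<in>Ix d. rho d g a (mk u) * b (mk z) * strc d u z w)
      = ?s * (\<Sum>y\<in>Ix d. a (mk y) * b (mk z) * oper g vsq (strc d y z) w)" if z: "z \<in> Ix d" for z
  proof -
    have "(\<Sum>u\<in>Ix d. rho d g a (mk u) * b (mk z) * strc d u z w)
        = (\<Sum>u\<in>Ix d. ?s * b (mk z) * (\<Sum>y\<in>Ix d. a (mk y) * oper g vsq (\<delta> y) u) * strc d u z w)"
    proof (intro sum.cong refl)
      fix u assume u: "u \<in> Ix d"
      show "rho d g a (mk u) * b (mk z) * strc d u z w
          = ?s * b (mk z) * (\<Sum>y\<in>Ix d. a (mk y) * oper g vsq (\<delta> y) u) * strc d u z w"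
        using strc_rank[OF u z w] by (cases "rk u = rk w") (simp_all add: rho_mk[OF u] expand[OF u])
    qed
    also have "\<dots> = (\<Sum>u\<in>Ix d. \<Sum>y\<in>Ix d. ?s * (a (mk y) * b (mk z)) * (oper g vsq (\<delta> y) u * strc d u z w))"
      by (simp add: sum_distrib_left sum_distrib_right mult_ac)
    also have "\<dots> = (\<Sum>y\<in>Ix d. \<Sum>u\<in>Ix d. ?s * (a (mk y) * b (mk z)) * (oper g vsq (\<delta> y) u * strc d u z w))"
      by (rule sum.swap)
    also have "\<dots> = (\<Sum>y\<in>Ix d. ?s * (a (mk y) * b (mk z)) * oper g vsq (strc d y z) w)"
      by (simp add: strc_oper[OF _ z w] flip: sum_distrib_left)
    finally show ?thesis by (simp add: sum_distrib_left mult_ac)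
  qed
  have "(rho d g a \<otimes>\<^bsub>MS d\<^esub> b) (mk w) = (\<Sum>z\<in>Ix d. \<Sum>u\<in>Ix d. rho d g a (mk u) * b (mk z) * strc d u z w)"
    unfolding MS_mult[OF w] by (rule sum.swap)
  also have "\<dots> = ?s * (\<Sum>z\<in>Ix d. \<Sum>y\<in>Ix d. a (mk y) * b (mk z) * oper g vsq (strc d y z) w)"
    by (simp add: inner sum_distrib_left)
  also have "(\<Sum>z\<in>Ix d. \<Sum>y\<in>Ix d. a (mk y) * b (mk z) * oper g vsq (strc d y z) w)
      = (\<Sum>y\<in>Ix d. \<Sum>z\<in>Ix d. a (mk y) * b (mk z) * oper g vsq (strc d y z) w)"
    by (rule sum.swap)
  also have "\<dots> = (\<Sum>p\<in>Ix d \<times> Ix d. (a (mk (fst p)) * b (mk (snd p))) * oper g vsq (strc d (fst p) (snd p)) w)"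
    by (simp add: sum.cartesian_product case_prod_unfold)
  also have "\<dots> = oper g vsq (\<lambda>w. \<Sum>p\<in>Ix d \<times> Ix d. (a (mk (fst p)) * b (mk (snd p))) * strc d (fst p) (snd p) w) w"
    by (rule oper_sum[symmetric])
  also have "\<dots> = oper g vsq (\<lambda>w. (a \<otimes>\<^bsub>MS d\<^esub> b) (mk w)) w"
    by (rule oper_cong[OF w]) (simp add: MS_mult sum.cartesian_product case_prod_unfold)
  finally show "(rho d g a \<otimes>\<^bsub>MS d\<^esub> b) (mk w) = rho d g (a \<otimes>\<^bsub>MS d\<^esub> b) (mk w)"
    by (simp add: rho_mk[OF w])
qed

lemma Tbas_mk: "Tbas (mk u) (mk w) = \<delta> u w"
  by (simp add: Tbas_def \<delta>_def mk_inj)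

lemma mk_unit: "(Dmat a b, {}) = mk (a, 0, 0, b, D0)"
  by (simp add: mk.simps Dmat_def vec_eq_iff forall_2)

lemma MS_one: "w \<in> Ix d \<Longrightarrow> \<one>\<^bsub>MS d\<^esub> (mk w) = (\<Sum>r\<le>d. \<delta> (r, 0, 0, d - r, D0) w)"
  by (simp only: MS_def monoid.simps mk_unit Tbas_mk atLeast0AtMost)

lemma MS_one_closed: "\<one>\<^bsub>MS d\<^esub> \<in> carrier (MS d)"
proof -
  have "Tbas (mk (r, 0, 0, d - r, D0)) X = 0" if X: "X \<notin> Xi d" and r: "r \<le> d" for X r
  proof -
    have "mk (r, 0, 0, d - r, D0) \<in> Xi d" using r by (simp add: Ix_def)
    then have "X \<noteq> mk (r, 0, 0, d - r, D0)" using X by blast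
    then show ?thesis by (simp add: Tbas_def)
  qed
  then have "(\<Sum>r\<in>{0..d}. Tbas (mk (r, 0, 0, d - r, D0)) X) = 0" if "X \<notin> Xi d" for X
    using that by (intro sum.neutral) simp
  then show ?thesis unfolding MS_simps(1) by (simp only: MS_def monoid.simps mk_unit mem_Collect_eq) blast
qed

lemma MS_one_mult:
  assumes b: "b \<in> carrier (MS d)" shows "\<one>\<^bsub>MS d\<^esub> \<otimes>\<^bsub>MS d\<^esub> b = b"
proof (rule MS_eqI[OF MS_mult_closed b])
  fix w assume w: "w \<in> Ix d"
  let ?u = "\<lambda>r. (r, 0, 0, d - r, D0) :: ix"
  have u: "?u r \<in> Ix d" if "r \<le> d" for r using that by (simp add: Ix_def)
  have "(\<one>\<^bsub>MS d\<^esub> \<otimes>\<^bsub>MS d\<^esub> b) (mk w) = (\<Sum>z\<in>Ix d. \<Sum>u\<in>Ix d. \<Sum>r\<le>d. \<delta> (?u r) u * b (mk z) * strc d u z w)"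
    unfolding MS_mult[OF w] by (subst sum.swap) (simp add: MS_one sum_distrib_right)
  also have "\<dots> = (\<Sum>z\<in>Ix d. \<Sum>r\<le>d. \<Sum>u\<in>Ix d. \<delta> (?u r) u * b (mk z) * strc d u z w)"
    by (intro sum.cong refl sum.swap)
  also have "\<dots> = (\<Sum>z\<in>Ix d. \<Sum>r\<le>d. \<Sum>u\<in>Ix d. if u = ?u r then b (mk z) * strc d u z w else 0)"
    by (intro sum.cong refl) (auto simp: \<delta>_def)
  also have "\<dots> = (\<Sum>z\<in>Ix d. b (mk z) * (\<Sum>r\<le>d. strc d (?u r) z w))"
    using u by (simp add: finite_Ix sum_distrib_left)
  also have "\<dots> = (\<Sum>z\<in>Ix d. if z = w then b (mk z) else 0)"
    by (intro sum.cong refl) (auto simp: strc_unit[OF _ w] \<delta>_def)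
  also have "\<dots> = b (mk w)" using w by (simp add: finite_Ix)
  finally show "(\<one>\<^bsub>MS d\<^esub> \<otimes>\<^bsub>MS d\<^esub> b) (mk w) = b (mk w)" .
qed

lemma rho_add: "rho d g (\<lambda>X. a X + b X) = (\<lambda>X. rho d g a X + rho d g b X)"
  and rho_scale: "rho d g (\<lambda>X. c * a X) = (\<lambda>X. c * rho d g a X)"
  by (rule ext; simp add: rho_def oper_add oper_scale algebra_simps)+

lemma rho_zero [simp]: "rho d g (\<lambda>X. 0) = (\<lambda>X. 0)"
  using rho_scale[of d g 0] by simp

section \<open>The action of the free algebra and the homomorphism to the target\<close>

definition rhow :: "nat \<Rightarrow> gen list \<Rightarrow> (dmat \<Rightarrow> ratfun) \<Rightarrow> dmat \<Rightarrow> ratfun" where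
  "rhow d w a = foldr (rho d) w a"

lemma rhow_Nil [simp]: "rhow d [] a = a"
  and rhow_Cons: "rhow d (g # w) a = rho d g (rhow d w a)"
  by (simp_all add: rhow_def)

definition Act :: "nat \<Rightarrow> free_elt \<Rightarrow> (dmat \<Rightarrow> ratfun) \<Rightarrow> dmat \<Rightarrow> ratfun" where
  "Act d p a X = (\<Sum>w\<in>Poly_Mapping.keys p. Poly_Mapping.lookup p w * rhow d w a X)"

lemma Act_superset:
  assumes "finite A" "Poly_Mapping.keys p \<subseteq> A"
  shows "Act d p a X = (\<Sum>w\<in>A. Poly_Mapping.lookup p w * rhow d w a X)"
  unfolding Act_def using assms by (intro sum.mono_neutral_left) (auto simp: in_keys_iff)

lemma Act_add: "Act d (p + q) a = (\<lambda>X. Act d p a X + Act d q a X)"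
proof
  fix X
  let ?A = "Poly_Mapping.keys p \<union> Poly_Mapping.keys q"
  have "Act d r a X = (\<Sum>w\<in>?A. Poly_Mapping.lookup r w * rhow d w a X)" if "r \<in> {p, q, p + q}" for r
    using that Poly_Mapping.keys_add[of p q] by (intro Act_superset) auto
  then show "Act d (p + q) a X = Act d p a X + Act d q a X"
    by (simp add: lookup_add distrib_right sum.distrib)
qed

lemma Act_single: "Act d (Poly_Mapping.single w c) a = (\<lambda>X. c * rhow d w a X)"
  by (rule ext) (simp add: Act_superset[of "{w}"])

lemma Act_0 [simp]: "Act d 0 a = (\<lambda>X. 0)"
  by (rule ext) (simp add: Act_def)

lemma Act_1 [simp]: "Act d 1 a = a"
  using Act_single[of d "[]" 1 a] by (simp add: single_Nil)

lemma Act_fsc: "Act d (fsc c p) a = (\<lambda>X. c * Act d p a X)"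
proof (induction p rule: free_induct)
  case (add w k p)
  have "fsc c (Poly_Mapping.single w k) = Poly_Mapping.single w (c * k)"
    by (simp add: fsc_def fconst_def mult_single plus_list_def)
  then show ?case by (simp add: add Act_add Act_single distrib_left mult.assoc fs.scale_right_distrib)
qed simp

lemma Act_minus: "Act d (p - q) a = (\<lambda>X. Act d p a X - Act d q a X)"
  using Act_add[of d p "fsc (- 1) q" a] Act_fsc[of d "- 1" q a] by simp

lemma Act_gen_mult: "Act d (fgen g * p) a = rho d g (Act d p a)"
proof (induction p rule: free_induct)
  case (add w k p)
  then show ?case
    by (simp add: distrib_left Act_add rho_add rho_scale Act_single rhow_Cons flip: single_Cons)
qed simp

lemma Act_mult: "Act d (p * q) a = Act d p (Act d q a)"
proof (induction p rule: free_induct)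
  case (add w c p)
  have "Act d (Poly_Mapping.single w c * q) a = Act d (Poly_Mapping.single w c) (Act d q a)"
  proof (induction w)
    case Nil then show ?case unfolding single_Nil by (simp add: fsc_mult_left Act_fsc)
  next
    case (Cons g w) then show ?case unfolding single_Cons by (simp add: mult.assoc Act_gen_mult)
  qed
  then show ?case using add by (simp add: distrib_right Act_add)
qed simp

lemma MS_add_closed: "a \<in> carrier (MS d) \<Longrightarrow> b \<in> carrier (MS d) \<Longrightarrow> (\<lambda>X. a X + b X) \<in> carrier (MS d)"
  and MS_scale_closed: "a \<in> carrier (MS d) \<Longrightarrow> (\<lambda>X. c * a X) \<in> carrier (MS d)"
  and MS_zero_closed: "(\<lambda>X. 0) \<in> carrier (MS d)"
  by (simp_all add: MS_simps)

lemma rhow_closed: "a \<in> carrier (MS d) \<Longrightarrow> rhow d w a \<in> carrier (MS d)"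
  by (cases w) (simp_all add: rhow_Cons rho_closed)

lemma Act_closed: "a \<in> carrier (MS d) \<Longrightarrow> Act d p a \<in> carrier (MS d)"
  by (induction p rule: free_induct)
    (simp_all add: Act_add Act_single MS_add_closed MS_scale_closed MS_zero_closed rhow_closed)

lemma MS_mult_linear:
  "(\<lambda>X. a X + a' X) \<otimes>\<^bsub>MS d\<^esub> b = (\<lambda>X. (a \<otimes>\<^bsub>MS d\<^esub> b) X + (a' \<otimes>\<^bsub>MS d\<^esub> b) X)"
  "(\<lambda>X. c * a X) \<otimes>\<^bsub>MS d\<^esub> b = (\<lambda>X. c * (a \<otimes>\<^bsub>MS d\<^esub> b) X)"
  unfolding MS_def monoid.simps
  by (rule ext, simp add: distrib_right sum.distrib sum_distrib_left mult.assoc)+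

lemma MS_mult_zero: "(\<lambda>X. 0) \<otimes>\<^bsub>MS d\<^esub> b = (\<lambda>X. 0)"
  using MS_mult_linear(2)[where c = 0 and a = "\<lambda>X. 0"] by simp

lemma rhow_mult: "a \<in> carrier (MS d) \<Longrightarrow> rhow d w a \<otimes>\<^bsub>MS d\<^esub> b = rhow d w (a \<otimes>\<^bsub>MS d\<^esub> b)"
  by (induction w) (simp_all add: rhow_Cons rho_mult rhow_closed)

lemma Act_MS_mult: "a \<in> carrier (MS d) \<Longrightarrow> Act d p a \<otimes>\<^bsub>MS d\<^esub> b = Act d p (a \<otimes>\<^bsub>MS d\<^esub> b)"
  by (induction p rule: free_induct) (simp_all add: Act_add Act_single MS_mult_linear MS_mult_zero rhow_mult)

text \<open>Since the action commutes with right multiplication and the unit is a left unit,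
  \<open>Act d p b\<close> is the product of \<open>Phi d p\<close> with b; this makes
  \<open>Phi d\<close> multiplicative.\<close>

definition Phi :: "nat \<Rightarrow> free_elt \<Rightarrow> dmat \<Rightarrow> ratfun" where
  "Phi d p = Act d p \<one>\<^bsub>MS d\<^esub>"

lemma Phi_closed: "Phi d p \<in> carrier (MS d)"
  unfolding Phi_def by (rule Act_closed[OF MS_one_closed])

lemma Act_Phi: "b \<in> carrier (MS d) \<Longrightarrow> Act d p b = Phi d p \<otimes>\<^bsub>MS d\<^esub> b"
  unfolding Phi_def by (simp add: Act_MS_mult MS_one_closed MS_one_mult)

lemma Phi_mult: "Phi d (p * q) = Phi d p \<otimes>\<^bsub>MS d\<^esub> Phi d q"
  using Act_Phi[OF Phi_closed] by (simp add: Phi_def Act_mult)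

lemma Phi_add: "Phi d (p + q) = (\<lambda>X. Phi d p X + Phi d q X)"
  and Phi_fsc: "Phi d (fsc c p) = (\<lambda>X. c * Phi d p X)"
  and Phi_1: "Phi d 1 = \<one>\<^bsub>MS d\<^esub>" and Phi_gen: "Phi d (fgen g) = rho d g \<one>\<^bsub>MS d\<^esub>"
  using Act_gen_mult[of d g 1] by (simp_all add: Phi_def Act_add Act_fsc)

fun operw :: "gen list \<Rightarrow> (ix \<Rightarrow> ratfun) \<Rightarrow> ix \<Rightarrow> ratfun" where
  "operw [] \<phi> = \<phi>"
| "operw (g # w) \<phi> = oper g vsq (operw w \<phi>)"

text \<open>The scalar part of a word, whose operator part is \<open>operw\<close>: the power of v
  of each letter is taken at the rank reached after the shifts of the letters to its left.\<close>

fun wprod :: "nat \<Rightarrow> gen list \<Rightarrow> int \<Rightarrow> ratfun" where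
  "wprod d [] i = 1"
| "wprod d (g # w) i = ws d g i * wprod d w (i + sh g)"

lemma oper_rank_cong:
  assumes "z \<in> Ix d" "\<And>y. y \<in> Ix d \<Longrightarrow> int (rk y) = int (rk z) + sh g \<Longrightarrow> \<phi> y = \<psi> y"
  shows "oper g t \<phi> z = oper g t \<psi> z"
  using assms opE_cong[of z \<phi> \<psi> t] opF_cong[of z \<phi> \<psi> t] opL_cong[of z \<phi> \<psi> t]
  by (cases g) (simp_all add: Ix_iff)

lemma oper_rank_scale:
  assumes "z \<in> Ix d"
  shows "oper g t (\<lambda>y. k (int (rk y)) * \<phi> y) z = k (int (rk z) + sh g) * oper g t \<phi> z"
  unfolding oper_scale[symmetric] by (rule oper_rank_cong[OF assms]) simp

lemma rhow_mk: "z \<in> Ix d \<Longrightarrow> rhow d w a (mk z) = wprod d w (int (rk z)) * operw w (\<lambda>u. a (mk u)) z"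
proof (induction w arbitrary: z)
  case (Cons g w)
  have "rhow d (g # w) a (mk z) = ws d g (int (rk z)) * oper g vsq (\<lambda>u. rhow d w a (mk u)) z"
    using Cons.prems by (simp add: rhow_Cons rho_mk)
  also have "oper g vsq (\<lambda>u. rhow d w a (mk u)) z
      = oper g vsq (\<lambda>u. wprod d w (int (rk u)) * operw w (\<lambda>u. a (mk u)) u) z"
    by (rule oper_cong[OF Cons.prems]) (rule Cons.IH)
  also have "\<dots> = wprod d w (int (rk z) + sh g) * oper g vsq (operw w (\<lambda>u. a (mk u))) z"
    by (rule oper_rank_scale[OF Cons.prems])
  finally show ?case by simp
qed simp

lemma vsq_power: "vsq ^ m = vv powi (2 * int m)"
  by (simp only: vsq_def power_int_mult power_int_of_nat)

lemma vsq_ne_1: "vsq - 1 \<noteq> 0"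
  using vv_powi_inject[of 2 0] by (simp add: vsq_def)

lemma vv_merge: "vv powi i * vv powi j = vv powi (i + j)" "vv powi i * (vv powi j * x) = vv powi (i + j) * x"
  by (simp_all add: power_int_add mult.assoc)

lemma opE_scaled: "opE t (\<lambda>z. k * \<phi> z) = (\<lambda>z. k * opE t \<phi> z)"
  and opF_scaled: "opF t (\<lambda>z. k * \<phi> z) = (\<lambda>z. k * opF t \<phi> z)"
  and opL_scaled: "opL t (\<lambda>z. k * \<phi> z) = (\<lambda>z. k * opL t \<phi> z)"
  by (rule ext, rule oper_scale[where g = Ge, unfolded oper.simps] oper_scale[where g = Gf, unfolded oper.simps]
      oper_scale[where g = Gl, unfolded oper.simps])+

lemmas op_scaled = opE_scaled opF_scaled opL_scaled

lemma op_primed: "opE' t \<phi> = (\<lambda>z. (t - 1) * opE t \<phi> z)" "opF' t \<phi> = (\<lambda>z. (t - 1) * opF t \<phi> z)"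
  by (rule ext; simp add: opE'_def opF'_def)+

lemma cancel_once: "s \<noteq> 0 \<Longrightarrow> r * (s * p) = u * (s * q) \<Longrightarrow> r * p = u * q"
  for s :: "'a::field"
  by (metis mult.left_commute mult_left_cancel)

lemma cancel_twice:
  fixes s :: "'a::field"
  assumes s: "s \<noteq> 0" and eq: "(1 + t) * (s * (s * p)) = t * (s * (s * q)) + s * (s * r)"
  shows "(1 + t) * p = t * q + r"
proof -
  have "(s * s) * ((1 + t) * p) = (s * s) * (t * q + r)" using eq by (simp add: algebra_simps)
  then show ?thesis using s by simp
qed

text \<open>The polynomial identities of the primed operators at t = v^2, where t - 1 is invertible
  and the cardinality t^(a+b) of the first flag becomes v^(2i).\<close>

lemma schur_relations:
  assumes z: "z \<in> Ix d" "z = (a, b, c, x, g)"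
  defines "i \<equiv> int (rk z)"
  shows "opE vsq (opF vsq \<phi>) z - opF vsq (opE vsq \<phi>) z
      = vv powi (int d - 1) * ((vv powi (2 * i - int d) - vv powi (- (2 * i - int d))) / (vv - inverse vv) * \<phi> z)"
    and "opL vsq (opL vsq \<phi>) z = vv powi (2 * i) * opL vsq \<phi> z"
    and "vsq * opL vsq (opE vsq (opL vsq \<phi>)) z = vv powi (2 * i) * opL vsq (opE vsq \<phi>) z"
    and "opL vsq (opF vsq (opL vsq \<phi>)) z = vv powi (2 * i) * opF vsq (opL vsq \<phi>) z"
    and "(1 + vsq) * opE vsq (opL vsq (opE vsq \<phi>)) z
      = vsq * opE vsq (opE vsq (opL vsq \<phi>)) z + opL vsq (opE vsq (opE vsq \<phi>)) z"
    and "(1 + vsq) * opF vsq (opL vsq (opF vsq \<phi>)) z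
      = vsq * opL vsq (opF vsq (opF vsq \<phi>)) z + opF vsq (opF vsq (opL vsq \<phi>)) z"
proof -
  have v: "valid (a, b, c, x, g)" and d: "a + b + c + x = d" using z by (auto simp: Ix_def)
  note n = vsq_ne_1
  have i: "vsq ^ (a + b) = vv powi (2 * i)" unfolding i_def z(2) vsq_power by simp
  have n2: "(vsq - 1) * (vsq - 1) \<noteq> 0" using n by simp
  have cancel: "p = q" if "(vsq - 1) * p = (vsq - 1) * q" for p q using that n by simp
  show "opL vsq (opL vsq \<phi>) z = vv powi (2 * i) * opL vsq \<phi> z" unfolding z(2) opL_opL i ..
  show "vsq * opL vsq (opE vsq (opL vsq \<phi>)) z = vv powi (2 * i) * opL vsq (opE vsq \<phi>) z"
    using opL_opE'_opL[OF v, of vsq \<phi>] unfolding i z(2) op_primed op_scaled by (rule cancel_once[OF n])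
  show "opL vsq (opF vsq (opL vsq \<phi>)) z = vv powi (2 * i) * opF vsq (opL vsq \<phi>) z"
    using cancel_once[OF n, of 1] opL_opF'_opL[OF v, of vsq \<phi>] unfolding i z(2) op_primed op_scaled mult_1_left by blast
  show "(1 + vsq) * opE vsq (opL vsq (opE vsq \<phi>)) z
      = vsq * opE vsq (opE vsq (opL vsq \<phi>)) z + opL vsq (opE vsq (opE vsq \<phi>)) z"
    using opE'_opL_opE'[OF v, of vsq \<phi>] unfolding z(2) op_primed op_scaled by (rule cancel_twice[OF n])
  show "(1 + vsq) * opF vsq (opL vsq (opF vsq \<phi>)) z
      = vsq * opL vsq (opF vsq (opF vsq \<phi>)) z + opF vsq (opF vsq (opL vsq \<phi>)) z"
    using opF'_opL_opF'[OF v, of vsq \<phi>] unfolding z(2) op_primed op_scaled by (rule cancel_twice[OF n])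
  have solve: "X = m * (B / w * f)" if "u \<noteq> 0" "w \<noteq> 0" "(u * w) * X = (u * m) * B * f" for X u w m B f :: ratfun
    using that by (simp add: field_simps)
  let ?D = "opE vsq (opF vsq \<phi>) z - opF vsq (opE vsq \<phi>) z"
  have cx: "vsq ^ (c + x) = vv powi (2 * int d - 2 * i)" unfolding i_def z(2) vsq_power using d by (auto simp: algebra_simps)
  have "(vsq - 1) * ((vsq - 1) * ?D) = (vsq - 1) * ((vv powi (2 * i) - vv powi (2 * int d - 2 * i)) * \<phi> z)"
    using opE'_opF'[OF v, of vsq \<phi>] unfolding i cx z(2) op_primed op_scaled by (simp add: algebra_simps)
  then have D: "(vsq - 1) * ?D = (vv powi (2 * i) - vv powi (2 * int d - 2 * i)) * \<phi> z" by (rule cancel)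
  have "vv powi (2 * i) - vv powi (2 * int d - 2 * i)
      = vv powi int d * (vv powi (2 * i - int d) - vv powi (- (2 * i - int d)))"
    unfolding right_diff_distrib vv_merge by (simp add: algebra_simps)
  moreover have "vsq - 1 = vv * (vv - inverse vv)"
    unfolding vsq_def by (simp add: right_diff_distrib power2_eq_square)
  moreover have "vv powi int d = vv * vv powi (int d - 1)"
    using power_int_add[of vv 1 "int d - 1"] by simp
  ultimately show "?D = vv powi (int d - 1) * ((vv powi (2 * i - int d) - vv powi (- (2 * i - int d))) / (vv - inverse vv) * \<phi> z)"
    using D solve[OF vv_nonzero vv_diff_inverse_nonzero] by metis
qed

lemma Act_gen: "Act d (fgen g) a = rho d g a"
  using Act_gen_mult[of d g 1 a] by simp

lemma Act_zero_right: "Act d p (\<lambda>X. 0) = (\<lambda>X. 0)"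
proof -
  have "rhow d w (\<lambda>X. 0) = (\<lambda>X. 0)" for w by (induction w) (simp_all add: rhow_Cons)
  then show ?thesis by (induction p rule: free_induct) (simp_all add: Act_add Act_single)
qed

section \<open>The defining relations and the two generators of the ideal in the kernel\<close>

definition phi_kernel :: "nat \<Rightarrow> free_elt set" where
  "phi_kernel d = {p. Phi d p = (\<lambda>X. 0)}"

lemma Phi_0: "Phi d 0 = (\<lambda>X. 0)"
  by (simp add: Phi_def)

lemma Phi_mult_zero: "Phi d p \<otimes>\<^bsub>MS d\<^esub> (\<lambda>X. 0) = (\<lambda>X. 0)"
  using Act_Phi[OF MS_zero_closed, of d p] by (simp add: Act_zero_right)

lemma ideal2_phi_kernel: "ideal2 (phi_kernel d)"
  unfolding ideal2_def fs.subspace_def phi_kernel_def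
  by (simp add: Phi_0 Phi_add Phi_fsc Phi_mult MS_mult_zero Phi_mult_zero)

lemma phi_kernelI: "(\<And>z. z \<in> Ix d \<Longrightarrow> Phi d p (mk z) = 0) \<Longrightarrow> p \<in> phi_kernel d"
  unfolding phi_kernel_def using MS_eqI[OF Phi_closed MS_zero_closed] by simp

text \<open>The scalar parts of the words in the defining relations. Together with
  \<open>schur_relations\<close> they reduce each relation to a comparison of powers of v; the words
  of a Serre relation are brought to a common power.\<close>

lemma wprod_values:
  "wprod d [Gk, Gki] i = 1" "wprod d [Gki, Gk] i = 1"
  "wprod d [Gk, Ge, Gki] i = vv powi 2 * wprod d [Ge] i"
  "wprod d [Gk, Gf, Gki] i = vv powi (- 2) * wprod d [Gf] i"
  "wprod d [Ge, Gf] i = vv powi (- (int d - 1))" "wprod d [Gf, Ge] i = vv powi (- (int d - 1))"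
  "wprod d [Gl, Gl] i * vv powi (2 * i) = wprod d [Gl] i"
  "wprod d [Gk, Gl] i = wprod d [Gl, Gk] i"
  "wprod d [Gl, Ge, Gl] i * vv powi (2 * i) = vsq * wprod d [Gl, Ge] i"
  "wprod d [Gl, Gf, Gl] i * vv powi (2 * i) = wprod d [Gf, Gl] i"
  "wprod d [Ge, Gl, Ge] i = vv * vv powi (4 - 4 * i)"
  "wprod d [Ge, Ge, Gl] i = vv * (vsq * vv powi (4 - 4 * i))"
  "wprod d [Gl, Ge, Ge] i = inverse vv * vv powi (4 - 4 * i)"
  "wprod d [Gf, Gl, Gf] i = vv * vv powi (- 2 * int d)"
  "wprod d [Gl, Gf, Gf] i = vv * (vsq * vv powi (- 2 * int d))"
  "wprod d [Gf, Gf, Gl] i = inverse vv * vv powi (- 2 * int d)"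
proof -
  have v: "vv * x = vv powi 1 * x" "inverse vv * x = vv powi (- 1) * x" "1 = vv powi 0" for x
    by (simp_all add: power_int_minus)
  note s = wprod.simps ws.simps sh.simps vv_merge mult_1_right vv_powi_inject vsq_def v
  show "wprod d [Gk, Gki] i = 1" "wprod d [Gki, Gk] i = 1"
    unfolding v(3) by (simp_all only: wprod.simps ws.simps sh.simps vv_merge mult_1_right vv_powi_inject) simp_all
  show "wprod d [Gk, Ge, Gki] i = vv powi 2 * wprod d [Ge] i"
    "wprod d [Gk, Gf, Gki] i = vv powi (- 2) * wprod d [Gf] i"
    "wprod d [Ge, Gf] i = vv powi (- (int d - 1))" "wprod d [Gf, Ge] i = vv powi (- (int d - 1))"
    "wprod d [Gl, Gl] i * vv powi (2 * i) = wprod d [Gl] i"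
    "wprod d [Gk, Gl] i = wprod d [Gl, Gk] i"
    "wprod d [Gl, Ge, Gl] i * vv powi (2 * i) = vsq * wprod d [Gl, Ge] i"
    "wprod d [Gl, Gf, Gl] i * vv powi (2 * i) = wprod d [Gf, Gl] i"
    "wprod d [Ge, Gl, Ge] i = vv * vv powi (4 - 4 * i)"
    "wprod d [Ge, Ge, Gl] i = vv * (vsq * vv powi (4 - 4 * i))"
    "wprod d [Gl, Ge, Ge] i = inverse vv * vv powi (4 - 4 * i)"
    "wprod d [Gf, Gl, Gf] i = vv * vv powi (- 2 * int d)"
    "wprod d [Gl, Gf, Gf] i = vv * (vsq * vv powi (- 2 * int d))"
    "wprod d [Gf, Gf, Gl] i = inverse vv * vv powi (- 2 * int d)"
    unfolding vsq_def v(1,2)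
    by (simp_all only: wprod.simps ws.simps sh.simps vv_merge mult_1_right mult.assoc vv_powi_inject) simp_all
qed

text \<open>Since v [2] = 1 + v^2, the form with coefficients 1 + q, q and 1 turns into the one with
  [2], v and its inverse.\<close>

lemma serre_scalar:
  assumes "(1 + vsq) * X = vsq * Y + Z"
  shows "qint 2 * (vv * c * X) - (inverse vv * (vv * (vsq * c) * Y) + vv * (inverse vv * c * Z)) = 0"
proof -
  have "qint 2 * (vv * c * X) = (vv * vv + vv * inverse vv) * (c * X)" by (simp add: qint_2 algebra_simps del: right_inverse)
  also have "\<dots> = c * ((1 + vsq) * X)" by (simp add: vsq_def power2_eq_square algebra_simps)
  also have "\<dots> = c * (vsq * Y) + c * Z" unfolding assms by (simp add: algebra_simps)
  finally have 1: "qint 2 * (vv * c * X) = c * (vsq * Y) + c * Z" .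
  have "inverse vv * (vv * (vsq * c) * Y) = (vv * inverse vv) * (c * (vsq * Y))"
    "vv * (inverse vv * c * Z) = (vv * inverse vv) * (c * Z)" by (simp_all only: mult_ac)
  then show ?thesis unfolding 1 by (simp only: right_inverse[OF vv_nonzero] mult_1_left diff_self)
qed

lemma mir_relations_phi: "mir_relations \<subseteq> phi_kernel d"
proof
  fix p assume p: "p \<in> mir_relations"
  show "p \<in> phi_kernel d"
  proof (rule phi_kernelI)
    fix z assume z: "z \<in> Ix d"
    define i where "i = int (rk z)"
    define a where "a = \<one>\<^bsub>MS d\<^esub>"
    define \<phi> where "\<phi> = (\<lambda>u. a (mk u))"
    have m: "rho d g a (mk z) = wprod d [g] i * operw [g] \<phi> z"
      "rho d g (rho d h a) (mk z) = wprod d [g, h] i * operw [g, h] \<phi> z"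
      "rho d g (rho d h (rho d j a)) (mk z) = wprod d [g, h, j] i * operw [g, h, j] \<phi> z" for g h j
      using rhow_mk[OF z, of "[g]" a] rhow_mk[OF z, of "[g, h]" a] rhow_mk[OF z, of "[g, h, j]" a]
      unfolding i_def \<phi>_def by (simp_all add: rhow_Cons)
    have op: "operw [g] \<phi> z = oper g vsq \<phi> z" "operw [g, h] \<phi> z = oper g vsq (oper h vsq \<phi>) z"
      "operw [g, h, j] \<phi> z = oper g vsq (oper h vsq (oper j vsq \<phi>)) z" for g h j by simp_all
    have eta: "oper Ge vsq \<psi> = opE vsq \<psi>" "oper Gf vsq \<psi> = opF vsq \<psi>" "oper Gl vsq \<psi> = opL vsq \<psi>"
      "oper Gk vsq \<psi> = \<psi>" "oper Gki vsq \<psi> = \<psi>" for \<psi> by (rule ext, simp)+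
    obtain za zb zc zx zg where zz: "z = (za, zb, zc, zx, zg)" by (metis prod.exhaust)
    note R = schur_relations[OF z zz, of \<phi>, folded i_def]
    note ev = Phi_def Act_minus Act_add Act_fsc Act_gen_mult Act_gen Act_1 mult.assoc fsc_def[symmetric] fsc_mult_left a_def[symmetric] m op eta
    let ?e = "fgen Ge" and ?f = "fgen Gf" and ?k = "fgen Gk" and ?k' = "fgen Gki" and ?l = "fgen Gl"
    have "Phi d (?k * ?k' - 1) (mk z) = 0" "Phi d (?k' * ?k - 1) (mk z) = 0"
      by (simp_all only: ev wprod_values) (simp_all add: \<phi>_def)
    moreover have "Phi d (?k * ?e * ?k' - fconst (vv powi 2) * ?e) (mk z) = 0"
      "Phi d (?k * ?f * ?k' - fconst (vv powi (-2)) * ?f) (mk z) = 0"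
      by (simp_all only: ev wprod_values(3,4)) (simp_all add: mult.assoc)
    moreover have "Phi d ((?e * ?f - ?f * ?e) - fconst (1 / (vv - inverse vv)) * (?k - ?k')) (mk z) = 0"
    proof -
      have "Phi d ((?e * ?f - ?f * ?e) - fconst (1 / (vv - inverse vv)) * (?k - ?k')) (mk z)
        = vv powi (- (int d - 1)) * (opE vsq (opF vsq \<phi>) z - opF vsq (opE vsq \<phi>) z)
          - 1 / (vv - inverse vv) * (vv powi (2 * i - int d) * \<phi> z - vv powi (- (2 * i - int d)) * \<phi> z)"
        by (simp only: ev wprod_values(5,6) wprod.simps(1,2)[of d] ws.simps mult_1_right right_diff_distrib)
      also have "\<dots> = (vv powi (- (int d - 1)) * vv powi (int d - 1) - 1) * ((vv powi (2 * i - int d) - vv powi (- (2 * i - int d))) / (vv - inverse vv) * \<phi> z)"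
        unfolding R(1) by (simp add: left_diff_distrib diff_divide_distrib mult.assoc)
      also have "\<dots> = 0" by (simp add: vv_merge)
      finally show ?thesis .
    qed
    moreover have "Phi d (?l * ?l - ?l) (mk z) = 0"
      by (simp only: ev R(2)) (simp only: wprod_values(7)[symmetric] mult.assoc diff_self)
    moreover have "Phi d (?k * ?l - ?l * ?k) (mk z) = 0"
      by (simp only: ev wprod_values(8) diff_self)
    moreover have "Phi d (?l * ?e * ?l - ?l * ?e) (mk z) = 0"
    proof -
      have "vsq * Phi d (?l * ?e * ?l - ?l * ?e) (mk z)
        = wprod d [Gl, Ge, Gl] i * (vsq * opL vsq (opE vsq (opL vsq \<phi>)) z) - (vsq * wprod d [Gl, Ge] i) * opL vsq (opE vsq \<phi>) z"
        by (simp only: ev right_diff_distrib mult.left_commute)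
      also have "\<dots> = 0" unfolding R(3) wprod_values(9)[symmetric] by (simp only: mult.assoc diff_self)
      finally show ?thesis by (simp add: vsq_def)
    qed
    moreover have "Phi d (?l * ?f * ?l - ?f * ?l) (mk z) = 0"
      by (simp only: ev R(4)) (simp only: wprod_values(10)[symmetric] mult.assoc diff_self)
    moreover have "Phi d (fconst (qint 2) * ?e * ?l * ?e - (fconst (inverse vv) * ?e * ?e * ?l + fconst vv * ?l * ?e * ?e)) (mk z) = 0"
      by (simp only: ev wprod_values(11-13)) (simp only: mult.assoc[symmetric] serre_scalar[OF R(5), unfolded mult.assoc[symmetric]])
    moreover have "Phi d (fconst (qint 2) * ?f * ?l * ?f - (fconst (inverse vv) * ?l * ?f * ?f + fconst vv * ?f * ?f * ?l)) (mk z) = 0"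
      by (simp only: ev wprod_values(14-16)) (simp only: mult.assoc[symmetric] serre_scalar[OF R(6), unfolded mult.assoc[symmetric]])
    ultimately show "Phi d p (mk z) = 0" using p unfolding mir_relations_def Let_def by (elim insertE emptyE) (simp_all only:)
  qed
qed

lemma Act_kp: "z \<in> Ix d \<Longrightarrow> Act d (kp d rs) a (mk z)
    = (\<Prod>r\<leftarrow>rs. vv powi (2 * int (rk z) - int d) - vv powi (2 * int r - int d)) * a (mk z)"
proof (induction rs)
  case (Cons r rs)
  have "kp d (r # rs) = fgen Gk * kp d rs - fsc (vv powi (2 * int r - int d)) (kp d rs)"
    by (simp add: kp_Cons left_diff_distrib fsc_def)
  then have "Act d (kp d (r # rs)) a (mk z)
      = vv powi (2 * int (rk z) - int d) * Act d (kp d rs) a (mk z) - vv powi (2 * int r - int d) * Act d (kp d rs) a (mk z)"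
    by (simp only: Act_minus Act_gen_mult Act_fsc rho_mk[OF Cons.prems] ws.simps oper.simps)
  then show ?case unfolding Cons.IH[OF Cons.prems] by (simp add: left_diff_distrib mult.assoc)
qed simp

lemma rk_le: "z \<in> Ix d \<Longrightarrow> rk z \<le> d"
  by (cases z) (auto simp: Ix_def)

lemma weight_product_eq_0_iff:
  "(\<Prod>r\<leftarrow>rs. vv powi (2 * int i - int d) - vv powi (2 * int r - int d)) = 0 \<longleftrightarrow> i \<in> set rs"
  by (induction rs) (simp_all add: vv_powi_inject)

lemma kp_all_phi: "kp d [0..<d + 1] \<in> phi_kernel d"
proof (rule phi_kernelI)
  fix z assume z: "z \<in> Ix d"
  have "(\<Prod>r\<leftarrow>[0..<d + 1]. vv powi (2 * int (rk z) - int d) - vv powi (2 * int r - int d)) = 0"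
    unfolding weight_product_eq_0_iff using rk_le[OF z] by (simp only: set_upt atLeastLessThan_iff) simp
  then show "Phi d (kp d [0..<d + 1]) (mk z) = 0" unfolding Phi_def Act_kp[OF z] by (rule mult_eq_0_iff[THEN iffD2, OF disjI1])
qed

text \<open>In rank 0 the first subspace is zero and allows only the zero translation.\<close>

lemma opL_rank_0: "valid z \<Longrightarrow> rk z = 0 \<Longrightarrow> opL t \<phi> z = \<phi> z"
proof -
  assume a: "valid z" "rk z = 0"
  obtain a b c x g where "z = (a, b, c, x, g)" by (metis prod.exhaust)
  then show "opL t \<phi> z = \<phi> z" using a by (cases g) simp_all
qed

text \<open>The image of Q_d(k) is supported in rank 0, where l acts as the identity by
  \<open>opL_rank_0\<close>.\<close>

lemma low_phi: "(fgen Gl - 1) * kp d [1..<d + 1] \<in> phi_kernel d"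
proof (rule phi_kernelI)
  fix z assume z: "z \<in> Ix d"
  define b where "b = Act d (kp d [1..<d + 1]) \<one>\<^bsub>MS d\<^esub>"
  have b0: "b (mk u) = 0" if "u \<in> Ix d" "rk u \<noteq> 0" for u
  proof -
    have "(\<Prod>r\<leftarrow>[1..<d + 1]. vv powi (2 * int (rk u) - int d) - vv powi (2 * int r - int d)) = 0"
      unfolding weight_product_eq_0_iff using rk_le[OF that(1)] that(2) by (simp only: set_upt atLeastLessThan_iff) simp
    then show ?thesis unfolding b_def Act_kp[OF that(1)] by (rule mult_eq_0_iff[THEN iffD2, OF disjI1])
  qed
  have "Phi d ((fgen Gl - 1) * kp d [1..<d + 1]) (mk z) = rho d Gl b (mk z) - b (mk z)"
    by (simp only: Phi_def left_diff_distrib mult_1_left Act_minus Act_gen_mult b_def)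
  also have "rho d Gl b (mk z) = b (mk z)"
  proof (cases "rk z = 0")
    case True
    then show ?thesis using z by (simp add: rho_mk opL_rank_0 Ix_iff)
  next
    case False
    have "oper Gl vsq (\<lambda>u. b (mk u)) z = oper Gl vsq (\<lambda>u. 0 * b (mk u)) z"
      by (rule oper_rank_cong[OF z]) (use False b0 in simp)
    then show ?thesis unfolding rho_mk[OF z] oper_scale using b0[OF z False] by simp
  qed
  finally show "Phi d ((fgen Gl - 1) * kp d [1..<d + 1]) (mk z) = 0" by simp
qed

section \<open>Surjectivity\<close>

definition phi_image :: "nat \<Rightarrow> (ix \<Rightarrow> ratfun) set" where
  "phi_image d = {\<phi>. \<exists>p. \<forall>z\<in>Ix d. Phi d p (mk z) = \<phi> z}"

lemma phi_imageI: "(\<And>z. z \<in> Ix d \<Longrightarrow> Phi d p (mk z) = \<phi> z) \<Longrightarrow> \<phi> \<in> phi_image d"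
  unfolding phi_image_def by blast

lemma phi_imageE: assumes "\<phi> \<in> phi_image d" obtains p where "\<And>z. z \<in> Ix d \<Longrightarrow> Phi d p (mk z) = \<phi> z"
  using assms unfolding phi_image_def by blast

lemma phi_image_add: assumes "\<phi> \<in> phi_image d" "\<psi> \<in> phi_image d" shows "(\<lambda>z. \<phi> z + \<psi> z) \<in> phi_image d"
proof -
  obtain p where p: "\<And>z. z \<in> Ix d \<Longrightarrow> Phi d p (mk z) = \<phi> z" using assms(1) by (rule phi_imageE) blast
  obtain q where q: "\<And>z. z \<in> Ix d \<Longrightarrow> Phi d q (mk z) = \<psi> z" using assms(2) by (rule phi_imageE) blast
  show ?thesis by (rule phi_imageI[of d "p + q"]) (simp add: Phi_add p q)
qed

lemma phi_image_scale: assumes "\<phi> \<in> phi_image d" shows "(\<lambda>z. c * \<phi> z) \<in> phi_image d"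
proof -
  obtain p where p: "\<And>z. z \<in> Ix d \<Longrightarrow> Phi d p (mk z) = \<phi> z" using assms(1) by (rule phi_imageE) blast
  show ?thesis by (rule phi_imageI[of d "fsc c p"]) (simp add: Phi_fsc p)
qed

lemma phi_image_agree: assumes "\<phi> \<in> phi_image d" "\<And>z. z \<in> Ix d \<Longrightarrow> \<psi> z = \<phi> z" shows "\<psi> \<in> phi_image d"
  using assms unfolding phi_image_def by simp

lemma phi_image_sum: "(\<And>i. i \<in> A \<Longrightarrow> \<phi> i \<in> phi_image d) \<Longrightarrow> (\<lambda>z. \<Sum>i\<in>A. \<phi> i z) \<in> phi_image d"
proof (induction A rule: infinite_finite_induct)
  case (insert i A)
  then show ?case using phi_image_add[of "\<phi> i" d] by simp
qed (use phi_imageI[of d 0 "\<lambda>z. 0"] Phi_fsc[of d 0 0] in simp_all)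

text \<open>Multiples of the products of \<open>k - v\<^bsup>2s-d\<^esup>\<close> over \<open>s \<noteq> r\<close> are the projectors to the functions
  supported in rank \<open>r\<close>.\<close>

lemma phi_image_weight:
  assumes "\<phi> \<in> phi_image d" shows "(\<lambda>z. h (rk z) * \<phi> z) \<in> phi_image d"
proof -
  obtain p where p: "\<And>z. z \<in> Ix d \<Longrightarrow> Phi d p (mk z) = \<phi> z" using assms(1) by (rule phi_imageE) blast
  define others where "others r = filter (\<lambda>s. s \<noteq> r) [0..<d + 1]" for r
  define c where "c i r = (\<Prod>s\<leftarrow>others r. vv powi (2 * int i - int d) - vv powi (2 * int s - int d))" for i r
  have c0: "c i r = 0 \<longleftrightarrow> i \<noteq> r" if "i \<le> d" for i r
    unfolding c_def weight_product_eq_0_iff others_def using that by auto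
  have "(\<lambda>z. h r / c r r * (c (rk z) r * \<phi> z)) \<in> phi_image d" for r
  proof (rule phi_image_scale, rule phi_imageI[of d "kp d (others r) * p"])
    fix z assume z: "z \<in> Ix d"
    have "Phi d (kp d (others r) * p) (mk z) = c (rk z) r * Phi d p (mk z)"
      unfolding c_def Phi_def Act_mult by (rule Act_kp[OF z])
    then show "Phi d (kp d (others r) * p) (mk z) = c (rk z) r * \<phi> z" using p[OF z] by simp
  qed
  then have "(\<lambda>z. \<Sum>r\<le>d. h r / c r r * (c (rk z) r * \<phi> z)) \<in> phi_image d" by (rule phi_image_sum)
  then show ?thesis
  proof (rule phi_image_agree)
    fix z assume z: "z \<in> Ix d"
    have "(\<Sum>r\<le>d. h r / c r r * (c (rk z) r * \<phi> z)) = (\<Sum>r\<le>d. if r = rk z then h r * \<phi> z else 0)"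
      using c0 rk_le[OF z] by (intro sum.cong refl) auto
    then show "h (rk z) * \<phi> z = (\<Sum>r\<le>d. h r / c r r * (c (rk z) r * \<phi> z))" using rk_le[OF z] by simp
  qed
qed

text \<open>Multiplication by the generator realises the operator times a power of v depending on
  the rank, and \<open>phi_image_weight\<close> removes that power.\<close>

lemma phi_image_oper: assumes "\<phi> \<in> phi_image d" shows "oper g vsq \<phi> \<in> phi_image d"
proof -
  obtain p where p: "\<And>z. z \<in> Ix d \<Longrightarrow> Phi d p (mk z) = \<phi> z" using assms(1) by (rule phi_imageE) blast
  have "(\<lambda>z. ws d g (int (rk z)) * oper g vsq \<phi> z) \<in> phi_image d"
  proof (rule phi_imageI[of d "fgen g * p"])
    fix z assume z: "z \<in> Ix d"
    have "oper g vsq (\<lambda>u. Phi d p (mk u)) z = oper g vsq \<phi> z" by (rule oper_cong[OF z]) (rule p)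
    then show "Phi d (fgen g * p) (mk z) = ws d g (int (rk z)) * oper g vsq \<phi> z"
      using Act_gen_mult[of d g p "\<one>\<^bsub>MS d\<^esub>"] rho_mk[OF z] by (simp add: Phi_def)
  qed
  then have "(\<lambda>z. inverse (ws d g (int (rk z))) * (ws d g (int (rk z)) * oper g vsq \<phi> z)) \<in> phi_image d"
    by (rule phi_image_weight)
  moreover have "ws d g i \<noteq> 0" for i by (cases g) simp_all
  ultimately show ?thesis by (simp flip: mult.assoc)
qed

lemma gn_vsq_nonzero: "gn vsq (Suc n) \<noteq> 0"
proof
  assume "gn vsq (Suc n) = 0"
  then have "vsq ^ Suc n = 1" using power_eq_gn[of vsq "Suc n"] by (simp del: power_Suc)
  then show False using vv_powi_inject[of "2 * int (Suc n)" 0] unfolding vsq_power by simp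
qed

lemma phi_image_generation: "generation vsq d (phi_image d)"
proof
  show "(\<lambda>_. 0) \<in> phi_image d" using phi_image_sum[of "{}"] by simp
  fix \<phi> \<psi> :: "ix \<Rightarrow> ratfun" and n r :: nat and k :: ratfun
  show "\<phi> \<in> phi_image d \<Longrightarrow> \<psi> \<in> phi_image d \<Longrightarrow> (\<lambda>y. \<phi> y + \<psi> y) \<in> phi_image d" by (rule phi_image_add)
  show "\<phi> \<in> phi_image d \<Longrightarrow> (\<lambda>y. k * \<phi> y) \<in> phi_image d" by (rule phi_image_scale)
  have "opE t \<phi> = oper Ge t \<phi>" "opF t \<phi> = oper Gf t \<phi>" "opL t \<phi> = oper Gl t \<phi>" for t by auto
  then show "\<phi> \<in> phi_image d \<Longrightarrow> opE vsq \<phi> \<in> phi_image d" "\<phi> \<in> phi_image d \<Longrightarrow> opF vsq \<phi> \<in> phi_image d"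
    "\<phi> \<in> phi_image d \<Longrightarrow> opL vsq \<phi> \<in> phi_image d"
    using phi_image_oper by metis+
  show "\<phi> \<in> phi_image d \<Longrightarrow> (\<And>z. z \<in> Ix d \<Longrightarrow> \<psi> z = \<phi> z) \<Longrightarrow> \<psi> \<in> phi_image d" by (rule phi_image_agree)
  have div: "\<phi> \<in> phi_image d" if "(\<lambda>z. m * \<phi> z) \<in> phi_image d" "m \<noteq> 0" for m
    using phi_image_scale[OF that(1), of "inverse m"] that(2) by (simp flip: mult.assoc)
  show "(\<lambda>z. gn vsq (Suc n) * \<phi> z) \<in> phi_image d \<Longrightarrow> \<phi> \<in> phi_image d" using div gn_vsq_nonzero by blast
  show "(\<lambda>z. vsq ^ n * \<phi> z) \<in> phi_image d \<Longrightarrow> \<phi> \<in> phi_image d" using div[of "vsq ^ n"] by (simp add: vsq_def)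
  show "\<delta> (r, 0, 0, d - r, D0) \<in> phi_image d" if "r \<le> d"
  proof -
    have "(\<lambda>z. \<Sum>s\<le>d. \<delta> (s, 0, 0, d - s, D0) z) \<in> phi_image d"
      by (rule phi_imageI[of d 1]) (simp only: Phi_1 MS_one)
    then have "(\<lambda>z. (if rk z = r then 1 else 0) * (\<Sum>s\<le>d. \<delta> (s, 0, 0, d - s, D0) z)) \<in> phi_image d"
      by (rule phi_image_weight)
    then show ?thesis
    proof (rule phi_image_agree)
      fix z
      have "(if rk z = r then 1 else 0) * (\<Sum>s\<le>d. \<delta> (s, 0, 0, d - s, D0) z) = (\<Sum>s\<le>d. if s = r then \<delta> (r, 0, 0, d - r, D0) z else 0)"
        unfolding sum_distrib_left by (intro sum.cong refl) (auto simp: \<delta>_def)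
      also have "\<dots> = \<delta> (r, 0, 0, d - r, D0) z" using that by simp
      finally show "\<delta> (r, 0, 0, d - r, D0) z = (if rk z = r then 1 else 0) * (\<Sum>s\<le>d. \<delta> (s, 0, 0, d - s, D0) z)"
        by (rule sym)
    qed
  qed
qed

lemma Phi_surj: assumes b: "b \<in> carrier (MS d)" shows "\<exists>p. Phi d p = b"
proof -
  have "(\<lambda>z. \<Sum>y\<in>Ix d. b (mk y) * \<delta> y z) \<in> phi_image d"
    by (intro phi_image_sum phi_image_scale generation.S_delta[OF phi_image_generation])
  then obtain p where p: "\<And>z. z \<in> Ix d \<Longrightarrow> Phi d p (mk z) = (\<Sum>y\<in>Ix d. b (mk y) * \<delta> y z)" by (rule phi_imageE) blast
  have "Phi d p = b"
  proof (rule MS_eqI[OF Phi_closed b])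
    fix z assume "z \<in> Ix d"
    then show "Phi d p (mk z) = b (mk z)" by (simp add: p \<delta>_def finite_Ix if_distrib cong: if_cong)
  qed
  then show ?thesis ..
qed

section \<open>The kernel\<close>

lemma Phi_sum: "Phi d (\<Sum>i\<in>A. fsc (c i) (b i)) X = (\<Sum>i\<in>A. c i * Phi d (b i) X)"
  by (induction A rule: infinite_finite_induct) (simp_all add: Phi_0 Phi_add Phi_fsc)

text \<open>Preimages of the basis of the target give \<open>card (Ix d)\<close> independent vectors
  modulo the kernel, all in the span of the image of Z. A nontrivial relation between the images of
  Z would leave a smaller spanning set. Hence an element of the kernel has no component along Z and
  lies in J.\<close>

lemma phi_kernel_subset:
  assumes J: "ideal2 J" and sub: "J \<subseteq> phi_kernel d" and grown: "grown (card (Ix d)) J UNIV"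
  shows "phi_kernel d \<subseteq> J"
proof
  fix p assume p: "p \<in> phi_kernel d"
  obtain \<kappa> where \<kappa>: "\<And>x y. \<kappa> (x + y) = \<kappa> x + \<kappa> y" "\<And>c x. \<kappa> (fsc c x) = fsc c (\<kappa> x)"
    "\<And>x. \<kappa> x = 0 \<longleftrightarrow> x \<in> phi_kernel d"
    using exists_projection[OF ideal2_subspace[OF ideal2_phi_kernel[of d]]] by blast
  interpret vp: vector_space_pair fsc fsc ..
  have lin: "Vector_Spaces.linear fsc fsc \<kappa>" by unfold_locales (simp_all add: \<kappa>)
  interpret \<kappa>: Vector_Spaces.linear fsc fsc \<kappa> by (rule lin)
  obtain Z where Z: "finite Z" "card Z \<le> card (Ix d)" "fs.span (Z \<union> J) = UNIV" using grown unfolding grown_def by auto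
  have Jk: "\<kappa> x = 0" if "x \<in> J" for x using sub that \<kappa>(3) by blast
  have dec: "\<exists>c. \<exists>j\<in>J. x = (\<Sum>z\<in>Z. fsc (c z) z) + j" for x
  proof -
    have "x \<in> fs.span (Z \<union> J)" using Z(3) by simp
    then obtain u j where uj: "u \<in> fs.span Z" "j \<in> fs.span J" "x = u + j" unfolding fs.span_Un by blast
    have "fs.span J = J" using fs.span_eq_iff ideal2_subspace[OF J] by blast
    moreover obtain c where "u = (\<Sum>z\<in>Z. fsc (c z) z)" using uj(1) unfolding fs.span_finite[OF Z(1)] by blast
    ultimately show ?thesis using uj by blast
  qed
  have "\<exists>b. Phi d b = Tbas (mk y)" if "y \<in> Ix d" for y
  proof (rule Phi_surj)
    have "mk y \<in> Xi d" using that by simp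
    then show "Tbas (mk y) \<in> carrier (MS d)" unfolding MS_simps(1) Tbas_def by auto
  qed
  then obtain b where b: "\<And>y. y \<in> Ix d \<Longrightarrow> Phi d (b y) = Tbas (mk y)" by metis
  have comb: "u y = 0" if "\<kappa> (\<Sum>y\<in>Ix d. fsc (u y) (b y)) = 0" "y \<in> Ix d" for u y
  proof -
    have "0 = Phi d (\<Sum>y\<in>Ix d. fsc (u y) (b y)) (mk y)" using that(1) unfolding \<kappa>(3) phi_kernel_def by simp
    also have "\<dots> = (\<Sum>z\<in>Ix d. if z = y then u z else 0)"
      unfolding Phi_sum using b by (intro sum.cong refl) (auto simp: Tbas_mk \<delta>_def)
    finally show ?thesis using that(2) by (simp add: finite_Ix)
  qed
  define B where "B = (\<lambda>y. \<kappa> (b y)) ` Ix d"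
  have inj: "inj_on (\<lambda>y. \<kappa> (b y)) (Ix d)"
  proof (rule inj_onI)
    fix y z assume yz: "y \<in> Ix d" "z \<in> Ix d" "\<kappa> (b y) = \<kappa> (b z)"
    have "\<kappa> (b y - b z) = 0" using yz(3) by (simp add: \<kappa>.diff)
    then have "Phi d (b y - b z + b z) = (\<lambda>X. 0 + Phi d (b z) X)" unfolding \<kappa>(3) phi_kernel_def Phi_add by simp
    then have "Tbas (mk y) = Tbas (mk z)" using b yz by simp
    then have "\<delta> y y = (\<delta> z y :: ratfun)" unfolding Tbas_mk[symmetric] by simp
    then show "y = z" by (simp add: \<delta>_def split: if_splits)
  qed
  have indep: "fs.independent B"
  proof
    assume "fs.dependent B"
    moreover have "finite B" unfolding B_def by (simp add: finite_Ix)
    ultimately obtain u v where u: "v \<in> B" "u v \<noteq> 0" "(\<Sum>v\<in>B. fsc (u v) v) = 0" using fs.dependent_finite by blast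
    obtain y where y: "y \<in> Ix d" "v = \<kappa> (b y)" using u(1) unfolding B_def by blast
    have "\<kappa> (\<Sum>y\<in>Ix d. fsc (u (\<kappa> (b y))) (b y)) = (\<Sum>y\<in>Ix d. fsc (u (\<kappa> (b y))) (\<kappa> (b y)))"
      by (simp add: \<kappa>.sum \<kappa>(2))
    also have "\<dots> = (\<Sum>v\<in>B. fsc (u v) v)" unfolding B_def by (subst sum.reindex[OF inj]) simp
    finally have "u (\<kappa> (b y)) = 0" using comb[of "\<lambda>y. u (\<kappa> (b y))", OF _ y(1)] u(3) by simp
    then show False using u(2) y(2) by simp
  qed
  have cardB: "card B = card (Ix d)" unfolding B_def by (rule card_image[OF inj])
  obtain c j where cj: "j \<in> J" "p = (\<Sum>z\<in>Z. fsc (c z) z) + j" using dec by blast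
  have zero: "(\<Sum>z\<in>Z. fsc (c z) (\<kappa> z)) = 0"
  proof -
    have "\<kappa> p = (\<Sum>z\<in>Z. fsc (c z) (\<kappa> z)) + \<kappa> j" unfolding cj(2) by (simp add: \<kappa>(1) \<kappa>.sum \<kappa>(2))
    moreover have "\<kappa> p = 0" unfolding \<kappa>(3) by (rule p)
    ultimately show ?thesis unfolding Jk[OF cj(1)] by simp
  qed
  have "c z = 0" if z0: "z \<in> Z" for z
  proof (rule ccontr)
    assume c0: "c z \<noteq> 0"
    let ?Z = "\<kappa> ` (Z - {z})"
    have "fsc (c z) (\<kappa> z) = - (\<Sum>y\<in>Z - {z}. fsc (c y) (\<kappa> y))"
      using zero unfolding sum.remove[OF Z(1) z0] eq_neg_iff_add_eq_0 .
    moreover have "- (\<Sum>y\<in>Z - {z}. fsc (c y) (\<kappa> y)) \<in> fs.span ?Z"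
      by (intro fs.span_neg fs.span_sum fs.span_scale fs.span_base) blast
    ultimately have "fsc (inverse (c z)) (fsc (c z) (\<kappa> z)) \<in> fs.span ?Z" by (metis fs.span_scale)
    then have "\<kappa> z \<in> fs.span ?Z" using c0 by simp
    then have Zs: "\<kappa> y \<in> fs.span ?Z" if "y \<in> Z" for y using that by (cases "y = z") (auto intro: fs.span_base)
    have "B \<subseteq> fs.span ?Z"
    proof
      fix v assume "v \<in> B"
      then obtain y where "v = \<kappa> (b y)" unfolding B_def by blast
      moreover obtain e i where "i \<in> J" "b y = (\<Sum>z\<in>Z. fsc (e z) z) + i" using dec by blast
      ultimately have "v = (\<Sum>z\<in>Z. fsc (e z) (\<kappa> z))" using Jk by (simp add: \<kappa>(1) \<kappa>.sum \<kappa>(2))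
      then show "v \<in> fs.span ?Z" using Zs by (simp add: fs.span_sum fs.span_scale)
    qed
    note Bs = this
    have fin: "finite ?Z" using Z(1) by simp
    have "card B \<le> card ?Z" by (rule conjunct2[OF fs.independent_span_bound[OF fin indep Bs]])
    also have "\<dots> \<le> card (Z - {z})" using Z(1) by (intro card_image_le) simp
    also have "\<dots> < card Z" by (rule card_Diff1_less[OF Z(1) z0])
    finally have "card (Ix d) < card Z" unfolding cardB .
    then show False using leD[OF Z(2)] by contradiction
  qed
  then have "p = j" unfolding cj(2) by simp
  then show "p \<in> J" using cj(1) by simp
qed

section \<open>The images of the generators\<close>

lemma abelian_monoid_MS: "abelian_monoid (MS d)"
  by (rule abelian_monoidI) (auto simp: MS_simps algebra_simps)

lemma finsum_MS:
  assumes "\<And>i. i \<in> A \<Longrightarrow> f i \<in> carrier (MS d)" "finite A"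
  shows "finsum (MS d) f A = (\<lambda>X. \<Sum>i\<in>A. f i X)"
  using assms(2,1)
proof (induction A rule: finite_induct)
  case empty
  show ?case using abelian_monoid.finsum_empty[OF abelian_monoid_MS, of d f] by (simp add: MS_simps)
next
  case (insert i A)
  have "finsum (MS d) f (insert i A) = f i \<oplus>\<^bsub>MS d\<^esub> finsum (MS d) f A"
    using insert by (intro abelian_monoid.finsum_insert[OF abelian_monoid_MS]) auto
  then show ?case using insert by (simp add: MS_simps)
qed

lemma Tbas_closed: "z \<in> Ix d \<Longrightarrow> Tbas (mk z) \<in> carrier (MS d)"
proof -
  assume "z \<in> Ix d"
  then have "mk z \<in> Xi d" by simp
  then show "Tbas (mk z) \<in> carrier (MS d)" unfolding MS_simps(1) Tbas_def by auto
qed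

lemma MS_gens_mk:
  "MS1 d r = Tbas (mk (r, 0, 0, d - r, D0))" "MSe d r = Tbas (mk (r, 1, 0, d - r - 1, D0))"
  "MSf d r = Tbas (mk (r, 0, 1, d - r - 1, D0))" "MSx d r = Tbas (mk (r, 0, 0, d - r, D11))"
  unfolding MS1_def MSe_def MSf_def MSx_def
  by (rule arg_cong[of _ _ Tbas], simp add: mk.simps Dmat_def Emat_def vec_eq_iff forall_2)+

lemma weighted_sum_MS:
  assumes "\<And>i. i \<in> A \<Longrightarrow> u i \<in> Ix d" "finite A"
  shows "(\<Oplus>\<^bsub>MS d\<^esub>i\<in>A. c i \<odot>\<^bsub>MS d\<^esub> Tbas (mk (u i))) = (\<lambda>X. \<Sum>i\<in>A. c i * Tbas (mk (u i)) X)"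
  using assms by (subst finsum_MS) (auto simp: MS_simps(4) intro!: MS_scale_closed Tbas_closed)

lemma weighted_sum_closed:
  assumes "\<And>i. i \<in> A \<Longrightarrow> u i \<in> Ix d"
  shows "(\<lambda>X. \<Sum>i\<in>A. c i * Tbas (mk (u i)) X) \<in> carrier (MS d)"
proof -
  have "(\<Sum>i\<in>A. c i * Tbas (mk (u i)) X) = 0" if "X \<notin> Xi d" for X
  proof (intro sum.neutral ballI)
    fix i assume "i \<in> A"
    then have "Tbas (mk (u i)) X = 0" using Tbas_closed[OF assms] that unfolding MS_simps(1) by blast
    then show "c i * Tbas (mk (u i)) X = 0" by simp
  qed
  then show ?thesis unfolding MS_simps(1) by blast
qed

lemma one_value: "(a, b, c, x, g) \<in> Ix d \<Longrightarrow> \<one>\<^bsub>MS d\<^esub> (mk (a, b, c, x, g)) = (if b = 0 \<and> c = 0 \<and> g = D0 then 1 else 0)"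
proof -
  assume z: "(a, b, c, x, g) \<in> Ix d"
  have "(\<Sum>r\<le>d. \<delta> (r, 0, 0, d - r, D0) (a, b, c, x, g)) = (\<Sum>r\<le>d. if r = a then if b = 0 \<and> c = 0 \<and> g = D0 then 1 else 0 else (0 :: ratfun))"
    using z by (intro sum.cong refl) (auto simp: \<delta>_def Ix_def)
  then show ?thesis using z by (simp add: MS_one Ix_def)
qed

text \<open>Applied to the unit, E leaves only undecorated positions with b = 1 and F those with c =
  1, the other off-diagonal entry being 0; L adds \<open>D11\<close> to the diagonal ones. These are
  the supports of the sums in \<open>MSgen\<close>.\<close>

lemma Phi_gen_MSgen: "Phi d (fgen g) = MSgen d g"
proof -
  \<comment> \<open>The coordinates of the unit with the sum over r carried out, in a form that the
    operators can be evaluated on.\<close>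
  define on :: "ix \<Rightarrow> ratfun" where "on = (\<lambda>(a, b, c, x, g). if b = 0 \<and> c = 0 \<and> g = D0 then 1 else 0)"
  have rho: "rho d g \<one>\<^bsub>MS d\<^esub> (mk z) = ws d g (int (rk z)) * oper g vsq on z" if z: "z \<in> Ix d" for z g
  proof -
    have "oper g vsq (\<lambda>u. \<one>\<^bsub>MS d\<^esub> (mk u)) z = oper g vsq on z"
      by (rule oper_cong[OF z]) (auto simp: one_value on_def split: prod.split)
    then show ?thesis by (simp add: rho_mk[OF z])
  qed
  have E: "opE vsq on (a, b, c, x, t) = (if b = 1 \<and> c = 0 \<and> t = D0 then 1 else 0)" if "valid (a, b, c, x, t)" for a b c x t
    using that by (cases t; cases b rule: nat3_cases) (auto simp: on_def)
  have F: "opF vsq on (a, b, c, x, t) = (if b = 0 \<and> c = 1 \<and> t = D0 then 1 else 0)" if "valid (a, b, c, x, t)" for a b c x t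
    using that by (cases t; cases c rule: nat3_cases) (auto simp: on_def)
  have L: "opL vsq on (a, b, c, x, t) = (if b = 0 \<and> c = 0 \<and> (t = D0 \<or> t = D11) then 1 else 0)" if "valid (a, b, c, x, t)" for a b c x t
    using that by (cases t) (auto simp: on_def)
  have pick: "(\<Sum>r\<in>A. h r * \<delta> (u r) z) = (if s \<in> A \<and> u s = z then h s else 0)"
    if "\<And>r. r \<in> A \<Longrightarrow> u r = z \<Longrightarrow> r = s" "finite A" for A :: "nat set" and h :: "nat \<Rightarrow> ratfun" and u z s
  proof -
    have "(\<Sum>r\<in>A. h r * \<delta> (u r) z) = (\<Sum>r\<in>A. if r = s then if u s = z then h s else 0 else 0)"
    proof (intro sum.cong refl)
      fix r assume r: "r \<in> A"
      show "h r * \<delta> (u r) z = (if r = s then if u s = z then h s else 0 else 0)"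
      proof (cases "u r = z")
        case True
        then have "r = s" using that(1) r by blast
        then show ?thesis using True by (simp add: \<delta>_def)
      next
        case False
        then show ?thesis by (cases "r = s") (simp_all add: \<delta>_def)
      qed
    qed
    then show ?thesis using that(2) by simp
  qed
  have cl: "MSgen d g \<in> carrier (MS d) \<and> (\<forall>a b c x t. (a, b, c, x, t) \<in> Ix d \<longrightarrow>
      MSgen d g (mk (a, b, c, x, t)) = ws d g (int (a + b)) * oper g vsq on (a, b, c, x, t))"
  proof (cases g)
    case Ge
    have i: "(r, 1, 0, d - r - 1, D0) \<in> Ix d" if "r \<in> {0..<d}" for r using that by (auto simp: Ix_def)
    have eq: "MSgen d Ge = (\<lambda>X. \<Sum>r\<in>{0..<d}. vv powi (- int r) * Tbas (mk (r, 1, 0, d - r - 1, D0)) X)"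
      unfolding MSgen.simps MS_gens_mk by (rule weighted_sum_MS[OF i]) simp_all
    have v: "MSgen d Ge (mk (a, b, c, x, t)) = (if a \<in> {0..<d} \<and> (a, 1, 0, d - a - 1, D0) = (a, b, c, x, t) then vv powi (- int a) else 0)" for a b c x t
      unfolding eq Tbas_mk by (rule pick) auto
    have "MSgen d Ge \<in> carrier (MS d)" unfolding eq by (rule weighted_sum_closed[OF i])
    then show ?thesis unfolding Ge v 
      by (auto simp: Ix_def E)
  next
    case Gf
    have i: "(r, 0, 1, d - r - 1, D0) \<in> Ix d" if "r \<in> {0..<d}" for r using that by (auto simp: Ix_def)
    have eq: "MSgen d Gf = (\<lambda>X. \<Sum>r\<in>{0..<d}. vv powi (1 + int r - int d) * Tbas (mk (r, 0, 1, d - r - 1, D0)) X)"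
      unfolding MSgen.simps MS_gens_mk by (rule weighted_sum_MS[OF i]) simp_all
    have v: "MSgen d Gf (mk (a, b, c, x, t)) = (if a \<in> {0..<d} \<and> (a, 0, 1, d - a - 1, D0) = (a, b, c, x, t) then vv powi (1 + int a - int d) else 0)" for a b c x t
      unfolding eq Tbas_mk by (rule pick) auto
    have "MSgen d Gf \<in> carrier (MS d)" unfolding eq by (rule weighted_sum_closed[OF i])
    then show ?thesis unfolding Gf v 
      by (auto simp: Ix_def F)
  next
    case Gk
    have i: "(r, 0, 0, d - r, D0) \<in> Ix d" if "r \<in> {0..d}" for r using that by (auto simp: Ix_def)
    have eq: "MSgen d Gk = (\<lambda>X. \<Sum>r\<in>{0..d}. vv powi (2 * int r - int d) * Tbas (mk (r, 0, 0, d - r, D0)) X)"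
      unfolding MSgen.simps MS_gens_mk by (rule weighted_sum_MS[OF i]) simp_all
    have v: "MSgen d Gk (mk (a, b, c, x, t)) = (if a \<in> {0..d} \<and> (a, 0, 0, d - a, D0) = (a, b, c, x, t) then vv powi (2 * int a - int d) else 0)" for a b c x t
      unfolding eq Tbas_mk by (rule pick) auto
    have "MSgen d Gk \<in> carrier (MS d)" unfolding eq by (rule weighted_sum_closed[OF i])
    then show ?thesis unfolding Gk v 
      by (auto simp: Ix_def on_def)
  next
    case Gki
    have i: "(r, 0, 0, d - r, D0) \<in> Ix d" if "r \<in> {0..d}" for r using that by (auto simp: Ix_def)
    have eq: "MSgen d Gki = (\<lambda>X. \<Sum>r\<in>{0..d}. vv powi (- (2 * int r - int d)) * Tbas (mk (r, 0, 0, d - r, D0)) X)"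
      unfolding MSgen.simps MS_gens_mk by (rule weighted_sum_MS[OF i]) simp_all
    have v: "MSgen d Gki (mk (a, b, c, x, t)) = (if a \<in> {0..d} \<and> (a, 0, 0, d - a, D0) = (a, b, c, x, t) then vv powi (- (2 * int a - int d)) else 0)" for a b c x t
      unfolding eq Tbas_mk by (rule pick) auto
    have "MSgen d Gki \<in> carrier (MS d)" unfolding eq by (rule weighted_sum_closed[OF i])
    then show ?thesis unfolding Gki v 
      by (auto simp: Ix_def on_def)
  next
    case Gl
    have i: "(r, 0, 0, d - r, D0) \<in> Ix d" "(r, 0, 0, d - r, D11) \<in> Ix d" if "r \<in> {1..d}" for r
      using that by (auto simp: Ix_def)
    have i0: "(0, 0, 0, d, D0) \<in> Ix d" by (simp add: Ix_def)
    let ?s = "\<lambda>X. \<Sum>r\<in>{1..d}. vv powi (- 2 * int r) * (Tbas (mk (r, 0, 0, d - r, D0)) X + Tbas (mk (r, 0, 0, d - r, D11)) X)"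
    have "(\<Oplus>\<^bsub>MS d\<^esub>r\<in>{1..d}. (vv powi (- 2 * int r)) \<odot>\<^bsub>MS d\<^esub> (MS1 d r \<oplus>\<^bsub>MS d\<^esub> MSx d r)) = ?s"
      unfolding MS_gens_mk MS_simps(3,4)
      by (rule finsum_MS) (auto intro!: MS_scale_closed MS_add_closed Tbas_closed i)
    then have eq: "MSgen d Gl = (\<lambda>X. Tbas (mk (0, 0, 0, d, D0)) X + ?s X)"
      unfolding MSgen.simps by (simp only: MS_simps(3)) (simp add: MS_gens_mk)
    have p0: "(\<Sum>r\<in>{1..d}. vv powi (- 2 * int r) * \<delta> (r, 0, 0, d - r, D0) (a, b, c, x, t))
        = (if a \<in> {1..d} \<and> (a, 0, 0, d - a, D0) = (a, b, c, x, t) then vv powi (- 2 * int a) else 0)" for a b c x t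
      by (rule pick) auto
    have p1: "(\<Sum>r\<in>{1..d}. vv powi (- 2 * int r) * \<delta> (r, 0, 0, d - r, D11) (a, b, c, x, t))
        = (if a \<in> {1..d} \<and> (a, 0, 0, d - a, D11) = (a, b, c, x, t) then vv powi (- 2 * int a) else 0)" for a b c x t
      by (rule pick) auto
    have v: "MSgen d Gl (mk (a, b, c, x, t)) = \<delta> (0, 0, 0, d, D0) (a, b, c, x, t)
        + ((if a \<in> {1..d} \<and> (a, 0, 0, d - a, D0) = (a, b, c, x, t) then vv powi (- 2 * int a) else 0)
        + (if a \<in> {1..d} \<and> (a, 0, 0, d - a, D11) = (a, b, c, x, t) then vv powi (- 2 * int a) else 0))" for a b c x t
      unfolding eq Tbas_mk distrib_left sum.distrib p0 p1 ..
    have "?s \<in> carrier (MS d)"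
      unfolding distrib_left sum.distrib by (intro MS_add_closed weighted_sum_closed i)
    then have "MSgen d Gl \<in> carrier (MS d)" unfolding eq by (rule MS_add_closed[OF Tbas_closed[OF i0]])
    then show ?thesis unfolding Gl v
      by (auto simp: Ix_def L \<delta>_def not_less_eq_eq)
  qed
  show ?thesis unfolding Phi_gen
    by (rule MS_eqI[OF rho_closed conjunct1[OF cl]]) (use cl rho in auto)
qed

section \<open>Quotients and the presentation\<close>

text \<open>A ring with those laws of the scalars that make ideals closed under them and that
  descend to quotients, so the construction can be iterated.\<close>

locale kalgebra = ring A for A :: "(ratfun, 'a) module" (structure) +
  assumes smult_closed: "x \<in> carrier A \<Longrightarrow> c \<odot> x \<in> carrier A"
    and smult_add: "x \<in> carrier A \<Longrightarrow> y \<in> carrier A \<Longrightarrow> c \<odot> (x \<oplus> y) = c \<odot> x \<oplus> c \<odot> y"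
    and smult_mult: "x \<in> carrier A \<Longrightarrow> y \<in> carrier A \<Longrightarrow> (c \<odot> x) \<otimes> y = c \<odot> (x \<otimes> y)"

lemma quot_alg_simps:
  "carrier (quot_alg A I) = carrier (A Quot I)" "monoid.mult (quot_alg A I) = monoid.mult (A Quot I)"
  "one (quot_alg A I) = one (A Quot I)" "zero (quot_alg A I) = zero (A Quot I)" "add (quot_alg A I) = add (A Quot I)"
  "c \<odot>\<^bsub>quot_alg A I\<^esub> X = (\<Union>x\<in>X. I +>\<^bsub>A\<^esub> (c \<odot>\<^bsub>A\<^esub> x))"
  by (simp_all add: quot_alg_def ring.defs module.defs)

context kalgebra begin

text \<open>A scalar multiple c x is the product of the ring element c 1 with x.\<close>

lemma smult_ideal: assumes I: "ideal I A" and x: "x \<in> I" shows "c \<odot> x \<in> I"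
proof -
  interpret I: ideal I A by (rule I)
  have xc: "x \<in> carrier A" using x by (rule I.Icarr)
  have "(c \<odot> \<one>) \<otimes> x \<in> I" using x by (intro I.I_l_closed smult_closed) simp_all
  then show ?thesis using xc smult_mult[of \<one> x c] by simp
qed

lemma coset_eq_iff:
  assumes I: "ideal I A" and xy: "x \<in> carrier A" "y \<in> carrier A"
  shows "I +> x = I +> y \<longleftrightarrow> x \<ominus> y \<in> I"
proof -
  interpret I: ideal I A by (rule I)
  show ?thesis using quotient_eq_iff_same_a_r_cos[OF I xy] by blast
qed

lemma quot_hom: assumes I: "ideal I A" shows "(+>) I \<in> alg_hom A (quot_alg A I)"
proof -
  interpret I: ideal I A by (rule I)
  have hom: "(+>) I \<in> ring_hom A (quot_alg A I)"
    using I.rcos_ring_hom unfolding ring_hom_def by (simp add: quot_alg_simps)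
  have "I +> (c \<odot> x) = c \<odot>\<^bsub>quot_alg A I\<^esub> (I +> x)" if x: "x \<in> carrier A" for c x
  proof -
    have "I +> (c \<odot> y) = I +> (c \<odot> x)" if y: "y \<in> I +> x" for y
    proof -
      obtain i where i: "i \<in> I" "y = i \<oplus> x" using y unfolding a_r_coset_def' by blast
      have ic: "i \<in> carrier A" using i(1) by (rule I.Icarr)
      have "c \<odot> y = c \<odot> i \<oplus> c \<odot> x" unfolding i(2) by (rule smult_add[OF ic x])
      then have "c \<odot> y \<ominus> c \<odot> x = c \<odot> i"
        using smult_closed[OF ic, of c] smult_closed[OF x, of c] by (simp add: a_minus_def a_assoc r_neg)
      then have "c \<odot> y \<ominus> c \<odot> x \<in> I" using smult_ideal[OF I i(1)] by simp
      then show ?thesis using coset_eq_iff[OF I smult_closed smult_closed[OF x]] ic x i(2) by simp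
    qed
    moreover have "x \<in> I +> x" using I.a_rcos_self[OF x] .
    ultimately show ?thesis unfolding quot_alg_simps(6) by blast
  qed
  then show ?thesis using hom unfolding alg_hom_def by blast
qed

lemma quot_carrier: "carrier (quot_alg A I) = (+>) I ` carrier A"
  unfolding quot_alg_simps FactRing_def by (auto simp: A_RCOSETS_def')

lemma quot_zero: "\<zero>\<^bsub>quot_alg A I\<^esub> = I"
  unfolding quot_alg_simps FactRing_def by simp

text \<open>The ring axioms hold because the quotient is the image of the class map; the laws of the
  scalars are checked on representatives.\<close>

lemma quot_kalgebra: assumes I: "ideal I A" shows "kalgebra (quot_alg A I)"
proof -
  interpret I: ideal I A by (rule I)
  let ?Q = "quot_alg A I"
  have h: "(+>) I \<in> ring_hom A ?Q" and s: "\<And>c x. x \<in> carrier A \<Longrightarrow> I +> (c \<odot> x) = c \<odot>\<^bsub>?Q\<^esub> (I +> x)"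
    using quot_hom[OF I] unfolding alg_hom_def by blast+
  have "ring (?Q \<lparr>carrier := (+>) I ` carrier A, zero := I +> \<zero>\<rparr>)" by (rule ring_hom_imp_img_ring[OF h])
  moreover have "?Q \<lparr>carrier := (+>) I ` carrier A, zero := I +> \<zero>\<rparr> = ?Q"
    using abelian_subgroup.a_rcos_const[OF abelian_subgroupI3[OF ideal.axioms(1)[OF I] is_abelian_group] I.zero_closed]
      quot_carrier[of I] quot_zero[of I] by simp
  ultimately have "ring ?Q" by simp
  then interpret Q: ring ?Q .
  note add = ring_hom_add[OF h] and mult = ring_hom_mult[OF h]
  show ?thesis
  proof unfold_locales
    fix c X Y assume "X \<in> carrier ?Q"
    then obtain x where x: "x \<in> carrier A" "X = I +> x" unfolding quot_carrier by blast
    show "c \<odot>\<^bsub>?Q\<^esub> X \<in> carrier ?Q"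
      unfolding x(2) s[OF x(1), symmetric] quot_carrier by (intro imageI smult_closed x(1))
    assume "Y \<in> carrier ?Q"
    then obtain y where y: "y \<in> carrier A" "Y = I +> y" unfolding quot_carrier by blast
    show "c \<odot>\<^bsub>?Q\<^esub> (X \<oplus>\<^bsub>?Q\<^esub> Y) = c \<odot>\<^bsub>?Q\<^esub> X \<oplus>\<^bsub>?Q\<^esub> c \<odot>\<^bsub>?Q\<^esub> Y"
      unfolding x(2) y(2) using x(1) y(1)
      by (simp add: s[symmetric] add[symmetric] smult_closed smult_add)
    show "c \<odot>\<^bsub>?Q\<^esub> X \<otimes>\<^bsub>?Q\<^esub> Y = c \<odot>\<^bsub>?Q\<^esub> (X \<otimes>\<^bsub>?Q\<^esub> Y)"
      unfolding x(2) y(2) using x(1) y(1)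
      by (simp add: s[symmetric] mult[symmetric] smult_closed smult_mult)
  qed
qed

end

lemma free_alg_simps [simp]:
  "carrier free_alg = UNIV" "p \<otimes>\<^bsub>free_alg\<^esub> q = p * q" "\<one>\<^bsub>free_alg\<^esub> = 1" "\<zero>\<^bsub>free_alg\<^esub> = 0"
  "p \<oplus>\<^bsub>free_alg\<^esub> q = p + q" "c \<odot>\<^bsub>free_alg\<^esub> p = fsc c p"
  by (simp_all add: free_alg_def fsc_def)

interpretation free: kalgebra free_alg
proof -
  have "ring free_alg"
  proof (rule ringI)
    show "abelian_group free_alg"
      by (rule abelian_groupI) (auto simp: add.assoc add.commute intro: exI[of _ "- _"])
    show "Group.monoid free_alg" by (rule monoidI) (simp_all add: mult.assoc)
  qed (simp_all add: distrib_left distrib_right)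
  then show "kalgebra free_alg"
    by (intro kalgebra.intro kalgebra_axioms.intro) (simp_all add: fs.scale_right_distrib fsc_mult_left)
qed

lemma free_minus [simp]: "p \<ominus>\<^bsub>free_alg\<^esub> q = p - q"
proof -
  have "\<ominus>\<^bsub>free_alg\<^esub> q = - q" by (rule free.minus_equality) simp_all
  then show ?thesis by (simp add: a_minus_def)
qed

lemma ideal_free_iff: "ideal J free_alg \<longleftrightarrow> ideal2 J"
proof
  assume J: "ideal J free_alg"
  interpret J: ideal J free_alg by (rule J)
  have "fs.subspace J"
    unfolding fs.subspace_def using J.zero_closed J.a_closed free.smult_ideal[OF J] by auto
  then show "ideal2 J" unfolding ideal2_def using J.I_l_closed J.I_r_closed by auto
next
  assume J: "ideal2 J"
  show "ideal J free_alg"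
  proof (rule idealI)
    show "ring free_alg" ..
    show "subgroup J (add_monoid free_alg)"
    proof (rule free.add.subgroupI)
      show "J \<noteq> {}" using fs.subspace_0[OF ideal2_subspace[OF J]] by auto
      fix x y assume xy: "x \<in> J" "y \<in> J"
      show "\<ominus>\<^bsub>free_alg\<^esub> x \<in> J" using fs.subspace_neg[OF ideal2_subspace[OF J] xy(1)] free_minus[of 0 x] free.minus_eq[of 0 x] by simp
      show "x \<oplus>\<^bsub>free_alg\<^esub> y \<in> J" using ideal2_add[OF J xy] by simp
    qed simp
  qed (simp_all add: ideal2_left[OF J] ideal2_right[OF J])
qed

section \<open>Homomorphisms out of quotients of the free algebra\<close>

lemma alg_hom_comp:
  assumes f: "f \<in> alg_hom A B" and g: "g \<in> alg_hom B C"
  shows "g \<circ> f \<in> alg_hom A C"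
proof -
  have "f \<in> ring_hom A B" "g \<in> ring_hom B C" using f g unfolding alg_hom_def by blast+
  then show ?thesis
    using f g ring_hom_trans[of f A B g C] ring_hom_closed[of f A B] unfolding alg_hom_def by simp
qed

text \<open>The composite with the class map agrees with \<open>Phi d\<close> on generators, hence
  on words and on their linear combinations. This serves for \<open>Umir\<close> as well as for
  \<open>U2 d\<close>.\<close>

lemma free_hom_determined:
  assumes cl: "cl \<in> alg_hom free_alg U" and h: "h \<in> alg_hom U (MS d)" and g: "\<And>g. h (cl (fgen g)) = MSgen d g"
  shows "h (cl p) = Phi d p"
proof -
  have c: "cl p \<in> carrier U" "cl (p + q) = cl p \<oplus>\<^bsub>U\<^esub> cl q" "cl (p * q) = cl p \<otimes>\<^bsub>U\<^esub> cl q"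
    "cl 1 = \<one>\<^bsub>U\<^esub>" "cl (fsc c p) = c \<odot>\<^bsub>U\<^esub> cl p" for p q c
    using cl unfolding alg_hom_def ring_hom_def by auto
  have hh: "h (cl (p + q)) = (\<lambda>X. h (cl p) X + h (cl q) X)" "h (cl (p * q)) = h (cl p) \<otimes>\<^bsub>MS d\<^esub> h (cl q)"
    "h (cl 1) = \<one>\<^bsub>MS d\<^esub>" "h (cl (fsc c p)) = (\<lambda>X. c * h (cl p) X)" for p q c
    using h unfolding alg_hom_def ring_hom_def c by (auto simp: c(1) MS_simps)
  show ?thesis
  proof (induction p rule: free_induct)
    case zero show ?case using hh(4)[of 0 0] by (simp add: Phi_0)
  next
    case (add w c p)
    have "h (cl (Poly_Mapping.single w c)) = Phi d (Poly_Mapping.single w c)"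
    proof (induction w)
      case Nil then show ?case unfolding single_Nil by (simp only: hh Phi_fsc Phi_1)
    next
      case (Cons x w) then show ?case unfolding single_Cons by (simp only: hh g Phi_mult Phi_gen_MSgen)
    qed
    then show ?case using add by (simp add: hh Phi_add)
  qed
qed

text \<open>Choosing representatives defines h, by \<open>wd\<close> independently of the choice. A
  homomorphism is arbitrary outside the carrier, so uniqueness is stated among extensional
  maps.\<close>

lemma free_hom_factor:
  assumes cl: "cl \<in> alg_hom free_alg U" and surj: "carrier U = range cl"
    and wd: "\<And>p q. cl p = cl q \<Longrightarrow> Phi d p = Phi d q"
  shows "\<exists>!h. h \<in> alg_hom U (MS d) \<inter> extensional (carrier U) \<and> (\<forall>g. h (cl (fgen g)) = MSgen d g)"
proof (rule ex1I)
  have c: "cl p \<in> carrier U" "cl p \<oplus>\<^bsub>U\<^esub> cl q = cl (p + q)" "cl p \<otimes>\<^bsub>U\<^esub> cl q = cl (p * q)"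
    "\<one>\<^bsub>U\<^esub> = cl 1" "c \<odot>\<^bsub>U\<^esub> cl p = cl (fsc c p)" for p q c
    using cl unfolding alg_hom_def ring_hom_def by auto
  define h where "h = restrict (\<lambda>X. Phi d (inv_into UNIV cl X)) (carrier U)"
  have h: "h (cl p) = Phi d p" for p
    unfolding h_def using c(1) wd[of "inv_into UNIV cl (cl p)" p] by (simp add: f_inv_into_f)
  have "h \<in> alg_hom U (MS d)"
    unfolding alg_hom_def ring_hom_def surj
    by (auto simp: c(2,3,4,5) h Phi_closed Phi_mult Phi_add Phi_1 Phi_fsc MS_simps(3,4))
  then show "h \<in> alg_hom U (MS d) \<inter> extensional (carrier U) \<and> (\<forall>g. h (cl (fgen g)) = MSgen d g)"
    by (simp add: h Phi_gen_MSgen) (simp add: h_def)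
  fix h' assume h': "h' \<in> alg_hom U (MS d) \<inter> extensional (carrier U) \<and> (\<forall>g. h' (cl (fgen g)) = MSgen d g)"
  show "h' = h"
  proof (rule extensionalityI[of _ "carrier U"])
    show "h' \<in> extensional (carrier U)" using h' by blast
    show "h \<in> extensional (carrier U)" by (simp add: h_def)
    fix X assume "X \<in> carrier U"
    then obtain p where "X = cl p" unfolding surj by blast
    then show "h' X = h X" using free_hom_determined[OF cl, of h' d p] h' h by simp
  qed
qed

section \<open>The mirabolic algebra and its ideal, seen from the free algebra\<close>

definition Ucl :: "free_elt \<Rightarrow> free_elt set" where
  "Ucl p = (Idl\<^bsub>free_alg\<^esub> mir_relations) +>\<^bsub>free_alg\<^esub> p"

lemma ideal_relations: "ideal (Idl\<^bsub>free_alg\<^esub> mir_relations) free_alg"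
  by (rule free.genideal_ideal) simp

interpretation U: kalgebra Umir
  unfolding Umir_def by (rule free.quot_kalgebra[OF ideal_relations])

lemma Ucl_hom: "Ucl \<in> alg_hom free_alg Umir"
  using free.quot_hom[OF ideal_relations] unfolding Umir_def Ucl_def[abs_def] .

lemma Ucl_simps: "Ucl p \<in> carrier Umir" "Ucl (p + q) = Ucl p \<oplus>\<^bsub>Umir\<^esub> Ucl q" "Ucl (p * q) = Ucl p \<otimes>\<^bsub>Umir\<^esub> Ucl q"
    "Ucl 1 = \<one>\<^bsub>Umir\<^esub>" "Ucl (fsc c p) = c \<odot>\<^bsub>Umir\<^esub> Ucl p"
  using Ucl_hom unfolding alg_hom_def ring_hom_def by auto

lemma carrier_Umir: "carrier Umir = range Ucl"
  unfolding Umir_def free.quot_carrier Ucl_def by simp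

lemma Ucl_eq_iff: "Ucl p = Ucl q \<longleftrightarrow> p - q \<in> Idl\<^bsub>free_alg\<^esub> mir_relations"
  unfolding Ucl_def using free.coset_eq_iff[OF ideal_relations, of p q] by simp

lemma Ucl_0: "Ucl 0 = \<zero>\<^bsub>Umir\<^esub>"
proof -
  have "Ucl 0 \<oplus>\<^bsub>Umir\<^esub> Ucl 0 = Ucl 0" unfolding Ucl_simps(2)[symmetric] by simp
  then show ?thesis using U.add.l_cancel_one[of "Ucl 0" "Ucl 0"] Ucl_simps(1) by simp
qed

lemma Ucl_uminus: "\<ominus>\<^bsub>Umir\<^esub> Ucl q = Ucl (- q)"
  by (rule U.minus_equality) (simp_all add: Ucl_simps(1) Ucl_0 flip: Ucl_simps(2))

lemma Ucl_diff: "Ucl (p - q) = Ucl p \<ominus>\<^bsub>Umir\<^esub> Ucl q"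
  unfolding a_minus_def Ucl_uminus Ucl_simps(2)[symmetric] by simp

lemma Ugen_eq: "Ugen g = Ucl (fgen g)"
  by (simp add: Ugen_def Ucl_def)

lemma kprod_eq: "kprod d rs = Ucl (kp d rs)"
proof (induction rs)
  case Nil then show ?case by (simp add: kprod_def Ucl_simps(4))
next
  case (Cons r rs)
  have "kprod d (r # rs) = (Ugen Gk \<ominus>\<^bsub>Umir\<^esub> ((vv powi (2 * int r - int d)) \<odot>\<^bsub>Umir\<^esub> \<one>\<^bsub>Umir\<^esub>)) \<otimes>\<^bsub>Umir\<^esub> kprod d rs"
    by (simp add: kprod_def)
  then show ?case
    unfolding Cons Ugen_eq Ucl_simps(4)[symmetric] Ucl_simps(5)[symmetric] Ucl_diff[symmetric] Ucl_simps(3)[symmetric]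
    by (simp add: kp_Cons fsc_def)
qed

lemma relations_subset: "Idl\<^bsub>free_alg\<^esub> mir_relations \<subseteq> phi_kernel d"
  by (rule free.genideal_minimal) (simp_all add: ideal_free_iff ideal2_phi_kernel mir_relations_phi)

lemma Ucl_well_defined: "Ucl p = Ucl q \<Longrightarrow> Phi d p = Phi d q"
proof -
  assume "Ucl p = Ucl q"
  then have "p - q \<in> phi_kernel d" using Ucl_eq_iff relations_subset by blast
  then have "Phi d (p - q + q) = (\<lambda>X. 0 + Phi d q X)" unfolding phi_kernel_def Phi_add by simp
  then show "Phi d p = Phi d q" by simp
qed

lemma mir_ideal_eq: "mir_ideal d = Idl\<^bsub>Umir\<^esub> {Ucl (kp d [0..<d + 1]), Ucl ((fgen Gl - 1) * kp d [1..<d + 1])}"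
  unfolding mir_ideal_def Pk_def Qk_def kprod_eq Ugen_eq Ucl_simps(4)[symmetric] Ucl_diff[symmetric] Ucl_simps(3)[symmetric] ..

lemma ideal_mir_ideal: "ideal (mir_ideal d) Umir"
  unfolding mir_ideal_eq by (rule U.genideal_ideal) (simp add: Ucl_simps(1))

lemma ideal_image_phi_kernel: "ideal (Ucl ` phi_kernel d) Umir"
proof (rule idealI)
  note K = ideal2_phi_kernel[of d]
  show "ring Umir" ..
  show "subgroup (Ucl ` phi_kernel d) (add_monoid Umir)"
  proof (rule U.add.subgroupI)
    show "Ucl ` phi_kernel d \<subseteq> carrier Umir" using Ucl_simps(1) by blast
    show "Ucl ` phi_kernel d \<noteq> {}" using fs.subspace_0[OF ideal2_subspace[OF K]] by blast
    fix X Y assume "X \<in> Ucl ` phi_kernel d"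
    then obtain p where p: "p \<in> phi_kernel d" "X = Ucl p" by blast
    show "\<ominus>\<^bsub>Umir\<^esub> X \<in> Ucl ` phi_kernel d"
      unfolding p(2) Ucl_uminus by (rule imageI) (rule fs.subspace_neg[OF ideal2_subspace[OF K] p(1)])
    assume "Y \<in> Ucl ` phi_kernel d"
    then obtain q where q: "q \<in> phi_kernel d" "Y = Ucl q" by blast
    show "X \<oplus>\<^bsub>Umir\<^esub> Y \<in> Ucl ` phi_kernel d"
      unfolding p(2) q(2) Ucl_simps(2)[symmetric] by (rule imageI) (rule ideal2_add[OF K p(1) q(1)])
  qed
  fix X Y assume "X \<in> Ucl ` phi_kernel d" "Y \<in> carrier Umir"
  then obtain p q where pq: "p \<in> phi_kernel d" "X = Ucl p" "Y = Ucl q" unfolding carrier_Umir by blast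
  show "Y \<otimes>\<^bsub>Umir\<^esub> X \<in> Ucl ` phi_kernel d" "X \<otimes>\<^bsub>Umir\<^esub> Y \<in> Ucl ` phi_kernel d"
    unfolding pq(2,3) Ucl_simps(3)[symmetric] using ideal2_left[OF K pq(1)] ideal2_right[OF K pq(1)] by blast+
qed

text \<open>The preimage J of the ideal in the free algebra has codimension at most
  \<open>card (Ix d)\<close> by \<open>dimension_bound\<close>. It is contained in the kernel
  because the image of the kernel is an ideal of \<open>Umir\<close> with both generators in it.
  Equality follows by \<open>phi_kernel_subset\<close>.\<close>

lemma mir_ideal_iff: "Ucl p \<in> mir_ideal d \<longleftrightarrow> Phi d p = (\<lambda>X. 0)"
proof -
  define J where "J = {p. Ucl p \<in> mir_ideal d}"
  interpret I: ideal "mir_ideal d" Umir by (rule ideal_mir_ideal)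
  have J: "ideal2 J"
    unfolding ideal2_def fs.subspace_def J_def
    by (auto simp: Ucl_simps(2,3,5) Ucl_0 Ucl_simps(1) I.I_l_closed I.I_r_closed U.smult_ideal[OF ideal_mir_ideal])
  have gens: "{Ucl (kp d [0..<d + 1]), Ucl ((fgen Gl - 1) * kp d [1..<d + 1])} \<subseteq> mir_ideal d"
    unfolding mir_ideal_eq by (rule U.genideal_self) (simp add: Ucl_simps(1))
  have "mir_relations \<subseteq> J"
  proof
    fix p assume "p \<in> mir_relations"
    then have "p - 0 \<in> Idl\<^bsub>free_alg\<^esub> mir_relations" using free.genideal_self[of mir_relations] by auto
    then have "Ucl p = \<zero>\<^bsub>Umir\<^esub>" unfolding Ucl_eq_iff[symmetric] Ucl_0 .
    then show "p \<in> J" unfolding J_def by simp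
  qed
  then have Q: "quotient_relations J d" using gens J unfolding quotient_relations_def J_def by blast
  have "grown (card (Ix d)) J UNIV"
    unfolding card_Ix by (rule dimension_bound[OF Q]) (use gens in \<open>simp add: J_def\<close>)
  moreover have "J \<subseteq> phi_kernel d"
  proof
    fix p assume "p \<in> J"
    moreover have "mir_ideal d \<subseteq> Ucl ` phi_kernel d"
      unfolding mir_ideal_eq
      by (rule U.genideal_minimal[OF ideal_image_phi_kernel]) (use kp_all_phi low_phi in blast)
    ultimately obtain q where "q \<in> phi_kernel d" "Ucl p = Ucl q" unfolding J_def by blast
    then show "p \<in> phi_kernel d" using Ucl_well_defined[of p q d] unfolding phi_kernel_def by simp
  qed
  ultimately have "J = phi_kernel d" using phi_kernel_subset[OF J] by blast
  then show ?thesis unfolding J_def phi_kernel_def by blast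
qed

theorem theorem1p1:
  fixes d :: nat
  shows
    "(\<exists>!\<pi>. \<pi> \<in> alg_hom Umir (MS d) \<inter> extensional (carrier Umir) \<and>
            (\<forall>g. \<pi> (Ugen g) = MSgen d g)) \<and>
     (\<forall>\<pi>. \<pi> \<in> alg_hom Umir (MS d) \<and> (\<forall>g. \<pi> (Ugen g) = MSgen d g) \<longrightarrow>
            \<pi> ` carrier Umir = carrier (MS d) \<and>
            a_kernel Umir (MS d) \<pi> = mir_ideal d) \<and>
     (\<exists>!\<phi>. \<phi> \<in> alg_iso (U2 d) (MS d) \<inter> extensional (carrier (U2 d)) \<and>
            (\<forall>g. \<phi> (U2gen d g) = MSgen d g))"
proof (intro conjI allI impI)
  show "\<exists>!\<pi>. \<pi> \<in> alg_hom Umir (MS d) \<inter> extensional (carrier Umir) \<and> (\<forall>g. \<pi> (Ugen g) = MSgen d g)"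
    unfolding Ugen_eq by (rule free_hom_factor[OF Ucl_hom carrier_Umir Ucl_well_defined])
  have range_Phi: "range (Phi d) = carrier (MS d)" using Phi_surj Phi_closed by blast
  {
    fix \<pi> assume \<pi>: "\<pi> \<in> alg_hom Umir (MS d) \<and> (\<forall>g. \<pi> (Ugen g) = MSgen d g)"
    have p: "\<pi> (Ucl p) = Phi d p" for p
      by (rule free_hom_determined[OF Ucl_hom]) (use \<pi> in \<open>simp_all add: Ugen_eq\<close>)
    show "\<pi> ` carrier Umir = carrier (MS d)"
      unfolding carrier_Umir image_image p by (rule range_Phi)
    have "mir_ideal d \<subseteq> carrier Umir" using ideal.Icarr[OF ideal_mir_ideal] by blast
    then show "a_kernel Umir (MS d) \<pi> = mir_ideal d"
      unfolding a_kernel_def' MS_simps(2) carrier_Umir using p mir_ideal_iff by fastforce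
  }
  \<comment> \<open>Composing the two class maps presents \<open>U2 d\<close> as a quotient of the
    free algebra, so the lemmas used for \<open>Umir\<close> apply to it.\<close>
  define cl where "cl p = mir_ideal d +>\<^bsub>Umir\<^esub> Ucl p" for p
  note hom2 = U.quot_hom[OF ideal_mir_ideal, of d, folded U2_def]
  have cl: "cl \<in> alg_hom free_alg (U2 d)"
    using alg_hom_comp[OF Ucl_hom hom2] unfolding cl_def comp_def .
  have carrier_U2: "carrier (U2 d) = range cl"
    unfolding U2_def U.quot_carrier carrier_Umir image_image cl_def ..
  have cl_eq: "cl p = cl q \<longleftrightarrow> Phi d p = Phi d q" for p q
  proof -
    have "cl p = cl q \<longleftrightarrow> Phi d (p - q) = (\<lambda>X. 0)"
      unfolding cl_def U.coset_eq_iff[OF ideal_mir_ideal Ucl_simps(1) Ucl_simps(1)] Ucl_diff[symmetric] mir_ideal_iff ..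
    also have "\<dots> \<longleftrightarrow> Phi d p = Phi d q"
    proof -
      have "Phi d p = (\<lambda>X. Phi d (p - q) X + Phi d q X)" unfolding Phi_add[symmetric] by simp
      then show ?thesis by (simp add: fun_eq_iff)
    qed
    finally show ?thesis .
  qed
  have gen: "U2gen d g = cl (fgen g)" for g by (simp add: U2gen_def cl_def Ugen_eq)
  have iso: "\<phi> \<in> alg_iso (U2 d) (MS d)"
    if \<phi>: "\<phi> \<in> alg_hom (U2 d) (MS d)" "\<And>g. \<phi> (cl (fgen g)) = MSgen d g" for \<phi>
  proof -
    have p: "\<phi> (cl p) = Phi d p" for p by (rule free_hom_determined[OF cl \<phi>])
    have "inj_on \<phi> (carrier (U2 d))"
    proof (rule inj_onI)
      fix X Y assume XY: "X \<in> carrier (U2 d)" "Y \<in> carrier (U2 d)" "\<phi> X = \<phi> Y"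
      obtain x where x: "X = cl x" using XY(1) unfolding carrier_U2 by blast
      obtain y where y: "Y = cl y" using XY(2) unfolding carrier_U2 by blast
      have "Phi d x = Phi d y" using XY(3) unfolding x y p .
      then show "X = Y" unfolding x y cl_eq .
    qed
    moreover have "\<phi> ` carrier (U2 d) = carrier (MS d)" unfolding carrier_U2 image_image p by (rule range_Phi)
    ultimately have "bij_betw \<phi> (carrier (U2 d)) (carrier (MS d))" unfolding bij_betw_def by blast
    then show ?thesis using \<phi>(1) unfolding alg_iso_def by blast
  qed
  \<comment> \<open>By \<open>iso\<close> every homomorphism with the prescribed values is
    bijective, so unique existence among homomorphisms is unique existence among
    isomorphisms.\<close>
  have sub: "alg_iso (U2 d) (MS d) \<subseteq> alg_hom (U2 d) (MS d)" unfolding alg_iso_def by blast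
  have "\<phi> \<in> alg_iso (U2 d) (MS d) \<inter> extensional (carrier (U2 d)) \<and> (\<forall>g. \<phi> (cl (fgen g)) = MSgen d g)
      \<longleftrightarrow> \<phi> \<in> alg_hom (U2 d) (MS d) \<inter> extensional (carrier (U2 d)) \<and> (\<forall>g. \<phi> (cl (fgen g)) = MSgen d g)" for \<phi>
    using iso[of \<phi>] sub by blast
  moreover have "\<exists>!\<phi>. \<phi> \<in> alg_hom (U2 d) (MS d) \<inter> extensional (carrier (U2 d)) \<and> (\<forall>g. \<phi> (cl (fgen g)) = MSgen d g)"
    by (rule free_hom_factor[OF cl carrier_U2]) (simp only: cl_eq)
  ultimately show "\<exists>!\<phi>. \<phi> \<in> alg_iso (U2 d) (MS d) \<inter> extensional (carrier (U2 d)) \<and> (\<forall>g. \<phi> (U2gen d g) = MSgen d g)"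
    unfolding gen by (simp only:)
qed

end
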